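(* There is an absolute constant $C>0$ such that the following holds. Let $n=3$, $S=\mathbb{R}^2\times(0,1)$, $k\in\mathcal{K}$, $D=I\times(0,1)$ with $I\subset\mathbb{R}^2$ and $D\subseteq B_\rho(0)\times(0,1)$ for some $\rho>0$, and let $V\in L^\infty(S)$ be supported in $D$. If the problem $-\Delta u=(k+V)u$ in $S$, $u=0$ on $\partial S$, has a nontrivial admissible solution, then $$\max\left\{C|D|^{3/4},\ \frac{|D|}{\pi}\left(1+\ln\left(\frac{\pi\rho^2}{|D|}\right)\right)\right\}\|V\|_\infty\ge1.$$
   Context: Points of $S$ are written $(x,y)$ with $x\in\mathbb{R}^2$, $y\in(0,1)$. $|D|$ denotes Lebesgue measure; $B_\rho(0)=\{x\in\mathbb{R}^2:|x|<\rho\}$. $\mathcal{K}=\{m^2\pi^2:m=1,2,\dots\}$. For $m=1,2,\dots$ let $k_m=\sqrt{k-m^2\pi^2}$ if $m^2\pi^2<k$ and $k_m=i\sqrt{m^2\pi^2-k}$ if $m^2\pi^2\ge k$. For $u\in H^1_{\rm loc}(S)$ put $u_m(x)=2\int_0^1u(x,y)\sin(m\pi y)\,dy$. A weak solution $u\in H^1_{\rm loc}(S)$ of $-\Delta u=(k+V)u$ in $S$, $u=0$ on $\partial S$, is called admissible (here $n=3$) if: (1) for every $m$ with $m^2\pi^2<k$, as $r=|x|\to\infty$, $u_m(x)=O(r^{-1/2})$ and $\left(\frac{\partial}{\partial r}-ik_m\right)u_m(x)=o(r^{-1/2})$, where $\frac{\partial}{\partial r}=\frac{x}{|x|}\cdot\nabla$;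 and (2) $u_m\in H^1(\mathbb{R}^2)$ for every $m$ with $m^2\pi^2\ge k$. *)

theory Defs
  imports
    "HOL-Analysis.Analysis"
    "HOL-Library.Landau_Symbols"
    "HOL-Probability.Essential_Supremum"
begin

section \<open>Test functions\<close>

definition partial :: "'a::euclidean_space \<Rightarrow> ('a \<Rightarrow> complex) \<Rightarrow> 'a \<Rightarrow> complex" where
  "partial b f x = frechet_derivative f (at x) b"

primrec C_k :: "nat \<Rightarrow> ('a::euclidean_space \<Rightarrow> complex) \<Rightarrow> bool" where
  "C_k 0 f \<longleftrightarrow> continuous_on UNIV f"
| "C_k (Suc n) f \<longleftrightarrow> (\<forall>x. f differentiable (at x)) \<and> (\<forall>b\<in>Basis. C_k n (partial b f))"

text \<open>\<open>C\<^sub>c\<^sup>\<infinity>(U)\<close>, complex valued, each function extended by zero to the whole space.\<close>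

definition test_functions :: "'a::euclidean_space set \<Rightarrow> ('a \<Rightarrow> complex) set" where
  "test_functions U = {\<phi>. (\<forall>n. C_k n \<phi>) \<and>
     compact (closure {x. \<phi> x \<noteq> 0}) \<and> closure {x. \<phi> x \<noteq> 0} \<subseteq> U}"

section \<open>Lebesgue and Sobolev spaces\<close>

text \<open>
  Elements of these spaces are represented by functions on the whole type of which only the
  values almost everywhere on \<open>U\<close> matter.
\<close>

definition Linf_norm :: "'a::euclidean_space set \<Rightarrow> ('a \<Rightarrow> complex) \<Rightarrow> ereal" where
  "Linf_norm U f = esssup (lebesgue_on U) (\<lambda>x. ereal (norm (f x)))"

definition Linf :: "'a::euclidean_space set \<Rightarrow> ('a \<Rightarrow> complex) set" where
  "Linf U = {f \<in> borel_measurable (lebesgue_on U). Linf_norm U f < \<infinity>}"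

definition L2 :: "'a::euclidean_space set \<Rightarrow> ('a \<Rightarrow> complex) set" where
  "L2 U = {f \<in> borel_measurable (lebesgue_on U). integrable (lebesgue_on U) (\<lambda>x. (norm (f x))\<^sup>2)}"

definition L1_loc :: "'a::euclidean_space set \<Rightarrow> ('a \<Rightarrow> complex) set" where
  "L1_loc U = {f. \<forall>K. compact K \<and> K \<subseteq> U \<longrightarrow> integrable (lebesgue_on K) f}"

definition has_weak_partial ::
  "'a::euclidean_space set \<Rightarrow> 'a \<Rightarrow> ('a \<Rightarrow> complex) \<Rightarrow> ('a \<Rightarrow> complex) \<Rightarrow> bool" where
  "has_weak_partial U b u g \<longleftrightarrow> u \<in> L1_loc U \<and> g \<in> L1_loc U \<and>
     (\<forall>\<phi>\<in>test_functions U.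
        (LINT x|lebesgue_on U. u x * partial b \<phi> x) = - (LINT x|lebesgue_on U. g x * \<phi> x))"

text \<open>A representative of the weak derivative, which is unique up to null sets if it exists.\<close>

definition weak_partial ::
  "'a::euclidean_space set \<Rightarrow> 'a \<Rightarrow> ('a \<Rightarrow> complex) \<Rightarrow> 'a \<Rightarrow> complex" where
  "weak_partial U b u = (SOME g. has_weak_partial U b u g)"

definition weakly_differentiable :: "'a::euclidean_space set \<Rightarrow> ('a \<Rightarrow> complex) \<Rightarrow> bool" where
  "weakly_differentiable U u \<longleftrightarrow> (\<forall>b\<in>Basis. \<exists>g. has_weak_partial U b u g)"

definition H1 :: "'a::euclidean_space set \<Rightarrow> ('a \<Rightarrow> complex) set" where
  "H1 U = {u \<in> L2 U. weakly_differentiable U u \<and> (\<forall>b\<in>Basis. weak_partial U b u \<in> L2 U)}"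

text \<open>
  Square integrability is required on bounded parts of \<open>U\<close>, hence up to the boundary of \<open>U\<close>,
  so that boundary values make sense.
\<close>

definition H1_loc :: "'a::euclidean_space set \<Rightarrow> ('a \<Rightarrow> complex) set" where
  "H1_loc U = {u. weakly_differentiable U u \<and>
     (\<forall>R. u \<in> L2 (U \<inter> ball 0 R) \<and> (\<forall>b\<in>Basis. weak_partial U b u \<in> L2 (U \<inter> ball 0 R)))}"

text \<open>The closure of \<open>C\<^sub>c\<^sup>\<infinity>(U)\<close> in \<open>H\<^sup>1(U)\<close>.\<close>

definition H1_0 :: "'a::euclidean_space set \<Rightarrow> ('a \<Rightarrow> complex) set" where
  "H1_0 U = {w \<in> H1 U. \<exists>\<phi>::nat \<Rightarrow> 'a \<Rightarrow> complex. (\<forall>n. \<phi> n \<in> test_functions U) \<and>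
     (\<lambda>n. LINT x|lebesgue_on U. (norm (\<phi> n x - w x))\<^sup>2) \<longlonglongrightarrow> 0 \<and>
     (\<forall>b\<in>Basis. (\<lambda>n. LINT x|lebesgue_on U.
        (norm (partial b (\<phi> n) x - weak_partial U b w x))\<^sup>2) \<longlonglongrightarrow> 0)}"

text \<open>For unbounded \<open>U\<close> the condition \<open>u = 0\<close> on the boundary is imposed after smooth truncation.\<close>

definition zero_on_boundary :: "'a::euclidean_space set \<Rightarrow> ('a \<Rightarrow> complex) \<Rightarrow> bool" where
  "zero_on_boundary U u \<longleftrightarrow> (\<forall>\<eta>\<in>test_functions UNIV. (\<lambda>x. \<eta> x * u x) \<in> H1_0 U)"

section \<open>The Dirichlet problem in the layer\<close>

definition layer :: "((real^2) \<times> real) set" where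
  "layer = UNIV \<times> {0<..<1}"

definition weak_Dirichlet_solution ::
  "real \<Rightarrow> ((real^2) \<times> real \<Rightarrow> complex) \<Rightarrow> ((real^2) \<times> real \<Rightarrow> complex) \<Rightarrow> bool" where
  "weak_Dirichlet_solution k V u \<longleftrightarrow> u \<in> H1_loc layer \<and> zero_on_boundary layer u \<and>
     (\<forall>\<phi>\<in>test_functions layer.
        (LINT z|lebesgue_on layer. (\<Sum>b\<in>Basis. weak_partial layer b u z * partial b \<phi> z)) =
        (LINT z|lebesgue_on layer. (of_real k + V z) * u z * \<phi> z))"

definition thresholds :: "real set" where
  "thresholds = {(real m)\<^sup>2 * pi\<^sup>2 | m. m \<ge> 1}"

definition mode_wavenumber :: "real \<Rightarrow> nat \<Rightarrow> complex" where
  "mode_wavenumber k m =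
     (if (real m)\<^sup>2 * pi\<^sup>2 < k then of_real (sqrt (k - (real m)\<^sup>2 * pi\<^sup>2))
      else \<i> * of_real (sqrt ((real m)\<^sup>2 * pi\<^sup>2 - k)))"

definition mode :: "((real^2) \<times> real \<Rightarrow> complex) \<Rightarrow> nat \<Rightarrow> real^2 \<Rightarrow> complex" where
  "mode u m x = 2 * (LINT y|lebesgue_on {0<..<1}. u (x, y) * of_real (sin (real m * pi * y)))"

definition radial_derivative :: "(real^2 \<Rightarrow> complex) \<Rightarrow> real^2 \<Rightarrow> complex" where
  "radial_derivative w x = (\<Sum>b\<in>Basis. of_real ((x /\<^sub>R norm x) \<bullet> b) * weak_partial UNIV b w x)"

text \<open>
  The filter for \<open>|x| \<rightarrow> \<infinity>\<close> up to null sets: a property holds eventually iff for some \<open>R\<close> it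
  holds for almost every \<open>x\<close> with \<open>|x| \<ge> R\<close>.  The modes of a Sobolev function and their weak
  derivatives are determined only almost everywhere, so the decay conditions refer to it.
\<close>

definition ae_at_infinity :: "(real^2) filter" where
  "ae_at_infinity = inf (ae_filter lebesgue) at_infinity"

definition admissible :: "real \<Rightarrow> ((real^2) \<times> real \<Rightarrow> complex) \<Rightarrow> bool" where
  "admissible k u \<longleftrightarrow>
     (\<forall>m\<ge>1. (real m)\<^sup>2 * pi\<^sup>2 < k \<longrightarrow>
        mode u m \<in> O[ae_at_infinity](\<lambda>x. of_real (norm x powr (-1/2))) \<and>
        (\<lambda>x. radial_derivative (mode u m) x - \<i> * mode_wavenumber k m * mode u m x)
          \<in> o[ae_at_infinity](\<lambda>x. of_real (norm x powr (-1/2)))) \<and>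
     (\<forall>m\<ge>1. (real m)\<^sup>2 * pi\<^sup>2 \<ge> k \<longrightarrow> mode u m \<in> H1 UNIV)"

definition admissible_solution ::
  "real \<Rightarrow> ((real^2) \<times> real \<Rightarrow> complex) \<Rightarrow> ((real^2) \<times> real \<Rightarrow> complex) \<Rightarrow> bool" where
  "admissible_solution k V u \<longleftrightarrow> weak_Dirichlet_solution k V u \<and> admissible k u"

lemma eventually_ae_at_infinity:
  "eventually P ae_at_infinity \<longleftrightarrow> (\<exists>R. AE x in lebesgue. norm x \<ge> R \<longrightarrow> P x)"
proof
  assume "eventually P ae_at_infinity"
  then obtain Q S where "AE x in lebesgue. Q x" and S: "eventually S at_infinity"
    and P: "\<And>x. Q x \<and> S x \<Longrightarrow> P x"
    unfolding ae_at_infinity_def eventually_inf by blast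
  moreover from S obtain R where "\<And>x. norm x \<ge> R \<Longrightarrow> S x"
    unfolding eventually_at_infinity by blast
  ultimately have "AE x in lebesgue. norm x \<ge> R \<longrightarrow> P x"
    by (auto elim!: eventually_mono)
  then show "\<exists>R. AE x in lebesgue. norm x \<ge> R \<longrightarrow> P x" ..
next
  assume "\<exists>R. AE x in lebesgue. norm x \<ge> R \<longrightarrow> P x"
  then obtain R where "AE x in lebesgue. norm x \<ge> R \<longrightarrow> P x" ..
  moreover have "eventually (\<lambda>x::real^2. norm x \<ge> R) at_infinity"
    unfolding eventually_at_infinity by blast
  ultimately show "eventually P ae_at_infinity"
    unfolding ae_at_infinity_def eventually_inf by blast
qed

end

(* Expanding a solution in sin (m pi y) reduces the problem to Helmholtz equations
   -Laplace u_m + c^2 u_m = f_m in the plane.  Each u_m is the convolution of f_m with the radiating, decaying or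
   (for c = 0) logarithmic fundamental solution.  The first two equal exp (-c r) times a Laplace integral and are
   dominated by a multiple of r^(-1/2); the representation follows by testing the weak equation with cut-off
   regularisations of the kernel, in which r is replaced by sqrt (r^2 + e^2).  At the threshold m^2 pi^2 = k square
   integrability of u_m removes the additive constant and forces f_m to have mean zero, so that the scale in the
   logarithm can be chosen freely.  Rearrangement bounds the kernels on a set of given area, the Schur test
   bounds each u_m in L^2, and Parseval's identity sums the bounds to |u| <= M |V| |u| on D. *)
theory Submission
  imports Defs "HOL-Probability.Probability" "HOL-Real_Asymp.Real_Asymp"
begin

section \<open>Smooth functions\<close>

text \<open>The modes are known only almost everywhere and their derivatives only weakly, so Green's
  formula on spheres gives way to a smooth cut-off whose gradient lives on an annulus; what is left
  at infinity is an integral over that annulus. From the representation only a bound is extracted: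
  |u_m| is at most the integral of |f_m| against a positive radial kernel, obtained by duality from
  continuous functions. Regularising the radius keeps the kernel smooth and radial, and its image
  under the Helmholtz operator is an explicit approximate identity of mass 2 pi. One constant serves
  all modes because k is itself a threshold: for m^2 pi^2 different from k the wavenumber is bounded
  away from 0. If the maximum times the norm of V were below 1, the energy on D would force V u = 0;
  the same bounds, now with zero right-hand side and on arbitrarily large balls, give u = 0 on the
  whole layer and not merely on D.\<close>

lemma partial_eq: "(f has_derivative f') (at x) \<Longrightarrow> partial b f x = f' b"
  unfolding partial_def by (metis frechet_derivative_at)

lemma has_derivative_partial:
  "f differentiable (at x) \<Longrightarrow> (f has_derivative (\<lambda>b. partial b f x)) (at x)"
  unfolding partial_def using frechet_derivative_works by blast

lemma C_k_SucI:
  assumes "\<And>x. (f has_derivative f' x) (at x)" "\<And>b. b \<in> Basis \<Longrightarrow> C_k n (\<lambda>x. f' x b)"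
  shows "C_k (Suc n) f"
proof -
  have "partial b f = (\<lambda>x. f' x b)" for b
    using assms(1) by (auto simp: partial_eq)
  then show ?thesis using assms by (auto simp: differentiable_def)
qed

lemma C_k_imp_continuous: "C_k n f \<Longrightarrow> continuous_on UNIV f"
  by (cases n) (auto simp: continuous_at_imp_continuous_on differentiable_imp_continuous_within)

lemma C_k_Suc_imp: "C_k (Suc n) f \<Longrightarrow> C_k n f"
proof (induction n arbitrary: f)
  case 0
  then show ?case using C_k_imp_continuous C_k.simps(1) by blast
next
  case (Suc n)
  then show ?case by (metis C_k.simps(2))
qed

lemma C_k_const: "C_k n (\<lambda>x. c)"
proof (induction n arbitrary: c)
  case (Suc n)
  show ?case by (rule C_k_SucI[where f'="\<lambda>x h. 0"]) (auto intro: Suc)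
qed auto

lemma C_k_of_real_linear:
  fixes L :: "'a::euclidean_space \<Rightarrow> real"
  assumes "bounded_linear L"
  shows "C_k n (\<lambda>x. complex_of_real (L x))"
proof (cases n)
  case 0
  then show ?thesis using assms by (auto intro!: continuous_intros linear_continuous_on)
next
  case (Suc k)
  have "((\<lambda>x. complex_of_real (L x)) has_derivative (\<lambda>h. complex_of_real (L h))) (at x)" for x
    using assms by (intro bounded_linear_imp_has_derivative bounded_linear_compose[OF bounded_linear_of_real])
  then show ?thesis unfolding Suc by (rule C_k_SucI) (rule C_k_const)
qed

lemma C_k_add: "C_k n f \<Longrightarrow> C_k n g \<Longrightarrow> C_k n (\<lambda>x. f x + g x)"
proof (induction n arbitrary: f g)
  case (Suc n)
  have "((\<lambda>x. f x + g x) has_derivative (\<lambda>b. partial b f x + partial b g x)) (at x)" for x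
    using Suc.prems by (auto intro!: derivative_intros has_derivative_partial)
  then show ?case using Suc by (intro C_k_SucI) auto
qed (auto intro!: continuous_intros)

lemma C_k_mult: "C_k n f \<Longrightarrow> C_k n g \<Longrightarrow> C_k n (\<lambda>x. f x * g x)"
proof (induction n arbitrary: f g)
  case (Suc n)
  have "((\<lambda>x. f x * g x) has_derivative (\<lambda>b. f x * partial b g x + partial b f x * g x)) (at x)" for x
    using Suc.prems by (auto intro!: has_derivative_mult has_derivative_partial)
  moreover have "C_k n (\<lambda>x. f x * partial b g x + partial b f x * g x)" if "b \<in> Basis" for b
    using Suc.prems that C_k_Suc_imp[OF Suc.prems(1)] C_k_Suc_imp[OF Suc.prems(2)]
    by (intro C_k_add Suc.IH) auto
  ultimately show ?case by (intro C_k_SucI)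
qed (auto intro!: continuous_intros)

lemma C_k_inverse:
  assumes "\<And>x. f x \<noteq> 0"
  shows "C_k n f \<Longrightarrow> C_k n (\<lambda>x. inverse (f x))"
proof (induction n)
  case (Suc n)
  have "((\<lambda>x. inverse (f x)) has_derivative
      (\<lambda>b. (- 1) * (inverse (f x) * partial b f x * inverse (f x)))) (at x)" for x
    using Suc.prems assms by (auto intro!: derivative_eq_intros has_derivative_partial)
  moreover have "C_k n (\<lambda>x. (- 1) * (inverse (f x) * partial b f x * inverse (f x)))" if "b \<in> Basis" for b
    using Suc that C_k_Suc_imp[OF Suc.prems]
    by (intro C_k_mult C_k_const) auto
  ultimately show ?case by (intro C_k_SucI)
qed (use assms in \<open>auto intro!: continuous_intros\<close>)

text \<open>Functions such as \<open>sqrt\<close>, \<open>ln\<close> and the kernels are smooth only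
  on a half-line, so the outer function enters as an explicit sequence of successive derivatives on
  \<open>S\<close>. Each derivative of the composition is a partial derivative of \<open>h\<close>
  times the next member, which closes an induction with \<open>j\<close> arbitrary.\<close>

lemma C_k_compose_tower:
  fixes F :: "nat \<Rightarrow> real \<Rightarrow> complex" and h :: "'a::euclidean_space \<Rightarrow> real"
  assumes "\<And>j t. t \<in> S \<Longrightarrow> (F j has_vector_derivative F (Suc j) t) (at t)"
    and S: "\<And>x. h x \<in> S"
  shows "C_k n (\<lambda>x. complex_of_real (h x)) \<Longrightarrow> C_k n (\<lambda>x. F j (h x))"
proof (induction n arbitrary: j)
  case 0
  have "continuous_on UNIV (\<lambda>x. Re (complex_of_real (h x)))"
    using 0 by (auto simp del: Re_complex_of_real intro!: continuous_intros)
  then have h: "continuous_on UNIV h" by simp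
  have "continuous_on S (F j)"
    using assms(1) by (auto intro!: continuous_at_imp_continuous_on has_vector_derivative_continuous)
  then show ?case using continuous_on_compose2[OF _ h] S by auto
next
  case (Suc n)
  have h: "(h has_derivative (\<lambda>b. Re (partial b (\<lambda>x. complex_of_real (h x)) x))) (at x)" for x
  proof -
    have "((\<lambda>x. Re (complex_of_real (h x))) has_derivative (\<lambda>b. Re (partial b (\<lambda>x. complex_of_real (h x)) x))) (at x)"
      using Suc.prems by (intro has_derivative_Re has_derivative_partial) auto
    then show ?thesis by simp
  qed
  \<comment> \<open>A real-valued function has real partial derivatives; this turns the scalar
    multiple in the vector derivative into a complex product.\<close>
  have p: "partial b (\<lambda>x. complex_of_real (h x)) x = complex_of_real (Re (partial b (\<lambda>x. complex_of_real (h x)) x))" for b x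
    using partial_eq[OF has_derivative_of_real[OF h]] by metis
  have "((\<lambda>x. F j (h x)) has_derivative
     (\<lambda>b. partial b (\<lambda>x. complex_of_real (h x)) x * F (Suc j) (h x))) (at x)" for x
  proof -
    have "((\<lambda>x. F j (h x)) has_derivative
      (\<lambda>b. Re (partial b (\<lambda>x. complex_of_real (h x)) x) *\<^sub>R F (Suc j) (h x))) (at x)"
      using has_derivative_compose[OF h assms(1)[OF S, unfolded has_vector_derivative_def]] .
    then show ?thesis unfolding scaleR_conv_of_real using p[symmetric] by simp
  qed
  moreover have "C_k n (\<lambda>x. partial b (\<lambda>x. complex_of_real (h x)) x * F (Suc j) (h x))" if "b \<in> Basis" for b
    using Suc that C_k_Suc_imp[OF Suc.prems] by (intro C_k_mult) auto
  ultimately show ?case by (intro C_k_SucI)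
qed

definition smooth :: "('a::euclidean_space \<Rightarrow> complex) \<Rightarrow> bool" where
  "smooth f \<longleftrightarrow> (\<forall>n. C_k n f)"

lemma smooth_const [intro]: "smooth (\<lambda>x. c)"
  by (simp add: smooth_def C_k_const)

lemma smooth_of_real_linear:
  fixes L :: "'a::euclidean_space \<Rightarrow> real"
  shows "bounded_linear L \<Longrightarrow> smooth (\<lambda>x. complex_of_real (L x))"
  by (simp add: smooth_def C_k_of_real_linear)

lemma smooth_add [intro]: "smooth f \<Longrightarrow> smooth g \<Longrightarrow> smooth (\<lambda>x. f x + g x)"
  by (simp add: smooth_def C_k_add)

lemma smooth_mult [intro]: "smooth f \<Longrightarrow> smooth g \<Longrightarrow> smooth (\<lambda>x. f x * g x)"
  by (simp add: smooth_def C_k_mult)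

lemma smooth_diff [intro]: "smooth f \<Longrightarrow> smooth g \<Longrightarrow> smooth (\<lambda>x. f x - g x)"
  using smooth_add[OF _ smooth_mult[OF smooth_const[of "-1"]]] by fastforce

lemma smooth_sum [intro]: "(\<And>i. i \<in> A \<Longrightarrow> smooth (f i)) \<Longrightarrow> smooth (\<lambda>x. \<Sum>i\<in>A. f i x)"
  by (induction A rule: infinite_finite_induct) auto

lemma smooth_power [intro]: "smooth f \<Longrightarrow> smooth (\<lambda>x. f x ^ n)"
  by (induction n) auto

lemma smooth_inverse: "smooth f \<Longrightarrow> (\<And>x. f x \<noteq> 0) \<Longrightarrow> smooth (\<lambda>x. inverse (f x))"
  by (simp add: smooth_def C_k_inverse)

lemma smooth_compose_tower:
  fixes F :: "nat \<Rightarrow> real \<Rightarrow> complex" and h :: "'a::euclidean_space \<Rightarrow> real"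
  assumes "\<And>j t. t \<in> S \<Longrightarrow> (F j has_vector_derivative F (Suc j) t) (at t)"
    and "\<And>x. h x \<in> S" "smooth (\<lambda>x. complex_of_real (h x))"
  shows "smooth (\<lambda>x. F j (h x))"
  unfolding smooth_def
proof
  fix n show "C_k n (\<lambda>x. F j (h x))"
    using assms(3) by (intro C_k_compose_tower[where S=S and h=h and F=F] assms) (auto simp: smooth_def)
qed

lemma smooth_differentiable: "smooth f \<Longrightarrow> f differentiable (at x)"
  unfolding smooth_def by (meson C_k.simps(2))

lemma smooth_has_derivative: "smooth f \<Longrightarrow> (f has_derivative (\<lambda>b. partial b f x)) (at x)"
  by (simp add: smooth_differentiable has_derivative_partial)

lemma smooth_partial: "smooth f \<Longrightarrow> b \<in> Basis \<Longrightarrow> smooth (partial b f)"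
  unfolding smooth_def by (meson C_k.simps(2))

lemma smooth_continuous: "smooth f \<Longrightarrow> continuous_on UNIV f"
  unfolding smooth_def using C_k_imp_continuous by blast

lemma smooth_norm2:
  fixes x0 :: "'a::euclidean_space"
  shows "smooth (\<lambda>x. complex_of_real ((norm (x - x0))\<^sup>2))"
proof -
  have "complex_of_real ((norm (x - x0))\<^sup>2) =
      (\<Sum>b\<in>Basis. (complex_of_real (x \<bullet> b) - complex_of_real (x0 \<bullet> b))\<^sup>2)" for x
    unfolding power2_norm_eq_inner euclidean_inner[of "x - x0" "x - x0"]
    by (simp add: inner_diff_left power2_eq_square)
  moreover have "smooth (\<lambda>x. \<Sum>b\<in>Basis. (complex_of_real (x \<bullet> b) - complex_of_real (x0 \<bullet> b))\<^sup>2)"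
    by (intro smooth_sum smooth_power smooth_diff smooth_of_real_linear smooth_const bounded_linear_inner_left)
  ultimately show ?thesis by simp
qed

lemma smooth_sqrt:
  fixes h :: "'a::euclidean_space \<Rightarrow> real"
  assumes "smooth (\<lambda>x. complex_of_real (h x))" "\<And>x. h x > 0"
  shows "smooth (\<lambda>x. complex_of_real (sqrt (h x)))"
proof -
  \<comment> \<open>The \<open>j\<close>-th derivative of the square root: a falling product of
    exponents times the lowered power.\<close>
  define F where "F j t = complex_of_real ((\<Prod>i<j. 1/2 - real i) * t powr (1/2 - real j))" for j t
  have "(F j has_vector_derivative F (Suc j) t) (at t)" if "t \<in> {0<..}" for j t
  proof -
    have "((\<lambda>t. (\<Prod>i<j. 1/2 - real i) * t powr (1/2 - real j)) has_real_derivative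
       (\<Prod>i<j. 1/2 - real i) * ((1/2 - real j) * t powr (1/2 - real j - 1))) (at t)"
      using that by (auto intro!: derivative_eq_intros)
    then have "((\<lambda>t. (\<Prod>i<j. 1/2 - real i) * t powr (1/2 - real j)) has_real_derivative
       (\<Prod>i<Suc j. 1/2 - real i) * t powr (1/2 - real (Suc j))) (at t)"
      by (simp add: algebra_simps)
    then show ?thesis unfolding F_def
      by (intro has_vector_derivative_of_real) (simp add: has_real_derivative_iff_has_vector_derivative)
  qed
  from smooth_compose_tower[of "{0<..}" F h 0, OF this] assms
  have "smooth (\<lambda>x. F 0 (h x))" by auto
  then show ?thesis using assms(2) by (simp add: F_def powr_half_sqrt less_imp_le)
qed

lemma smooth_ln:
  fixes h :: "'a::euclidean_space \<Rightarrow> real"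
  assumes "smooth (\<lambda>x. complex_of_real (h x))" "\<And>x. h x > 0"
  shows "smooth (\<lambda>x. complex_of_real (ln (h x)))"
proof -
  \<comment> \<open>The logarithm first, then the successive derivatives of \<open>1 / t\<close>
    written as powers; the case split is there because the logarithm is no power.\<close>
  define F where "F j t = (case j of 0 \<Rightarrow> complex_of_real (ln t)
     | Suc i \<Rightarrow> complex_of_real ((\<Prod>l<i. - 1 - real l) * t powr (- 1 - real i)))" for j t
  have "(F j has_vector_derivative F (Suc j) t) (at t)" if "t \<in> {0<..}" for j t
  proof (cases j)
    case 0
    have "(ln has_real_derivative t powr (- 1)) (at t)"
      using that by (auto intro!: derivative_eq_intros simp: powr_minus_divide)
    then have "(ln has_real_derivative (\<Prod>l<0. - 1 - real l) * t powr (- 1 - real 0)) (at t)" by simp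
    then show ?thesis unfolding F_def 0 nat.case
      by (intro has_vector_derivative_of_real) (simp only: has_real_derivative_iff_has_vector_derivative)
  next
    case (Suc i)
    have "((\<lambda>t. (\<Prod>l<i. - 1 - real l) * t powr (- 1 - real i)) has_real_derivative
       (\<Prod>l<i. - 1 - real l) * ((- 1 - real i) * t powr (- 1 - real i - 1))) (at t)"
      using that by (auto intro!: derivative_eq_intros)
    then have "((\<lambda>t. (\<Prod>l<i. - 1 - real l) * t powr (- 1 - real i)) has_real_derivative
       (\<Prod>l<Suc i. - 1 - real l) * t powr (- 1 - real (Suc i))) (at t)"
      by (simp add: algebra_simps)
    then show ?thesis unfolding F_def Suc nat.case
      by (intro has_vector_derivative_of_real) (simp add: has_real_derivative_iff_has_vector_derivative)
  qed
  from smooth_compose_tower[of "{0<..}" F h 0, OF this] assms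
  have "smooth (\<lambda>x. F 0 (h x))" by auto
  then show ?thesis by (simp add: F_def)
qed

lemma smooth_sin: "smooth (\<lambda>y::real. complex_of_real (sin (a * y)))"
  and smooth_cos: "smooth (\<lambda>y::real. complex_of_real (cos (a * y)))"
proof -
  \<comment> \<open>Differentiating a sine adds a quarter period to its phase, so one formula gives
    all derivatives; starting at \<open>j = 1\<close> yields the cosine.\<close>
  define F where "F j t = complex_of_real (sin (t + real j * pi / 2))" for j t
  have sc: "cos (t + real j * pi / 2) = sin (t + real (Suc j) * pi / 2)" for t j
  proof -
    have "t + real (Suc j) * pi / 2 = (t + real j * pi / 2) + pi / 2" by (simp add: field_simps)
    then show ?thesis by (simp only: sin_add) simp
  qed
  have F: "(F j has_vector_derivative F (Suc j) t) (at t)" for j t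
  proof -
    have "((\<lambda>t. sin (t + real j * pi / 2)) has_real_derivative cos (t + real j * pi / 2)) (at t)"
      by (auto intro!: derivative_eq_intros)
    then show ?thesis unfolding F_def sc
      by (intro has_vector_derivative_of_real) (simp add: has_real_derivative_iff_has_vector_derivative)
  qed
  have l: "smooth (\<lambda>y::real. complex_of_real (a * y))"
    by (intro smooth_of_real_linear) (rule bounded_linear_mult_right)
  have "smooth (\<lambda>y. F j (a * y))" for j
    using smooth_compose_tower[of UNIV F "\<lambda>y. a * y" j, OF F _ l] by auto
  from this[of 0] this[of 1]
  show "smooth (\<lambda>y::real. complex_of_real (sin (a * y)))" "smooth (\<lambda>y::real. complex_of_real (cos (a * y)))"
    by (simp_all add: F_def sin_add) 
qed

text \<open>The sequence demanded by \<open>smooth_compose_tower\<close> is built from iterated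
  derivatives; on the line the derivative is a linear map determined by its value at 1.\<close>

lemma smooth_compose_real:
  fixes f :: "real \<Rightarrow> complex" and h :: "'a::euclidean_space \<Rightarrow> real"
  assumes "smooth f" "smooth (\<lambda>x. complex_of_real (h x))"
  shows "smooth (\<lambda>x. f (h x))"
proof -
  define F where "F j = (partial 1 ^^ j) f" for j
  have sF: "smooth (F j)" for j
    by (induction j) (auto simp: F_def assms(1) intro: smooth_partial)
  have "(F j has_vector_derivative F (Suc j) t) (at t)" for j t
  proof -
    have d: "(F j has_derivative (\<lambda>b. partial b (F j) t)) (at t)"
      by (rule smooth_has_derivative[OF sF])
    have "partial b (F j) t = b *\<^sub>R F (Suc j) t" for b
      using linear_scale[OF has_derivative_linear[OF d], of b 1] by (simp add: F_def)
    then show ?thesis using d unfolding has_vector_derivative_def by simp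
  qed
  then have "smooth (\<lambda>x. F 0 (h x))"
    by (intro smooth_compose_tower[where S=UNIV and F=F]) (auto intro: assms(2))
  then show ?thesis by (simp add: F_def)
qed

text \<open>Serves functions of \<open>fst z\<close> and \<open>snd z\<close>. The chain rule
  expresses a partial derivative of \<open>g (L x)\<close> through the partials of \<open>g\<close>
  at \<open>L x\<close>, which are smooth again; hence the induction runs over all smooth
  \<open>g\<close>.\<close>

lemma smooth_compose_linear:
  fixes f :: "'b::euclidean_space \<Rightarrow> complex" and L :: "'a::euclidean_space \<Rightarrow> 'b"
  assumes "smooth f" "bounded_linear L"
  shows "smooth (\<lambda>x. f (L x))"
proof -
  have "C_k n (\<lambda>x. g (L x))" if "smooth g" for n g
    using that
  proof (induction n arbitrary: g)
    case 0
    then show ?case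
      using continuous_on_compose2[OF smooth_continuous linear_continuous_on[OF assms(2)]] by auto
  next
    case (Suc n)
    have "((\<lambda>x. g (L x)) has_derivative (\<lambda>b. \<Sum>c\<in>Basis. complex_of_real (L b \<bullet> c) * partial c g (L x))) (at x)" for x
    proof -
      have d: "(g has_derivative (\<lambda>b. partial b g (L x))) (at (L x))"
        by (rule smooth_has_derivative[OF Suc.prems])
      interpret l: linear "\<lambda>b. partial b g (L x)" by (rule has_derivative_linear[OF d])
      have "partial (L b) g (L x) = (\<Sum>c\<in>Basis. complex_of_real (L b \<bullet> c) * partial c g (L x))" for b
        by (subst euclidean_representation[symmetric, of "L b"])
           (simp add: l.sum l.scale scaleR_conv_of_real)
      then show ?thesis
        using has_derivative_compose[OF bounded_linear_imp_has_derivative[OF assms(2)] d] by simp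
    qed
    moreover have "C_k n (\<lambda>x. \<Sum>c\<in>Basis. complex_of_real (L b \<bullet> c) * partial c g (L x))" for b
    proof -
      have "C_k n (\<lambda>x. \<Sum>c\<in>A. complex_of_real (L b \<bullet> c) * partial c g (L x))" if "A \<subseteq> Basis" "finite A" for A
        using that(2,1)
      proof (induction A)
        case (insert c A)
        then have "C_k n (\<lambda>x. complex_of_real (L b \<bullet> c) * partial c g (L x))"
          by (intro C_k_mult C_k_const Suc.IH smooth_partial Suc.prems) auto
        then show ?case using insert by (auto simp del: mult_eq_0_iff intro: C_k_add)
      qed (simp add: C_k_const)
      then show ?thesis by auto
    qed
    ultimately show ?case by (intro C_k_SucI)
  qed
  then show ?thesis using assms(1) by (simp add: smooth_def)
qed

lemma smooth_imp_real_derivative: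
  assumes "smooth (\<lambda>t::real. complex_of_real (f t))"
  obtains f' where "\<And>t. (f has_real_derivative f' t) (at t)" "continuous_on UNIV f'"
proof
  define f' where "f' t = Re (partial 1 (\<lambda>t. complex_of_real (f t)) t)" for t
  show "(f has_real_derivative f' t) (at t)" for t
  proof -
    have d: "((\<lambda>t. complex_of_real (f t)) has_derivative (\<lambda>b. partial b (\<lambda>t. complex_of_real (f t)) t)) (at t)"
      by (rule smooth_has_derivative[OF assms])
    have *: "partial b (\<lambda>t. complex_of_real (f t)) t = b *\<^sub>R partial 1 (\<lambda>t. complex_of_real (f t)) t" for b
      using linear_scale[OF has_derivative_linear[OF d], of b 1] by simp
    have "((\<lambda>t. Re (complex_of_real (f t))) has_derivative (\<lambda>b. Re (partial b (\<lambda>t. complex_of_real (f t)) t))) (at t)"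
      by (rule has_derivative_Re[OF d])
    moreover have "(\<lambda>b. Re (partial b (\<lambda>t. complex_of_real (f t)) t)) = (*) (f' t)"
      by (rule ext, subst *) (simp add: f'_def mult.commute)
    ultimately show ?thesis unfolding has_field_derivative_def by simp
  qed
  show "continuous_on UNIV f'"
    unfolding f'_def by (intro continuous_intros smooth_continuous smooth_partial assms) simp
qed

section \<open>A smooth step function on the line\<close>

definition expinv :: "real \<Rightarrow> real" where
  "expinv t = (if t \<le> 0 then 0 else exp (- 1 / t))"

lemma smooth_expinv: "smooth (\<lambda>t. complex_of_real (expinv t))"
proof -
  \<comment> \<open>This family is closed under differentiation up to linear combinations: the
    derivative of \<open>e j\<close> involves \<open>e (j + 1)\<close> and \<open>e (j + 2)\<close>.
    So all members are treated at once, and \<open>expinv\<close> is \<open>e 0\<close>.\<close>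
  define e where "e j t = (if t \<le> 0 then 0 else t powr (- real j) * exp (- 1 / t))" for j t
  have e_der: "(e j has_real_derivative - real j * e (Suc j) t + e (j + 2) t) (at t)" for j t
  proof -
    consider "t < 0" | "t > 0" | "t = 0" by linarith
    then show ?thesis
    proof cases
      case 1
      have "((\<lambda>_. 0) has_real_derivative 0) (at t)" by simp
      then have "(e j has_real_derivative 0) (at t)"
        by (rule DERIV_cong_ev[THEN iffD1, rotated -1])
           (use 1 in \<open>auto simp: e_def intro!: eventually_mono[OF eventually_nhds_in_open[of "{..<0}"]]\<close>)
      then show ?thesis using 1 by (simp add: e_def)
    next
      case 2
      have p: "t powr (- real j - 2) = t powr (- real j) / t^2"
        using 2 by (simp add: powr_diff flip: powr_numeral)
      have q: "t powr (- real j - 1) = t powr (- real j) / t"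
        using 2 by (simp add: powr_diff)
      have "((\<lambda>t. t powr (- real j) * exp (- 1 / t)) has_real_derivative
          (- real j * t powr (- real j - 1)) * exp (- 1 / t) + t powr (- real j) * (exp (- 1 / t) * (1 / t^2))) (at t)"
        using 2 by (auto intro!: derivative_eq_intros simp: power2_eq_square)
      then have "(e j has_real_derivative
          (- real j * t powr (- real j - 1)) * exp (- 1 / t) + t powr (- real j) * (exp (- 1 / t) * (1 / t^2))) (at t)"
        by (rule DERIV_cong_ev[THEN iffD1, rotated -1])
           (use 2 in \<open>auto simp: e_def intro!: eventually_mono[OF eventually_nhds_in_open[of "{0<..}"]]\<close>)
      moreover have "(- real j * t powr (- real j - 1)) * exp (- 1 / t) + t powr (- real j) * (exp (- 1 / t) * (1 / t^2))
         = - real j * e (Suc j) t + e (j + 2) t"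
      proof -
        have a: "- real (Suc j) = - real j - 1" "- real (j + 2) = - real j - 2" by auto
        show ?thesis unfolding e_def a p q using 2 by (simp add: field_simps)
      qed
      ultimately show ?thesis by simp
    next
      case 3
      \<comment> \<open>At the origin the exponential beats every negative power, so the right
        difference quotient tends to 0; on the left the function is 0.\<close>
      have r: "((\<lambda>h. (e j (0 + h) - e j 0) / h) \<longlongrightarrow> 0) (at_right 0)"
      proof -
        have "((\<lambda>h. h powr (- real j) * exp (- 1 / h) / h) \<longlongrightarrow> 0) (at_right 0)"
          by real_asymp
        then show ?thesis
          by (rule Lim_transform_eventually)
             (auto simp: e_def intro!: eventually_mono[OF eventually_at_right_less[of 0]])
      qed
      have l: "((\<lambda>h. (e j (0 + h) - e j 0) / h) \<longlongrightarrow> 0) (at_left 0)"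
        by (rule Lim_transform_eventually[OF tendsto_const])
           (auto simp: e_def intro!: eventually_mono[OF eventually_at_left_real[of "-1" 0]])
      have "(e j has_real_derivative 0) (at 0)"
        unfolding DERIV_def using filterlim_split_at[OF l r] by simp
      then show ?thesis using 3 by (simp add: e_def)
    qed
  qed
  have "C_k n (\<lambda>t. complex_of_real (e j t))" for n j
  proof (induction n arbitrary: j)
    case 0
    have "continuous_on UNIV (e j)"
      using e_der DERIV_isCont continuous_at_imp_continuous_on by blast
    then show ?case by (auto intro!: continuous_intros)
  next
    case (Suc n)
    have "((\<lambda>t. complex_of_real (e j t)) has_derivative
        (\<lambda>h. complex_of_real h * (complex_of_real (- real j) * complex_of_real (e (Suc j) t) + complex_of_real (e (j + 2) t)))) (at t)" for t
    proof -
      have "((\<lambda>t. complex_of_real (e j t)) has_derivative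
        (\<lambda>h. complex_of_real ((- real j * e (Suc j) t + e (j + 2) t) * h))) (at t)"
        using has_derivative_of_real[OF e_der[of j t, unfolded has_field_derivative_def]] .
      then show ?thesis by (simp add: mult.commute)
    qed
    then show ?case
      by (rule C_k_SucI) (intro C_k_mult C_k_add C_k_const Suc)
  qed
  moreover have "e 0 = expinv" by (auto simp: e_def expinv_def fun_eq_iff)
  ultimately show ?thesis unfolding smooth_def by metis
qed

definition step :: "real \<Rightarrow> real" where
  "step t = expinv (t - 1) / (expinv (t - 1) + expinv (2 - t))"

lemma expinv_nonneg: "expinv t \<ge> 0"
  by (simp add: expinv_def)

text \<open>The half-lines \<open>t > 1\<close> and \<open>t < 2\<close>, on which the two summands
  are positive, cover the line.\<close>

lemma step_denom_pos: "expinv (t - 1) + expinv (2 - t) > 0"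
proof (cases "t > 1")
  case True
  then have "expinv (t - 1) > 0" by (simp add: expinv_def)
  then show ?thesis using expinv_nonneg[of "2 - t"] by linarith
next
  case False
  then have "expinv (2 - t) > 0" by (simp add: expinv_def)
  then show ?thesis using expinv_nonneg[of "t - 1"] by linarith
qed

lemma step_eq_0: "t \<le> 1 \<Longrightarrow> step t = 0"
  and step_eq_1: "t \<ge> 2 \<Longrightarrow> step t = 1"
  using step_denom_pos[of t] by (auto simp: step_def expinv_def)

lemma step_nonneg: "0 \<le> step t" and step_le_1: "step t \<le> 1"
  using step_denom_pos[of t] expinv_nonneg[of "t - 1"] expinv_nonneg[of "2 - t"]
  by (auto simp: step_def)

lemma smooth_step: 
  fixes h :: "'a::euclidean_space \<Rightarrow> real"
  assumes "smooth (\<lambda>x. complex_of_real (h x))"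
  shows "smooth (\<lambda>x. complex_of_real (step (h x)))"
proof -
  have a: "smooth (\<lambda>x. complex_of_real (expinv (h x - 1)))"
    using smooth_compose_real[OF smooth_expinv, of "\<lambda>x. h x - 1"] smooth_diff[OF assms smooth_const, of 1] by auto
  have b: "smooth (\<lambda>x. complex_of_real (expinv (2 - h x)))"
    using smooth_compose_real[OF smooth_expinv, of "\<lambda>x. 2 - h x"] assms smooth_diff[OF smooth_const assms, of 2] by auto
  have "smooth (\<lambda>x. complex_of_real (expinv (h x - 1)) * inverse (complex_of_real (expinv (h x - 1)) + complex_of_real (expinv (2 - h x))))"
    using step_denom_pos
    by (intro smooth_mult a smooth_inverse smooth_add b)
       (metis of_real_add of_real_eq_0_iff less_irrefl)
  then show ?thesis by (simp add: step_def divide_inverse)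
qed

lemma step_deriv:
  obtains step' L where "\<And>t. (step has_real_derivative step' t) (at t)"
    "\<And>t. \<bar>step' t\<bar> \<le> L" "\<And>t. step' t \<noteq> 0 \<Longrightarrow> 1 \<le> t \<and> t \<le> 2" "L > 0" "continuous_on UNIV step'"
proof -
  have "smooth (\<lambda>t::real. complex_of_real (step t))"
    by (intro smooth_step) (rule smooth_of_real_linear[OF bounded_linear_ident])
  then obtain s where s: "\<And>t. (step has_real_derivative s t) (at t)" and c: "continuous_on UNIV s"
    using smooth_imp_real_derivative by blast
  have z: "s t = 0" if "t < 1 \<or> t > 2" for t
  proof -
    have "\<exists>S c. open S \<and> t \<in> S \<and> (\<forall>x\<in>S. step x = c)"
    proof (cases "t < 1")
      case True
      then show ?thesis by (intro exI[of _ "{..<1}"] exI[of _ 0]) (auto simp: step_eq_0)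
    next
      case False
      then show ?thesis using that by (intro exI[of _ "{2<..}"] exI[of _ 1]) (auto simp: step_eq_1)
    qed
    then obtain S c where S: "open S" "t \<in> S" "\<And>x. x \<in> S \<Longrightarrow> step x = c" by blast
    have "((\<lambda>_. c) has_real_derivative 0) (at t)" by simp
    then have "(step has_real_derivative 0) (at t)"
      by (rule DERIV_cong_ev[THEN iffD1, rotated -1])
         (use S in \<open>auto intro!: eventually_mono[OF eventually_nhds_in_open[of S]]\<close>)
    then show ?thesis using s DERIV_unique by blast
  qed
  have "compact (s ` {1..2})" 
    by (intro compact_continuous_image continuous_on_subset[OF c]) auto
  then obtain L where "\<forall>x\<in>s ` {1..2}. norm x \<le> L"
    using compact_imp_bounded bounded_iff by metis
  \<comment> \<open>The added 1 makes the bound strictly positive, as later divisions by it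
    require.\<close>
  then have L: "\<bar>s t\<bar> \<le> \<bar>L\<bar> + 1" for t
  proof (cases "t < 1 \<or> t > 2")
    case False
    then have "s t \<in> s ` {1..2}" by auto
    then have "\<bar>s t\<bar> \<le> L" using \<open>\<forall>x\<in>s ` {1..2}. norm x \<le> L\<close> by fastforce
    then show ?thesis by linarith
  qed (use z[of t] in auto)
  show ?thesis
  proof (rule that[OF s L _ _ c])
    show "1 \<le> t \<and> t \<le> 2" if "s t \<noteq> 0" for t using z[of t] that by force
  qed auto
qed

section \<open>Test functions\<close>

lemma test_functionsI:
  assumes "smooth \<phi>" "compact K" "K \<subseteq> U" "\<And>x. \<phi> x \<noteq> 0 \<Longrightarrow> x \<in> K"
  shows "\<phi> \<in> test_functions U"
proof -
  have "closure {x. \<phi> x \<noteq> 0} \<subseteq> K"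
    using assms by (intro closure_minimal) (auto intro: compact_imp_closed)
  moreover have "compact (closure {x. \<phi> x \<noteq> 0})"
    using compact_Int_closed[OF assms(2) closed_closure] calculation by (metis inf.absorb2)
  ultimately show ?thesis using assms by (auto simp: test_functions_def smooth_def)
qed

text \<open>One compact set serves the function and all its partials: outside the closed support the
  function vanishes on a neighbourhood, hence so do its derivatives.\<close>

lemma test_functionsE:
  assumes "\<phi> \<in> test_functions U"
  obtains K where "smooth \<phi>" "compact K" "K \<subseteq> U" "\<And>x. x \<notin> K \<Longrightarrow> \<phi> x = 0"
    "\<And>b x. x \<notin> K \<Longrightarrow> partial b \<phi> x = 0"
proof -
  let ?K = "closure {x. \<phi> x \<noteq> 0}"
  have "partial b \<phi> x = 0" if "x \<notin> ?K" for b x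
  proof -
    have "((\<lambda>_. 0) has_derivative (\<lambda>_. 0)) (at x)" by simp
    then have "(\<phi> has_derivative (\<lambda>_. 0)) (at x)"
    proof (rule has_derivative_transform_within_open)
      show "open (- ?K)" "x \<in> - ?K" using that by auto
      show "0 = \<phi> y" if "y \<in> - ?K" for y
        using that closure_subset[of "{x. \<phi> x \<noteq> 0}"] by auto
    qed
    then show ?thesis by (rule partial_eq)
  qed
  moreover have "\<phi> x = 0" if "x \<notin> ?K" for x
    using that closure_subset[of "{x. \<phi> x \<noteq> 0}"] by auto
  moreover have "smooth \<phi>" "compact ?K" "?K \<subseteq> U"
    using assms by (simp_all add: test_functions_def smooth_def)
  ultimately show ?thesis using that by blast
qed

lemma test_functions_smooth: "\<phi> \<in> test_functions U \<Longrightarrow> smooth \<phi>"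
  by (simp add: test_functions_def smooth_def)

lemma test_functions_mult:
  assumes "\<phi> \<in> test_functions U" "smooth g"
  shows "(\<lambda>x. \<phi> x * g x) \<in> test_functions U"
proof -
  obtain K where K: "smooth \<phi>" "compact K" "K \<subseteq> U" "\<And>x. x \<notin> K \<Longrightarrow> \<phi> x = 0"
    using assms(1) by (rule test_functionsE) blast
  show ?thesis
    by (rule test_functionsI[of _ K]) (use K assms(2) in auto)
qed

lemma test_functions_partial:
  assumes "\<phi> \<in> test_functions U" "b \<in> Basis"
  shows "partial b \<phi> \<in> test_functions U"
proof -
  obtain K where K: "smooth \<phi>" "compact K" "K \<subseteq> U" "\<And>b x. x \<notin> K \<Longrightarrow> partial b \<phi> x = 0"
    using assms(1) by (rule test_functionsE) blast
  show ?thesis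
    by (rule test_functionsI[of _ K]) (use K assms(2) in \<open>auto intro: smooth_partial\<close>)
qed

lemma test_functions_mono: "\<phi> \<in> test_functions U \<Longrightarrow> U \<subseteq> U' \<Longrightarrow> \<phi> \<in> test_functions U'"
  by (auto simp: test_functions_def)

lemma test_functions_Times:
  assumes "\<phi> \<in> test_functions U" "\<zeta> \<in> test_functions W"
  shows "(\<lambda>z. \<phi> (fst z) * \<zeta> (snd z)) \<in> test_functions (U \<times> W)"
proof -
  obtain K where K: "smooth \<phi>" "compact K" "K \<subseteq> U" "\<And>x. x \<notin> K \<Longrightarrow> \<phi> x = 0"
    using assms(1) by (rule test_functionsE) blast
  obtain K' where K': "smooth \<zeta>" "compact K'" "K' \<subseteq> W" "\<And>x. x \<notin> K' \<Longrightarrow> \<zeta> x = 0"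
    using assms(2) by (rule test_functionsE) blast
  show ?thesis
    by (rule test_functionsI[of _ "K \<times> K'"])
       (use K K' in \<open>force intro!: smooth_mult smooth_compose_linear[OF _ bounded_linear_fst]
         smooth_compose_linear[OF _ bounded_linear_snd] compact_Times\<close>)+
qed

lemma partial_Times:
  assumes "smooth \<phi>" "smooth \<zeta>"
  shows "partial (a, b) (\<lambda>z. \<phi> (fst z) * \<zeta> (snd z)) z =
    partial a \<phi> (fst z) * \<zeta> (snd z) + \<phi> (fst z) * partial b \<zeta> (snd z)"
proof -
  have 1: "((\<lambda>z. \<phi> (fst z)) has_derivative (\<lambda>h. partial (fst h) \<phi> (fst z))) (at z)"
    by (rule has_derivative_compose[OF has_derivative_fst[OF has_derivative_ident] smooth_has_derivative[OF assms(1)]])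
  have 2: "((\<lambda>z. \<zeta> (snd z)) has_derivative (\<lambda>h. partial (snd h) \<zeta> (snd z))) (at z)"
    by (rule has_derivative_compose[OF has_derivative_snd[OF has_derivative_ident] smooth_has_derivative[OF assms(2)]])
  show ?thesis using partial_eq[OF has_derivative_mult[OF 1 2], of "(a, b)"] by (simp add: algebra_simps)
qed

lemma partial_mult:
  "smooth f \<Longrightarrow> smooth g \<Longrightarrow> partial b (\<lambda>x. f x * g x) x = partial b f x * g x + f x * partial b g x"
  using partial_eq[OF has_derivative_mult[OF smooth_has_derivative[of f] smooth_has_derivative[of g]]]
  by simp

lemma partial_0: "smooth f \<Longrightarrow> partial 0 f x = 0"
  using linear_0[OF has_derivative_linear[OF smooth_has_derivative[of f x]]] by simp

section \<open>An integral representation of the fundamental solution\<close>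

text \<open>The mean value inequality bounds the difference quotients by \<open>B\<close>, so their
  deviation from the derivative is dominated by \<open>2 * B\<close>, and dominated convergence
  applies along every null sequence.\<close>

lemma has_vector_derivative_integral:
  fixes f f' :: "real \<Rightarrow> 'a \<Rightarrow> complex"
  assumes ab: "a < r" "r < b"
    and int: "\<And>s. a < s \<Longrightarrow> s < b \<Longrightarrow> integrable M (f s)"
    and int': "integrable M (f' r)"
    and der: "\<And>s v. a < s \<Longrightarrow> s < b \<Longrightarrow> ((\<lambda>s. f s v) has_vector_derivative f' s v) (at s)"
    and bound: "\<And>s v. a < s \<Longrightarrow> s < b \<Longrightarrow> norm (f' s v) \<le> B v"
    and B: "integrable M B"
  shows "((\<lambda>s. integral\<^sup>L M (f s)) has_vector_derivative integral\<^sup>L M (f' r)) (at r)"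
proof -
  define q where "q h v = (f (r + h) v - f r v - h *\<^sub>R f' r v) /\<^sub>R \<bar>h\<bar>" for h v
  have "((\<lambda>h. norm (integral\<^sup>L M (f (r + h)) - integral\<^sup>L M (f r) - h *\<^sub>R integral\<^sup>L M (f' r)) / norm h) \<longlongrightarrow> 0) (at 0)"
    unfolding tendsto_at_iff_sequentially comp_def
  proof (intro allI impI)
    fix X :: "nat \<Rightarrow> real" assume X0: "\<forall>i. X i \<in> UNIV - {0}" and X: "X \<longlonglongrightarrow> 0"
    define d where "d = min (r - a) (b - r)"
    have "d > 0" using ab by (simp add: d_def)
    then have ev: "\<forall>\<^sub>F n in sequentially. \<bar>X n\<bar> < d"
      using X by (simp add: tendsto_iff dist_real_def)
    then obtain N where N: "\<And>n. n \<ge> N \<Longrightarrow> \<bar>X n\<bar> < d" by (auto simp: eventually_sequentially)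
    have in_ab: "a < r + X n" "r + X n < b" if "n \<ge> N" for n
      using N[OF that] by (auto simp: d_def)
    have diff: "norm (f (r + X n) v - f r v) \<le> B v * \<bar>X n\<bar>" if "n \<ge> N" for n v
    proof -
      have "norm (f (r + X n) v - f r v) \<le> B v * norm (r + X n - r)"
      proof (rule differentiable_bound[of "{a<..<b}" _ "\<lambda>s h. h *\<^sub>R f' s v"])
        show "((\<lambda>s. f s v) has_derivative (\<lambda>h. h *\<^sub>R f' s v)) (at s within {a<..<b})" if "s \<in> {a<..<b}" for s
          using der[of s v] that by (auto simp: has_vector_derivative_def intro: has_derivative_at_withinI)
        show "onorm (\<lambda>h. h *\<^sub>R f' s v) \<le> B v" if "s \<in> {a<..<b}" for s
          using bound[of s v] that by (auto simp: onorm_scaleR_left onorm_id bounded_linear_ident intro!: onorm_le)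
      qed (use ab in_ab[OF that] in auto)
      then show ?thesis by simp
    qed
    \<comment> \<open>The shift by \<open>N\<close> keeps the points \<open>r + X n\<close> inside
      the interval on which derivatives and bounds are available.\<close>
    have "(\<lambda>n. integral\<^sup>L M (q (X (n + N)))) \<longlonglongrightarrow> integral\<^sup>L M (\<lambda>v. 0)"
    proof (rule integral_dominated_convergence)
      show "q (X (n + N)) \<in> borel_measurable M" for n
        unfolding q_def using int[OF in_ab[of "n+N"]] int[OF ab] int'
        by (auto intro!: borel_measurable_scaleR borel_measurable_diff borel_measurable_integrable)
      show "integrable M (\<lambda>v. 2 * B v)" using B by simp
      show "AE v in M. (\<lambda>n. q (X (n + N)) v) \<longlonglongrightarrow> 0"
      proof (rule AE_I2)
        fix v
        have "((\<lambda>s. f s v) has_derivative (\<lambda>h. h *\<^sub>R f' r v)) (at r)"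
          using der[OF ab] by (simp add: has_vector_derivative_def)
        then have "((\<lambda>h. norm (f (r + h) v - f r v - h *\<^sub>R f' r v) / norm h) \<longlongrightarrow> 0) (at 0)"
          by (simp add: has_derivative_at)
        then have "(\<lambda>n. norm (f (r + X n) v - f r v - X n *\<^sub>R f' r v) / norm (X n)) \<longlonglongrightarrow> 0"
          using X X0 unfolding tendsto_at_iff_sequentially comp_def by blast
        then have "(\<lambda>n. norm (q (X n) v)) \<longlonglongrightarrow> 0"
          by (simp add: q_def divide_inverse mult.commute)
        then show "(\<lambda>n. q (X (n + N)) v) \<longlonglongrightarrow> 0"
          using LIMSEQ_ignore_initial_segment tendsto_norm_zero_iff by blast
      qed
      show "AE v in M. norm (q (X (n + N)) v) \<le> 2 * B v" for n
      proof (rule AE_I2)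
        fix v
        let ?h = "X (n + N)"
        have "norm (f (r + ?h) v - f r v - ?h *\<^sub>R f' r v) \<le> B v * \<bar>?h\<bar> + \<bar>?h\<bar> * B v"
          using diff[of "n+N" v] bound[OF ab, of v]
          by (intro order_trans[OF norm_triangle_ineq4[of "f (r + ?h) v - f r v"]] add_mono) (auto intro: mult_left_mono)
        moreover have "norm (q ?h v) = norm (f (r + ?h) v - f r v - ?h *\<^sub>R f' r v) / \<bar>?h\<bar>"
          by (simp add: q_def divide_inverse mult.commute)
        moreover have "\<bar>?h\<bar> > 0" using X0 by simp
        ultimately show "norm (q ?h v) \<le> 2 * B v" by (simp add: divide_le_eq algebra_simps)
      qed
    qed auto
    moreover have "integral\<^sup>L M (q (X (n + N))) =
        (integral\<^sup>L M (f (r + X (n+N))) - integral\<^sup>L M (f r) - X (n+N) *\<^sub>R integral\<^sup>L M (f' r)) /\<^sub>R \<bar>X (n+N)\<bar>" for n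
      unfolding q_def using int[OF in_ab[of "n+N"]] int[OF ab] int'
      by (subst integral_scaleR_right, (simp add: Bochner_Integration.integral_diff)+)
    ultimately have "(\<lambda>n. norm ((integral\<^sup>L M (f (r + X (n+N))) - integral\<^sup>L M (f r) - X (n+N) *\<^sub>R integral\<^sup>L M (f' r)) /\<^sub>R \<bar>X (n+N)\<bar>)) \<longlonglongrightarrow> 0"
      using tendsto_norm_zero by fastforce
    then have "(\<lambda>n. norm (integral\<^sup>L M (f (r + X (n+N))) - integral\<^sup>L M (f r) - X (n+N) *\<^sub>R integral\<^sup>L M (f' r)) / norm (X (n+N))) \<longlonglongrightarrow> 0"
      by (simp add: divide_inverse mult.commute)
    then show "(\<lambda>n. norm (integral\<^sup>L M (f (r + X n)) - integral\<^sup>L M (f r) - X n *\<^sub>R integral\<^sup>L M (f' r)) / norm (X n)) \<longlonglongrightarrow> 0"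
      by (rule LIMSEQ_offset)
  qed
  then show ?thesis unfolding has_vector_derivative_def has_derivative_at
    by (auto intro: bounded_linear_scaleR_left)
qed

section \<open>Gaussian integrals and exponential bounds\<close>

lemma integrable_gaussian:
  assumes "r > (0::real)"
  shows "integrable lborel (\<lambda>v. exp (- r * v\<^sup>2))" "(\<integral>v. exp (- r * v\<^sup>2) \<partial>lborel) = sqrt (pi / r)"
proof -
  \<comment> \<open>The variance is \<open>1 / (2 * r)\<close>: with it the Gaussian is
    \<open>sqrt (pi / r)\<close> times the normal density.\<close>
  define \<sigma> where "\<sigma> = 1 / sqrt (2 * r)"
  have s: "\<sigma> > 0" "\<sigma>\<^sup>2 = 1 / (2 * r)" using assms by (auto simp: \<sigma>_def power_divide)
  have "normal_density 0 \<sigma> v = 1 / sqrt (pi / r) * exp (- r * v\<^sup>2)" for v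
    using assms by (simp add: normal_density_def s field_simps)
  then have e: "exp (- r * v\<^sup>2) = sqrt (pi / r) * normal_density 0 \<sigma> v" for v
    using assms by (simp add: field_simps)
  show "integrable lborel (\<lambda>v. exp (- r * v\<^sup>2))" unfolding e using s by simp
  show "(\<integral>v. exp (- r * v\<^sup>2) \<partial>lborel) = sqrt (pi / r)" unfolding e using s by simp
qed

lemma integrable_gaussian_bound:
  fixes f :: "real \<Rightarrow> 'b::{banach, second_countable_topology}"
  assumes "f \<in> borel_measurable borel" "r > 0" "C \<ge> 0" "\<And>v. norm (f v) \<le> C * exp (- r * v\<^sup>2)"
  shows "integrable lborel f" "norm (integral\<^sup>L lborel f) \<le> C * sqrt (pi / r)"
proof -
  have i: "integrable lborel (\<lambda>v. C * exp (- r * v\<^sup>2))"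
    using integrable_gaussian(1)[OF assms(2)] by simp
  show f: "integrable lborel f"
    by (rule Bochner_Integration.integrable_bound[OF i]) (use assms in auto)
  have "norm (integral\<^sup>L lborel f) \<le> (\<integral>v. norm (f v) \<partial>lborel)" by simp
  also have "\<dots> \<le> (\<integral>v. C * exp (- r * v\<^sup>2) \<partial>lborel)"
    using f i assms(4) by (intro integral_mono) auto
  finally show "norm (integral\<^sup>L lborel f) \<le> C * sqrt (pi / r)"
    using integrable_gaussian(2)[OF assms(2)] by simp
qed

lemma power_exp_bound:
  fixes A t e :: real
  assumes "A \<ge> 0" "e > 0"
  obtains K where "K \<ge> 0" "\<And>t. t \<ge> 0 \<Longrightarrow> (A + t) ^ j \<le> K * exp (e * t)"
proof -
  \<comment> \<open>Each factor of the \<open>j\<close>-th power receives the share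
    \<open>e'\<close> of the exponent; \<open>j + 1\<close> instead of \<open>j\<close> covers
    \<open>j = 0\<close>.\<close>
  define e' where "e' = e / (real j + 1)"
  have e': "e' > 0" using assms by (simp add: e'_def)
  define K where "K = (A + 1 / e') ^ j"
  show ?thesis
  proof
    show "K \<ge> 0" using assms e' by (simp add: K_def)
    fix t :: real assume t: "t \<ge> 0"
    have "A + t \<le> (A + 1 / e') * exp (e' * t)"
    proof -
      have "0 \<le> e' * t" using t e' by simp
      then have "e' * t \<le> exp (e' * t)" "1 \<le> exp (e' * t)" using exp_ge_add_one_self[of "e' * t"] by linarith+
      then have "A * 1 \<le> A * exp (e' * t)" using assms by (intro mult_left_mono) auto
      moreover have "t \<le> 1 / e' * exp (e' * t)"
        using \<open>e' * t \<le> exp (e' * t)\<close> e' by (simp add: field_simps)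
      ultimately      show ?thesis by (simp add: algebra_simps)
    qed
    then have "(A + t) ^ j \<le> ((A + 1 / e') * exp (e' * t)) ^ j"
      using assms t by (intro power_mono) auto
    also have "\<dots> = K * exp (real j * (e' * t))"
      by (simp add: K_def power_mult_distrib exp_of_nat_mult)
    also have "\<dots> \<le> K * exp (e * t)"
    proof -
      have "real j * e' \<le> e" using assms by (simp add: e'_def field_simps)
      then have "real j * (e' * t) \<le> e * t" using t by (metis mult.assoc mult_right_mono)
      then show ?thesis using assms e' by (auto simp: K_def intro!: mult_left_mono)
    qed
    finally show "(A + t) ^ j \<le> K * exp (e * t)" .
  qed
qed

section \<open>The Laplace integral for the Bessel kernel\<close>

lemma powr_m_half: "r > 0 \<Longrightarrow> r powr (-1/2) = 1 / sqrt r"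
  using powr_minus_divide[of r "1/2"] by (simp add: powr_half_sqrt)

text \<open>Decaying modes have \<open>c > 0\<close>, outgoing ones \<open>c = - \<i> * s\<close>
  with \<open>s > 0\<close>; \<open>Re c \<ge> 0\<close> treats both at once and keeps
  \<open>exp (- c * r)\<close> bounded.\<close>

locale wavenumber =
  fixes c :: complex
  assumes Re_c: "Re c \<ge> 0" and c_nz: "c \<noteq> 0"
begin

definition s :: "real \<Rightarrow> complex" where "s v = csqrt (2 * c + of_real (v\<^sup>2))"

text \<open>Keeps \<open>csqrt\<close> away from its branch cut for all real \<open>v\<close>, which
  gives continuity of \<open>s\<close> and, later, a derivative in \<open>v\<close>.\<close>

lemma radicand: "2 * c + of_real (v\<^sup>2) \<notin> \<real>\<^sub>\<le>\<^sub>0"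
proof
  assume *: "2 * c + of_real (v\<^sup>2) \<in> \<real>\<^sub>\<le>\<^sub>0"
  then have "2 * Re c + v\<^sup>2 \<le> 0" and "Im c = 0"
    by (auto simp: complex_nonpos_Reals_iff simp del: of_real_power)
  moreover from this(1) have "Re c = 0" using Re_c zero_le_power2[of v] by linarith
  ultimately have "Re c = 0" "Im c = 0" by auto
  then show False using c_nz by (simp add: complex_eq_iff)
qed

lemma s_nz: "s v \<noteq> 0"
  using radicand[of v] by (auto simp: s_def)

lemma s_sq: "(s v)\<^sup>2 = 2 * c + of_real (v\<^sup>2)"
  by (simp add: s_def)

text \<open>Because \<open>Re c \<ge> 0\<close>, adding a nonnegative real number cannot shorten the
  vector \<open>2 * c\<close>. The resulting factor \<open>1 / sqrt (2 * norm c)\<close> is at most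
  1 once \<open>norm c \<ge> 1/2\<close>.\<close>

lemma norm_radicand: "norm (2 * c + of_real (v\<^sup>2)) \<ge> 2 * norm c"
proof (rule power2_le_imp_le)
  have "0 \<le> v\<^sup>2 * v\<^sup>2 + 4 * (Re c * v\<^sup>2)" using Re_c by simp
  then show "(2 * norm c)\<^sup>2 \<le> (norm (2 * c + of_real (v\<^sup>2)))\<^sup>2"
    unfolding power_mult_distrib cmod_power2
    by (simp add: power2_eq_square algebra_simps mult.left_commute) 
qed simp

lemma norm_s: "norm (s v) \<ge> sqrt (2 * norm c)"
proof -
  have "(norm (s v))\<^sup>2 \<ge> 2 * norm c"
    using norm_radicand[of v] by (simp add: s_sq flip: norm_power)
  then show ?thesis using real_sqrt_le_mono[of "2 * norm c" "(norm (s v))\<^sup>2"] by simp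
qed

lemma s_cont: "isCont s v"
  unfolding s_def using radicand[of v] by (intro isCont_csqrt' continuous_intros)

lemma s_measurable [measurable]: "s \<in> borel_measurable borel"
  using s_cont by (intro borel_measurable_continuous_onI continuous_at_imp_continuous_on) auto

text \<open>\<open>g j r\<close> is the \<open>j\<close>-th derivative in \<open>r\<close> of
  \<open>exp (- (c + v^2) * r) / s v\<close>. The integral of the latter is the modified Bessel
  function \<open>K_0 (c * r)\<close>: substitute \<open>t = 1 + v^2 / c\<close> in the integral of
  \<open>exp (- c * r * t) / sqrt (t^2 - 1)\<close> over \<open>t > 1\<close>. For
  \<open>c = - \<i> * s\<close> it is a multiple of the outgoing Hankel function.\<close>

definition g :: "nat \<Rightarrow> real \<Rightarrow> real \<Rightarrow> complex" where
  "g j r v = (- (c + of_real (v\<^sup>2))) ^ j * exp (- (c + of_real (v\<^sup>2)) * of_real r) / s v"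

definition G :: "nat \<Rightarrow> real \<Rightarrow> complex" where
  "G j r = (\<integral>v. g j r v \<partial>lborel)"

lemma g_measurable [measurable]: "g j r \<in> borel_measurable borel"
  unfolding g_def by measurable

lemma norm_exp_le: "r \<ge> 0 \<Longrightarrow> norm (exp (- (c + of_real (v\<^sup>2)) * of_real r)) \<le> exp (- r * v\<^sup>2)"
  using Re_c by (simp add: norm_exp_eq_Re algebra_simps del: of_real_power)

lemma norm_g: 
  assumes "r \<ge> 0" shows "norm (g j r v) \<le> (norm c + v\<^sup>2) ^ j * exp (- r * v\<^sup>2) / sqrt (2 * norm c)"
proof -
  have "norm (c + of_real (v\<^sup>2)) \<le> norm c + v\<^sup>2"
    using norm_triangle_ineq[of c "of_real (v\<^sup>2)"] by (simp del: of_real_power)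
  then have "norm (- (c + of_real (v\<^sup>2))) ^ j \<le> (norm c + v\<^sup>2) ^ j"
    unfolding norm_minus_cancel by (intro power_mono) auto
  then show ?thesis
    unfolding g_def norm_divide norm_mult norm_power
    using c_nz norm_exp_le[OF assms, of v] norm_s[of v] by (intro frac_le mult_mono) auto
qed

text \<open>Half of the Gaussian decay absorbs the polynomial factor, leaving one majorant for all
  \<open>r \<ge> r0\<close>, as differentiation under the integral requires.\<close>

lemma g_bound:
  assumes "r0 > 0"
  obtains K where "K \<ge> 0" "\<And>r v. r0 \<le> r \<Longrightarrow> norm (g j r v) \<le> K * exp (- (r0 / 2) * v\<^sup>2)"
proof -
  obtain K where K: "K \<ge> 0" "\<And>t. t \<ge> 0 \<Longrightarrow> (norm c + t) ^ j \<le> K * exp ((r0 / 2) * t)"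
    using power_exp_bound[of "norm c" "r0 / 2" j] assms by auto
  show ?thesis
  proof (rule that[of "K / sqrt (2 * norm c)"])
    fix r v assume r: "r0 \<le> r"
    have "norm (g j r v) \<le> (norm c + v\<^sup>2) ^ j * exp (- r * v\<^sup>2) / sqrt (2 * norm c)"
      using norm_g r assms by auto
    also have "\<dots> \<le> (K * exp ((r0 / 2) * v\<^sup>2)) * exp (- r0 * v\<^sup>2) / sqrt (2 * norm c)"
      using K r by (intro divide_right_mono mult_mono) (auto intro: mult_right_mono)
    also have "\<dots> = K / sqrt (2 * norm c) * exp (- (r0 / 2) * v\<^sup>2)"
      by (simp add: mult.assoc flip: exp_add)
    finally show "norm (g j r v) \<le> K / sqrt (2 * norm c) * exp (- (r0 / 2) * v\<^sup>2)" .
  qed (use K in auto)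
qed

lemma g_integrable: "r > 0 \<Longrightarrow> integrable lborel (g j r)"
proof -
  assume r: "r > 0"
  then obtain K where "K \<ge> 0" "\<And>r' v. r \<le> r' \<Longrightarrow> norm (g j r' v) \<le> K * exp (- (r / 2) * v\<^sup>2)"
    using g_bound by blast
  then show ?thesis using r by (intro integrable_gaussian_bound(1)[of _ "r/2" K]) auto
qed

lemma G_deriv: 
  assumes "r > 0" shows "(G j has_vector_derivative G (Suc j) r) (at r)"
proof -
  \<comment> \<open>The majorant must hold on a whole interval around \<open>r\<close>; the one for
    radii from \<open>r / 2\<close> on serves the interval from \<open>r / 2\<close> to
    \<open>2 * r\<close>.\<close>
  have "r / 2 > 0" using assms by simp
  from g_bound[OF this] obtain K where K: "K \<ge> 0"
    "\<And>r' v. r / 2 \<le> r' \<Longrightarrow> norm (g (Suc j) r' v) \<le> K * exp (- (r / 2 / 2) * v\<^sup>2)"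
    by blast
  show ?thesis unfolding G_def
  proof (rule has_vector_derivative_integral[where a="r/2" and b="2*r" and B="\<lambda>v. K * exp (- (r / 2 / 2) * v\<^sup>2)"])
    fix t v assume t: "r / 2 < t" "t < 2 * r"
    show "integrable lborel (g j t)" using t assms by (intro g_integrable) auto
    have "((\<lambda>z. (- (c + of_real (v\<^sup>2))) ^ j * exp (- (c + of_real (v\<^sup>2)) * z) / s v) has_field_derivative
       g (Suc j) t v) (at (of_real t))"
      unfolding g_def using s_nz[of v] by (auto intro!: derivative_eq_intros)
    from has_vector_derivative_real_field[OF this]
    show "((\<lambda>t. g j t v) has_vector_derivative g (Suc j) t v) (at t)" by (simp add: g_def)
  next
    have "integrable lborel (\<lambda>v. exp (- (r / 2 / 2) * v\<^sup>2))"
      by (rule integrable_gaussian(1)) (use assms in auto)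
    then show "integrable lborel (\<lambda>v. K * exp (- (r / 2 / 2) * v\<^sup>2))" by simp
  qed (use assms K g_integrable in auto)
qed

text \<open>Crude near 0, where the true singularity is logarithmic, but valid for every
  \<open>r\<close>, of the right order at infinity in the radiating case, and locally integrable in
  the plane.\<close>

lemma norm_G0: "r > 0 \<Longrightarrow> norm (G 0 r) \<le> sqrt pi / sqrt (2 * norm c) * r powr (-1/2)"
proof -
  assume r: "r > 0"
  have "norm (G 0 r) \<le> 1 / sqrt (2 * norm c) * sqrt (pi / r)"
    unfolding G_def by (rule integrable_gaussian_bound) (use norm_g[of r 0] r in auto)
  also have "\<dots> = sqrt pi / sqrt (2 * norm c) * r powr (-1/2)"
    using powr_m_half[OF r] by (simp add: real_sqrt_divide)
  finally show ?thesis .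
qed

text \<open>The outgoing radiation condition.\<close>

lemma norm_G1_plus: 
  assumes r: "r > 0"
  shows "norm (G 1 r + c * G 0 r) \<le> sqrt (2 * pi) / sqrt (2 * norm c) * r powr (-3/2)"
proof -
  have "G 1 r + c * G 0 r = (\<integral>v. g 1 r v + c * g 0 r v \<partial>lborel)"
    unfolding G_def using g_integrable[OF r] by simp
  also have "norm \<dots> \<le> 1 / (r * sqrt (2 * norm c)) * sqrt (pi / (r / 2))"
  proof (rule integrable_gaussian_bound)
    fix v
    \<comment> \<open>The terms with \<open>c\<close> cancel and leave \<open>v^2\<close>, which
      under the Gaussian is worth an extra factor \<open>1 / r\<close>.\<close>
    have "g 1 r v + c * g 0 r v = - of_real (v\<^sup>2) * (exp (- (c + of_real (v\<^sup>2)) * of_real r) / s v)"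
      using s_nz[of v] by (simp add: g_def field_simps del: of_real_power)
    then have "norm (g 1 r v + c * g 0 r v) = v\<^sup>2 * (norm (exp (- (c + of_real (v\<^sup>2)) * of_real r)) / norm (s v))"
      by (simp add: norm_mult norm_divide del: of_real_power)
    also have "\<dots> \<le> v\<^sup>2 * (exp (- r * v\<^sup>2) / sqrt (2 * norm c))"
      using norm_exp_le[of r v] norm_s[of v] r c_nz by (intro mult_left_mono frac_le) auto
    also have "\<dots> \<le> 1 / (r * sqrt (2 * norm c)) * exp (- (r / 2) * v\<^sup>2)"
    proof -
      \<comment> \<open>With \<open>x = r * v^2\<close>,
        \<open>exp (x / 2) \<ge> (1 + x / 4)^2 \<ge> x\<close>, so
        \<open>x * exp (- x) \<le> exp (- x / 2)\<close>.\<close>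
      have "1 + r * v\<^sup>2 / 4 \<le> exp (r * v\<^sup>2 / 4)" using exp_ge_add_one_self by blast
      then have "(1 + r * v\<^sup>2 / 4) ^ 2 \<le> exp (r * v\<^sup>2 / 4) ^ 2" using r by (intro power_mono) auto
      also have "exp (r * v\<^sup>2 / 4) ^ 2 = exp (r * v\<^sup>2 / 2)" by (simp add: exp_double[symmetric])
      finally have "r * v\<^sup>2 \<le> exp (r * v\<^sup>2 / 2)"
        using sum_power2_ge_zero[of "1 - r * v\<^sup>2 / 4" 0] by (simp add: power2_eq_square algebra_simps)
      then have "r * v\<^sup>2 * exp (- r * v\<^sup>2) \<le> exp (r * v\<^sup>2 / 2) * exp (- r * v\<^sup>2)"
        by (intro mult_right_mono) auto
      then have "r * v\<^sup>2 * exp (- r * v\<^sup>2) \<le> exp (- (r / 2) * v\<^sup>2)"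
        by (simp flip: exp_add)
      then show ?thesis using r c_nz by (simp add: field_simps)
    qed
    finally show "norm (g 1 r v + c * g 0 r v) \<le> 1 / (r * sqrt (2 * norm c)) * exp (- (r / 2) * v\<^sup>2)" .
  qed (use r in auto)
  also have "\<dots> = sqrt (2 * pi) / sqrt (2 * norm c) * r powr (-3/2)"
  proof -
    have "r powr (-3/2) = r powr (- 1) * r powr (-1/2)" by (subst powr_add[symmetric]) simp
    also have "\<dots> = 1 / (r * sqrt r)" using powr_m_half[OF r] r by (simp add: powr_minus_divide)
    finally show ?thesis by (simp add: real_sqrt_divide real_sqrt_mult)
  qed
  finally show ?thesis .
qed

end

section \<open>Bessel equation and behaviour at the origin\<close>

lemma csqrt_scale: 
  assumes "a > 0" shows "csqrt (of_real a * z) = of_real (sqrt a) * csqrt z"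
proof (rule csqrt_unique)
  show "(of_real (sqrt a) * csqrt z)\<^sup>2 = of_real a * z"
    using assms by (simp add: power_mult_distrib flip: of_real_power)
  show "0 < Re (of_real (sqrt a) * csqrt z) \<or> Re (of_real (sqrt a) * csqrt z) = 0 \<and> 0 \<le> Im (of_real (sqrt a) * csqrt z)"
    using csqrt_principal[of z] assms by (auto simp: zero_less_mult_iff)
qed

lemma has_bochner_integral_abs_gaussian:
  "has_bochner_integral lborel (\<lambda>q::real. \<bar>q\<bar> * exp (- q\<^sup>2)) 1"
proof -
  have "has_bochner_integral lborel (\<lambda>q::real. indicator {0..} q *\<^sub>R (\<bar>q\<bar> * exp (- q\<^sup>2))) (1/2)"
    by (rule has_bochner_integral_cong[THEN iffD1, OF refl _ refl gaussian_moment_1])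
       (auto split: split_indicator)
  then have "has_bochner_integral lborel (\<lambda>q::real. \<bar>q\<bar> * exp (- q\<^sup>2)) (2 *\<^sub>R (1/2))"
    by (rule has_bochner_integral_even_function) simp
  then show ?thesis by simp
qed

context wavenumber
begin

text \<open>Up to the factor \<open>- 2 * r\<close>, the combined integrand is the derivative in
  \<open>v\<close> of a function \<open>P\<close> that vanishes at both infinities; so it integrates
  to 0.\<close>

lemma G_ode:
  assumes r: "r > 0"
  shows "G 2 r + G 1 r / of_real r = c\<^sup>2 * G 0 r"
proof -
  define P where "P v = of_real v * s v * exp (- (c + of_real (v\<^sup>2)) * of_real r)" for v
  have P_eq: "P = (\<lambda>v. of_real v * csqrt (2 * c + (of_real v)\<^sup>2) * exp (- (c + (of_real v)\<^sup>2) * of_real r))"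
    by (simp add: P_def s_def fun_eq_iff)
  define p where "p v = - 2 * of_real r * (g 2 r v + g 1 r v / of_real r - c\<^sup>2 * g 0 r v)" for v
  have P_der: "(P has_vector_derivative p v) (at v)" for v
  proof -
    have "((\<lambda>z. z * csqrt (2 * c + z\<^sup>2) * exp (- (c + z\<^sup>2) * of_real r)) has_field_derivative
        (s v + of_real v * (2 * of_real v * inverse (2 * s v))) * exp (- (c + of_real (v\<^sup>2)) * of_real r)
          + of_real v * s v * (exp (- (c + of_real (v\<^sup>2)) * of_real r) * (- 2 * of_real v * of_real r)))
        (at (of_real v))"
      using radicand[of v] by (auto intro!: derivative_eq_intros simp: s_def algebra_simps)
         (simp add: divide_inverse)
    from has_vector_derivative_real_field[OF this]
    have "(P has_vector_derivative (s v + of_real v * (2 * of_real v * inverse (2 * s v))) * exp (- (c + of_real (v\<^sup>2)) * of_real r)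
          + of_real v * s v * (exp (- (c + of_real (v\<^sup>2)) * of_real r) * (- 2 * of_real v * of_real r))) (at v)"
      unfolding P_eq .
    moreover have "(s v + of_real v * (2 * of_real v * inverse (2 * s v))) * exp (- (c + of_real (v\<^sup>2)) * of_real r)
          + of_real v * s v * (exp (- (c + of_real (v\<^sup>2)) * of_real r) * (- 2 * of_real v * of_real r)) = p v"
    proof -
      define E where "E = exp (- (c + of_real (v\<^sup>2)) * of_real r)"
      define V where "V = complex_of_real v"
      have V: "of_real (v\<^sup>2) = V\<^sup>2" by (simp add: V_def)
      have s2: "s v * s v = 2 * c + V\<^sup>2" using s_sq[of v] by (simp add: power2_eq_square V_def)
      have "(s v + V * (2 * V * inverse (2 * s v))) * E + V * s v * (E * (- 2 * V * of_real r))
         = E / s v * (s v * s v + V\<^sup>2 - 2 * of_real r * V\<^sup>2 * (s v * s v))"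
        using s_nz[of v] by (simp add: field_simps power2_eq_square)
      also have "\<dots> = - 2 * of_real r * (((- (c + V\<^sup>2))\<^sup>2 * E / s v) + (- (c + V\<^sup>2) * E / s v) / of_real r - c\<^sup>2 * (E / s v))"
        unfolding s2 using s_nz[of v] r by (simp add: field_simps) (simp add: power2_eq_square power4_eq_xxxx algebra_simps)
      finally show ?thesis by (simp add: p_def g_def E_def V_def)
    qed
    ultimately show ?thesis by simp
  qed
  have p_int: "integrable lborel p"
    unfolding p_def using g_integrable[OF r] by auto
  \<comment> \<open>Any polynomial times the Gaussian suffices for the limits at infinity, so the
    bounds of \<open>v\<close> and \<open>s v\<close> are deliberately generous.\<close>
  have P_bound: "norm (P v) \<le> (1 + v\<^sup>2) * (1 + 2 * norm c + v\<^sup>2) * exp (- r * v\<^sup>2)" for v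
  proof -
    have "norm (s v)^2 \<le> 2 * norm c + v\<^sup>2"
      using norm_triangle_ineq[of "2 * c" "of_real (v\<^sup>2)"] 
      by (simp add: s_sq norm_mult flip: norm_power del: of_real_power)
    moreover have "norm (s v) \<le> 1 + norm (s v)^2"
    proof -
      have "0 \<le> (norm (s v) - 1)\<^sup>2" by simp
      then have "2 * norm (s v) \<le> 1 + (norm (s v))\<^sup>2" by (simp add: power2_diff)
      then show ?thesis using norm_ge_zero[of "s v"] by linarith
    qed
    ultimately have a: "norm (s v) \<le> 1 + 2 * norm c + v\<^sup>2" by linarith
    have "0 \<le> (\<bar>v\<bar> - 1)\<^sup>2" by simp
    then have "2 * \<bar>v\<bar> \<le> 1 + v\<^sup>2" by (simp add: power2_diff)
    then have b: "\<bar>v\<bar> \<le> 1 + v\<^sup>2" using abs_ge_zero[of v] by linarith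
    show ?thesis unfolding P_def norm_mult
      using a b norm_exp_le[of r v] r by (intro mult_mono) (auto intro!: mult_nonneg_nonneg add_nonneg_nonneg)
  qed
  have "(LBINT v=-\<infinity>..\<infinity>. p v) = 0 - 0"
  proof (rule interval_integral_FTC_integrable)
    show "isCont p v" for v
      unfolding p_def g_def using s_nz[of v] s_cont[of v] r by (intro continuous_intros) auto
    show "set_integrable lborel (einterval (-\<infinity>) \<infinity>) p"
      using p_int by (simp add: set_integrable_def)
    have "(P \<longlongrightarrow> 0) at_bot"
      by (rule Lim_null_comparison[OF always_eventually, OF allI, OF P_bound]) (use r in real_asymp)
    then show "((P \<circ> real_of_ereal) \<longlongrightarrow> 0) (at_right (-\<infinity>))"
      by (simp add: ereal_tendsto_simps)
    have "(P \<longlongrightarrow> 0) at_top"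
      by (rule Lim_null_comparison[OF always_eventually, OF allI, OF P_bound]) (use r in real_asymp)
    then show "((P \<circ> real_of_ereal) \<longlongrightarrow> 0) (at_left \<infinity>)"
      by (simp add: ereal_tendsto_simps)
  qed (use P_der in auto)
  then have "integral\<^sup>L lborel p = 0"
    by (simp add: interval_integral_to_infinity_eq interval_lebesgue_integral_def set_lebesgue_integral_def)
  moreover have "integral\<^sup>L lborel p = - 2 * of_real r * (G 2 r + G 1 r / of_real r - c\<^sup>2 * G 0 r)"
    unfolding p_def G_def using g_integrable[OF r] by simp
  ultimately show ?thesis using r by simp
qed

text \<open>The integrand of \<open>r * G 1 r\<close> after \<open>v = q / sqrt r\<close>. In the
  original variable the mass escapes to infinity as \<open>r\<close> tends to 0; in \<open>q\<close>
  the limit can be taken under the integral.\<close>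

definition h :: "real \<Rightarrow> real \<Rightarrow> complex" where
  "h r q = - (c * of_real r + of_real (q\<^sup>2)) * exp (- (c * of_real r + of_real (q\<^sup>2))) / csqrt (2 * c * of_real r + of_real (q\<^sup>2))"

lemma G1_h:
  assumes r: "r > 0"
  shows "of_real r * G 1 r = (\<integral>q. h r q \<partial>lborel)"
proof -
  define a where "a = sqrt r"
  have a: "a > 0" "r = a\<^sup>2" using r by (auto simp: a_def)
  have sc: "s (inverse a * q) = csqrt (2 * c * of_real r + of_real (q\<^sup>2)) / of_real a" for q
  proof -
    have "2 * c * of_real r + of_real (q\<^sup>2) = of_real (a\<^sup>2) * (2 * c + of_real ((inverse a * q)\<^sup>2))"
      using a(1) unfolding a(2) by (simp add: field_simps)
    then have "csqrt (2 * c * of_real r + of_real (q\<^sup>2)) = of_real (sqrt (a\<^sup>2)) * s (inverse a * q)"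
      using csqrt_scale[of "a\<^sup>2"] a(1) by (simp add: s_def)
    then show ?thesis using a(1) by simp
  qed
  have e: "(c + of_real ((inverse a * q)\<^sup>2)) * of_real r = c * of_real r + of_real (q\<^sup>2)" for q
    using a(1) unfolding a(2) by (simp add: field_simps)
  have "G 1 r = \<bar>inverse a\<bar> *\<^sub>R (\<integral>q. g 1 r (0 + inverse a * q) \<partial>lborel)"
    unfolding G_def using a by (intro lborel_integral_real_affine) auto
  also have "\<dots> = of_real (inverse a) * (\<integral>q. g 1 r (inverse a * q) \<partial>lborel)"
    using a by (simp add: scaleR_conv_of_real)
  finally have "of_real r * G 1 r = (\<integral>q. of_real r * of_real (inverse a) * g 1 r (inverse a * q) \<partial>lborel)"
    by simp
  also have "(\<lambda>q. of_real r * of_real (inverse a) * g 1 r (inverse a * q)) = h r"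
  proof
    fix q
    have "g 1 r (inverse a * q) = - (c + of_real ((inverse a * q)\<^sup>2)) * exp (- ((c + of_real ((inverse a * q)\<^sup>2)) * of_real r)) / s (inverse a * q)"
      by (simp only: g_def power_one_right mult_minus_left)
    also have "of_real r * of_real (inverse a) * \<dots> = - ((c + of_real ((inverse a * q)\<^sup>2)) * of_real r) * exp (- ((c + of_real ((inverse a * q)\<^sup>2)) * of_real r)) / (of_real a * s (inverse a * q))"
    proof -
      have "R * inverse A * (- Y * E / S) = - (Y * R) * E / (A * S)" for R A Y E S :: complex
        by (simp add: divide_inverse)
      then show ?thesis unfolding of_real_inverse .
    qed
    also have "\<dots> = h r q"
      unfolding e sc using a(1) by (simp add: h_def)
    finally show "of_real r * of_real (inverse a) * g 1 r (inverse a * q) = h r q" .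
  qed
  finally show ?thesis .
qed

text \<open>As \<open>Re c \<ge> 0\<close>, \<open>c * r + q^2\<close> is no longer than
  \<open>2 * c * r + q^2\<close>, so the quotient by the square root of the latter is bounded by
  that square root itself; this is integrable against \<open>exp (- q^2)\<close>.\<close>

lemma norm_h: 
  assumes r: "r \<ge> 0"
  shows "norm (h r q) \<le> (sqrt (2 * norm c * r) + \<bar>q\<bar>) * exp (- q\<^sup>2)"
proof -
  define z where "z = 2 * c * of_real r + of_real (q\<^sup>2)"
  have "norm (c * of_real r + of_real (q\<^sup>2)) \<le> norm z"
  proof (rule power2_le_imp_le)
    have "0 \<le> Re c * r * q\<^sup>2" using Re_c r by simp
    then show "(norm (c * of_real r + of_real (q\<^sup>2)))\<^sup>2 \<le> (norm z)\<^sup>2"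
      unfolding z_def cmod_power2 using zero_le_power2[of "Re c * r"] zero_le_power2[of "Im c * r"]
      by (simp add: power2_eq_square algebra_simps)
  qed simp
  also have "norm z = norm (csqrt z) * norm (csqrt z)"
    by (metis norm_mult power2_csqrt power2_eq_square)
  finally have 1: "norm (c * of_real r + of_real (q\<^sup>2)) \<le> norm (csqrt z) * norm (csqrt z)" .
  have "norm (csqrt z) = sqrt (norm z)" by (metis norm_power power2_csqrt norm_ge_zero real_sqrt_unique)
  also have "\<dots> \<le> sqrt (2 * norm c * r + q\<^sup>2)"
    unfolding z_def using norm_triangle_ineq[of "2 * c * of_real r" "of_real (q\<^sup>2)"] r by (simp add: norm_mult del: of_real_power)
  also have "\<dots> \<le> sqrt (2 * norm c * r) + sqrt (q\<^sup>2)"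
    using r by (intro sqrt_add_le_add_sqrt) auto
  finally have 2: "norm (csqrt z) \<le> sqrt (2 * norm c * r) + \<bar>q\<bar>" by simp
  have "norm (exp (- (c * of_real r + of_real (q\<^sup>2)))) \<le> exp (- q\<^sup>2)"
    using Re_c r by (simp add: norm_exp_eq_Re del: of_real_power)
  then have "norm (h r q) \<le> norm (csqrt z) * norm (csqrt z) * exp (- q\<^sup>2) / norm (csqrt z)"
    unfolding h_def norm_divide norm_mult norm_minus_cancel z_def[symmetric]
    using 1 by (intro divide_right_mono mult_mono) auto
  also have "\<dots> \<le> norm (csqrt z) * exp (- q\<^sup>2)"
  proof -
    have "x * x * e / x \<le> x * e" for x e :: real by simp
    then show ?thesis .
  qed
  also have "\<dots> \<le> (sqrt (2 * norm c * r) + \<bar>q\<bar>) * exp (- q\<^sup>2)"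
    using 2 by (intro mult_right_mono) auto
  finally show ?thesis .
qed

lemma h_measurable: "r > 0 \<Longrightarrow> h r \<in> borel_measurable borel"
proof (intro borel_measurable_continuous_onI continuous_at_imp_continuous_on ballI)
  fix q assume r: "r > 0"
  have nz: "2 * c * of_real r + of_real (q\<^sup>2) \<notin> \<real>\<^sub>\<le>\<^sub>0"
  proof
    assume *: "2 * c * of_real r + of_real (q\<^sup>2) \<in> \<real>\<^sub>\<le>\<^sub>0"
    then have "2 * Re c * r + q\<^sup>2 \<le> 0" and i: "Im c = 0"
      using r by (auto simp: complex_nonpos_Reals_iff simp del: of_real_power)
    then have "Re c * r \<le> 0" using zero_le_power2[of q] by linarith
    then have "Re c = 0" using Re_c r by (simp add: mult_le_0_iff)
    then show False using i c_nz by (simp add: complex_eq_iff)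
  qed
  then show "isCont (h r) q"
    unfolding h_def by (intro continuous_intros isCont_csqrt') auto
qed

lemma integrable_h_bound: "integrable lborel (\<lambda>q::real. (a + \<bar>q\<bar>) * exp (- q\<^sup>2))"
  "(integral\<^sup>L lborel (\<lambda>q::real. (a + \<bar>q\<bar>) * exp (- q\<^sup>2))) = a * sqrt pi + 1"
proof -
  have 1: "integrable lborel (\<lambda>q::real. a * exp (- q\<^sup>2))" "integrable lborel (\<lambda>q::real. \<bar>q\<bar> * exp (- q\<^sup>2))"
    using integrable_gaussian(1)[of 1] has_bochner_integral_abs_gaussian
    by (auto simp: has_bochner_integral_iff)
  then show "integrable lborel (\<lambda>q::real. (a + \<bar>q\<bar>) * exp (- q\<^sup>2))"
    by (simp only: distrib_right) simp
  show "(integral\<^sup>L lborel (\<lambda>q::real. (a + \<bar>q\<bar>) * exp (- q\<^sup>2))) = a * sqrt pi + 1"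
    using 1 integrable_gaussian(2)[of 1] has_bochner_integral_abs_gaussian
    by (simp only: distrib_right) (simp add: has_bochner_integral_iff)
qed

lemma norm_G1: 
  assumes r: "r > 0" shows "norm (of_real r * G 1 r) \<le> sqrt (2 * norm c * r) * sqrt pi + 1"
proof -
  have i: "integrable lborel (h r)"
    by (rule Bochner_Integration.integrable_bound[OF integrable_h_bound(1)[of "sqrt (2 * norm c * r)"]])
       (use norm_h[of r] h_measurable r in \<open>auto intro!: AE_I2 order_trans[OF norm_h]\<close>)
  have "norm (integral\<^sup>L lborel (h r)) \<le> (\<integral>q. norm (h r q) \<partial>lborel)" by simp
  also have "\<dots> \<le> (integral\<^sup>L lborel (\<lambda>q::real. (sqrt (2 * norm c * r) + \<bar>q\<bar>) * exp (- q\<^sup>2)))"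
    using i integrable_h_bound(1) norm_h r by (intro integral_mono) auto
  finally show ?thesis unfolding integrable_h_bound(2) G1_h[OF r] .
qed

text \<open>At \<open>r = 0\<close> the integrand \<open>h r q\<close> becomes
  \<open>- |q| * exp (- q^2)\<close>, whose integral is \<open>- 1\<close>. Thus the kernel has the
  singularity of \<open>- ln r\<close>, which fixes the mass of the approximate identity
  below.\<close>

lemma G1_limit: "((\<lambda>r. of_real r * G 1 r) \<longlongrightarrow> - 1) (at_right 0)"
  unfolding tendsto_at_iff_sequentially comp_def
proof (intro allI impI)
  fix X :: "nat \<Rightarrow> real" assume X0: "\<forall>i. X i \<in> {0<..} - {0}" and X: "X \<longlonglongrightarrow> 0"
  have Xpos: "X i > 0" for i using X0 by auto
  obtain N where N: "\<And>n. n \<ge> N \<Longrightarrow> X n < 1"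
    using order_tendstoD(2)[OF X, of 1] by (auto simp: eventually_sequentially)
  have "(\<lambda>n. integral\<^sup>L lborel (h (X (n + N)))) \<longlonglongrightarrow> (\<integral>q. complex_of_real (- (\<bar>q\<bar> * exp (- q\<^sup>2))) \<partial>lborel)"
  proof (rule integral_dominated_convergence)
    show "h (X (n + N)) \<in> borel_measurable lborel" for n using h_measurable[OF Xpos] by simp
    show "integrable lborel (\<lambda>q::real. (sqrt (2 * norm c) + \<bar>q\<bar>) * exp (- q\<^sup>2))"
      by (rule integrable_h_bound)
    show "AE q in lborel. (\<lambda>n. h (X (n + N)) q) \<longlonglongrightarrow> complex_of_real (- (\<bar>q\<bar> * exp (- q\<^sup>2)))"
    \<comment> \<open>The point \<open>q = 0\<close> is excluded because there the limit would
      evaluate \<open>csqrt\<close> at 0, on its branch cut.\<close>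
    proof (rule AE_mp[OF AE_lborel_singleton[of 0] AE_I2], rule impI)
      fix q :: real assume q: "q \<noteq> 0"
      have XN: "(\<lambda>n. complex_of_real (X (n + N))) \<longlonglongrightarrow> complex_of_real 0"
        using LIMSEQ_ignore_initial_segment[OF X] by (intro tendsto_of_real)
      have "isCont csqrt (2 * c * of_real 0 + of_real (q\<^sup>2))"
        using q by (intro continuous_at_csqrt) (auto simp: complex_nonpos_Reals_iff simp del: of_real_power)
      then have "(\<lambda>n. csqrt (2 * c * of_real (X (n + N)) + of_real (q\<^sup>2))) \<longlonglongrightarrow> csqrt (2 * c * of_real 0 + of_real (q\<^sup>2))"
        by (rule isCont_tendsto_compose) (intro tendsto_intros XN)
      moreover have "csqrt (2 * c * of_real 0 + of_real (q\<^sup>2)) = of_real \<bar>q\<bar>"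
        using csqrt_of_real_nonneg[of "q\<^sup>2"] by simp
      ultimately have "(\<lambda>n. h (X (n + N)) q) \<longlonglongrightarrow>
          - (c * of_real 0 + of_real (q\<^sup>2)) * exp (- (c * of_real 0 + of_real (q\<^sup>2))) / of_real \<bar>q\<bar>"
        unfolding h_def using q by (intro tendsto_intros XN) (auto)
      also have "- (c * of_real 0 + of_real (q\<^sup>2)) * exp (- (c * of_real 0 + of_real (q\<^sup>2))) / of_real \<bar>q\<bar>
         = complex_of_real (- (q\<^sup>2 * exp (- q\<^sup>2) / \<bar>q\<bar>))"
        by (simp add: exp_of_real[symmetric])
      also have "q\<^sup>2 * exp (- q\<^sup>2) / \<bar>q\<bar> = \<bar>q\<bar> * exp (- q\<^sup>2)"
        using q by (simp add: field_simps power2_eq_square abs_mult_self_eq)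
      finally show "(\<lambda>n. h (X (n + N)) q) \<longlonglongrightarrow> complex_of_real (- (\<bar>q\<bar> * exp (- q\<^sup>2)))" .
    qed
    show "AE q in lborel. norm (h (X (n + N)) q) \<le> (sqrt (2 * norm c) + \<bar>q\<bar>) * exp (- q\<^sup>2)" for n
    proof (rule AE_I2)
      fix q
      have "norm (h (X (n + N)) q) \<le> (sqrt (2 * norm c * X (n + N)) + \<bar>q\<bar>) * exp (- q\<^sup>2)"
        using norm_h Xpos less_imp_le by blast
      also have "\<dots> \<le> (sqrt (2 * norm c * 1) + \<bar>q\<bar>) * exp (- q\<^sup>2)"
        using N[of "n+N"] by (intro mult_right_mono add_mono real_sqrt_le_mono mult_left_mono) auto
      finally show "norm (h (X (n + N)) q) \<le> (sqrt (2 * norm c) + \<bar>q\<bar>) * exp (- q\<^sup>2)" by simp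
    qed
  qed auto
  then have "(\<lambda>n. of_real (X (n+N)) * G 1 (X (n+N))) \<longlonglongrightarrow> - 1"
    using has_bochner_integral_abs_gaussian G1_h[OF Xpos]
    by (simp only: integral_complex_of_real) (simp add: has_bochner_integral_iff)
  then show "(\<lambda>n. of_real (X n) * G 1 (X n)) \<longlonglongrightarrow> - 1" by (rule LIMSEQ_offset)
qed

end

section \<open>Sine series in square mean\<close>

text \<open>Measurable functions are limits of continuous ones off a null set; composing with the
  nearest-point projection onto the disc of radius \<open>B\<close> preserves continuity and
  restores the bound.\<close>

lemma bounded_continuous_approx:
  fixes f :: "'a::euclidean_space \<Rightarrow> complex"
  assumes f: "f \<in> borel_measurable lebesgue" and B: "\<And>x. norm (f x) \<le> B"
  obtains g where "\<And>n::nat. continuous_on UNIV (g n)" "\<And>n x. norm (g n x) \<le> B"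
    "AE x in lebesgue. (\<lambda>n. g n x) \<longlonglongrightarrow> f x"
proof -
  have "f measurable_on UNIV"
    using f by (intro lebesgue_measurable_imp_measurable_on) auto
  then obtain N g0 where N: "negligible N" and g0: "\<And>n::nat. continuous_on UNIV (g0 n)"
    and lim: "\<And>x. x \<notin> N \<Longrightarrow> (\<lambda>n. g0 n x) \<longlonglongrightarrow> f x"
    unfolding measurable_on_def by auto
  have B0: "0 \<le> B" using B[of undefined] norm_ge_zero order_trans by blast
  let ?p = "closest_point (cball (0::complex) B)"
  have pc: "continuous_on UNIV ?p"
    using B0 by (intro continuous_on_closest_point) auto
  have pf: "?p (f x) = f x" for x
    using B[of x] by (intro closest_point_self) auto
  show thesis
  proof (rule that[of "\<lambda>n x. ?p (g0 n x)"])
    show "continuous_on UNIV (\<lambda>x. ?p (g0 n x))" for n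
      using continuous_on_compose2[OF pc g0] by auto
    show "norm (?p (g0 n x)) \<le> B" for n x
      using closest_point_in_set[of "cball 0 B" "g0 n x"] B0 by auto
    have "AE x in lebesgue. x \<notin> N"
      using N by (simp add: negligible_iff_null_sets AE_not_in)
    then show "AE x in lebesgue. (\<lambda>n. ?p (g0 n x)) \<longlonglongrightarrow> f x"
    proof eventually_elim
      case (elim x)
      have "isCont ?p (f x)" using pc by (simp add: continuous_on_eq_continuous_at)
      then show ?case using isCont_tendsto_compose[OF _ lim[OF elim], of ?p] pf[of x] by simp
    qed
  qed
qed

section \<open>Orthogonality and Bessel's inequality for sines\<close>

abbreviation "I01 \<equiv> lebesgue_on {0<..<1::real}"

lemma finite_measure_I01: "finite_measure I01"
  by (rule finite_measureI) (simp add: emeasure_restrict_space)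

lemma measure_I01: "measure I01 (space I01) = 1"
  by (simp add: measure_restrict_space)

lemma AE_I01: "(AE y in lebesgue. P y) \<Longrightarrow> AE y in I01. P y"
  by (simp add: AE_restrict_space_iff) (auto elim: eventually_mono)

lemma AE_I01_I: "(\<And>y. 0 < y \<Longrightarrow> y < 1 \<Longrightarrow> P y) \<Longrightarrow> AE y in I01. P y"
  by (rule AE_I2) auto

lemma continuous_measurable_I01: 
  fixes f :: "real \<Rightarrow> 'b::real_normed_vector"
  assumes "continuous_on UNIV f" shows "f \<in> borel_measurable I01"
proof -
  have "f \<in> borel_measurable lborel" using borel_measurable_continuous_onI[OF assms] by simp
  then show ?thesis by (intro measurable_restrict_space1 measurable_completion)
qed

lemma bounded_integrable_I01:
  fixes f :: "real \<Rightarrow> 'b::{banach, second_countable_topology}"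
  assumes "f \<in> borel_measurable I01" "\<And>y. 0 < y \<Longrightarrow> y < 1 \<Longrightarrow> norm (f y) \<le> B"
  shows "integrable I01 f"
  by (rule finite_measure.integrable_const_bound[OF finite_measure_I01 _ assms(1), of B])
     (auto intro!: AE_I01_I assms)

lemma continuous_integrable_I01:
  fixes f :: "real \<Rightarrow> 'b::{banach, second_countable_topology}"
  assumes "continuous_on UNIV f" shows "integrable I01 f"
proof -
  have "compact (f ` {0..1})"
    by (intro compact_continuous_image continuous_on_subset[OF assms]) auto
  then obtain B where "\<forall>x\<in>f ` {0..1}. norm x \<le> B"
    using compact_imp_bounded bounded_iff by metis
  then show ?thesis
    by (intro bounded_integrable_I01[where B=B] continuous_measurable_I01 assms) auto
qed

lemma integral_I01_FTC:
  fixes F :: "real \<Rightarrow> real"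
  assumes "\<And>y. (F has_real_derivative f y) (at y)" "continuous_on UNIV f"
  shows "(\<integral>y. f y \<partial>I01) = F 1 - F 0"
proof -
  have "(f has_integral (F 1 - F 0)) {0..1}"
    using assms(1)
    by (intro fundamental_theorem_of_calculus)
       (auto simp: has_real_derivative_iff_has_vector_derivative intro: has_vector_derivative_at_within)
  then have "integral {0<..<1} f = F 1 - F 0"
    by (metis integral_open_interval_real integral_unique)
  then show ?thesis
    using lebesgue_integral_eq_integral[OF continuous_integrable_I01[OF assms(2)]] by simp
qed

lemma integral_I01_cos: 
  fixes k :: int
  shows "(\<integral>y. cos (of_int k * pi * y) \<partial>I01) = (if k = 0 then 1 else 0)"
proof (cases "k = 0")
  case True
  then show ?thesis using measure_I01 by simp
next
  case False
  have "(\<integral>y. cos (of_int k * pi * y) \<partial>I01) = sin (of_int k * pi * 1) / (of_int k * pi) - sin (of_int k * pi * 0) / (of_int k * pi)"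
    using False by (intro integral_I01_FTC) (auto intro!: derivative_eq_intros continuous_intros)
  then show ?thesis using False by (simp add: sin_zero_iff_int2)
qed

lemma integral_I01_sin_sin:
  assumes "m \<ge> 1" "n \<ge> 1"
  shows "(\<integral>y. sin (real m * pi * y) * sin (real n * pi * y) \<partial>I01) = (if m = n then 1/2 else 0)"
proof -
  have "sin (real m * pi * y) * sin (real n * pi * y) =
      cos (of_int (int m - int n) * pi * y) / 2 - cos (of_int (int m + int n) * pi * y) / 2" for y
    unfolding sin_times_sin by (simp add: algebra_simps diff_divide_distrib)
  moreover have "integrable I01 (\<lambda>y. cos (of_int k * pi * y) / 2)" for k :: int
    by (intro continuous_integrable_I01 continuous_intros) auto
  ultimately have "(\<integral>y. sin (real m * pi * y) * sin (real n * pi * y) \<partial>I01) =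
     (\<integral>y. cos (of_int (int m - int n) * pi * y) / 2 \<partial>I01) - (\<integral>y. cos (of_int (int m + int n) * pi * y) / 2 \<partial>I01)"
    by (simp only: Bochner_Integration.integral_diff)
  then show ?thesis using assms by (simp only: integral_divide_zero integral_I01_cos) auto
qed

definition sin_coeff :: "(real \<Rightarrow> complex) \<Rightarrow> nat \<Rightarrow> complex" where
  "sin_coeff f m = 2 * (\<integral>y. f y * of_real (sin (real m * pi * y)) \<partial>I01)"

definition sin_poly :: "(nat \<Rightarrow> complex) \<Rightarrow> nat \<Rightarrow> real \<Rightarrow> complex" where
  "sin_poly a N y = (\<Sum>m=1..N. a m * of_real (sin (real m * pi * y)))"

lemma sin_measurable_I01: "(\<lambda>y. of_real (sin (a * y)) :: complex) \<in> borel_measurable I01"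
  by (intro continuous_measurable_I01 continuous_intros)

lemma L2_imp_integrable_I01:
  fixes f :: "real \<Rightarrow> complex"
  assumes "f \<in> borel_measurable I01" "integrable I01 (\<lambda>y. (norm (f y))\<^sup>2)"
  shows "integrable I01 f"
proof (rule Bochner_Integration.integrable_bound)
  show "integrable I01 (\<lambda>y. 1 + (norm (f y))\<^sup>2)"
    by (intro Bochner_Integration.integrable_add assms(2)) (rule bounded_integrable_I01[where B=1], auto)
  have "norm z \<le> 1 + (norm z)\<^sup>2" for z :: complex
  proof -
    have "0 \<le> (norm z - 1)\<^sup>2" by simp
    then have "2 * norm z \<le> 1 + (norm z)\<^sup>2" by (simp add: power2_diff)
    then show ?thesis using norm_ge_zero[of z] by linarith
  qed
  then show "AE y in I01. norm (f y) \<le> norm (1 + (norm (f y))\<^sup>2)"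
    by (intro AE_I2) (simp add: abs_of_nonneg add_nonneg_nonneg)
qed fact

lemma integrable_times_sin_I01:
  "integrable I01 f \<Longrightarrow> integrable I01 (\<lambda>y. f y * of_real (sin (a * y)) :: complex)"
proof -
  assume f: "integrable I01 f"
  show ?thesis
  proof (rule Bochner_Integration.integrable_bound[OF f])
    show "(\<lambda>y. f y * of_real (sin (a * y)) :: complex) \<in> borel_measurable I01"
      using f by (intro borel_measurable_times sin_measurable_I01) auto
  qed (auto intro!: AE_I2 mult_left_le simp: norm_mult)
qed

lemma norm2_diff: "(norm (z - w))\<^sup>2 = (norm z)\<^sup>2 - 2 * Re (z * cnj w) + (norm w)\<^sup>2" for z w :: complex
  unfolding cmod_power2 by (simp add: power2_eq_square algebra_simps)

lemma integral_combine3: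
  fixes a b d :: "'a \<Rightarrow> real"
  assumes "integrable M a" "integrable M b" "integrable M d"
  shows "(\<integral>y. a y - 2 * b y + d y \<partial>M) = integral\<^sup>L M a - 2 * integral\<^sup>L M b + integral\<^sup>L M d"
  using assms by simp

text \<open>Expanding the square and using orthogonality isolates \<open>a\<close> in one
  nonnegative term. Choosing \<open>a\<close> as the coefficients gives Bessel's inequality,
  dropping that term gives best approximation.\<close>

lemma L2_dist_sin_poly:
  fixes f :: "real \<Rightarrow> complex"
  assumes fm: "f \<in> borel_measurable I01" and f2: "integrable I01 (\<lambda>y. (norm (f y))\<^sup>2)"
  shows "integrable I01 (\<lambda>y. (norm (f y - sin_poly a N y))\<^sup>2)"
    "(\<integral>y. (norm (f y - sin_poly a N y))\<^sup>2 \<partial>I01) = (\<integral>y. (norm (f y))\<^sup>2 \<partial>I01)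
      + (\<Sum>m=1..N. ((norm (sin_coeff f m - a m))\<^sup>2 - (norm (sin_coeff f m))\<^sup>2) / 2)"
proof -
  let ?T = "sin_poly a N"
  have fi: "integrable I01 f" by (rule L2_imp_integrable_I01[OF assms])
  have cont: "continuous_on UNIV ?T" unfolding sin_poly_def by (intro continuous_intros)
  have T2: "integrable I01 (\<lambda>y. (norm (?T y))\<^sup>2)"
    by (intro continuous_integrable_I01 continuous_intros cont)
  have fT_eq: "f y * cnj (?T y) = (\<Sum>m=1..N. cnj (a m) * (f y * of_real (sin (real m * pi * y))))" for y
    by (simp add: sin_poly_def sum_distrib_left algebra_simps)
  have fT: "integrable I01 (\<lambda>y. f y * cnj (?T y))"
    unfolding fT_eq by (intro Bochner_Integration.integrable_sum integrable_mult_right integrable_times_sin_I01 fi)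
  have fT_int: "(\<integral>y. f y * cnj (?T y) \<partial>I01) = (\<Sum>m=1..N. cnj (a m) * (sin_coeff f m / 2))"
    unfolding fT_eq by (subst Bochner_Integration.integral_sum)
      (auto intro!: integrable_mult_right integrable_times_sin_I01 fi simp: sin_coeff_def)
  have TT_int: "(\<integral>y. (norm (?T y))\<^sup>2 \<partial>I01) = (\<Sum>m=1..N. (norm (a m))\<^sup>2 / 2)"
  proof -
    have ss: "integrable I01 (\<lambda>y. complex_of_real (sin (real m * pi * y) * sin (real n * pi * y)))" for m n
      by (intro continuous_integrable_I01 continuous_intros)
    have "complex_of_real (\<integral>y. (norm (?T y))\<^sup>2 \<partial>I01) = (\<integral>y. ?T y * cnj (?T y) \<partial>I01)"
      by (simp only: complex_norm_square integral_complex_of_real[symmetric])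
    also have "(\<lambda>y. ?T y * cnj (?T y)) = (\<lambda>y. \<Sum>m=1..N. \<Sum>n=1..N. (a m * cnj (a n)) *
        complex_of_real (sin (real m * pi * y) * sin (real n * pi * y)))"
      by (simp add: fun_eq_iff sin_poly_def sum_product algebra_simps)
    also have "integral\<^sup>L I01 \<dots> = (\<Sum>m=1..N. \<Sum>n=1..N. (a m * cnj (a n)) *
        (\<integral>y. complex_of_real (sin (real m * pi * y) * sin (real n * pi * y)) \<partial>I01))"
      using ss by (subst Bochner_Integration.integral_sum | intro Bochner_Integration.integrable_sum integrable_mult_right ss sum.cong refl | simp only: integral_mult_right_zero)+
    also have "\<dots> = (\<Sum>m=1..N. \<Sum>n=1..N. (a m * cnj (a n)) * (if m = n then 1/2 else 0))"
      unfolding integral_complex_of_real by (intro sum.cong refl) (subst integral_I01_sin_sin, auto)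
    also have "\<dots> = (\<Sum>m=1..N. of_real ((norm (a m))\<^sup>2 / 2))"
      by (intro sum.cong refl) (simp add: sum.delta if_distrib cong: if_cong flip: complex_norm_square)
    finally show ?thesis unfolding of_real_sum[symmetric] of_real_eq_iff .
  qed
  have eq: "(norm (f y - ?T y))\<^sup>2 = (norm (f y))\<^sup>2 - 2 * Re (f y * cnj (?T y)) + (norm (?T y))\<^sup>2" for y
    by (rule norm2_diff)
  show "integrable I01 (\<lambda>y. (norm (f y - ?T y))\<^sup>2)"
    unfolding eq by (intro Bochner_Integration.integrable_add Bochner_Integration.integrable_diff integrable_mult_right integrable_Re f2 fT T2)
  have "(\<integral>y. (norm (f y - ?T y))\<^sup>2 \<partial>I01) =
      (\<integral>y. (norm (f y))\<^sup>2 \<partial>I01) - 2 * Re (\<integral>y. f y * cnj (?T y) \<partial>I01) + (\<integral>y. (norm (?T y))\<^sup>2 \<partial>I01)"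
    unfolding eq integral_Re[OF fT, symmetric]
    by (rule integral_combine3[OF f2 integrable_Re[OF fT] T2])
  also have "\<dots> = (\<integral>y. (norm (f y))\<^sup>2 \<partial>I01) + (\<Sum>m=1..N. ((norm (sin_coeff f m - a m))\<^sup>2 - (norm (sin_coeff f m))\<^sup>2) / 2)"
  proof -
    have eq: "((norm (sin_coeff f m - a m))\<^sup>2 - (norm (sin_coeff f m))\<^sup>2) / 2 = (norm (a m))\<^sup>2 / 2 - 2 * Re (cnj (a m) * (sin_coeff f m / 2))" for m
      unfolding norm2_diff by (simp add: field_simps)
    show ?thesis unfolding fT_int TT_int Re_sum eq sum_subtractf sum_distrib_left by simp
  qed
  finally show "(\<integral>y. (norm (f y - ?T y))\<^sup>2 \<partial>I01) = (\<integral>y. (norm (f y))\<^sup>2 \<partial>I01)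
      + (\<Sum>m=1..N. ((norm (sin_coeff f m - a m))\<^sup>2 - (norm (sin_coeff f m))\<^sup>2) / 2)" .
qed

lemma sin_Bessel:
  fixes f :: "real \<Rightarrow> complex"
  assumes fm: "f \<in> borel_measurable I01" and f2: "integrable I01 (\<lambda>y. (norm (f y))\<^sup>2)"
  shows "(\<Sum>m=1..N. (norm (sin_coeff f m))\<^sup>2 / 2) \<le> (\<integral>y. (norm (f y))\<^sup>2 \<partial>I01)"
proof -
  have "0 \<le> (\<integral>y. (norm (f y - sin_poly (sin_coeff f) N y))\<^sup>2 \<partial>I01)" by simp
  then show ?thesis unfolding L2_dist_sin_poly(2)[OF assms] by (simp add: sum_negf)
qed

section \<open>Density of sine polynomials\<close>

lemma sin_poly_add: "\<exists>c M. \<forall>y. sin_poly a N y + sin_poly b K y = sin_poly c M y"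
proof -
  have pad: "sin_poly a N y = sin_poly (\<lambda>m. if m \<le> N then a m else 0) (max N K) y" for a N K y
  proof -
    have "sin_poly (\<lambda>m. if m \<le> N then a m else 0) (max N K) y = (\<Sum>m\<in>{1..max N K}. if m \<in> {1..N} then a m * of_real (sin (real m * pi * y)) else 0)"
      unfolding sin_poly_def by (intro sum.cong) auto
    also have "\<dots> = sin_poly a N y"
      unfolding sin_poly_def by (subst sum.inter_restrict[symmetric]) (auto intro!: sum.cong)
    finally show ?thesis ..
  qed
  have "sin_poly a N y + sin_poly b K y =
    sin_poly (\<lambda>m. (if m \<le> N then a m else 0) + (if m \<le> K then b m else 0)) (max N K) y" for y
    unfolding pad[of a N y K] pad[of b K y N] max.commute[of K N]
    by (simp add: sin_poly_def sum.distrib algebra_simps)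
  then show ?thesis by blast
qed

text \<open>An inductive closure makes stability under multiplication by \<open>cos (pi * y)\<close>
  provable generator by generator. The index \<open>m = 0\<close> is allowed since product formulas
  produce it; its generator is 0.\<close>

inductive_set sin_span :: "(real \<Rightarrow> complex) set" where
  base: "(\<lambda>y. c * of_real (sin (real m * pi * y))) \<in> sin_span"
| add: "S \<in> sin_span \<Longrightarrow> T \<in> sin_span \<Longrightarrow> (\<lambda>y. S y + T y) \<in> sin_span"

lemma sin_span_sin_poly: "T \<in> sin_span \<Longrightarrow> \<exists>a N. \<forall>y. T y = sin_poly a N y"
proof (induction rule: sin_span.induct)
  case (base c m)
  have "c * of_real (sin (real m * pi * y)) = sin_poly (\<lambda>i. if i = m then c else 0) m y" for y
    by (cases "m = 0") (auto simp: sin_poly_def if_distrib[of "\<lambda>x. x * _"] sum.delta cong: if_cong)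
  then show ?case by blast
next
  case (add S T)
  then show ?case using sin_poly_add by metis
qed

lemma sin_span_scale: "T \<in> sin_span \<Longrightarrow> (\<lambda>y. k * T y) \<in> sin_span"
proof (induction rule: sin_span.induct)
  case (base c m)
  then show ?case using sin_span.base[of "k * c" m] by (simp add: mult.assoc)
qed (auto simp: distrib_left intro: sin_span.add)

lemma sin_span_cos: "T \<in> sin_span \<Longrightarrow> (\<lambda>y. of_real (cos (pi * y)) * T y) \<in> sin_span"
proof (induction rule: sin_span.induct)
  case (base c m)
  show ?case
  proof (cases m)
    case 0
    then show ?thesis using sin_span.base[of 0 0] by simp
  next
    case (Suc k)
    have sc: "sin (real m * pi * y) * cos (pi * y) = (sin (real (Suc m) * pi * y) + sin (real k * pi * y)) / 2" for y
      unfolding sin_times_cos Suc by (simp add: algebra_simps)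
    then have "of_real (cos (pi * y)) * (c * of_real (sin (real m * pi * y))) =
       c / 2 * of_real (sin (real (Suc m) * pi * y)) + c / 2 * of_real (sin (real k * pi * y))" for y
    proof -
      have "of_real (cos (pi * y)) * (c * of_real (sin (real m * pi * y))) = c * complex_of_real (sin (real m * pi * y) * cos (pi * y))"
        by simp
      also have "\<dots> = c * complex_of_real ((sin (real (Suc m) * pi * y) + sin (real k * pi * y)) / 2)"
        by (simp only: sc)
      also have "\<dots> = c / 2 * of_real (sin (real (Suc m) * pi * y)) + c / 2 * of_real (sin (real k * pi * y))"
        by (simp only: of_real_add of_real_divide of_real_numeral add_divide_distrib distrib_left
            times_divide_eq_left times_divide_eq_right)
      finally show ?thesis .
    qed
    then show ?thesis by (simp only:) (intro sin_span.intros)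
  qed
next
  case (add S T)
  then show ?case by (auto simp: distrib_left intro: sin_span.add)
qed

lemma sin_span_polynomial:
  "(\<lambda>y. k * of_real (sin (pi * y) * (\<Sum>i\<le>n. a i * cos (pi * y) ^ i))) \<in> sin_span"
proof -
  have *: "(\<lambda>y. c * of_real (sin (pi * y) * cos (pi * y) ^ i)) \<in> sin_span" for c i
  proof (induction i)
    case 0
    show ?case using sin_span.base[of c 1] by simp
  next
    case (Suc i)
    show ?case using sin_span_cos[OF Suc] by (simp add: algebra_simps)
  qed
  show ?thesis
  proof (induction n)
    case 0
    show ?case using *[of "k * of_real (a 0)" 0] by (simp add: algebra_simps)
  next
    case (Suc n)
    show ?case using sin_span.add[OF Suc *[of "k * of_real (a (Suc n))" "Suc n"]]
      by (simp add: algebra_simps)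
  qed
qed

text \<open>Division by \<open>sin (pi * y)\<close> and the variable \<open>t = cos (pi * y)\<close>
  reduce the problem to uniform polynomial approximation on [-1, 1]; sine times a polynomial in
  cosine is again a sine polynomial.\<close>

lemma sin_span_dense_real:
  fixes g :: "real \<Rightarrow> real"
  assumes g: "continuous_on UNIV g" and a: "0 < a" "a < 1/2" and g0: "\<And>y. y < a \<or> y > 1 - a \<Longrightarrow> g y = 0"
    and e: "e > 0"
  obtains b n where "\<And>y. 0 < y \<Longrightarrow> y < 1 \<Longrightarrow> \<bar>g y - sin (pi * y) * (\<Sum>i\<le>n::nat. b i * cos (pi * y) ^ i)\<bar> \<le> e"
proof -
  have pa: "0 \<le> pi * a" using a by simp
  have sa: "sin (pi * a) > 0" using a by (intro sin_gt_zero) auto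
  \<comment> \<open>The maximum keeps the denominator positive on the whole line and equals
    \<open>sin (pi * y)\<close> wherever \<open>g\<close> can be nonzero on the interval.\<close>
  define h where "h y = g y / max (sin (pi * y)) (sin (pi * a))" for y
  have hc: "continuous_on UNIV h"
    unfolding h_def using sa by (intro continuous_intros g) (auto simp: max_def)
  have gh: "g y = sin (pi * y) * h y" if "0 < y" "y < 1" for y
  proof (cases "y < a \<or> y > 1 - a")
    case False
    have "sin (pi * a) \<le> sin (pi * y)"
    proof (cases "y \<le> 1/2")
      case True
      then show ?thesis using False a pa pi_gt_zero by (intro sin_monotone_2pi_le) (linarith, auto)
    next
      case F: False
      have "sin (pi * a) \<le> sin (pi * (1 - y))"
        using F False a pa pi_gt_zero by (intro sin_monotone_2pi_le) (linarith, auto)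
      also have "\<dots> = sin (pi * y)" by (simp add: right_diff_distrib)
      finally show ?thesis .
    qed
    then show ?thesis using sa by (simp add: h_def)
  qed (simp add: g0 h_def)
  have "continuous_on {-1..1} (\<lambda>t. h (arccos t / pi))"
    by (intro continuous_on_compose2[OF hc] continuous_intros continuous_on_arccos') auto
  then obtain p where p: "real_polynomial_function p" "\<And>t. t \<in> {-1..1} \<Longrightarrow> \<bar>h (arccos t / pi) - p t\<bar> < e"
    using Stone_Weierstrass_real_polynomial_function[of "{-1..1}" "\<lambda>t. h (arccos t / pi)" e] e by auto
  obtain b n where bn: "p = (\<lambda>x. \<Sum>i\<le>n. b i * x ^ i)" using p(1) real_polynomial_function_iff_sum by auto
  show ?thesis
  proof (rule that)
    fix y :: real assume y: "0 < y" "y < 1"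
    have "arccos (cos (pi * y)) = pi * y" using y by (intro arccos_cos) auto
    then have "\<bar>h y - p (cos (pi * y))\<bar> < e" using p(2)[of "cos (pi * y)"] by simp
    then have "\<bar>sin (pi * y)\<bar> * \<bar>h y - p (cos (pi * y))\<bar> \<le> 1 * e" by (intro mult_mono) auto
    then show "\<bar>g y - sin (pi * y) * (\<Sum>i\<le>n. b i * cos (pi * y) ^ i)\<bar> \<le> e"
      unfolding gh[OF y] bn by (simp only: abs_mult[symmetric] right_diff_distrib mult_1)
  qed
qed

lemma sin_poly_dense_continuous:
  fixes g :: "real \<Rightarrow> complex"
  assumes g: "continuous_on UNIV g" and a: "0 < a" "a < 1/2" and g0: "\<And>y. y < a \<or> y > 1 - a \<Longrightarrow> g y = 0"
    and e: "e > 0"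
  obtains c N where "\<And>y. 0 < y \<Longrightarrow> y < 1 \<Longrightarrow> norm (g y - sin_poly c N y) \<le> e"
proof -
  obtain b n where 1: "\<And>y. 0 < y \<Longrightarrow> y < 1 \<Longrightarrow> \<bar>Re (g y) - sin (pi * y) * (\<Sum>i\<le>n::nat. b i * cos (pi * y) ^ i)\<bar> \<le> e/2"
    using sin_span_dense_real[of "\<lambda>y. Re (g y)" a "e/2"] assms by (auto intro: continuous_intros)
  obtain b' n' where 2: "\<And>y. 0 < y \<Longrightarrow> y < 1 \<Longrightarrow> \<bar>Im (g y) - sin (pi * y) * (\<Sum>i\<le>n'::nat. b' i * cos (pi * y) ^ i)\<bar> \<le> e/2"
    using sin_span_dense_real[of "\<lambda>y. Im (g y)" a "e/2"] assms by (auto intro: continuous_intros)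
  define R where "R y = sin (pi * y) * (\<Sum>i\<le>n::nat. b i * cos (pi * y) ^ i)" for y
  define J where "J y = sin (pi * y) * (\<Sum>i\<le>n'::nat. b' i * cos (pi * y) ^ i)" for y
  have "(\<lambda>y. 1 * of_real (R y) + \<i> * of_real (J y)) \<in> sin_span"
    unfolding R_def J_def by (intro sin_span.add sin_span_polynomial)
  then obtain c N where cN: "\<And>y. 1 * of_real (R y) + \<i> * of_real (J y) = sin_poly c N y"
    using sin_span_sin_poly by blast
  show ?thesis
  proof (rule that)
    fix y :: real assume y: "0 < y" "y < 1"
    have "norm (g y - sin_poly c N y) \<le> \<bar>Re (g y - sin_poly c N y)\<bar> + \<bar>Im (g y - sin_poly c N y)\<bar>"
      by (rule cmod_le)
    also have "\<dots> \<le> e/2 + e/2"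
      using 1[OF y] 2[OF y] by (intro add_mono) (simp_all add: R_def J_def flip: cN)
    finally show "norm (g y - sin_poly c N y) \<le> e" by simp
  qed
qed

lemma norm_add3_sq: "(norm (a + b + c))\<^sup>2 \<le> 3 * ((norm a)\<^sup>2 + (norm b)\<^sup>2 + (norm c)\<^sup>2)" for a b c :: complex
proof -
  have "(norm (a + b + c))\<^sup>2 \<le> (norm a + norm b + norm c)\<^sup>2"
    by (intro power_mono norm_triangle_le add_mono norm_triangle_ineq) auto
  also have "\<dots> \<le> 3 * ((norm a)\<^sup>2 + (norm b)\<^sup>2 + (norm c)\<^sup>2)"
  proof -
    have "0 \<le> (x - y)\<^sup>2 + (y - z)\<^sup>2 + (x - z)\<^sup>2" for x y z :: real by simp
    from this[of "norm a" "norm b" "norm c"] show ?thesis by (simp add: power2_eq_square algebra_simps)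
  qed
  finally show ?thesis .
qed

lemma L2_approx_bounded_I01:
  fixes f :: "real \<Rightarrow> complex"
  assumes fm: "f \<in> borel_measurable I01" and f2: "integrable I01 (\<lambda>y. (norm (f y))\<^sup>2)" and e: "e > 0"
  obtains f' B where "f' \<in> borel_measurable lebesgue" "\<And>y. norm (f' y) \<le> B"
    "(\<integral>y. (norm (f y - f' y))\<^sup>2 \<partial>I01) < e"
proof -
  \<comment> \<open>Large values are set to 0, so the error is either 0 or \<open>f y\<close> and is
    dominated by \<open>f\<close> itself.\<close>
  define F where "F k y = (if y \<in> {0<..<1} then (if norm (f y) \<le> real k then f y else 0) else 0)" for k y
  have Fm: "F k \<in> borel_measurable lebesgue" for k
  proof -
    have "{y \<in> space I01. norm (f y) \<le> real k} \<in> sets I01" using fm by measurable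
    then have "(\<lambda>y. if norm (f y) \<le> real k then f y else 0) \<in> borel_measurable I01"
      using fm by (intro measurable_If) auto
    then show ?thesis unfolding F_def by (subst borel_measurable_if) auto
  qed
  have FmI: "F k \<in> borel_measurable I01" for k using Fm by (rule measurable_restrict_space1)
  have "(\<lambda>k. \<integral>y. (norm (f y - F k y))\<^sup>2 \<partial>I01) \<longlonglongrightarrow> (\<integral>y. 0 \<partial>I01)"
  proof (rule integral_dominated_convergence[OF _ _ f2])
    show "AE y in I01. (\<lambda>k. (norm (f y - F k y))\<^sup>2) \<longlonglongrightarrow> 0"
    proof (rule AE_I01_I)
      fix y :: real assume y: "0 < y" "y < 1"
      have "\<forall>\<^sub>F k in sequentially. norm (f y) \<le> real k"
        using filterlim_at_top[THEN iffD1, OF filterlim_real_sequentially] by blast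
      then have "\<forall>\<^sub>F k in sequentially. 0 = (norm (f y - F k y))\<^sup>2"
        by eventually_elim (use y in \<open>simp add: F_def\<close>)
      then show "(\<lambda>k. (norm (f y - F k y))\<^sup>2) \<longlonglongrightarrow> 0"
        by (rule Lim_transform_eventually[OF tendsto_const])
    qed
    show "AE y in I01. norm ((norm (f y - F k y))\<^sup>2) \<le> (norm (f y))\<^sup>2" for k
      by (rule AE_I01_I) (simp add: F_def)
  qed (use fm FmI in auto)
  then have "\<forall>\<^sub>F k in sequentially. (\<integral>y. (norm (f y - F k y))\<^sup>2 \<partial>I01) < e"
    using e by (intro order_tendstoD(2)) auto
  then obtain k where "(\<integral>y. (norm (f y - F k y))\<^sup>2 \<partial>I01) < e" by (auto simp: eventually_sequentially)
  then show ?thesis by (intro that[of "F k" "real k"] Fm) (simp_all add: F_def)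
qed

lemma L2_approx_continuous_I01:
  fixes f :: "real \<Rightarrow> complex"
  assumes fm: "f \<in> borel_measurable lebesgue" and B: "\<And>y. norm (f y) \<le> B" and e: "e > 0"
  obtains g a where "continuous_on UNIV g" "0 < a" "a < 1/2" "\<And>y. y < a \<or> y > 1 - a \<Longrightarrow> g y = 0"
    "(\<integral>y. (norm (f y - g y))\<^sup>2 \<partial>I01) < e"
proof -
  obtain g where g: "\<And>n::nat. continuous_on UNIV (g n)" "\<And>n x. norm (g n x) \<le> B"
    "AE x in lebesgue. (\<lambda>n. g n x) \<longlonglongrightarrow> f x"
    using bounded_continuous_approx[OF fm B] by blast
  \<comment> \<open>A continuous cut-off that vanishes near both end points and tends to 1 inside,
    to create the margin \<open>a\<close>.\<close>
  define ct :: "nat \<Rightarrow> real \<Rightarrow> real" where "ct n y = min 1 (max 0 (real n * min y (1 - y) - 1))" for n y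
  have ctc: "continuous_on UNIV (ct n)" for n unfolding ct_def by (intro continuous_intros)
  have ct1: "0 \<le> ct n y" "ct n y \<le> 1" for n y by (auto simp: ct_def)
  have ctlim: "(\<lambda>n. ct n y) \<longlonglongrightarrow> 1" if "0 < y" "y < 1" for y
  proof -
    have "\<forall>\<^sub>F n in sequentially. 2 / min y (1 - y) \<le> real n"
      using filterlim_at_top[THEN iffD1, OF filterlim_real_sequentially] by blast
    then have "\<forall>\<^sub>F n in sequentially. 1 = ct n y"
    proof eventually_elim
      case (elim n)
      have "min y (1 - y) > 0" using that by auto
      then have "2 \<le> real n * min y (1 - y)" using elim by (simp add: divide_le_eq)
      then show ?case by (simp add: ct_def)
    qed
    then show ?thesis by (rule Lim_transform_eventually[OF tendsto_const])
  qed
  define h where "h n y = of_real (ct n y) * g n y" for n y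
  have hc: "continuous_on UNIV (h n)" for n unfolding h_def by (intro continuous_intros ctc g)
  have hB: "norm (h n y) \<le> B" for n y
    using mult_mono[OF ct1(2)[of n y] g(2)[of n y]] ct1(1)[of n y] by (simp add: h_def norm_mult)
  have fI: "f \<in> borel_measurable I01" using fm by (rule measurable_restrict_space1)
  have "(\<lambda>n. \<integral>y. (norm (f y - h n y))\<^sup>2 \<partial>I01) \<longlonglongrightarrow> (\<integral>y. 0 \<partial>I01)"
  proof (rule integral_dominated_convergence)
    have "AE y in I01. 0 < y \<and> y < 1" by (rule AE_I01_I) auto
    then show "AE y in I01. (\<lambda>n. (norm (f y - h n y))\<^sup>2) \<longlonglongrightarrow> 0"
      using AE_I01[OF g(3)]
    proof eventually_elim
      case (elim y)
      have "(\<lambda>n. (norm (f y - h n y))\<^sup>2) \<longlonglongrightarrow> (norm (f y - of_real 1 * f y))\<^sup>2"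
        unfolding h_def using elim ctlim by (intro tendsto_intros) auto
      then show ?case by simp
    qed
    show "AE y in I01. norm ((norm (f y - h n y))\<^sup>2) \<le> (2 * B)\<^sup>2" for n
    proof (rule AE_I2)
      fix y
      have "norm (f y - h n y) \<le> 2 * B" using norm_triangle_ineq4[of "f y" "h n y"] B[of y] hB[of n y] by linarith
      then have "(norm (f y - h n y))\<^sup>2 \<le> (2 * B)\<^sup>2" by (intro power_mono) auto
      then show "norm ((norm (f y - h n y))\<^sup>2) \<le> (2 * B)\<^sup>2" by simp
    qed
    show "integrable I01 (\<lambda>y. (2 * B)\<^sup>2)" by (intro continuous_integrable_I01 continuous_intros)
  qed (use fI continuous_measurable_I01[OF hc] in auto)
  then have "\<forall>\<^sub>F n in sequentially. (\<integral>y. (norm (f y - h n y))\<^sup>2 \<partial>I01) < e"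
    using e by (intro order_tendstoD(2)) auto
  then obtain n where n: "(\<integral>y. (norm (f y - h n y))\<^sup>2 \<partial>I01) < e" by (auto simp: eventually_sequentially)
  \<comment> \<open>Within \<open>a\<close> of the end points \<open>ct\<close> vanishes because
    \<open>n * a \<le> 1\<close>; the summand 3 gives \<open>a < 1/2\<close>.\<close>
  define a where "a = 1 / (real n + 3)"
  have z: "h n y = 0" if "y < a \<or> y > 1 - a" for y
  proof -
    have "min y (1 - y) \<le> a" using that by auto
    then have "real n * min y (1 - y) \<le> real n * a" by (intro mult_left_mono) auto
    also have "\<dots> \<le> 1" by (simp add: a_def)
    finally show ?thesis by (simp add: h_def ct_def)
  qed
  show ?thesis
  proof (rule that[of "h n" a])
    show "0 < a" "a < 1/2" by (auto simp: a_def field_simps)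
  qed (use hc z n in auto)
qed

lemma sin_poly_dense_L2:
  fixes f :: "real \<Rightarrow> complex"
  assumes fm: "f \<in> borel_measurable I01" and f2: "integrable I01 (\<lambda>y. (norm (f y))\<^sup>2)" and e: "e > 0"
  obtains c N where "(\<integral>y. (norm (f y - sin_poly c N y))\<^sup>2 \<partial>I01) < e"
proof -
  \<comment> \<open>Three errors of size \<open>e / 9\<close>, tripled by
    \<open>norm_add3_sq\<close>, add up to \<open>e\<close>; two of the estimates are
    strict.\<close>
  have e9: "e / 9 > 0" using e by simp
  obtain f' B where f': "f' \<in> borel_measurable lebesgue" "\<And>y. norm (f' y) \<le> B"
    "(\<integral>y. (norm (f y - f' y))\<^sup>2 \<partial>I01) < e / 9"
    using L2_approx_bounded_I01[OF fm f2 e9] by blast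
  obtain g a where g: "continuous_on UNIV g" "0 < a" "a < 1/2" "\<And>y. y < a \<or> y > 1 - a \<Longrightarrow> g y = 0"
    "(\<integral>y. (norm (f' y - g y))\<^sup>2 \<partial>I01) < e / 9"
    using L2_approx_continuous_I01[OF f'(1,2) e9] by blast
  have se: "sqrt (e / 9) > 0" using e by simp
  obtain c N where cN: "\<And>y. 0 < y \<Longrightarrow> y < 1 \<Longrightarrow> norm (g y - sin_poly c N y) \<le> sqrt (e / 9)"
    using sin_poly_dense_continuous[OF g(1-4) se] by blast
  have cP: "continuous_on UNIV (sin_poly c N)" unfolding sin_poly_def by (intro continuous_intros)
  have f'I: "f' \<in> borel_measurable I01" using f'(1) by (rule measurable_restrict_space1)
  have f'2: "integrable I01 (\<lambda>y. (norm (f' y))\<^sup>2)"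
    by (rule bounded_integrable_I01[where B="B\<^sup>2"]) (use f'I f'(2) in \<open>auto intro: power_mono\<close>)
  have gI: "g \<in> borel_measurable I01" by (rule continuous_measurable_I01[OF g(1)])
  have i1: "integrable I01 (\<lambda>y. (norm (f y - f' y))\<^sup>2)"
  proof (rule Bochner_Integration.integrable_bound)
    show "integrable I01 (\<lambda>y. 3 * ((norm (f y))\<^sup>2 + (norm (f' y))\<^sup>2))" using f2 f'2 by simp
    show "AE y in I01. norm ((norm (f y - f' y))\<^sup>2) \<le> norm (3 * ((norm (f y))\<^sup>2 + (norm (f' y))\<^sup>2))"
      using norm_add3_sq[of "f y" "- f' y" 0 for y] by (intro AE_I2) auto
  qed (use fm f'I in auto)
  have i2: "integrable I01 (\<lambda>y. (norm (f' y - g y))\<^sup>2)"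
  proof (rule Bochner_Integration.integrable_bound)
    have "integrable I01 (\<lambda>y. (norm (g y))\<^sup>2)" by (intro continuous_integrable_I01 continuous_intros g)
    then show "integrable I01 (\<lambda>y. 3 * ((norm (f' y))\<^sup>2 + (norm (g y))\<^sup>2))" using f'2 by simp
    show "AE y in I01. norm ((norm (f' y - g y))\<^sup>2) \<le> norm (3 * ((norm (f' y))\<^sup>2 + (norm (g y))\<^sup>2))"
      using norm_add3_sq[of "f' y" "- g y" 0 for y] by (intro AE_I2) auto
  qed (use gI f'I in auto)
  have i3: "integrable I01 (\<lambda>y. (norm (g y - sin_poly c N y))\<^sup>2)"
    by (intro continuous_integrable_I01 continuous_intros g cP)
  have "(\<integral>y. (norm (f y - sin_poly c N y))\<^sup>2 \<partial>I01) \<le>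
    (\<integral>y. 3 * ((norm (f y - f' y))\<^sup>2 + (norm (f' y - g y))\<^sup>2 + (norm (g y - sin_poly c N y))\<^sup>2) \<partial>I01)"
  proof (rule integral_mono)
    show "integrable I01 (\<lambda>y. (norm (f y - sin_poly c N y))\<^sup>2)" by (rule L2_dist_sin_poly(1)[OF fm f2])
    show "(norm (f y - sin_poly c N y))\<^sup>2 \<le> 3 * ((norm (f y - f' y))\<^sup>2 + (norm (f' y - g y))\<^sup>2 + (norm (g y - sin_poly c N y))\<^sup>2)" for y
      using norm_add3_sq[of "f y - f' y" "f' y - g y" "g y - sin_poly c N y"] by simp
  qed (use i1 i2 i3 in auto)
  also have "\<dots> = 3 * ((\<integral>y. (norm (f y - f' y))\<^sup>2 \<partial>I01) + (\<integral>y. (norm (f' y - g y))\<^sup>2 \<partial>I01) + (\<integral>y. (norm (g y - sin_poly c N y))\<^sup>2 \<partial>I01))"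
    using i1 i2 i3 by simp
  also have "(\<integral>y. (norm (g y - sin_poly c N y))\<^sup>2 \<partial>I01) \<le> (\<integral>y. e / 9 \<partial>I01)"
  proof (rule integral_mono_AE[OF i3])
    show "integrable I01 (\<lambda>y. e / 9)" by (intro continuous_integrable_I01 continuous_intros)
    show "AE y in I01. (norm (g y - sin_poly c N y))\<^sup>2 \<le> e / 9"
    proof (rule AE_I01_I)
      fix y :: real assume "0 < y" "y < 1"
      then have "(norm (g y - sin_poly c N y))\<^sup>2 \<le> (sqrt (e / 9))\<^sup>2" by (intro power_mono cN) auto
      then show "(norm (g y - sin_poly c N y))\<^sup>2 \<le> e / 9" using e by simp
    qed
  qed
  also have "(\<integral>y. e / 9 \<partial>I01) = e / 9" using measure_I01 by simp
  finally show ?thesis using f'(3) g(5) by (intro that[of c N]) simp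
qed

lemma sin_Parseval:
  fixes f :: "real \<Rightarrow> complex"
  assumes fm: "f \<in> borel_measurable I01" and f2: "integrable I01 (\<lambda>y. (norm (f y))\<^sup>2)"
  shows "(\<lambda>m. (norm (sin_coeff f (Suc m)))\<^sup>2 / 2) sums (\<integral>y. (norm (f y))\<^sup>2 \<partial>I01)"
  unfolding sums_def LIMSEQ_iff
proof (intro allI impI)
  fix e :: real assume "e > 0"
  then obtain c N where cN: "(\<integral>y. (norm (f y - sin_poly c N y))\<^sup>2 \<partial>I01) < e"
    using sin_poly_dense_L2[OF fm f2] by blast
  let ?S = "\<lambda>n. \<Sum>m=1..n. (norm (sin_coeff f m))\<^sup>2 / 2"
  have S: "(\<Sum>m<n. (norm (sin_coeff f (Suc m)))\<^sup>2 / 2) = ?S n" for n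
    by (rule sum.reindex_bij_witness[of _ "\<lambda>m. m - 1" Suc]) auto
  \<comment> \<open>No sine polynomial of degree \<open>N\<close> comes closer than the partial sum
    of the series, so density forces the partial sums to exhaust the norm.\<close>
  have "(\<integral>y. (norm (f y))\<^sup>2 \<partial>I01) - ?S N \<le> (\<integral>y. (norm (f y - sin_poly c N y))\<^sup>2 \<partial>I01)"
  proof -
    have "(\<Sum>m=1..N. ((norm (sin_coeff f m - c m))\<^sup>2 - (norm (sin_coeff f m))\<^sup>2) / 2) \<ge> (\<Sum>m=1..N. - ((norm (sin_coeff f m))\<^sup>2 / 2))"
      by (intro sum_mono) simp
    then show ?thesis unfolding L2_dist_sin_poly(2)[OF assms] by (simp add: sum_negf)
  qed
  with cN have less: "(\<integral>y. (norm (f y))\<^sup>2 \<partial>I01) - ?S N < e" by simp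
  show "\<exists>no. \<forall>n\<ge>no. norm ((\<Sum>m<n. (norm (sin_coeff f (Suc m)))\<^sup>2 / 2) - (\<integral>y. (norm (f y))\<^sup>2 \<partial>I01)) < e"
  proof (intro exI allI impI)
    fix n assume "N \<le> n"
    then have "?S N \<le> ?S n" by (intro sum_mono2) auto
    with less sin_Bessel[OF assms, of n]
    show "norm ((\<Sum>m<n. (norm (sin_coeff f (Suc m)))\<^sup>2 / 2) - (\<integral>y. (norm (f y))\<^sup>2 \<partial>I01)) < e"
      unfolding S real_norm_def by linarith
  qed
qed

section \<open>Integration tools\<close>

lemma test_function_bounded:
  fixes \<phi> :: "'a::euclidean_space \<Rightarrow> complex"
  assumes "\<phi> \<in> test_functions U"
  obtains B where "B > 0" "\<And>x. norm (\<phi> x) \<le> B"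
proof -
  obtain K where K: "smooth \<phi>" "compact K" "\<And>x. x \<notin> K \<Longrightarrow> \<phi> x = 0"
    using assms by (rule test_functionsE) blast
  have "compact (\<phi> ` K)"
    by (intro compact_continuous_image continuous_on_subset[OF smooth_continuous] K) auto
  then obtain B where B: "\<forall>x\<in>\<phi> ` K. norm x \<le> B"
    using compact_imp_bounded bounded_iff by metis
  show ?thesis
  proof (rule that[of "\<bar>B\<bar> + 1"])
    show "norm (\<phi> x) \<le> \<bar>B\<bar> + 1" for x
      using B K(3)[of x] by (cases "x \<in> K") fastforce+
  qed auto
qed

lemma compact_support_integrable:
  fixes f :: "'a::euclidean_space \<Rightarrow> complex"
  assumes "continuous_on UNIV f" "compact K" "\<And>x. x \<notin> K \<Longrightarrow> f x = 0"
  shows "integrable lborel f"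
proof -
  have "integrable lborel (\<lambda>x. indicator K x *\<^sub>R f x)"
    by (rule borel_integrable_compact) (use assms in \<open>auto intro: continuous_on_subset\<close>)
  moreover have "(\<lambda>x. indicator K x *\<^sub>R f x) = f" using assms(3) by (auto simp: indicator_def)
  ultimately show ?thesis by simp
qed

lemma integral_translation:
  fixes f :: "'a::euclidean_space \<Rightarrow> complex"
  assumes "f \<in> borel_measurable borel"
  shows "(\<integral>x. f (t + x) \<partial>lborel) = (\<integral>x. f x \<partial>lborel)"
proof -
  have "(\<integral>x. f x \<partial>lborel) = (\<integral>x. f x \<partial>distr lborel borel ((+) t))"
    by (simp add: lborel_distr_plus)
  also have "\<dots> = (\<integral>x. f (t + x) \<partial>lborel)"
    using assms by (subst integral_distr) auto
  finally show ?thesis ..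
qed

text \<open>Lebesgue measure is translation invariant, so every difference quotient of
  \<open>\<phi>\<close> has integral 0; the bounded derivative and the compact support allow the
  limit.\<close>

lemma integral_partial_eq_0:
  fixes \<phi> :: "'a::euclidean_space \<Rightarrow> complex"
  assumes \<phi>: "\<phi> \<in> test_functions UNIV" and b: "b \<in> Basis"
  shows "(\<integral>x. partial b \<phi> x \<partial>lborel) = 0"
proof -
  obtain K where K: "smooth \<phi>" "compact K" "\<And>x. x \<notin> K \<Longrightarrow> \<phi> x = 0"
    using \<phi> by (rule test_functionsE) blast
  obtain B where B: "B > 0" "\<And>x. norm (partial b \<phi> x) \<le> B"
    using test_function_bounded[OF test_functions_partial[OF \<phi> b]] by blast
  have cont: "continuous_on UNIV \<phi>" by (rule smooth_continuous[OF K(1)])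
  have m: "\<phi> \<in> borel_measurable borel" by (rule borel_measurable_continuous_onI[OF cont])
  obtain R where R: "\<And>x. x \<in> K \<Longrightarrow> norm x \<le> R" using compact_imp_bounded[OF K(2)] bounded_iff by metis
  define q where "q n x = (\<phi> (inverse (real (Suc n)) *\<^sub>R b + x) - \<phi> x) * of_nat (Suc n)" for n x
  have i: "integrable lborel \<phi>" using compact_support_integrable[OF cont K(2)] K(3) by blast
  have i': "integrable lborel (\<lambda>x. \<phi> (t + x))" for t
  proof -
    have "integrable (distr lborel borel ((+) t)) \<phi>" using i by (simp add: lborel_distr_plus)
    then show ?thesis using m by (subst (asm) integrable_distr_eq) auto
  qed
  have qz: "integral\<^sup>L lborel (q n) = 0" for n
    unfolding q_def using integral_translation[OF m] i i' by simp
  have "(\<lambda>n. integral\<^sup>L lborel (q n)) \<longlonglongrightarrow> integral\<^sup>L lborel (partial b \<phi>)"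
  proof (rule integral_dominated_convergence)
    show "partial b \<phi> \<in> borel_measurable lborel"
      using borel_measurable_continuous_onI[OF smooth_continuous[OF smooth_partial[OF K(1) b]]] by simp
    show "q n \<in> borel_measurable lborel" for n unfolding q_def using m by simp
    \<comment> \<open>Radius \<open>R + 1\<close> because the translations in the quotients have
      length at most 1.\<close>
    show "integrable lborel (\<lambda>x. indicator (cball 0 (R + 1)) x *\<^sub>R B)"
      by (intro integrable_scaleR_left integrable_real_indicator) (use emeasure_bounded_finite[OF bounded_cball, of 0 "R + 1"] in auto)
    show "AE x in lborel. (\<lambda>n. q n x) \<longlonglongrightarrow> partial b \<phi> x"
    proof (rule AE_I2)
      fix x
      have d: "(\<phi> has_derivative (\<lambda>h. partial h \<phi> x)) (at x)" by (rule smooth_has_derivative[OF K(1)])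
      have "((\<lambda>t::real. t *\<^sub>R b + x) has_derivative (\<lambda>t. t *\<^sub>R b)) (at 0)"
        by (auto intro!: derivative_eq_intros)
      then have "((\<lambda>t::real. \<phi> (t *\<^sub>R b + x)) has_derivative (\<lambda>t. partial (t *\<^sub>R b) \<phi> x)) (at 0)"
        by (rule has_derivative_compose) (use d in simp)
      moreover have "partial (t *\<^sub>R b) \<phi> x = t *\<^sub>R partial b \<phi> x" for t
        by (rule linear_scale[OF has_derivative_linear[OF d]])
      ultimately have "((\<lambda>t::real. norm (\<phi> (t *\<^sub>R b + x) - \<phi> x - t *\<^sub>R partial b \<phi> x) / norm t) \<longlongrightarrow> 0) (at 0)"
        by (simp add: has_derivative_at)
      then have "(\<lambda>n. norm (\<phi> (inverse (real (Suc n)) *\<^sub>R b + x) - \<phi> x - inverse (real (Suc n)) *\<^sub>R partial b \<phi> x) / norm (inverse (real (Suc n)))) \<longlonglongrightarrow> 0"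
        unfolding tendsto_at_iff_sequentially comp_def
        by (elim allE[where x="\<lambda>n. inverse (real (Suc n))"] impE) (use LIMSEQ_inverse_real_of_nat in auto)
      moreover have "norm (\<phi> (inverse (real (Suc n)) *\<^sub>R b + x) - \<phi> x - inverse (real (Suc n)) *\<^sub>R partial b \<phi> x) / norm (inverse (real (Suc n)))
         = norm (q n x - partial b \<phi> x)" for n
      proof -
        have "q n x - partial b \<phi> x = of_nat (Suc n) * (\<phi> (inverse (real (Suc n)) *\<^sub>R b + x) - \<phi> x - inverse (real (Suc n)) *\<^sub>R partial b \<phi> x)"
          unfolding q_def scaleR_conv_of_real by (simp add: algebra_simps del: of_nat_Suc)
        then show ?thesis by (simp add: norm_mult divide_inverse mult.commute del: of_nat_Suc)
      qed
      ultimately have "(\<lambda>n. norm (q n x - partial b \<phi> x)) \<longlonglongrightarrow> 0" by simp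
      then show "(\<lambda>n. q n x) \<longlonglongrightarrow> partial b \<phi> x" using tendsto_norm_zero_iff LIM_zero_iff by blast
    qed
    show "AE x in lborel. norm (q n x) \<le> indicator (cball 0 (R + 1)) x *\<^sub>R B" for n
    proof (rule AE_I2)
      fix x
      define t where "t = inverse (real (Suc n))"
      have t: "0 < t" "t \<le> 1" by (auto simp: t_def field_simps)
      show "norm (q n x) \<le> indicator (cball 0 (R + 1)) x *\<^sub>R B"
      proof (cases "norm x \<le> R + 1")
        case True
        have "norm (\<phi> (t *\<^sub>R b + x) - \<phi> (0 *\<^sub>R b + x)) \<le> B * norm (t - 0)"
        proof (rule differentiable_bound[of UNIV "\<lambda>s. \<phi> (s *\<^sub>R b + x)" "\<lambda>s h. h *\<^sub>R partial b \<phi> (s *\<^sub>R b + x)"])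
          fix s :: real
          have d: "(\<phi> has_derivative (\<lambda>h. partial h \<phi> (s *\<^sub>R b + x))) (at (s *\<^sub>R b + x))" by (rule smooth_has_derivative[OF K(1)])
          have "((\<lambda>s::real. s *\<^sub>R b + x) has_derivative (\<lambda>t. t *\<^sub>R b)) (at s)"
            by (auto intro!: derivative_eq_intros)
          then have "((\<lambda>t::real. \<phi> (t *\<^sub>R b + x)) has_derivative (\<lambda>t. partial (t *\<^sub>R b) \<phi> (s *\<^sub>R b + x))) (at s)"
            by (rule has_derivative_compose) (use d in simp)
          moreover have "partial (t *\<^sub>R b) \<phi> (s *\<^sub>R b + x) = t *\<^sub>R partial b \<phi> (s *\<^sub>R b + x)" for t
            by (rule linear_scale[OF has_derivative_linear[OF d]])
          ultimately show "((\<lambda>s. \<phi> (s *\<^sub>R b + x)) has_derivative (\<lambda>h. h *\<^sub>R partial b \<phi> (s *\<^sub>R b + x))) (at s within UNIV)"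
            by simp
          show "onorm (\<lambda>h. h *\<^sub>R partial b \<phi> (s *\<^sub>R b + x)) \<le> B"
          proof (rule onorm_le)
            show "norm (h *\<^sub>R partial b \<phi> (s *\<^sub>R b + x)) \<le> B * norm h" for h
              using mult_right_mono[OF B(2) abs_ge_zero[of h], of "s *\<^sub>R b + x"] by (simp add: mult.commute)
          qed
        qed auto
        then have "norm (\<phi> (t *\<^sub>R b + x) - \<phi> x) * inverse t \<le> B" using t by (simp add: field_simps)
        moreover have "norm (q n x) = norm (\<phi> (t *\<^sub>R b + x) - \<phi> x) * inverse t"
          by (simp add: q_def t_def norm_mult del: of_nat_Suc)
        ultimately show ?thesis using True by simp
      next
        case False
        have "norm x \<le> norm (t *\<^sub>R b + x) + norm (t *\<^sub>R b)" by (metis add.commute norm_diff_ineq norm_minus_commute norm_triangle_sub add_diff_cancel)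
        then have "norm (t *\<^sub>R b + x) > R" using False t b by (simp add: abs_of_pos)
        then have "\<phi> (t *\<^sub>R b + x) = 0" "\<phi> x = 0" using R K(3) False by fastforce+
        then show ?thesis using B(1) by (simp add: q_def t_def indicator_def)
      qed
    qed
  qed
  then show ?thesis unfolding qz using LIMSEQ_unique tendsto_const by blast
qed

section \<open>Radial kernels integrated over sets of given area\<close>

lemma nn_integral_layer_cake:
  fixes x :: "'a::euclidean_space" and \<kappa> :: "real \<Rightarrow> ennreal"
  assumes [measurable]: "\<kappa> \<in> borel_measurable borel" "I \<in> sets borel"
  shows "(\<integral>\<^sup>+y. indicator I y * (\<integral>\<^sup>+s. \<kappa> s * indicator {norm (y - x)..} s \<partial>lborel) \<partial>lborel) =
    (\<integral>\<^sup>+s. \<kappa> s * emeasure lborel (I \<inter> cball x s) \<partial>lborel)"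
proof -
  have "(\<integral>\<^sup>+y. indicator I y * (\<integral>\<^sup>+s. \<kappa> s * indicator {norm (y - x)..} s \<partial>lborel) \<partial>lborel) =
     (\<integral>\<^sup>+y. (\<integral>\<^sup>+s. \<kappa> s * (indicator I y * (if norm (y - x) \<le> s then 1 else 0)) \<partial>lborel) \<partial>lborel)"
    by (intro nn_integral_cong, subst nn_integral_cmult[symmetric])
       (auto simp: indicator_def intro!: nn_integral_cong)
  also have "\<dots> = (\<integral>\<^sup>+s. (\<integral>\<^sup>+y. \<kappa> s * (indicator I y * (if norm (y - x) \<le> s then 1 else 0)) \<partial>lborel) \<partial>lborel)"
    by (rule lborel_pair.Fubini'[symmetric]) measurable
  also have "\<dots> = (\<integral>\<^sup>+s. \<kappa> s * emeasure lborel (I \<inter> cball x s) \<partial>lborel)"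
  proof (rule nn_integral_cong)
    fix s
    have "indicator I y * (if norm (y - x) \<le> s then 1 else 0) = (indicator (I \<inter> cball x s) y :: ennreal)" for y
      by (auto simp: indicator_def dist_norm norm_minus_commute)
    then show "(\<integral>\<^sup>+y. \<kappa> s * (indicator I y * (if norm (y - x) \<le> s then 1 else 0)) \<partial>lborel) = \<kappa> s * emeasure lborel (I \<inter> cball x s)"
      using assms(2) by (simp only:) (subst nn_integral_cmult_indicator, auto)
  qed
  finally show ?thesis .
qed

lemma emeasure_cball_2: "s \<ge> 0 \<Longrightarrow> emeasure lborel (cball (x::real^2) s) = ennreal (pi * s\<^sup>2)"
  by (simp add: emeasure_cball unit_ball_vol_2)

text \<open>The kernel is dominated by the constant \<open>b\<close> plus a superposition of
  indicators of discs with density \<open>\<kappa>\<close>. By Tonelli the second part sees only the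
  area of \<open>I\<close> within discs of radius at most \<open>a\<close>, which is bounded by that
  of the full disc. This is the rearrangement step.\<close>

lemma nn_integral_kernel_bound:
  fixes x :: "real^2"
  assumes I: "I \<in> sets borel" "emeasure lborel I = ennreal A" "A \<ge> 0"
    and \<kappa>: "\<kappa> \<in> borel_measurable borel" and a: "a > 0" and b: "b \<ge> 0" and M: "M \<ge> 0"
    and \<kappa>M: "\<And>s. 0 < s \<Longrightarrow> s \<le> a \<Longrightarrow> 0 \<le> \<kappa> s \<and> \<kappa> s * s\<^sup>2 \<le> M"
    and k: "\<And>r. 0 < r \<Longrightarrow> ennreal (k r) \<le> ennreal b + (\<integral>\<^sup>+s. ennreal (\<kappa> s) * indicator {0<..a} s * indicator {r..} s \<partial>lborel)"
  shows "(\<integral>\<^sup>+y. indicator I y * ennreal (k (norm (y - x))) \<partial>lborel) \<le> ennreal (b * A + pi * M * a)"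
proof -
  have "(\<integral>\<^sup>+y. indicator I y * ennreal (k (norm (y - x))) \<partial>lborel) \<le>
    (\<integral>\<^sup>+y. indicator I y * ennreal b + indicator I y * (\<integral>\<^sup>+s. (ennreal (\<kappa> s) * indicator {0<..a} s) * indicator {norm (y - x)..} s \<partial>lborel) \<partial>lborel)"
  \<comment> \<open>The point \<open>y = x\<close> is left out, since \<open>k\<close> is controlled
    only at positive distance.\<close>
  proof (rule nn_integral_mono_AE)
    show "AE y in lborel. indicator I y * ennreal (k (norm (y - x))) \<le> indicator I y * ennreal b + indicator I y * (\<integral>\<^sup>+s. (ennreal (\<kappa> s) * indicator {0<..a} s) * indicator {norm (y - x)..} s \<partial>lborel)"
      using AE_lborel_singleton[of x]
    proof eventually_elim
      case (elim y)
      then show ?case using k[of "norm (y - x)"] by (auto simp: indicator_def)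
    qed
  qed
  also have "\<dots> = (\<integral>\<^sup>+y. indicator I y * ennreal b \<partial>lborel) +
     (\<integral>\<^sup>+y. indicator I y * (\<integral>\<^sup>+s. (ennreal (\<kappa> s) * indicator {0<..a} s) * indicator {norm (y - x)..} s \<partial>lborel) \<partial>lborel)"
  proof (rule nn_integral_add)
    have [measurable]: "\<kappa> \<in> borel_measurable borel" "I \<in> sets borel" by fact+
    have "(\<lambda>y. \<integral>\<^sup>+s. (ennreal (\<kappa> s) * indicator {0<..a} s) * (if norm (y - x) \<le> s then 1 else 0) \<partial>lborel) \<in> borel_measurable lborel"
      by measurable
    then have "(\<lambda>y. \<integral>\<^sup>+s. (ennreal (\<kappa> s) * indicator {0<..a} s) * indicator {norm (y - x)..} s \<partial>lborel) \<in> borel_measurable lborel"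
      by (simp add: indicator_def)
    then show "(\<lambda>y. indicator I y * (\<integral>\<^sup>+s. (ennreal (\<kappa> s) * indicator {0<..a} s) * indicator {norm (y - x)..} s \<partial>lborel)) \<in> borel_measurable lborel"
      using I(1) by (intro borel_measurable_times_ennreal) auto
  qed (use I(1) in auto)
  also have "(\<integral>\<^sup>+y. indicator I y * ennreal b \<partial>lborel) = ennreal (b * A)"
    using I b nn_integral_cmult_indicator[of I lborel "ennreal b"] by (simp add: ennreal_mult mult.commute)
  also have "(\<integral>\<^sup>+y. indicator I y * (\<integral>\<^sup>+s. (ennreal (\<kappa> s) * indicator {0<..a} s) * indicator {norm (y - x)..} s \<partial>lborel) \<partial>lborel)
     = (\<integral>\<^sup>+s. (ennreal (\<kappa> s) * indicator {0<..a} s) * emeasure lborel (I \<inter> cball x s) \<partial>lborel)"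
    using \<kappa> I(1) by (intro nn_integral_layer_cake) auto
  also have "\<dots> \<le> (\<integral>\<^sup>+s. ennreal (pi * M) * indicator {0<..a} s \<partial>lborel)"
  proof (rule nn_integral_mono)
    fix s :: real
    show "(ennreal (\<kappa> s) * indicator {0<..a} s) * emeasure lborel (I \<inter> cball x s) \<le> ennreal (pi * M) * indicator {0<..a} s"
    proof (cases "s \<in> {0<..a}")
      case True
      have "emeasure lborel (I \<inter> cball x s) \<le> emeasure lborel (cball x s)" by (intro emeasure_mono) auto
      also have "\<dots> = ennreal (pi * s\<^sup>2)" using True by (simp add: emeasure_cball_2)
      finally have "ennreal (\<kappa> s) * emeasure lborel (I \<inter> cball x s) \<le> ennreal (\<kappa> s) * ennreal (pi * s\<^sup>2)" by (rule mult_left_mono) simp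
      also have "\<dots> = ennreal (pi * (\<kappa> s * s\<^sup>2))" using \<kappa>M[of s] True by (simp add: ennreal_mult' [symmetric] algebra_simps)
      also have "\<dots> \<le> ennreal (pi * M)" using \<kappa>M[of s] True by (intro ennreal_leI mult_left_mono) auto
      finally show ?thesis using True by simp
    qed simp
  qed
  also have "\<dots> = ennreal (pi * M * a)" using a M by (simp add: nn_integral_cmult ennreal_mult)
  also have "ennreal (b * A) + ennreal (pi * M * a) = ennreal (b * A + pi * M * a)"
    using a b M I(3) by (intro ennreal_plus[symmetric]) auto
  finally show ?thesis by (simp add: add_left_mono)
qed

lemma nn_integral_powr_kernel:
  fixes x :: "real^2"
  assumes I: "I \<in> sets borel" "emeasure lborel I = ennreal A" and A: "A > 0"
  shows "(\<integral>\<^sup>+y. indicator I y * ennreal (norm (y - x) powr (-1/2)) \<partial>lborel) \<le> ennreal ((1 + pi) * A powr (3/4))"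
proof -
  \<comment> \<open>A radius comparable to that of the disc of area \<open>A\<close>; the exact
    radius would only alter the constant.\<close>
  define a where "a = sqrt A"
  have a: "a > 0" "A = a\<^sup>2" using A by (auto simp: a_def)
  have "(\<integral>\<^sup>+y. indicator I y * ennreal (norm (y - x) powr (-1/2)) \<partial>lborel) \<le> ennreal (a powr (-1/2) * A + pi * (a powr (1/2)) * a)"
  proof (rule nn_integral_kernel_bound[OF I, where \<kappa>="\<lambda>s. 1/2 * s powr (-3/2)"])
    fix s :: real assume s: "0 < s" "s \<le> a"
    have "s powr (-3/2) * s\<^sup>2 = s powr (1/2)"
      using s by (simp add: powr_add[symmetric] flip: powr_numeral)
    moreover have "s powr (1/2) \<le> a powr (1/2)" using s by (intro powr_mono2) auto
    ultimately have "1/2 * s powr (-3/2) * s\<^sup>2 \<le> 1/2 * a powr (1/2)" by simp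
    also have "\<dots> \<le> a powr (1/2)" by simp
    finally show "0 \<le> 1/2 * s powr (-3/2) \<and> 1/2 * s powr (-3/2) * s\<^sup>2 \<le> a powr (1/2)" by simp
  next
    fix r :: real assume r: "0 < r"
    show "ennreal (r powr (-1/2)) \<le> ennreal (a powr (-1/2)) + (\<integral>\<^sup>+s. ennreal (1/2 * s powr (-3/2)) * indicator {0<..a} s * indicator {r..} s \<partial>lborel)"
    proof (cases "r \<le> a")
      case True
      have "(\<integral>\<^sup>+s. ennreal (1/2 * s powr (-3/2)) * indicator {0<..a} s * indicator {r..} s \<partial>lborel) =
        (\<integral>\<^sup>+s. ennreal (1/2 * s powr (-3/2)) * indicator {r..a} s \<partial>lborel)"
        using r by (intro nn_integral_cong) (auto simp: indicator_def)
      also have "\<dots> = ennreal (- (a powr (-1/2)) - - (r powr (-1/2)))"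
      proof (rule nn_integral_FTC_Icc)
        show "((\<lambda>s. - (s powr (-1/2))) has_real_derivative 1/2 * s powr (-3/2)) (at s)" if "s \<in> {r..a}" for s
          using r that by (auto intro!: derivative_eq_intros)
      qed (use True in auto)
      finally show ?thesis
        using powr_mono2'[of "-1/2" r a] r True by (simp add: ennreal_plus[symmetric] del: ennreal_plus)
    next
      case False
      then have "r powr (-1/2) \<le> a powr (-1/2)" using a by (intro powr_mono2') auto
      then show ?thesis by (intro add_increasing2) (auto intro: ennreal_leI)
    qed
  qed (use A a in auto)
  also have "a powr (-1/2) * A + pi * (a powr (1/2)) * a = (1 + pi) * A powr (3/4)"
  proof -
  have "a powr (-1/2) * A = A powr (3/4)"
    using a by (simp add: powr_add[symmetric] powr_powr flip: powr_numeral)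
  moreover have "a powr (1/2) * a = A powr (3/4)"
    using a powr_mult_base[of a "1/2"] by (simp add: powr_powr mult.commute flip: powr_numeral)
  ultimately show ?thesis by (simp add: algebra_simps)
  qed
  finally show ?thesis .
qed

lemma nn_integral_ln_kernel:
  fixes x :: "real^2"
  assumes I: "I \<in> sets borel" "emeasure lborel I = ennreal A" and A: "A > 0" and L: "pi * L\<^sup>2 \<ge> A" "L > 0"
  shows "(\<integral>\<^sup>+y. indicator I y * ennreal (ln (L / norm (y - x))) \<partial>lborel) \<le> ennreal (A * (1 + ln (pi * L\<^sup>2 / A) / 2))"
proof -
  \<comment> \<open>Here \<open>a\<close> is exactly the radius of the disc of area
    \<open>A\<close>, so that \<open>L / a\<close> produces the quotient \<open>pi * L^2 / A\<close>
    under the logarithm.\<close>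
  define a where "a = sqrt (A / pi)"
  have a: "a > 0" "A = pi * a\<^sup>2" using A by (auto simp: a_def)
  have "a \<le> L" using L a by (auto intro: power2_le_imp_le)
  have "(\<integral>\<^sup>+y. indicator I y * ennreal (ln (L / norm (y - x))) \<partial>lborel) \<le> ennreal (ln (L / a) * A + pi * a * a)"
  proof (rule nn_integral_kernel_bound[OF I, where \<kappa>="\<lambda>s. 1 / s"])
    fix s :: real assume s: "0 < s" "s \<le> a"
    then show "0 \<le> 1 / s \<and> 1 / s * s\<^sup>2 \<le> a" by (simp add: power2_eq_square)
  next
    fix r :: real assume r: "0 < r"
    show "ennreal (ln (L / r)) \<le> ennreal (ln (L / a)) + (\<integral>\<^sup>+s. ennreal (1 / s) * indicator {0<..a} s * indicator {r..} s \<partial>lborel)"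
    proof (cases "r \<le> a")
      case True
      have "(\<integral>\<^sup>+s. ennreal (1 / s) * indicator {0<..a} s * indicator {r..} s \<partial>lborel) =
        (\<integral>\<^sup>+s. ennreal (1 / s) * indicator {r..a} s \<partial>lborel)"
        using r by (intro nn_integral_cong) (auto simp: indicator_def)
      also have "\<dots> = ennreal (ln a - ln r)"
      proof (rule nn_integral_FTC_Icc)
        show "(ln has_real_derivative 1 / s) (at s)" if "s \<in> {r..a}" for s
          using r that by (auto intro!: derivative_eq_intros)
      qed (use r True in auto)
      finally show ?thesis
        using r True \<open>a \<le> L\<close> a by (simp add: ln_div ennreal_plus[symmetric] del: ennreal_plus)
    next
      case False
      then have "ln (L / r) \<le> ln (L / a)" using a L by (simp add: frac_le)
      then show ?thesis by (intro add_increasing2) (auto intro: ennreal_leI)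
    qed
  qed (use A a \<open>a \<le> L\<close> in auto)
  also have "ln (L / a) * A + pi * a * a = A * (1 + ln (L / a))"
    using a by (simp add: power2_eq_square algebra_simps)
  also have "ln (pi * L\<^sup>2 / A) = ln ((L / a)\<^sup>2)"
    using a by (simp add: power_divide)
  then have "ln (L / a) = ln (pi * L\<^sup>2 / A) / 2"
    using a L by (simp add: ln_realpow)
  finally show ?thesis .
qed

text \<open>On the set \<open>E\<close> where the bound fails, testing with the conjugate phase of
  \<open>h\<close> shows that \<open>norm (h x)\<close> has at most the integral of
  \<open>K\<close>, so \<open>E\<close> is null. The phase is only measurable; it is approximated by
  continuous functions bounded by 1 and supported in the ball.\<close>

lemma pointwise_bound_from_duality:
  fixes h :: "'a::euclidean_space \<Rightarrow> complex" and K :: "'a \<Rightarrow> real"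
  assumes K0: "\<And>x. K x \<ge> 0" and h: "integrable lebesgue (\<lambda>x. indicator (ball 0 \<rho>) x *\<^sub>R h x)"
    and K: "integrable lebesgue (\<lambda>x. indicator (ball 0 \<rho>) x *\<^sub>R K x)"
    and dual: "\<And>\<theta>. continuous_on UNIV \<theta> \<Longrightarrow> (\<And>x. norm (\<theta> x) \<le> 1) \<Longrightarrow> (\<And>x. x \<notin> ball 0 \<rho> \<Longrightarrow> \<theta> x = 0)
      \<Longrightarrow> norm (\<integral>x. h x * \<theta> x \<partial>lebesgue) \<le> (\<integral>x. norm (\<theta> x) * K x \<partial>lebesgue)"
  shows "AE x in lebesgue. x \<in> ball 0 \<rho> \<longrightarrow> norm (h x) \<le> K x"
proof -
  let ?B = "ball (0::'a) \<rho>"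
  define H where "H = (\<lambda>x. indicator ?B x *\<^sub>R h x)"
  define k where "k = (\<lambda>x. indicator ?B x *\<^sub>R K x)"
  have Hi: "integrable lebesgue H" and ki: "integrable lebesgue k" using h K unfolding H_def k_def by auto
  have [measurable]: "H \<in> borel_measurable lebesgue" "k \<in> borel_measurable lebesgue"
    using Hi ki by (auto dest: borel_measurable_integrable)
  define E where "E = {x \<in> space lebesgue. k x < norm (H x)}"
  have E[measurable]: "E \<in> sets lebesgue" unfolding E_def by measurable
  define \<theta>0 where "\<theta>0 x = indicator E x * cnj (sgn (H x))" for x
  have \<theta>0_bound: "norm (\<theta>0 x) \<le> 1" for x by (simp add: \<theta>0_def norm_mult norm_sgn indicator_def)
  have \<theta>0_m: "\<theta>0 \<in> borel_measurable lebesgue"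
  proof -
    have "(\<lambda>x. sgn (H x)) \<in> borel_measurable lebesgue" unfolding sgn_div_norm by measurable
    then have "(\<lambda>x. cnj (sgn (H x))) \<in> borel_measurable lebesgue"
      by (rule measurable_compose[OF _ borel_measurable_continuous_onI]) (intro continuous_intros)
    then show ?thesis unfolding \<theta>0_def by (intro borel_measurable_times borel_measurable_indicator E)
  qed
  obtain g where g: "\<And>n::nat. continuous_on UNIV (g n)" "\<And>n x. norm (g n x) \<le> 1"
    "AE x in lebesgue. (\<lambda>n. g n x) \<longlonglongrightarrow> \<theta>0 x"
    using bounded_continuous_approx[OF \<theta>0_m \<theta>0_bound] by blast
  \<comment> \<open>Makes the approximants vanish outside the open ball, as \<open>dual\<close>
    requires, and tends to 1 inside it.\<close>
  define ct :: "nat \<Rightarrow> 'a \<Rightarrow> real" where "ct n x = min 1 (max 0 (real n * (\<rho> - norm x)))" for n x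
  have ctc: "continuous_on UNIV (ct n)" for n unfolding ct_def by (intro continuous_intros)
  have ct1: "0 \<le> ct n x" "ct n x \<le> 1" for n x by (auto simp: ct_def)
  have ct0: "ct n x = 0" if "x \<notin> ?B" for n x
  proof -
    have "real n * (\<rho> - norm x) \<le> 0" using that by (simp add: mult_nonneg_nonpos)
    then show ?thesis by (simp add: ct_def max_absorb1)
  qed
  have ctlim: "(\<lambda>n. ct n x) \<longlonglongrightarrow> 1" if "x \<in> ?B" for x
  proof -
    have "\<forall>\<^sub>F n in sequentially. 1 / (\<rho> - norm x) \<le> real n"
      using filterlim_at_top[THEN iffD1, OF filterlim_real_sequentially] by blast
    then have "\<forall>\<^sub>F n in sequentially. 1 = ct n x"
      by eventually_elim (use that in \<open>auto simp: ct_def divide_le_eq\<close>)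
    then show ?thesis by (rule Lim_transform_eventually[OF tendsto_const])
  qed
  define \<theta> where "\<theta> n x = of_real (ct n x) * g n x" for n x
  have \<theta>c: "continuous_on UNIV (\<theta> n)" for n unfolding \<theta>_def by (intro continuous_intros ctc g)
  have \<theta>1: "norm (\<theta> n x) \<le> 1" for n x
    using mult_mono[OF ct1(2)[of n x] g(2)[of n x]] ct1(1)[of n x] by (simp add: \<theta>_def norm_mult)
  have \<theta>z: "\<theta> n x = 0" if "x \<notin> ?B" for n x using ct0[OF that] by (simp add: \<theta>_def)
  have \<theta>m: "\<theta> n \<in> borel_measurable lebesgue" for n
    using borel_measurable_continuous_onI[OF \<theta>c[of n]] by (intro measurable_completion) simp
  have lim: "AE x in lebesgue. x \<in> ?B \<longrightarrow> (\<lambda>n. \<theta> n x) \<longlonglongrightarrow> \<theta>0 x"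
    using g(3)
  proof eventually_elim
    case (elim x)
    show ?case
    proof
      assume "x \<in> ?B"
      then have "(\<lambda>n. of_real (ct n x) * g n x) \<longlonglongrightarrow> of_real 1 * \<theta>0 x"
        by (intro tendsto_intros ctlim elim)
      then show "(\<lambda>n. \<theta> n x) \<longlonglongrightarrow> \<theta>0 x" by (simp add: \<theta>_def)
    qed
  qed
  have L1: "(\<lambda>n. \<integral>x. H x * \<theta> n x \<partial>lebesgue) \<longlonglongrightarrow> (\<integral>x. H x * \<theta>0 x \<partial>lebesgue)"
  proof (rule integral_dominated_convergence[OF _ _ integrable_norm[OF Hi]])
    show "AE x in lebesgue. (\<lambda>n. H x * \<theta> n x) \<longlonglongrightarrow> H x * \<theta>0 x"
      using lim by eventually_elim (auto simp: H_def intro!: tendsto_intros split: split_indicator)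
    show "AE x in lebesgue. norm (H x * \<theta> n x) \<le> norm (H x)" for n
      by (rule AE_I2) (simp add: norm_mult mult_left_le \<theta>1)
  qed (use \<theta>0_m \<theta>m in auto)
  have L2: "(\<lambda>n. \<integral>x. norm (\<theta> n x) * k x \<partial>lebesgue) \<longlonglongrightarrow> (\<integral>x. norm (\<theta>0 x) * k x \<partial>lebesgue)"
  proof (rule integral_dominated_convergence[OF _ _ integrable_norm[OF ki]])
    show "AE x in lebesgue. (\<lambda>n. norm (\<theta> n x) * k x) \<longlonglongrightarrow> norm (\<theta>0 x) * k x"
      using lim by eventually_elim (auto simp: k_def intro!: tendsto_intros split: split_indicator)
    show "AE x in lebesgue. norm (norm (\<theta> n x) * k x) \<le> norm (k x)" for n
      by (rule AE_I2) (simp add: abs_mult mult_left_le_one_le \<theta>1)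
  qed (use \<theta>0_m \<theta>m in auto)
  have le: "norm (\<integral>x. H x * \<theta> n x \<partial>lebesgue) \<le> (\<integral>x. norm (\<theta> n x) * k x \<partial>lebesgue)" for n
  proof -
    have "H x * \<theta> n x = h x * \<theta> n x" "norm (\<theta> n x) * k x = norm (\<theta> n x) * K x" for x
      using \<theta>z[of x n] by (auto simp: H_def k_def indicator_def)
    moreover have "norm (\<integral>x. h x * \<theta> n x \<partial>lebesgue) \<le> (\<integral>x. norm (\<theta> n x) * K x \<partial>lebesgue)"
      by (rule dual[OF \<theta>c \<theta>1]) (rule \<theta>z)
    ultimately show ?thesis by (simp only:)
  qed
  have "norm (\<integral>x. H x * \<theta>0 x \<partial>lebesgue) \<le> (\<integral>x. norm (\<theta>0 x) * k x \<partial>lebesgue)"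
    by (rule LIMSEQ_le[OF tendsto_norm[OF L1] L2]) (use le in blast)
  moreover have "(\<integral>x. H x * \<theta>0 x \<partial>lebesgue) = complex_of_real (\<integral>x. indicator E x * norm (H x) \<partial>lebesgue)"
  proof -
    have "H x * \<theta>0 x = complex_of_real (indicator E x * norm (H x))" for x
      by (cases "H x = 0") (auto simp: \<theta>0_def sgn_div_norm indicator_def complex_norm_square[symmetric] scaleR_conv_of_real power2_eq_square field_simps)
    then show ?thesis by (simp only: integral_complex_of_real)
  qed
  ultimately have "(\<integral>x. indicator E x * norm (H x) \<partial>lebesgue) \<le> (\<integral>x. norm (\<theta>0 x) * k x \<partial>lebesgue)"
    by (simp add: norm_of_real)
  also have "(\<lambda>x. norm (\<theta>0 x) * k x) = (\<lambda>x. indicator E x * k x)"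
  proof
    fix x
    have "k x \<ge> 0" using K0[of x] by (simp add: k_def)
    then show "norm (\<theta>0 x) * k x = indicator E x * k x"
      by (auto simp: \<theta>0_def norm_mult norm_sgn indicator_def E_def)
  qed
  finally have le0: "(\<integral>x. indicator E x * norm (H x) \<partial>lebesgue) \<le> (\<integral>x. indicator E x * k x \<partial>lebesgue)" .
  have Ei: "integrable lebesgue (\<lambda>x. indicator E x * norm (H x))" "integrable lebesgue (\<lambda>x. indicator E x * k x)"
    using integrable_mult_indicator[OF E integrable_norm[OF Hi]] integrable_mult_indicator[OF E ki] by simp_all
  have nn: "0 \<le> indicator E x * norm (H x) - indicator E x * k x" for x
    by (auto simp: indicator_def E_def)
  have Ed: "integrable lebesgue (\<lambda>x. indicator E x * norm (H x) - indicator E x * k x)"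
    using Ei by simp
  \<comment> \<open>A nonnegative integrand with integral 0 vanishes almost everywhere, although
    this one is positive on \<open>E\<close>; so \<open>E\<close> is null.\<close>
  have "(\<integral>x. indicator E x * norm (H x) - indicator E x * k x \<partial>lebesgue) = 0"
  proof (rule antisym)
    show "(\<integral>x. indicator E x * norm (H x) - indicator E x * k x \<partial>lebesgue) \<le> 0" using le0 Ei by simp
    show "0 \<le> (\<integral>x. indicator E x * norm (H x) - indicator E x * k x \<partial>lebesgue)"
      by (rule Bochner_Integration.integral_nonneg_AE[OF AE_I2]) (rule nn)
  qed
  then have "AE x in lebesgue. indicator E x * norm (H x) - indicator E x * k x = 0"
    using integral_nonneg_eq_0_iff_AE[OF Ed] nn by simp
  then show ?thesis
  proof eventually_elim
    case (elim x)
    then have "x \<notin> E" by (auto simp: indicator_def E_def)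
    then show ?case by (auto simp: E_def H_def k_def)
  qed
qed


text \<open>The first weight is the limit of the rescaled images of the kernel and
  \<open>2 * pi\<close> their mass; the second dominates them. Each is written as a tail integral of
  minus its radial derivative, and the layer cake formula leaves a one-dimensional integral.\<close>

lemma nn_integral_weight:
  "(nn_integral lborel (\<lambda>q::real^2. ennreal (2 / ((norm q)\<^sup>2 + 1)\<^sup>2))) = ennreal (2 * pi)" (is ?exact)
  "(nn_integral lborel (\<lambda>q::real^2. ennreal (((norm q)\<^sup>2 + 1) powr (-5/4)))) < \<infinity>" (is ?finite)
proof -
  have pos: "(s::real)\<^sup>2 + 1 > 0" for s by (intro add_nonneg_pos) auto
  have k1: "(\<integral>\<^sup>+s. ennreal (if 0 \<le> s then 8 * s / (s\<^sup>2 + 1)^3 else 0) * indicator {r..} s \<partial>lborel) = ennreal (2 / (r\<^sup>2 + 1)\<^sup>2)" if "r \<ge> 0" for r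
  proof -
    have "(\<integral>\<^sup>+s. ennreal (if 0 \<le> s then 8 * s / (s\<^sup>2 + 1)^3 else 0) * indicator {r..} s \<partial>lborel) =
      (\<integral>\<^sup>+s. ennreal (8 * s / (s\<^sup>2 + 1)^3) * indicator {r..} s \<partial>lborel)"
      using that by (intro nn_integral_cong) (auto simp: indicator_def)
    also have "\<dots> = ennreal (0 - (- 2 / (r\<^sup>2 + 1)\<^sup>2))"
    proof (rule nn_integral_FTC_atLeast)
      show "((\<lambda>s. - 2 / (s\<^sup>2 + 1)\<^sup>2) has_real_derivative 8 * s / (s\<^sup>2 + 1)^3) (at s)" for s :: real
        using pos[of s] by (auto intro!: derivative_eq_intros simp: field_simps) (simp add: eval_nat_numeral algebra_simps)
      show "((\<lambda>s::real. - 2 / (s\<^sup>2 + 1)\<^sup>2) \<longlongrightarrow> 0) at_top" by real_asymp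
    qed (use that in auto)
    finally show ?thesis by simp
  qed
  have "(nn_integral lborel (\<lambda>q::real^2. ennreal (2 / ((norm q)\<^sup>2 + 1)\<^sup>2))) =
     (nn_integral lborel (\<lambda>q::real^2. indicator UNIV q * (\<integral>\<^sup>+s. ennreal (if 0 \<le> s then 8 * s / (s\<^sup>2 + 1)^3 else 0) * indicator {norm (q - 0)..} s \<partial>lborel)))"
    by (intro nn_integral_cong) (simp add: k1)
  also have "\<dots> = (\<integral>\<^sup>+s. ennreal (if 0 \<le> s then 8 * s / (s\<^sup>2 + 1)^3 else 0) * emeasure lborel (UNIV \<inter> cball (0::real^2) s) \<partial>lborel)"
    by (rule nn_integral_layer_cake) auto
  also have "\<dots> = (\<integral>\<^sup>+s. ennreal (8 * pi * s^3 / (s\<^sup>2 + 1)^3) * indicator {0..} s \<partial>lborel)"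
    by (intro nn_integral_cong) (auto simp: indicator_def emeasure_cball_2 ennreal_mult'[symmetric] power2_eq_square power3_eq_cube algebra_simps)
  also have "\<dots> = ennreal (2 * pi - 2 * pi * 0 ^ 4 / (0\<^sup>2 + 1)\<^sup>2)"
  proof (rule nn_integral_FTC_atLeast)
    show "((\<lambda>s. 2 * pi * s ^ 4 / (s\<^sup>2 + 1)\<^sup>2) has_real_derivative 8 * pi * s^3 / (s\<^sup>2 + 1)^3) (at s)" for s :: real
      using pos[of s] by (auto intro!: derivative_eq_intros simp: field_simps) (simp add: eval_nat_numeral algebra_simps)
    show "((\<lambda>s::real. 2 * pi * s ^ 4 / (s\<^sup>2 + 1)\<^sup>2) \<longlongrightarrow> 2 * pi) at_top" by real_asymp
  qed auto
  finally show ?exact by simp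
  have k2: "(\<integral>\<^sup>+s. ennreal (if 0 \<le> s then 5/2 * s * (s\<^sup>2 + 1) powr (-9/4) else 0) * indicator {r..} s \<partial>lborel) = ennreal ((r\<^sup>2 + 1) powr (-5/4))" if "r \<ge> 0" for r
  proof -
    have "(\<integral>\<^sup>+s. ennreal (if 0 \<le> s then 5/2 * s * (s\<^sup>2 + 1) powr (-9/4) else 0) * indicator {r..} s \<partial>lborel) =
      (\<integral>\<^sup>+s. ennreal (5/2 * s * (s\<^sup>2 + 1) powr (-9/4)) * indicator {r..} s \<partial>lborel)"
      using that by (intro nn_integral_cong) (auto simp: indicator_def)
    also have "\<dots> = ennreal (0 - (- ((r\<^sup>2 + 1) powr (-5/4))))"
    proof (rule nn_integral_FTC_atLeast)
      show "((\<lambda>s. - ((s\<^sup>2 + 1) powr (-5/4))) has_real_derivative 5/2 * s * (s\<^sup>2 + 1) powr (-9/4)) (at s)" for s :: real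
        using pos[of s] by (auto intro!: derivative_eq_intros)
      show "((\<lambda>s::real. - ((s\<^sup>2 + 1) powr (-5/4))) \<longlongrightarrow> 0) at_top" by real_asymp
    qed (use that in auto)
    finally show ?thesis by simp
  qed
  have "(nn_integral lborel (\<lambda>q::real^2. ennreal (((norm q)\<^sup>2 + 1) powr (-5/4)))) =
     (nn_integral lborel (\<lambda>q::real^2. indicator UNIV q * (\<integral>\<^sup>+s. ennreal (if 0 \<le> s then 5/2 * s * (s\<^sup>2 + 1) powr (-9/4) else 0) * indicator {norm (q - 0)..} s \<partial>lborel)))"
    by (intro nn_integral_cong) (simp add: k2)
  also have "\<dots> = (\<integral>\<^sup>+s. ennreal (if 0 \<le> s then 5/2 * s * (s\<^sup>2 + 1) powr (-9/4) else 0) * emeasure lborel (UNIV \<inter> cball (0::real^2) s) \<partial>lborel)"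
    by (rule nn_integral_layer_cake) auto
  also have "\<dots> \<le> (\<integral>\<^sup>+s. ennreal (5/2 * pi * s * (s\<^sup>2 + 1) powr (-5/4)) * indicator {0..} s \<partial>lborel)"
  proof (rule nn_integral_mono)
    fix s :: real
    show "ennreal (if 0 \<le> s then 5/2 * s * (s\<^sup>2 + 1) powr (-9/4) else 0) * emeasure lborel (UNIV \<inter> cball (0::real^2) s)
      \<le> ennreal (5/2 * pi * s * (s\<^sup>2 + 1) powr (-5/4)) * indicator {0..} s"
    proof (cases "s \<ge> 0")
      case True
      have "(s\<^sup>2 + 1) powr (-9/4) * (s\<^sup>2 + 1) = (s\<^sup>2 + 1) powr (-5/4)"
        using powr_mult_base[of "s\<^sup>2 + 1" "-9/4"] pos[of s] by (simp add: mult.commute)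
      then have "(s\<^sup>2 + 1) powr (-9/4) * s\<^sup>2 \<le> (s\<^sup>2 + 1) powr (-5/4)"
        using powr_ge_zero[of "s\<^sup>2 + 1" "-9/4"] unfolding distrib_left by linarith
      then have "5/2 * pi * s * ((s\<^sup>2 + 1) powr (-9/4) * s\<^sup>2) \<le> 5/2 * pi * s * (s\<^sup>2 + 1) powr (-5/4)"
        using True by (intro mult_left_mono) auto
      then show ?thesis using True
        by (simp add: emeasure_cball_2 ennreal_mult'[symmetric] ennreal_leI algebra_simps)
    qed simp
  qed
  also have "\<dots> = ennreal (0 - (- 5 * pi * (0\<^sup>2 + 1) powr (-1/4)))"
  proof (rule nn_integral_FTC_atLeast)
    show "((\<lambda>s. - 5 * pi * (s\<^sup>2 + 1) powr (-1/4)) has_real_derivative 5/2 * pi * s * (s\<^sup>2 + 1) powr (-5/4)) (at s)" for s :: real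
      using pos[of s] by (auto intro!: derivative_eq_intros)
    show "((\<lambda>s::real. - 5 * pi * (s\<^sup>2 + 1) powr (-1/4)) \<longlongrightarrow> 0) at_top" by real_asymp
  qed auto
  finally show ?finite by (rule le_less_trans) simp
qed

lemma integrable_weight:
  "integrable lborel (\<lambda>q::real^2. ((norm q)\<^sup>2 + 1) powr (-5/4))"
  by (rule integrableI_bounded) (use nn_integral_weight(2) in auto)

lemma integral_weight:
  "integrable lborel (\<lambda>q::real^2. 2 / ((norm q)\<^sup>2 + 1)\<^sup>2)"
  "(\<integral>q. 2 / ((norm (q::real^2))\<^sup>2 + 1)\<^sup>2 \<partial>lborel) = 2 * pi"
  by (rule integrableI_bounded) (use nn_integral_weight(1) in \<open>auto intro!: integral_eq_nn_integral[THEN trans]\<close>)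

section \<open>Regularised radial kernels as an approximate identity\<close>

lemma integral_scale:
  fixes f :: "'a::euclidean_space \<Rightarrow> complex"
  assumes "f \<in> borel_measurable borel" "c > 0"
  shows "(\<integral>z. f z \<partial>lborel) = of_real (c ^ DIM('a)) * (\<integral>q. f (c *\<^sub>R q) \<partial>lborel)"
proof -
  have "(\<integral>z. f z \<partial>lborel) = (\<integral>z. f z \<partial>density (distr lborel borel (\<lambda>x. 0 + c *\<^sub>R x)) (\<lambda>_. ennreal (\<bar>c\<bar>^DIM('a))))"
    using assms(2) by (subst lborel_affine[of c 0]) auto
  also have "\<dots> = (\<integral>z. (\<bar>c\<bar>^DIM('a)) *\<^sub>R f z \<partial>distr lborel borel (\<lambda>x. 0 + c *\<^sub>R x))"
    using assms by (intro integral_density) auto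
  also have "\<dots> = (\<integral>q. (\<bar>c\<bar>^DIM('a)) *\<^sub>R f (0 + c *\<^sub>R q) \<partial>lborel)"
    using assms by (intro integral_distr) auto
  finally show ?thesis using assms(2) by (simp add: scaleR_conv_of_real)
qed

lemma integrable_scale:
  fixes f :: "'a::euclidean_space \<Rightarrow> complex"
  assumes f: "f \<in> borel_measurable borel" and c: "c > 0" and i: "integrable lborel (\<lambda>q. f (c *\<^sub>R q))"
  shows "integrable lborel f"
proof -
  have "integrable (density (distr lborel borel (\<lambda>x. 0 + c *\<^sub>R x)) (\<lambda>_. ennreal (\<bar>c\<bar>^DIM('a)))) f"
    using f c i by (subst integrable_density) (auto simp: integrable_distr_eq)
  then show ?thesis using lborel_affine[of c "0::'a"] c by simp
qed

text \<open>The part of the theory common to the Bessel kernel and the logarithm: \<open>G1\<close>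
  is the derivative of \<open>G0\<close>, the second rule is the radial equation
  \<open>G'' + G' / r = c2 * G\<close>, and \<open>lim1\<close> fixes the strength of the
  singularity. \<open>bound0\<close> carries the factor \<open>c2\<close>, so that the unbounded
  logarithm qualifies with \<open>c2 = 0\<close>.\<close>

locale radial_kernel =
  fixes G0 G1 :: "real \<Rightarrow> complex" and c2 :: complex and A :: real
  assumes deriv0: "r > 0 \<Longrightarrow> (G0 has_vector_derivative G1 r) (at r)"
    and deriv1: "r > 0 \<Longrightarrow> (G1 has_vector_derivative c2 * G0 r - G1 r / of_real r) (at r)"
    and smooth_G0: "\<epsilon> > 0 \<Longrightarrow> smooth (\<lambda>y::real^2. G0 (sqrt ((norm (y - x))\<^sup>2 + \<epsilon>\<^sup>2)))"
    and lim1: "((\<lambda>r. of_real r * G1 r) \<longlongrightarrow> - 1) (at_right 0)"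
    and bound1: "r > 0 \<Longrightarrow> norm (of_real r * G1 r) \<le> A * (1 + sqrt r)"
    and bound0: "r > 0 \<Longrightarrow> norm (c2 * G0 r) \<le> A * r powr (-1/2)"
begin

lemma A_nonneg: "A \<ge> 0"
  using bound0[of 1] norm_ge_zero[of "c2 * G0 1"] by (simp del: norm_ge_zero)

definition rg :: "real \<Rightarrow> real^2 \<Rightarrow> real" where "rg \<epsilon> z = sqrt ((norm z)\<^sup>2 + \<epsilon>\<^sup>2)"

text \<open>The image of the regularised kernel under the operator \<open>- \<Delta> + c2\<close>.\<close>

definition \<psi> :: "real \<Rightarrow> real^2 \<Rightarrow> complex" where
  "\<psi> \<epsilon> z = - 2 * of_real (\<epsilon>\<^sup>2 / rg \<epsilon> z ^ 4) * (of_real (rg \<epsilon> z) * G1 (rg \<epsilon> z)) + of_real (\<epsilon>\<^sup>2 / (rg \<epsilon> z)\<^sup>2) * (c2 * G0 (rg \<epsilon> z))"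

lemma rg_pos: "\<epsilon> > 0 \<Longrightarrow> rg \<epsilon> z > 0"
  by (simp add: rg_def add_nonneg_pos)

lemma rg_cont: "continuous_on UNIV (rg \<epsilon>)"
  unfolding rg_def by (intro continuous_intros)

lemma G_rg_cont:
  assumes "\<epsilon> > 0"
  shows "continuous_on UNIV (\<lambda>z. G0 (rg \<epsilon> z))" "continuous_on UNIV (\<lambda>z. G1 (rg \<epsilon> z))"
proof -
  have "continuous_on {0<..} G0" "continuous_on {0<..} G1"
    by (auto intro!: continuous_at_imp_continuous_on has_vector_derivative_continuous deriv0 deriv1)
  then show "continuous_on UNIV (\<lambda>z. G0 (rg \<epsilon> z))" "continuous_on UNIV (\<lambda>z. G1 (rg \<epsilon> z))"
    using rg_pos[OF assms] by (auto intro!: continuous_on_compose2[OF _ rg_cont])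
qed

lemma \<psi>_cont: "\<epsilon> > 0 \<Longrightarrow> continuous_on UNIV (\<psi> \<epsilon>)"
  unfolding \<psi>_def using rg_pos[of \<epsilon>] by (intro continuous_intros G_rg_cont rg_cont) (auto simp: less_imp_neq[symmetric])

lemma rg_scale: "\<epsilon> > 0 \<Longrightarrow> rg \<epsilon> (\<epsilon> *\<^sub>R q) = \<epsilon> * rg 1 q"
proof -
  assume \<epsilon>: "\<epsilon> > 0"
  have "(norm (\<epsilon> *\<^sub>R q))\<^sup>2 + \<epsilon>\<^sup>2 = \<epsilon>\<^sup>2 * ((norm q)\<^sup>2 + 1\<^sup>2)" by (simp add: power_mult_distrib algebra_simps)
  then show ?thesis using \<epsilon> by (simp only: rg_def real_sqrt_mult) simp
qed

text \<open>The factor \<open>\<epsilon>^2\<close> is the Jacobian of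
  \<open>z = \<epsilon> * q\<close> in the plane. After it, \<open>\<epsilon>\<close> survives only
  in the arguments of the kernel and in front of the lower order term.\<close>

lemma \<psi>_scale:
  assumes "\<epsilon> > 0"
  shows "of_real (\<epsilon>\<^sup>2) * \<psi> \<epsilon> (\<epsilon> *\<^sub>R q) = - 2 * of_real (1 / rg 1 q ^ 4) * (of_real (\<epsilon> * rg 1 q) * G1 (\<epsilon> * rg 1 q))
     + of_real (\<epsilon>\<^sup>2 / (rg 1 q)\<^sup>2) * (c2 * G0 (\<epsilon> * rg 1 q))"
proof -
  have "\<epsilon>\<^sup>2 * (\<epsilon>\<^sup>2 / (\<epsilon> * \<sigma>) ^ 4) = 1 / \<sigma> ^ 4" "\<epsilon>\<^sup>2 * (\<epsilon>\<^sup>2 / (\<epsilon> * \<sigma>)\<^sup>2) = \<epsilon>\<^sup>2 / \<sigma>\<^sup>2" for \<sigma>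
    using assms by (simp_all add: power_mult_distrib field_simps eval_nat_numeral)
  then have "complex_of_real (\<epsilon>\<^sup>2) * of_real (\<epsilon>\<^sup>2 / (\<epsilon> * \<sigma>) ^ 4) = of_real (1 / \<sigma> ^ 4)"
     "complex_of_real (\<epsilon>\<^sup>2) * of_real (\<epsilon>\<^sup>2 / (\<epsilon> * \<sigma>)\<^sup>2) = of_real (\<epsilon>\<^sup>2 / \<sigma>\<^sup>2)" for \<sigma>
    by (simp_all only: of_real_mult[symmetric])
  then show ?thesis unfolding \<psi>_def rg_scale[OF assms] distrib_left
    by (simp only: mult.assoc[symmetric] mult.commute[of _ "- 2"]) (simp only: mult.assoc)
qed

lemma rg1_ge_1: "rg 1 q \<ge> 1"
  by (simp add: rg_def)

text \<open>Gives a majorant independent of \<open>\<epsilon>\<close>. With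
  \<open>\<sigma> = sqrt (|q|^2 + 1)\<close> the two terms decay like the powers
  \<open>- 7/2\<close> and \<open>- 5/2\<close> of \<open>\<sigma>\<close>, both faster than the
  rate 2 that is critical in the plane.\<close>

lemma norm_\<psi>_scale:
  assumes "0 < \<epsilon>" "\<epsilon> \<le> 1"
  shows "norm (of_real (\<epsilon>\<^sup>2) * \<psi> \<epsilon> (\<epsilon> *\<^sub>R q)) \<le> 5 * A * ((norm q)\<^sup>2 + 1) powr (-5/4)"
proof -
  define \<sigma> where "\<sigma> = rg 1 q"
  have \<sigma>: "\<sigma> \<ge> 1" "\<sigma> > 0" using rg1_ge_1[of q] by (auto simp: \<sigma>_def)
  have w: "((norm q)\<^sup>2 + 1) powr (-5/4) = \<sigma> powr (-5/2)"
  proof -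
    have "(norm q)\<^sup>2 + 1 = \<sigma> powr 2" using \<sigma> by (simp add: \<sigma>_def rg_def)
    then show ?thesis by (simp add: powr_powr)
  qed
  have r: "\<epsilon> * \<sigma> > 0" using assms \<sigma> by simp
  have "norm (of_real (\<epsilon> * \<sigma>) * G1 (\<epsilon> * \<sigma>)) \<le> A * (1 + sqrt (\<epsilon> * \<sigma>))" by (rule bound1[OF r])
  also have "\<dots> \<le> A * (2 * \<sigma> powr (1/2))"
  proof -
    have "sqrt (\<epsilon> * \<sigma>) \<le> sqrt \<sigma>" using assms \<sigma> by (intro real_sqrt_le_mono) (simp add: mult_left_le_one_le)
    moreover have "1 \<le> sqrt \<sigma>" using \<sigma> by simp
    ultimately have "1 + sqrt (\<epsilon> * \<sigma>) \<le> 2 * sqrt \<sigma>" by linarith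
    then show ?thesis using A_nonneg \<sigma> by (simp only: powr_half_sqrt[OF less_imp_le[OF \<sigma>(2)]] mult_left_mono)
  qed
  finally have 1: "norm (of_real (\<epsilon> * \<sigma>) * G1 (\<epsilon> * \<sigma>)) \<le> A * (2 * \<sigma> powr (1/2))" .
  have "norm (- 2 * of_real (1 / \<sigma> ^ 4) * (of_real (\<epsilon> * \<sigma>) * G1 (\<epsilon> * \<sigma>))) = 2 / \<sigma> ^ 4 * norm (of_real (\<epsilon> * \<sigma>) * G1 (\<epsilon> * \<sigma>))"
    using \<sigma> by (simp add: norm_mult norm_divide norm_power)
  also have "\<dots> \<le> 2 / \<sigma> ^ 4 * (A * (2 * \<sigma> powr (1/2)))"
    using 1 \<sigma> by (intro mult_left_mono) auto
  also have "\<dots> = 4 * A * \<sigma> powr (-7/2)"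
  proof -
    have "\<sigma> powr (1/2) / \<sigma> ^ 4 = \<sigma> powr (-7/2)"
      using \<sigma> by (simp add: powr_diff[symmetric] flip: powr_numeral)
    moreover have "2 / \<sigma> ^ 4 * (A * (2 * \<sigma> powr (1/2))) = 4 * A * (\<sigma> powr (1/2) / \<sigma> ^ 4)" by simp
    ultimately show ?thesis by (simp only:)
  qed
  also have "\<dots> \<le> 4 * A * \<sigma> powr (-5/2)"
    using \<sigma> A_nonneg by (intro mult_left_mono powr_mono) auto
  finally have a: "norm (- 2 * of_real (1 / \<sigma> ^ 4) * (of_real (\<epsilon> * \<sigma>) * G1 (\<epsilon> * \<sigma>))) \<le> 4 * A * \<sigma> powr (-5/2)" .
  have "norm (of_real (\<epsilon>\<^sup>2 / \<sigma>\<^sup>2) * (c2 * G0 (\<epsilon> * \<sigma>))) \<le> \<epsilon>\<^sup>2 / \<sigma>\<^sup>2 * (A * (\<epsilon> * \<sigma>) powr (-1/2))"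
    unfolding norm_mult[of "of_real _"] using bound0[OF r] \<sigma> by (intro mult_mono) (auto simp: norm_divide norm_power)
  also have "\<dots> = \<epsilon> powr (3/2) * (A * \<sigma> powr (-5/2))"
  proof -
    have "\<epsilon>\<^sup>2 * \<epsilon> powr (-1/2) = \<epsilon> powr (3/2)" "\<sigma> powr (-1/2) / \<sigma>\<^sup>2 = \<sigma> powr (-5/2)"
      using \<sigma> assms by (simp_all add: powr_diff[symmetric] powr_add[symmetric] flip: powr_numeral)
    then show ?thesis using \<sigma> assms by (simp add: powr_mult field_simps)
  qed
  also have "\<dots> \<le> 1 * (A * \<sigma> powr (-5/2))"
    using assms A_nonneg powr_le1[of "3/2" \<epsilon>] by (intro mult_right_mono) auto
  finally have b: "norm (of_real (\<epsilon>\<^sup>2 / \<sigma>\<^sup>2) * (c2 * G0 (\<epsilon> * \<sigma>))) \<le> A * \<sigma> powr (-5/2)" by simp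
  show ?thesis unfolding \<psi>_scale[OF assms(1)] w \<sigma>_def[symmetric]
    using norm_triangle_ineq[of "- 2 * of_real (1 / \<sigma> ^ 4) * (of_real (\<epsilon> * \<sigma>) * G1 (\<epsilon> * \<sigma>))" "of_real (\<epsilon>\<^sup>2 / \<sigma>\<^sup>2) * (c2 * G0 (\<epsilon> * \<sigma>))"] a b by linarith
qed

lemma \<psi>_integrable:
  assumes "0 < \<epsilon>" "\<epsilon> \<le> 1"
  shows "integrable lborel (\<psi> \<epsilon>)"
proof (rule integrable_scale[OF borel_measurable_continuous_onI[OF \<psi>_cont] assms(1)])
  have m: "(\<lambda>q. \<psi> \<epsilon> (\<epsilon> *\<^sub>R q)) \<in> borel_measurable borel"
    by (intro borel_measurable_continuous_onI continuous_on_compose2[OF \<psi>_cont] continuous_intros) (use assms in auto)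
  have "integrable lborel (\<lambda>q. of_real (\<epsilon>\<^sup>2) * \<psi> \<epsilon> (\<epsilon> *\<^sub>R q))"
    by (rule Bochner_Integration.integrable_bound[OF integrable_mult_right[OF integrable_weight, of "5 * A"]])
       (use m norm_\<psi>_scale[OF assms] in \<open>auto intro!: AE_I2 order_trans[OF norm_\<psi>_scale[OF assms]] simp: abs_of_nonneg A_nonneg\<close>)
  then have "integrable lborel (\<lambda>q. inverse (of_real (\<epsilon>\<^sup>2)) * (of_real (\<epsilon>\<^sup>2) * \<psi> \<epsilon> (\<epsilon> *\<^sub>R q)))"
    by (rule integrable_mult_right)
  moreover have "inverse (of_real (\<epsilon>\<^sup>2)) * (of_real (\<epsilon>\<^sup>2) * z) = z" for z :: complex
    using assms by (simp add: field_simps)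
  ultimately show "integrable lborel (\<lambda>q. \<psi> \<epsilon> (\<epsilon> *\<^sub>R q))" by (simp only:)
qed (use assms in auto)

text \<open>Rescaling, then dominated convergence. The mass \<open>2 * pi\<close> reflects that the
  kernels are not divided by \<open>2 * pi\<close>; the factor reappears in all pointwise
  bounds.\<close>

lemma approx_identity:
  fixes \<theta> :: "real^2 \<Rightarrow> complex"
  assumes \<theta>: "continuous_on UNIV \<theta>" "\<And>x. norm (\<theta> x) \<le> 1"
    and \<epsilon>: "\<And>n::nat. 0 < \<epsilon> n" "\<And>n. \<epsilon> n \<le> 1" "\<epsilon> \<longlonglongrightarrow> 0"
  shows "(\<lambda>n. \<integral>z. \<theta> (y + z) * \<psi> (\<epsilon> n) z \<partial>lborel) \<longlonglongrightarrow> 2 * pi * \<theta> y"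
    and "norm (\<integral>z. \<theta> (y + z) * \<psi> (\<epsilon> n) z \<partial>lborel) \<le> (\<integral>q. 5 * A * ((norm (q::real^2))\<^sup>2 + 1) powr (-5/4) \<partial>lborel)"
proof -
  define F where "F n q = \<theta> (y + \<epsilon> n *\<^sub>R q) * (of_real ((\<epsilon> n)\<^sup>2) * \<psi> (\<epsilon> n) (\<epsilon> n *\<^sub>R q))" for n q
  have Fc: "continuous_on UNIV (F n)" for n
    unfolding F_def
    by (intro continuous_intros continuous_on_compose2[OF \<theta>(1)] continuous_on_compose2[OF \<psi>_cont]) (use \<epsilon> in auto)
  have Fm: "F n \<in> borel_measurable borel" for n by (rule borel_measurable_continuous_onI[OF Fc])
  have eq: "(\<integral>z. \<theta> (y + z) * \<psi> (\<epsilon> n) z \<partial>lborel) = integral\<^sup>L lborel (F n)" for n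
  proof -
    have "(\<lambda>z. \<theta> (y + z) * \<psi> (\<epsilon> n) z) \<in> borel_measurable borel"
      by (intro borel_measurable_continuous_onI continuous_intros continuous_on_compose2[OF \<theta>(1)] \<psi>_cont \<epsilon>) auto
    then have "(\<integral>z. \<theta> (y + z) * \<psi> (\<epsilon> n) z \<partial>lborel) = of_real ((\<epsilon> n) ^ DIM(real^2)) * (\<integral>q. \<theta> (y + \<epsilon> n *\<^sub>R q) * \<psi> (\<epsilon> n) (\<epsilon> n *\<^sub>R q) \<partial>lborel)"
      by (rule integral_scale) (rule \<epsilon>)
    moreover have "F n = (\<lambda>q. of_real ((\<epsilon> n)\<^sup>2) * (\<theta> (y + \<epsilon> n *\<^sub>R q) * \<psi> (\<epsilon> n) (\<epsilon> n *\<^sub>R q)))"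
      by (simp add: F_def fun_eq_iff mult.left_commute)
    ultimately show ?thesis by (simp only: integral_mult_right_zero) simp
  qed
  have bound: "norm (F n q) \<le> 5 * A * ((norm q)\<^sup>2 + 1) powr (-5/4)" for n q
    using mult_mono[OF \<theta>(2)[of "y + \<epsilon> n *\<^sub>R q"] norm_\<psi>_scale[OF \<epsilon>(1,2), of n q]]
    by (simp add: F_def norm_mult)
  have wi: "integrable lborel (\<lambda>q::real^2. 5 * A * ((norm q)\<^sup>2 + 1) powr (-5/4))"
    by (intro integrable_mult_right integrable_weight)
  have "(\<lambda>n. integral\<^sup>L lborel (F n)) \<longlonglongrightarrow> (\<integral>q. \<theta> y * of_real (2 / ((norm (q::real^2))\<^sup>2 + 1)\<^sup>2) \<partial>lborel)"
  proof (rule integral_dominated_convergence[OF _ _ wi])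
    show "AE q in lborel. (\<lambda>n. F n q) \<longlonglongrightarrow> \<theta> y * of_real (2 / ((norm q)\<^sup>2 + 1)\<^sup>2)"
    proof (rule AE_I2)
      fix q
      define \<sigma> where "\<sigma> = rg 1 q"
      have \<sigma>: "\<sigma> \<ge> 1" using rg1_ge_1[of q] by (simp add: \<sigma>_def)
      have s2: "\<sigma>\<^sup>2 = (norm q)\<^sup>2 + 1" by (simp add: \<sigma>_def rg_def)
      have t0: "(\<lambda>n. \<epsilon> n * \<sigma>) \<longlonglongrightarrow> 0" using tendsto_mult_right[OF \<epsilon>(3), of \<sigma>] by simp
      have tp: "\<epsilon> n * \<sigma> > 0" for n using \<epsilon>(1)[of n] \<sigma> by simp
      have "(\<lambda>n. \<theta> (y + \<epsilon> n *\<^sub>R q)) \<longlonglongrightarrow> \<theta> (y + 0 *\<^sub>R q)"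
      proof (rule isCont_tendsto_compose[of _ \<theta>])
        show "isCont \<theta> (y + 0 *\<^sub>R q)" using \<theta>(1) by (simp add: continuous_on_eq_continuous_at)
      qed (intro tendsto_intros \<epsilon>)
      moreover have "(\<lambda>n. of_real (\<epsilon> n * \<sigma>) * G1 (\<epsilon> n * \<sigma>)) \<longlonglongrightarrow> - 1"
        using lim1 t0 tp unfolding tendsto_at_iff_sequentially comp_def
        by (elim allE[where x="\<lambda>n. \<epsilon> n * \<sigma>"] impE) (auto simp: less_imp_neq[symmetric])
      \<comment> \<open>Times \<open>c2\<close>, the kernel is at worst of the order of
        \<open>\<epsilon>\<close> to the power \<open>- 1/2\<close>, so the factor
        \<open>\<epsilon>^2\<close> makes this term disappear.\<close>
      moreover have "(\<lambda>n. of_real ((\<epsilon> n)\<^sup>2 / \<sigma>\<^sup>2) * (c2 * G0 (\<epsilon> n * \<sigma>))) \<longlonglongrightarrow> 0"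
      proof (rule Lim_null_comparison[OF always_eventually, OF allI])
        fix n
        have "norm (of_real ((\<epsilon> n)\<^sup>2 / \<sigma>\<^sup>2) * (c2 * G0 (\<epsilon> n * \<sigma>))) \<le> (\<epsilon> n)\<^sup>2 / \<sigma>\<^sup>2 * (A * (\<epsilon> n * \<sigma>) powr (-1/2))"
          unfolding norm_mult[of "of_real _"] using bound0[OF tp] by (intro mult_mono) (auto simp: norm_divide norm_power)
        also have "\<dots> \<le> (\<epsilon> n)\<^sup>2 * (A * (\<epsilon> n) powr (-1/2))"
        proof -
          have "(\<epsilon> n * \<sigma>) powr (-1/2) \<le> (\<epsilon> n) powr (-1/2)"
            using \<epsilon>(1)[of n] \<sigma> by (intro powr_mono2') auto
          moreover have "(\<epsilon> n)\<^sup>2 / \<sigma>\<^sup>2 \<le> (\<epsilon> n)\<^sup>2" 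
          using \<sigma> mult_left_mono[of 1 "\<sigma>\<^sup>2" "(\<epsilon> n)\<^sup>2"] by (simp add: divide_le_eq one_le_power)
          ultimately show ?thesis using A_nonneg by (intro mult_mono mult_left_mono) auto
        qed
        also have "(\<epsilon> n)\<^sup>2 * (A * (\<epsilon> n) powr (-1/2)) = A * (\<epsilon> n) powr (3/2)"
          using \<epsilon>(1)[of n] by (simp add: powr_add[symmetric] mult.left_commute flip: powr_numeral)
        finally show "norm (of_real ((\<epsilon> n)\<^sup>2 / \<sigma>\<^sup>2) * (c2 * G0 (\<epsilon> n * \<sigma>))) \<le> A * (\<epsilon> n) powr (3/2)" .
      next
        have "(\<lambda>n. (\<epsilon> n) powr (3/2)) \<longlonglongrightarrow> 0"
          by (rule tendsto_zero_powrI[OF \<epsilon>(3)]) (auto intro: always_eventually less_imp_le \<epsilon>)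
        then show "(\<lambda>n. A * (\<epsilon> n) powr (3/2)) \<longlonglongrightarrow> 0" by (rule tendsto_mult_right_zero)
      qed
      ultimately have "(\<lambda>n. F n q) \<longlonglongrightarrow> \<theta> (y + 0 *\<^sub>R q) * (- 2 * of_real (1 / \<sigma> ^ 4) * (- 1) + 0)"
        unfolding F_def \<psi>_scale[OF \<epsilon>(1)] \<sigma>_def[symmetric] by (intro tendsto_intros)
      moreover have "\<sigma> ^ 4 = ((norm q)\<^sup>2 + 1)\<^sup>2" unfolding s2[symmetric] by simp
      ultimately show "(\<lambda>n. F n q) \<longlonglongrightarrow> \<theta> y * of_real (2 / ((norm q)\<^sup>2 + 1)\<^sup>2)" by simp
    qed
    show "AE q in lborel. norm (F n q) \<le> 5 * A * ((norm q)\<^sup>2 + 1) powr (-5/4)" for n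
      by (intro AE_I2 bound)
  qed (use Fm in auto)
  also have "(\<integral>q. \<theta> y * of_real (2 / ((norm (q::real^2))\<^sup>2 + 1)\<^sup>2) \<partial>lborel) = 2 * pi * \<theta> y"
    by (simp only: integral_mult_right_zero integral_complex_of_real integral_weight) simp
  finally show "(\<lambda>n. \<integral>z. \<theta> (y + z) * \<psi> (\<epsilon> n) z \<partial>lborel) \<longlonglongrightarrow> 2 * pi * \<theta> y" unfolding eq .
  have Fi: "integrable lborel (F n)"
    by (rule Bochner_Integration.integrable_bound[OF wi]) (use Fm bound in \<open>auto intro!: AE_I2 order_trans[OF bound] simp: abs_of_nonneg A_nonneg\<close>)
  have "norm (integral\<^sup>L lborel (F n)) \<le> (\<integral>q. norm (F n q) \<partial>lborel)" by simp
  also have "\<dots> \<le> (\<integral>q. 5 * A * ((norm (q::real^2))\<^sup>2 + 1) powr (-5/4) \<partial>lborel)"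
    using Fi wi bound by (intro integral_mono) auto
  finally show "norm (\<integral>z. \<theta> (y + z) * \<psi> (\<epsilon> n) z \<partial>lborel) \<le> (\<integral>q. 5 * A * ((norm (q::real^2))\<^sup>2 + 1) powr (-5/4) \<partial>lborel)"
    unfolding eq .
qed

end

section \<open>Local representation of solutions of the Helmholtz equation in the plane\<close>

lemma deriv_step: "(step has_real_derivative deriv step t) (at t)"
  using step_deriv DERIV_imp_deriv by metis

lemma deriv_step_bound: obtains L where "L > 0" "\<And>t. \<bar>deriv step t\<bar> \<le> L"
proof -
  obtain s L where s: "\<And>t. (step has_real_derivative s t) (at t)" "\<And>t. \<bar>s t\<bar> \<le> L" "L > 0"
    using step_deriv by metis
  then have "deriv step = s" by (auto simp: DERIV_imp_deriv)
  then show ?thesis using s that by blast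
qed

lemma deriv_step_eq_0: "\<not> (1 \<le> t \<and> t \<le> 2) \<Longrightarrow> deriv step t = 0"
  using step_deriv DERIV_imp_deriv by metis

lemma deriv_step_cont: "continuous_on UNIV (deriv step)"
proof -
  obtain s where s: "\<And>t. (step has_real_derivative s t) (at t)" "continuous_on UNIV s"
    using step_deriv by metis
  then have "deriv step = s" by (auto simp: DERIV_imp_deriv)
  then show ?thesis using s by simp
qed

text \<open>Equal to 1 up to radius \<open>R\<close> and to 0 from \<open>sqrt 2 * R\<close> on. The
  squared norm makes it smooth at the origin and its gradient a multiple of \<open>y\<close>, so
  that only radial derivatives appear in the commutator.\<close>

definition cutoff :: "real \<Rightarrow> 'a::euclidean_space \<Rightarrow> complex" where
  "cutoff R y = 1 - of_real (step ((norm y)\<^sup>2 / R\<^sup>2))"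

lemma smooth_cutoff: "smooth (cutoff R :: 'a::euclidean_space \<Rightarrow> complex)"
proof -
  have "smooth (\<lambda>y::'a. of_real (inverse (R\<^sup>2)) * complex_of_real ((norm (y - 0))\<^sup>2))"
    by (intro smooth_mult smooth_const smooth_norm2)
  then have "smooth (\<lambda>y::'a. complex_of_real ((norm y)\<^sup>2 / R\<^sup>2))"
    by (simp add: divide_inverse mult.commute)
  then show ?thesis unfolding cutoff_def by (intro smooth_diff smooth_const smooth_step)
qed

lemma cutoff_eq_1: "R > 0 \<Longrightarrow> norm y \<le> R \<Longrightarrow> cutoff R y = 1"
  by (simp add: cutoff_def step_eq_0 power_mono)

lemma cutoff_eq_0: 
  assumes "R > 0" "norm y \<ge> 2 * R" shows "cutoff R y = 0"
proof -
  have "(2 * R)\<^sup>2 \<le> (norm y)\<^sup>2" using assms by (intro power_mono) auto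
  then have "4 * R\<^sup>2 \<le> (norm y)\<^sup>2" by (simp add: power_mult_distrib)
  then have "2 * R\<^sup>2 \<le> (norm y)\<^sup>2" using zero_le_power2[of R] by linarith
  then have "2 \<le> (norm y)\<^sup>2 / R\<^sup>2" using assms by (simp add: le_divide_eq)
  then show ?thesis by (simp add: cutoff_def step_eq_1)
qed

lemma norm_cutoff: "norm (cutoff R y) \<le> 1"
proof -
  have "cutoff R y = of_real (1 - step ((norm y)\<^sup>2 / R\<^sup>2))" by (simp add: cutoff_def)
  then show ?thesis
    using step_nonneg[of "(norm y)\<^sup>2 / R\<^sup>2"] step_le_1[of "(norm y)\<^sup>2 / R\<^sup>2"] by (simp only: norm_of_real)
qed

lemma cutoff_test: "R > 0 \<Longrightarrow> cutoff R \<in> test_functions UNIV"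
  by (rule test_functionsI[of _ "cball 0 (2 * R)"]) (use cutoff_eq_0[of R] in \<open>force intro: smooth_cutoff\<close>)+

lemma partial_cutoff:
  "partial b (cutoff R) y = - of_real (deriv step ((norm y)\<^sup>2 / R\<^sup>2) * (2 / R\<^sup>2) * (y \<bullet> b))"
proof -
  have 1: "((\<lambda>y. (norm y)\<^sup>2 / R\<^sup>2) has_derivative (\<lambda>h. 2 * (y \<bullet> h) / R\<^sup>2)) (at y)"
  proof -
    have "((\<lambda>y. inverse (R\<^sup>2) * (y \<bullet> y)) has_derivative (\<lambda>h. inverse (R\<^sup>2) * (2 * (y \<bullet> h)))) (at y)"
      by (auto intro!: derivative_eq_intros simp: inner_commute)
    then show ?thesis unfolding power2_norm_eq_inner divide_inverse mult.commute[of _ "inverse _"] .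
  qed
  have "((\<lambda>y. step ((norm y)\<^sup>2 / R\<^sup>2)) has_derivative (\<lambda>h. deriv step ((norm y)\<^sup>2 / R\<^sup>2) * (2 * (y \<bullet> h) / R\<^sup>2))) (at y)"
    using has_derivative_compose[OF 1 deriv_step[unfolded has_field_derivative_def]] .
  then have "(cutoff R has_derivative (\<lambda>h. 0 - of_real (deriv step ((norm y)\<^sup>2 / R\<^sup>2) * (2 * (y \<bullet> h) / R\<^sup>2)))) (at y)"
    unfolding cutoff_def by (intro has_derivative_diff has_derivative_const has_derivative_of_real)
  from partial_eq[OF this, of b] show ?thesis by simp
qed

text \<open>The weak form of \<open>- Laplace w + c2 * w = f\<close>. The derivatives
  \<open>W\<close> are separate Borel functions, tied to \<open>w\<close> only through
  testing.\<close>

locale weak_helmholtz =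
  fixes w :: "real^2 \<Rightarrow> complex" and W :: "real^2 \<Rightarrow> real^2 \<Rightarrow> complex" and f :: "real^2 \<Rightarrow> complex"
    and c2 :: complex
  assumes w_m [measurable]: "w \<in> borel_measurable borel"
    and W_m [measurable]: "\<And>b. b \<in> Basis \<Longrightarrow> W b \<in> borel_measurable borel"
    and f_m [measurable]: "f \<in> borel_measurable borel"
    and w_loc: "\<And>R. integrable lborel (\<lambda>x. indicator (cball 0 R) x *\<^sub>R w x)"
    and W_loc: "\<And>b R. b \<in> Basis \<Longrightarrow> integrable lborel (\<lambda>x. indicator (cball 0 R) x *\<^sub>R W b x)"
    and f_int: "integrable lborel f"
    and weak_derivative: "\<And>b \<phi>. b \<in> Basis \<Longrightarrow> \<phi> \<in> test_functions UNIV \<Longrightarrow>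
      (\<integral>x. w x * partial b \<phi> x \<partial>lborel) = - (\<integral>x. W b x * \<phi> x \<partial>lborel)"
    and equation: "\<And>\<phi>. \<phi> \<in> test_functions UNIV \<Longrightarrow>
      (\<Sum>b\<in>Basis. \<integral>x. W b x * partial b \<phi> x \<partial>lborel) + c2 * (\<integral>x. w x * \<phi> x \<partial>lborel) = (\<integral>x. f x * \<phi> x \<partial>lborel)"
begin

lemma loc_integrable_mult:
  fixes g \<phi> :: "real^2 \<Rightarrow> complex"
  assumes g: "\<And>R. integrable lborel (\<lambda>x. indicator (cball 0 R) x *\<^sub>R g x)" "g \<in> borel_measurable borel"
    and \<phi>: "\<phi> \<in> test_functions UNIV"
  shows "integrable lborel (\<lambda>x. g x * \<phi> x)"
proof -
  obtain B where B: "\<And>x. norm (\<phi> x) \<le> B" using test_function_bounded[OF \<phi>] by metis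
  obtain K where K: "smooth \<phi>" "compact K" "\<And>x. x \<notin> K \<Longrightarrow> \<phi> x = 0" using \<phi> by (rule test_functionsE) blast
  obtain R where R: "\<And>x. x \<in> K \<Longrightarrow> norm x \<le> R" using compact_imp_bounded[OF K(2)] bounded_iff by metis
  have m: "\<phi> \<in> borel_measurable borel" by (rule borel_measurable_continuous_onI[OF smooth_continuous[OF K(1)]])
  show ?thesis
  proof (rule Bochner_Integration.integrable_bound[OF integrable_mult_right[OF integrable_norm[OF g(1)[of R]], of B]])
    show "AE x in lborel. norm (g x * \<phi> x) \<le> norm (B * norm (indicator (cball 0 R) x *\<^sub>R g x))"
    proof (rule AE_I2)
      fix x
      have "B \<ge> 0" using B[of 0] norm_ge_zero order_trans by blast
      show "norm (g x * \<phi> x) \<le> norm (B * norm (indicator (cball 0 R) x *\<^sub>R g x))"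
      proof (cases "x \<in> K")
        case True
        then show ?thesis using R[OF True] B[of x] \<open>B \<ge> 0\<close> mult_right_mono[OF B[of x] norm_ge_zero[of "g x"]]
          by (simp add: norm_mult mult.commute abs_of_nonneg)
      qed (simp add: K)
    qed
  qed (use g m in auto)
qed

lemmas w_mult = loc_integrable_mult[OF w_loc w_m]
lemmas W_mult = loc_integrable_mult[OF W_loc W_m]

text \<open>The commutator of the equation with the cutoff, tested with a function that has values
  \<open>g0\<close> and whose derivative in the direction of \<open>y\<close> is \<open>g1\<close>.\<close>

definition bd :: "real \<Rightarrow> (real^2 \<Rightarrow> complex) \<Rightarrow> (real^2 \<Rightarrow> complex) \<Rightarrow> complex" where
  "bd R g0 g1 = (\<integral>y. - of_real (deriv step ((norm y)\<^sup>2 / R\<^sup>2) * (2 / R\<^sup>2)) *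
     (w y * g1 y - g0 y * (\<Sum>b\<in>Basis. W b y * of_real (y \<bullet> b))) \<partial>lborel)"

text \<open>Green's second identity in weak form. The equation is tested with the cut-off times
  \<open>g\<close>; the term in which the gradient falls on \<open>g\<close> is transformed once
  more by \<open>weak_derivative\<close>, and all terms with the gradient of the cut-off are
  gathered in \<open>bd\<close>.\<close>

lemma cutoff_identity:
  assumes R: "R > 0" and g: "smooth g"
  shows "(\<integral>y. w y * cutoff R y * (c2 * g y - (\<Sum>b\<in>Basis. partial b (partial b g) y)) \<partial>lborel) =
    (\<integral>y. f y * cutoff R y * g y \<partial>lborel) + bd R g (\<lambda>y. \<Sum>b\<in>Basis. of_real (y \<bullet> b) * partial b g y)"
proof -
  let ?c = "cutoff R :: real^2 \<Rightarrow> complex"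
  have c: "?c \<in> test_functions UNIV" "smooth ?c" using R by (auto intro: cutoff_test smooth_cutoff)
  have cg: "(\<lambda>y. ?c y * g y) \<in> test_functions UNIV" by (rule test_functions_mult[OF c(1) g])
  have pcg: "(\<lambda>y. partial b ?c y * g y) \<in> test_functions UNIV" if "b \<in> Basis" for b
    by (rule test_functions_mult[OF test_functions_partial[OF c(1) that] g])
  have cpg: "(\<lambda>y. ?c y * partial b g y) \<in> test_functions UNIV" if "b \<in> Basis" for b
    by (rule test_functions_mult[OF c(1) smooth_partial[OF g that]])
  have pcpg: "(\<lambda>y. partial b ?c y * partial b g y) \<in> test_functions UNIV" if "b \<in> Basis" for b
    by (rule test_functions_mult[OF test_functions_partial[OF c(1) that] smooth_partial[OF g that]])
  have cppg: "(\<lambda>y. ?c y * partial b (partial b g) y) \<in> test_functions UNIV" if "b \<in> Basis" for b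
    by (rule test_functions_mult[OF c(1) smooth_partial[OF smooth_partial[OF g that] that]])
  define a1 where "a1 b = (\<integral>y. W b y * (partial b ?c y * g y) \<partial>lborel)" for b
  define a2 where "a2 b = (\<integral>y. W b y * (?c y * partial b g y) \<partial>lborel)" for b
  define a3 where "a3 b = (\<integral>y. w y * (partial b ?c y * partial b g y) \<partial>lborel)" for b
  define a4 where "a4 b = (\<integral>y. w y * (?c y * partial b (partial b g) y) \<partial>lborel)" for b
  have 1: "(\<integral>y. W b y * partial b (\<lambda>y. ?c y * g y) y \<partial>lborel) = a1 b + a2 b" if "b \<in> Basis" for b
    unfolding partial_mult[OF c(2) g] distrib_left a1_def a2_def
    by (intro Bochner_Integration.integral_add W_mult pcg cpg that)
  \<comment> \<open>The second partial integration: the derivative of \<open>w\<close> is paired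
    with the cut-off times \<open>partial b g\<close>, which moves it onto that product.\<close>
  have 2: "a2 b = - a3 b - a4 b" if "b \<in> Basis" for b
  proof -
    have "(\<integral>y. w y * partial b (\<lambda>y. ?c y * partial b g y) y \<partial>lborel) = a3 b + a4 b"
      unfolding partial_mult[OF c(2) smooth_partial[OF g that]] distrib_left a3_def a4_def
      by (intro Bochner_Integration.integral_add w_mult pcpg cppg that)
    then have "a3 b + a4 b = - a2 b" using weak_derivative[OF that cpg[OF that]] by (simp add: a2_def)
    then have "a2 b = - (a3 b + a4 b)" by simp
    then show ?thesis by simp
  qed
  have eqn: "(\<Sum>b\<in>Basis. a1 b + a2 b) + c2 * (\<integral>y. w y * (?c y * g y) \<partial>lborel) = (\<integral>y. f y * (?c y * g y) \<partial>lborel)"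
    using equation[OF cg] 1 by simp
  have L: "(\<integral>y. w y * ?c y * (c2 * g y - (\<Sum>b\<in>Basis. partial b (partial b g) y)) \<partial>lborel) =
      c2 * (\<integral>y. w y * (?c y * g y) \<partial>lborel) - (\<Sum>b\<in>Basis. a4 b)"
  proof -
    have "w y * ?c y * (c2 * g y - (\<Sum>b\<in>Basis. partial b (partial b g) y)) =
      c2 * (w y * (?c y * g y)) - (\<Sum>b\<in>Basis. w y * (?c y * partial b (partial b g) y))" for y
      by (simp add: algebra_simps sum_distrib_left)
    moreover have "integrable lborel (\<lambda>y. c2 * (w y * (?c y * g y)))"
      by (intro integrable_mult_right w_mult cg)
    moreover have "integrable lborel (\<lambda>y. \<Sum>b\<in>Basis. w y * (?c y * partial b (partial b g) y))"
      by (intro Bochner_Integration.integrable_sum w_mult cppg)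
    ultimately show ?thesis unfolding a4_def
      by (simp only: Bochner_Integration.integral_diff integral_mult_right_zero)
         (subst Bochner_Integration.integral_sum, auto intro!: w_mult cppg)
  qed
  have B: "bd R g (\<lambda>y. \<Sum>b\<in>Basis. of_real (y \<bullet> b) * partial b g y) = (\<Sum>b\<in>Basis. a3 b - a1 b)"
  proof -
    have "- of_real (deriv step ((norm y)\<^sup>2 / R\<^sup>2) * (2 / R\<^sup>2)) *
       (w y * (\<Sum>b\<in>Basis. of_real (y \<bullet> b) * partial b g y) - g y * (\<Sum>b\<in>Basis. W b y * of_real (y \<bullet> b)))
      = (\<Sum>b\<in>Basis. w y * (partial b ?c y * partial b g y) - W b y * (partial b ?c y * g y))" for y
    proof -
      have "- of_real \<kappa> * (v * (\<Sum>b\<in>Basis. of_real (y \<bullet> b) * P b) - h * (\<Sum>b\<in>Basis. X b * of_real (y \<bullet> b))) =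
        (\<Sum>b\<in>Basis. v * (- of_real (\<kappa> * (y \<bullet> b)) * P b) - X b * (- of_real (\<kappa> * (y \<bullet> b)) * h))" for \<kappa> and v h :: complex and P X
        by (simp add: algebra_simps sum_distrib_left sum.distrib sum_subtractf sum_negf)
      then show ?thesis unfolding partial_cutoff .
    qed
    then have "bd R g (\<lambda>y. \<Sum>b\<in>Basis. of_real (y \<bullet> b) * partial b g y) =
       (\<integral>y. (\<Sum>b\<in>Basis. w y * (partial b ?c y * partial b g y) - W b y * (partial b ?c y * g y)) \<partial>lborel)"
      unfolding bd_def by (simp only:)
    also have "\<dots> = (\<Sum>b\<in>Basis. \<integral>y. w y * (partial b ?c y * partial b g y) - W b y * (partial b ?c y * g y) \<partial>lborel)"
      by (intro Bochner_Integration.integral_sum Bochner_Integration.integrable_diff w_mult W_mult pcpg pcg)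
    also have "\<dots> = (\<Sum>b\<in>Basis. a3 b - a1 b)"
      unfolding a3_def a1_def
      by (intro sum.cong refl Bochner_Integration.integral_diff w_mult W_mult pcpg pcg)
    finally show ?thesis .
  qed
  have "(\<Sum>b\<in>Basis. a2 b) = - (\<Sum>b\<in>Basis. a3 b) - (\<Sum>b\<in>Basis. a4 b)"
    by (subst sum.cong[OF refl 2]) (simp_all only: sum_subtractf sum_negf)
  then have "c2 * (\<integral>y. w y * (?c y * g y) \<partial>lborel) - (\<Sum>b\<in>Basis. a4 b) =
      (\<integral>y. f y * (?c y * g y) \<partial>lborel) + ((\<Sum>b\<in>Basis. a3 b) - (\<Sum>b\<in>Basis. a1 b))"
    unfolding eqn[symmetric] sum.distrib by simp
  then show ?thesis unfolding L B sum_subtractf by (simp only: mult.assoc)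
qed

end

section \<open>The Helmholtz operator on a regularised kernel\<close>

context radial_kernel
begin

lemma smooth_G_rg: "\<epsilon> > 0 \<Longrightarrow> smooth (\<lambda>y. G0 (rg \<epsilon> (y - x)))"
  unfolding rg_def by (rule smooth_G0)

lemma has_derivative_rg:
  assumes "\<epsilon> > 0"
  shows "((\<lambda>y. rg \<epsilon> (y - x)) has_derivative (\<lambda>h. (y - x) \<bullet> h / rg \<epsilon> (y - x))) (at y)"
proof -
  have "(y - x) \<bullet> (y - x) + \<epsilon>\<^sup>2 > 0" using assms by (simp add: add_nonneg_pos)
  then show ?thesis
    unfolding rg_def power2_norm_eq_inner
    by (auto intro!: derivative_eq_intros simp: inner_commute inner_diff_left inner_diff_right field_simps)
qed

lemma partial_G_rg:
  assumes "\<epsilon> > 0"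
  shows "partial b (\<lambda>y. G0 (rg \<epsilon> (y - x))) y = of_real ((y - x) \<bullet> b) * (G1 (rg \<epsilon> (y - x)) / of_real (rg \<epsilon> (y - x)))"
proof -
  have "((\<lambda>y. G0 (rg \<epsilon> (y - x))) has_derivative (\<lambda>h. ((y - x) \<bullet> h / rg \<epsilon> (y - x)) *\<^sub>R G1 (rg \<epsilon> (y - x)))) (at y)"
    using has_derivative_compose[OF has_derivative_rg[OF assms] deriv0[OF rg_pos[OF assms], unfolded has_vector_derivative_def]] .
  from partial_eq[OF this, of b] show ?thesis by (simp add: scaleR_conv_of_real)
qed

lemma partial2_G_rg:
  assumes "\<epsilon> > 0" "b \<in> Basis" and s_def: "s = rg \<epsilon> (y - x)"
  shows "partial b (partial b (\<lambda>y. G0 (rg \<epsilon> (y - x)))) y =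
    G1 s / of_real s + of_real (((y - x) \<bullet> b)\<^sup>2) * (c2 * G0 s / of_real (s\<^sup>2) - 2 * G1 s / of_real (s ^ 3))"
proof -
  have s: "s > 0" using rg_pos[OF assms(1)] by (simp add: s_def)
  have "((\<lambda>r. G1 r / of_real r) has_vector_derivative (c2 * G0 s / of_real s - 2 * G1 s / of_real (s\<^sup>2))) (at s)"
  proof -
    have "((\<lambda>r. complex_of_real (inverse r)) has_vector_derivative complex_of_real (- inverse (s\<^sup>2))) (at s)"
      using s by (intro has_vector_derivative_of_real)
        (auto intro!: derivative_eq_intros simp: has_real_derivative_iff_has_vector_derivative[symmetric] power2_eq_square)
    from has_vector_derivative_mult[OF deriv1[OF s] this]
    have "((\<lambda>r. G1 r * complex_of_real (inverse r)) has_vector_derivative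
       (G1 s * of_real (- inverse (s\<^sup>2)) + (c2 * G0 s - G1 s / of_real s) * of_real (inverse s))) (at s)" .
    moreover have "G1 s * of_real (- inverse (s\<^sup>2)) + (c2 * G0 s - G1 s / of_real s) * of_real (inverse s)
       = c2 * G0 s / of_real s - 2 * G1 s / of_real (s\<^sup>2)"
      using s by (simp add: field_simps power2_eq_square)
    moreover have "(\<lambda>r. G1 r * complex_of_real (inverse r)) = (\<lambda>r. G1 r / complex_of_real r)"
      by (simp add: divide_inverse fun_eq_iff)
    ultimately show ?thesis by (simp only:)
  qed
  from has_derivative_compose[OF has_derivative_rg[OF assms(1)] this[unfolded has_vector_derivative_def s_def]]
  have 1: "((\<lambda>y. G1 (rg \<epsilon> (y - x)) / of_real (rg \<epsilon> (y - x))) has_derivative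
     (\<lambda>h. ((y - x) \<bullet> h / s) *\<^sub>R (c2 * G0 s / of_real s - 2 * G1 s / of_real (s\<^sup>2)))) (at y)"
    by (simp add: s_def)
  have 2: "((\<lambda>y. complex_of_real ((y - x) \<bullet> b)) has_derivative (\<lambda>h. of_real (h \<bullet> b))) (at y)"
    by (auto intro!: derivative_eq_intros)
  have "partial b (partial b (\<lambda>y. G0 (rg \<epsilon> (y - x)))) y =
    of_real ((y - x) \<bullet> b) * (((y - x) \<bullet> b / s) *\<^sub>R (c2 * G0 s / of_real s - 2 * G1 s / of_real (s\<^sup>2))) + of_real (b \<bullet> b) * (G1 s / of_real s)"
    unfolding partial_G_rg[OF assms(1), abs_def]
    using partial_eq[OF has_derivative_mult[OF 2 1], of b] by (simp add: s_def)
  then show ?thesis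
    using s assms(2) by (simp add: scaleR_conv_of_real field_simps power2_eq_square power3_eq_cube)
qed

text \<open>The squares of the coordinates of \<open>y - x\<close> sum to
  \<open>s^2 - \<epsilon>^2\<close>. The part with \<open>s^2\<close> cancels by the radial equation
  in two dimensions, and what remains carries the factor \<open>\<epsilon>^2\<close>.\<close>

lemma laplacian_G_rg:
  assumes "\<epsilon> > 0"
  shows "c2 * G0 (rg \<epsilon> (y - x)) - (\<Sum>b\<in>Basis. partial b (partial b (\<lambda>y. G0 (rg \<epsilon> (y - x)))) y) = \<psi> \<epsilon> (y - x)"
proof -
  define s where "s = rg \<epsilon> (y - x)"
  have s: "s > 0" using rg_pos[OF assms(1)] by (simp add: s_def)
  have n: "(norm (y - x))\<^sup>2 = s\<^sup>2 - \<epsilon>\<^sup>2" by (simp add: s_def rg_def)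
  have "(\<Sum>b\<in>Basis. partial b (partial b (\<lambda>y. G0 (rg \<epsilon> (y - x)))) y) =
     (\<Sum>b\<in>(Basis::(real^2) set). G1 s / of_real s + of_real (((y - x) \<bullet> b)\<^sup>2) * (c2 * G0 s / of_real (s\<^sup>2) - 2 * G1 s / of_real (s ^ 3)))"
    by (intro sum.cong refl) (simp add: partial2_G_rg[OF assms _ s_def])
  also have "\<dots> = 2 * (G1 s / of_real s) + of_real (\<Sum>b\<in>Basis. ((y - x) \<bullet> b)\<^sup>2) * (c2 * G0 s / of_real (s\<^sup>2) - 2 * G1 s / of_real (s ^ 3))"
    by (simp add: sum.distrib sum_distrib_right)
  also have "(\<Sum>b\<in>Basis. ((y - x) \<bullet> b)\<^sup>2) = s\<^sup>2 - \<epsilon>\<^sup>2"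
    unfolding n[symmetric] power2_norm_eq_inner euclidean_inner[of "y - x" "y - x"] by (simp add: power2_eq_square)
  finally have "c2 * G0 s - (\<Sum>b\<in>Basis. partial b (partial b (\<lambda>y. G0 (rg \<epsilon> (y - x)))) y)
     = c2 * G0 s - (2 * (G1 s / of_real s) + of_real (s\<^sup>2 - \<epsilon>\<^sup>2) * (c2 * G0 s / of_real (s\<^sup>2) - 2 * G1 s / of_real (s ^ 3)))"
    by simp
  also have "\<dots> = - 2 * of_real (\<epsilon>\<^sup>2 / s ^ 4) * (of_real s * G1 s) + of_real (\<epsilon>\<^sup>2 / s\<^sup>2) * (c2 * G0 s)"
    using s by (simp add: field_simps eval_nat_numeral)
  finally show ?thesis by (simp add: \<psi>_def s_def)
qed

end

text \<open>For non-integrable \<open>g\<close> the integral is 0 by convention, and the right side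
  is nonnegative because \<open>h\<close> dominates a norm.\<close>

lemma norm_integral_le:
  fixes g :: "'a \<Rightarrow> complex" and h :: "'a \<Rightarrow> real"
  assumes "integrable M h" "AE x in M. norm (g x) \<le> h x"
  shows "norm (integral\<^sup>L M g) \<le> integral\<^sup>L M h"
proof (cases "integrable M g")
  case True
  have "norm (integral\<^sup>L M g) \<le> (\<integral>x. norm (g x) \<partial>M)" by simp
  also have "\<dots> \<le> integral\<^sup>L M h" using True assms by (intro integral_mono_AE) auto
  finally show ?thesis .
next
  case False
  have "AE x in M. 0 \<le> h x" using assms(2) by eventually_elim (use norm_ge_zero order_trans in blast)
  then show ?thesis using False by (simp add: not_integrable_integral_eq integral_nonneg_AE)
qed

lemma integrable_product_lborel:
  fixes a :: "'a::euclidean_space \<Rightarrow> real" and b :: "'b::euclidean_space \<Rightarrow> real" and F :: "'a \<times> 'b \<Rightarrow> complex"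
  assumes a: "integrable lborel a" and b: "integrable lborel b"
    and F: "F \<in> borel_measurable borel" "\<And>x y. norm (F (x, y)) \<le> a x * b y"
  shows "integrable (lborel \<Otimes>\<^sub>M lborel) F"
proof (rule integrableI_bounded)
  have [measurable]: "a \<in> borel_measurable borel" "b \<in> borel_measurable borel" using a b by (auto dest: borel_measurable_integrable)
  show Fm: "F \<in> borel_measurable (lborel \<Otimes>\<^sub>M lborel)" using F(1) by (simp add: lborel_prod)
  have "(\<integral>\<^sup>+z. ennreal (norm (F z)) \<partial>(lborel \<Otimes>\<^sub>M lborel)) = (\<integral>\<^sup>+x. \<integral>\<^sup>+y. ennreal (norm (F (x, y))) \<partial>lborel \<partial>lborel)"
    using Fm by (subst lborel.nn_integral_fst[symmetric]) auto
  also have "\<dots> \<le> (\<integral>\<^sup>+x. \<integral>\<^sup>+y. ennreal (norm (a x)) * ennreal (norm (b y)) \<partial>lborel \<partial>lborel)"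
  proof (intro nn_integral_mono)
    fix x y
    have "norm (F (x, y)) \<le> norm (a x) * norm (b y)" using F(2)[of x y] by (metis abs_ge_self abs_mult order_trans real_norm_def)
    then show "ennreal (norm (F (x, y))) \<le> ennreal (norm (a x)) * ennreal (norm (b y))"
      by (simp add: ennreal_mult[symmetric] ennreal_leI del: real_norm_def)
  qed
  also have "\<dots> = (\<integral>\<^sup>+x. ennreal (norm (a x)) \<partial>lborel) * (\<integral>\<^sup>+y. ennreal (norm (b y)) \<partial>lborel)"
    by (simp add: nn_integral_cmult nn_integral_multc)
  also have "\<dots> < \<infinity>"
    using a b unfolding integrable_iff_bounded by (simp add: ennreal_mult_less_top)
  finally show "(\<integral>\<^sup>+z. ennreal (norm (F z)) \<partial>(lborel \<Otimes>\<^sub>M lborel)) < \<infinity>" .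
qed

locale helmholtz_kernel = weak_helmholtz w W f c2 + radial_kernel G0 G1 c2 A
  for w :: "real^2 \<Rightarrow> complex" and W f c2 G0 G1 A
begin

lemma kernel_identity:
  assumes "R > 0" "\<epsilon> > 0"
  shows "(\<integral>y. w y * cutoff R y * \<psi> \<epsilon> (y - x) \<partial>lborel) =
    (\<integral>y. f y * cutoff R y * G0 (rg \<epsilon> (y - x)) \<partial>lborel) +
    bd R (\<lambda>y. G0 (rg \<epsilon> (y - x))) (\<lambda>y. of_real (y \<bullet> (y - x)) * (G1 (rg \<epsilon> (y - x)) / of_real (rg \<epsilon> (y - x))))"
proof -
  have "(\<Sum>b\<in>Basis. of_real (y \<bullet> b) * partial b (\<lambda>y. G0 (rg \<epsilon> (y - x))) y) =
     of_real (y \<bullet> (y - x)) * (G1 (rg \<epsilon> (y - x)) / of_real (rg \<epsilon> (y - x)))" for y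
    unfolding partial_G_rg[OF assms(2)] euclidean_inner[of y "y - x"]
    by (simp add: sum_distrib_right sum_divide_distrib mult.assoc)
  then show ?thesis
    using cutoff_identity[OF assms(1) smooth_G_rg[OF assms(2), of x]] unfolding laplacian_G_rg[OF assms(2)] by simp
qed

text \<open>The identity for the regularised kernel is integrated against a continuous
  \<open>\<theta>\<close> in \<open>x\<close>. Fubini puts the approximate identity on
  \<open>\<theta>\<close>, whose continuity gives the limit as \<open>\<epsilon>\<close> tends to 0;
  the annulus term is made small first, uniformly in \<open>x\<close> and \<open>\<epsilon>\<close>.
  Duality returns to almost every \<open>x\<close>.\<close>

lemma pointwise_representation:
  assumes \<rho>: "\<rho> > 0" and supp: "\<And>x. x \<notin> ball 0 \<rho> \<Longrightarrow> f x = 0" and \<epsilon>0: "0 < \<epsilon>0" "\<epsilon>0 \<le> 1"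
    and bdlim: "\<And>e. e > 0 \<Longrightarrow> \<exists>R\<ge>\<rho>. \<forall>x\<in>ball 0 \<rho>. \<forall>\<epsilon>\<in>{0<..\<epsilon>0}.
      norm (bd R (\<lambda>y. G0 (rg \<epsilon> (y - x))) (\<lambda>y. of_real (y \<bullet> (y - x)) * (G1 (rg \<epsilon> (y - x)) / of_real (rg \<epsilon> (y - x))))) \<le> e"
    and k_m [measurable]: "k \<in> borel_measurable borel" and k0: "\<And>r. k r \<ge> 0"
    and kS: "\<And>x::real^2. (\<integral>\<^sup>+y. indicator (ball 0 \<rho>) y * ennreal (k (norm (y - x))) \<partial>lborel) \<le> ennreal S"
    and Gk: "\<And>r \<epsilon>. 0 < r \<Longrightarrow> r < 2 * \<rho> \<Longrightarrow> 0 < \<epsilon> \<Longrightarrow> \<epsilon> \<le> \<epsilon>0 \<Longrightarrow> norm (G0 (sqrt (r\<^sup>2 + \<epsilon>\<^sup>2))) \<le> k r"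
  shows "AE x in lebesgue. x \<in> ball 0 \<rho> \<longrightarrow> 2 * pi * norm (w x) \<le> (\<integral>y. norm (f y) * k (norm (y - x)) \<partial>lborel)"
proof -
  let ?B = "ball (0::real^2) \<rho>"
  have [measurable]: "?B \<in> sets borel" by simp
  define Kf where "Kf = (\<lambda>x. \<integral>y. norm (f y) * k (norm (y - x)) \<partial>lborel)"
  have Kf_m [measurable]: "Kf \<in> borel_measurable borel" unfolding Kf_def by measurable
  have Kf0: "Kf x \<ge> 0" for x unfolding Kf_def using k0 by (intro Bochner_Integration.integral_nonneg) auto
  \<comment> \<open>Joint integrability over ball times plane shows that the right-hand side is
    finite almost everywhere and integrable over the ball, as duality demands.\<close>
  define F where "F = (\<lambda>(x, y). indicator ?B x * (norm (f y) * k (norm (y - x))))"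
  have F_m [measurable]: "F \<in> borel_measurable (lborel \<Otimes>\<^sub>M lborel)"
  proof -
    have "F \<in> borel_measurable (borel \<Otimes>\<^sub>M borel)" unfolding F_def split_beta' by measurable
    then show ?thesis
      by (simp only: measurable_cong_sets[OF sets_pair_measure_cong[OF sets_lborel sets_lborel] refl])
  qed
  have F_int: "integrable (lborel \<Otimes>\<^sub>M lborel) F"
  proof (rule integrableI_bounded[OF F_m])
    have "(\<integral>\<^sup>+z. ennreal (norm (F z)) \<partial>(lborel \<Otimes>\<^sub>M lborel)) = (\<integral>\<^sup>+y. \<integral>\<^sup>+x. ennreal (norm (F (x, y))) \<partial>lborel \<partial>lborel)"
      by (subst lborel_pair.nn_integral_snd[symmetric]) auto
    also have "\<dots> = (\<integral>\<^sup>+y. \<integral>\<^sup>+x. ennreal (norm (f y)) * (indicator ?B x * ennreal (k (norm (x - y)))) \<partial>lborel \<partial>lborel)"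
      by (intro nn_integral_cong) (auto simp: F_def indicator_def k0 ennreal_mult' norm_minus_commute abs_mult)
    also have "\<dots> = (\<integral>\<^sup>+y. ennreal (norm (f y)) * (\<integral>\<^sup>+x. indicator ?B x * ennreal (k (norm (x - y))) \<partial>lborel) \<partial>lborel)"
      by (intro nn_integral_cong nn_integral_cmult) measurable
    also have "\<dots> \<le> (\<integral>\<^sup>+y. ennreal (norm (f y)) * ennreal S \<partial>lborel)"
      by (intro nn_integral_mono mult_left_mono kS) auto
    also have "\<dots> = (\<integral>\<^sup>+y. ennreal (norm (f y)) \<partial>lborel) * ennreal S"
      by (intro nn_integral_multc) measurable
    also have "\<dots> < \<infinity>" using f_int unfolding integrable_iff_bounded by (simp add: ennreal_mult_less_top)
    finally show "(\<integral>\<^sup>+z. ennreal (norm (F z)) \<partial>(lborel \<Otimes>\<^sub>M lborel)) < \<infinity>" .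
  qed
  have AE_F: "AE x in lborel. x \<in> ?B \<longrightarrow> integrable lborel (\<lambda>y. norm (f y) * k (norm (y - x)))"
    using lborel_pair.AE_integrable_fst'[OF F_int]
    by eventually_elim (auto simp: F_def)
  have Kf_int: "integrable lborel (\<lambda>x. indicator ?B x * Kf x)"
    using lborel_pair.integrable_fst'[OF F_int] by (simp add: F_def Kf_def)
  have dual: "norm (\<integral>x. 2 * pi * w x * \<theta> x \<partial>lborel) \<le> (\<integral>x. norm (\<theta> x) * Kf x \<partial>lborel)"
    if \<theta>: "continuous_on UNIV \<theta>" "\<And>x. norm (\<theta> x) \<le> 1" "\<And>x. x \<notin> ?B \<Longrightarrow> \<theta> x = 0" for \<theta>
  proof (rule field_le_epsilon)
    fix e :: real assume e: "e > 0"
    have \<theta>_m [measurable]: "\<theta> \<in> borel_measurable borel" by (rule borel_measurable_continuous_onI[OF \<theta>(1)])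
    define m where "m = measure lborel ?B"
    have m0: "m \<ge> 0" by (simp add: m_def)
    \<comment> \<open>The annulus term is integrated over the ball of area \<open>m\<close>; this
      share keeps the total below \<open>e\<close>.\<close>
    define e' where "e' = e / (m + 1)"
    have e': "e' > 0" "e' * m \<le> e" using e m0 by (auto simp: e'_def field_simps)
    obtain R where R: "R \<ge> \<rho>" and bdR: "\<And>x \<epsilon>. x \<in> ?B \<Longrightarrow> 0 < \<epsilon> \<Longrightarrow> \<epsilon> \<le> \<epsilon>0 \<Longrightarrow>
      norm (bd R (\<lambda>y. G0 (rg \<epsilon> (y - x))) (\<lambda>y. of_real (y \<bullet> (y - x)) * (G1 (rg \<epsilon> (y - x)) / of_real (rg \<epsilon> (y - x))))) \<le> e'"
      using bdlim[OF e'(1)] by auto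
    have R0: "R > 0" using R \<rho> by simp
    define \<epsilon> where "\<epsilon> n = \<epsilon>0 * inverse (real (Suc n))" for n
    have \<epsilon>: "0 < \<epsilon> n" "\<epsilon> n \<le> \<epsilon>0" "\<epsilon> n \<le> 1" for n
    proof -
      show "0 < \<epsilon> n" using \<epsilon>0 by (simp add: \<epsilon>_def)
      have "inverse (real (Suc n)) \<le> 1" by (simp add: field_simps)
      then show "\<epsilon> n \<le> \<epsilon>0" using \<epsilon>0 by (simp add: \<epsilon>_def mult_left_le)
      then show "\<epsilon> n \<le> 1" using \<epsilon>0 by simp
    qed
    have \<epsilon>lim: "\<epsilon> \<longlonglongrightarrow> 0" unfolding \<epsilon>_def using tendsto_mult_right_zero[OF LIMSEQ_inverse_real_of_nat] .
    let ?c = "cutoff R :: real^2 \<Rightarrow> complex"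
    have c_m [measurable]: "?c \<in> borel_measurable borel"
      by (rule borel_measurable_continuous_onI[OF smooth_continuous[OF smooth_cutoff]])
    have wc_int: "integrable lborel (\<lambda>y. w y * ?c y)" by (rule w_mult[OF cutoff_test[OF R0]])
    have \<psi>_m [measurable]: "\<psi> (\<epsilon> n) \<in> borel_measurable borel" for n
      by (rule borel_measurable_continuous_onI[OF \<psi>_cont[OF \<epsilon>(1)]])
    have indB: "integrable lborel (indicator ?B :: real^2 \<Rightarrow> real)"
      using emeasure_bounded_finite[OF bounded_ball, of "0::real^2" \<rho>] by simp
    \<comment> \<open>The left side of the kernel identity smeared with \<open>\<theta>\<close>. It
      is bounded through the right side of that identity and, after exchanging the integrals,
      evaluated in the limit.\<close>
    define J where "J n = (\<integral>x. \<theta> x * (\<integral>y. w y * ?c y * \<psi> (\<epsilon> n) (y - x) \<partial>lborel) \<partial>lborel)" for n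
    have Ja: "norm (J n) \<le> (\<integral>x. norm (\<theta> x) * Kf x \<partial>lborel) + e" for n
    proof -
      have i1: "integrable lborel (\<lambda>x. norm (\<theta> x) * Kf x)"
      proof (rule Bochner_Integration.integrable_bound[OF Kf_int])
        show "AE x in lborel. norm (norm (\<theta> x) * Kf x) \<le> norm (indicator ?B x * Kf x)"
          using \<theta>(2,3) Kf0 by (intro AE_I2) (auto simp: abs_mult indicator_def mult_left_le_one_le)
      qed measurable
      have i2: "integrable lborel (\<lambda>x. e' * indicator ?B x)" using indB by simp
      have "norm (J n) \<le> (\<integral>x. norm (\<theta> x) * Kf x + e' * indicator ?B x \<partial>lborel)"
        unfolding J_def
      proof (rule norm_integral_le)
        show "AE x in lborel. norm (\<theta> x * (\<integral>y. w y * ?c y * \<psi> (\<epsilon> n) (y - x) \<partial>lborel)) \<le> norm (\<theta> x) * Kf x + e' * indicator ?B x"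
          using AE_F
        proof eventually_elim
          case (elim x)
          show ?case
          proof (cases "x \<in> ?B")
            case True
            have "norm (\<integral>y. f y * ?c y * G0 (rg (\<epsilon> n) (y - x)) \<partial>lborel) \<le> Kf x"
              unfolding Kf_def
            proof (rule norm_integral_le)
              show "integrable lborel (\<lambda>y. norm (f y) * k (norm (y - x)))" using elim True by blast
              show "AE y in lborel. norm (f y * ?c y * G0 (rg (\<epsilon> n) (y - x))) \<le> norm (f y) * k (norm (y - x))"
                using AE_lborel_singleton[of x]
              proof eventually_elim
                case (elim y)
                show ?case
                proof (cases "y \<in> ?B")
                  case yB: True
                  have "norm (y - x) < 2 * \<rho>" using yB True norm_triangle_ineq4[of y x] by simp
                  then have "norm (G0 (rg (\<epsilon> n) (y - x))) \<le> k (norm (y - x))"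
                    unfolding rg_def using elim \<epsilon> by (intro Gk) auto
                  then have "norm (?c y) * norm (G0 (rg (\<epsilon> n) (y - x))) \<le> 1 * k (norm (y - x))"
                    by (intro mult_mono norm_cutoff) auto
                  then show ?thesis by (simp add: norm_mult mult.assoc mult_left_mono)
                qed (simp add: supp)
              qed
            qed
            moreover have "norm (\<integral>y. w y * ?c y * \<psi> (\<epsilon> n) (y - x) \<partial>lborel) \<le>
               norm (\<integral>y. f y * ?c y * G0 (rg (\<epsilon> n) (y - x)) \<partial>lborel) + e'"
              unfolding kernel_identity[OF R0 \<epsilon>(1)]
              by (rule order_trans[OF norm_triangle_ineq add_left_mono[OF bdR[OF True \<epsilon>(1,2)]]])
            ultimately have "norm (\<integral>y. w y * ?c y * \<psi> (\<epsilon> n) (y - x) \<partial>lborel) \<le> Kf x + e'" by linarith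
            then have "norm (\<theta> x) * norm (\<integral>y. w y * ?c y * \<psi> (\<epsilon> n) (y - x) \<partial>lborel) \<le> norm (\<theta> x) * (Kf x + e')"
              by (intro mult_left_mono) auto
            also have "\<dots> \<le> norm (\<theta> x) * Kf x + e'"
              using \<theta>(2)[of x] e' by (simp add: distrib_left mult_left_le_one_le)
            finally show ?thesis using True by (simp add: norm_mult)
          qed (simp add: \<theta>(3))
        qed
      qed (use i1 i2 in auto)
      also have "\<dots> = (\<integral>x. norm (\<theta> x) * Kf x \<partial>lborel) + e' * m"
        using i1 i2 by (simp add: m_def)
      finally show ?thesis using e'(2) by linarith
    qed
    have J_eq: "J n = (\<integral>y. w y * ?c y * (\<integral>z. \<theta> (y + z) * \<psi> (\<epsilon> n) z \<partial>lborel) \<partial>lborel)" for n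
    proof -
      \<comment> \<open>Fubini needs an integrable majorant: \<open>y - x\<close> stays in a compact
        ball, on which the continuous \<open>\<psi>\<close> is bounded.\<close>
      have "continuous_on (cball 0 (2 * R + \<rho>)) (\<psi> (\<epsilon> n))" by (rule continuous_on_subset[OF \<psi>_cont[OF \<epsilon>(1)]]) simp
      then have "compact (\<psi> (\<epsilon> n) ` cball 0 (2 * R + \<rho>))" by (rule compact_continuous_image) simp
      then obtain B where B: "\<forall>z\<in>\<psi> (\<epsilon> n) ` cball 0 (2 * R + \<rho>). norm z \<le> B" using compact_imp_bounded bounded_iff by metis
      have int: "integrable (lborel \<Otimes>\<^sub>M lborel) (\<lambda>(x, y). \<theta> x * (w y * ?c y * \<psi> (\<epsilon> n) (y - x)))"
      proof (rule integrable_product_lborel)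
        show "integrable lborel (indicator ?B :: real^2 \<Rightarrow> real)" by (rule indB)
        show "integrable lborel (\<lambda>y. norm (w y * ?c y) * \<bar>B\<bar>)" using wc_int by (intro integrable_mult_left integrable_norm)
        have "(\<lambda>(x, y). \<theta> x * (w y * ?c y * \<psi> (\<epsilon> n) (y - x))) \<in> borel_measurable (borel \<Otimes>\<^sub>M borel)" by measurable
        then show "(\<lambda>(x, y). \<theta> x * (w y * ?c y * \<psi> (\<epsilon> n) (y - x))) \<in> borel_measurable borel" by (simp add: borel_prod)
        show "norm (case (x, y) of (x, y) \<Rightarrow> \<theta> x * (w y * ?c y * \<psi> (\<epsilon> n) (y - x))) \<le> indicator ?B x * (norm (w y * ?c y) * \<bar>B\<bar>)" for x y
        proof (cases "x \<in> ?B \<and> norm y < 2 * R")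
          case True
          then have "y - x \<in> cball 0 (2 * R + \<rho>)" using norm_triangle_ineq4[of y x] by auto
          then have "norm (\<psi> (\<epsilon> n) (y - x)) \<le> B" using B by blast
          then have "norm (\<psi> (\<epsilon> n) (y - x)) \<le> \<bar>B\<bar>" by linarith
          then have "norm (\<theta> x) * (norm (w y * ?c y) * norm (\<psi> (\<epsilon> n) (y - x))) \<le> 1 * (norm (w y * ?c y) * \<bar>B\<bar>)"
            by (intro mult_mono \<theta>(2) mult_left_mono) auto
          then show ?thesis using True by (simp add: norm_mult)
        next
          case False
          then show ?thesis using \<theta>(3)[of x] cutoff_eq_0[OF R0, of y] by auto
        qed
      qed
      have "J n = (\<integral>x. \<integral>y. \<theta> x * (w y * ?c y * \<psi> (\<epsilon> n) (y - x)) \<partial>lborel \<partial>lborel)" by (simp add: J_def)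
      also have "\<dots> = (\<integral>y. \<integral>x. \<theta> x * (w y * ?c y * \<psi> (\<epsilon> n) (y - x)) \<partial>lborel \<partial>lborel)"
        by (rule lborel_pair.Fubini_integral[symmetric]) (use int in simp)
      also have "\<dots> = (\<integral>y. w y * ?c y * (\<integral>z. \<theta> (y + z) * \<psi> (\<epsilon> n) z \<partial>lborel) \<partial>lborel)"
      proof (rule Bochner_Integration.integral_cong[OF refl])
        fix y
        have "(\<integral>x. \<theta> x * (w y * ?c y * \<psi> (\<epsilon> n) (y - x)) \<partial>lborel) = w y * ?c y * (\<integral>x. \<theta> x * \<psi> (\<epsilon> n) (y - x) \<partial>lborel)"
        proof -
          have "(\<lambda>x. \<theta> x * (w y * ?c y * \<psi> (\<epsilon> n) (y - x))) = (\<lambda>x. w y * ?c y * (\<theta> x * \<psi> (\<epsilon> n) (y - x)))"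
            by (simp add: fun_eq_iff ac_simps)
          then show ?thesis by (simp only: integral_mult_right_zero)
        qed
        also have "(\<integral>x. \<theta> x * \<psi> (\<epsilon> n) (y - x) \<partial>lborel) = (\<integral>z. \<theta> (y + z) * \<psi> (\<epsilon> n) (y - (y + z)) \<partial>lborel)"
          by (rule integral_translation[symmetric]) measurable
        \<comment> \<open>\<open>\<psi>\<close> is even, as it depends on the norm only.\<close>
        also have "\<dots> = (\<integral>z. \<theta> (y + z) * \<psi> (\<epsilon> n) z \<partial>lborel)" by (simp add: \<psi>_def rg_def)
        finally show "(\<integral>x. \<theta> x * (w y * ?c y * \<psi> (\<epsilon> n) (y - x)) \<partial>lborel) = w y * ?c y * (\<integral>z. \<theta> (y + z) * \<psi> (\<epsilon> n) z \<partial>lborel)" .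
      qed
      finally show ?thesis .
    qed
    define C where "C = (\<integral>q. 5 * A * ((norm (q::real^2))\<^sup>2 + 1) powr (-5/4) \<partial>lborel)"
    have "(\<lambda>n. \<integral>y. w y * ?c y * (\<integral>z. \<theta> (y + z) * \<psi> (\<epsilon> n) z \<partial>lborel) \<partial>lborel) \<longlonglongrightarrow> (\<integral>y. w y * ?c y * (2 * pi * \<theta> y) \<partial>lborel)"
    proof (rule integral_dominated_convergence)
      show "integrable lborel (\<lambda>y. norm (w y * ?c y) * C)" using wc_int by (intro integrable_mult_left integrable_norm)
      show "AE y in lborel. (\<lambda>n. w y * ?c y * (\<integral>z. \<theta> (y + z) * \<psi> (\<epsilon> n) z \<partial>lborel)) \<longlonglongrightarrow> w y * ?c y * (2 * pi * \<theta> y)"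
        by (intro AE_I2 tendsto_intros approx_identity(1)[OF \<theta>(1,2) \<epsilon>(1,3) \<epsilon>lim])
      show "AE y in lborel. norm (w y * ?c y * (\<integral>z. \<theta> (y + z) * \<psi> (\<epsilon> n) z \<partial>lborel)) \<le> norm (w y * ?c y) * C" for n
        unfolding norm_mult[of "w _ * _"] C_def
        by (intro AE_I2 mult_left_mono approx_identity(2)[OF \<theta>(1,2) \<epsilon>(1,3) \<epsilon>lim]) auto
    qed measurable
    \<comment> \<open>The cut-off is 1 where \<open>\<theta>\<close> is nonzero because
      \<open>R \<ge> \<rho>\<close>.\<close>
    moreover have "w y * ?c y * (2 * pi * \<theta> y) = 2 * pi * w y * \<theta> y" for y
      using \<theta>(3)[of y] cutoff_eq_1[OF R0, of y] R by (cases "y \<in> ?B") auto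
    ultimately have "(\<lambda>n. norm (J n)) \<longlonglongrightarrow> norm (\<integral>y. 2 * pi * w y * \<theta> y \<partial>lborel)"
      unfolding J_eq by (simp only:) (rule tendsto_norm)
    then show "norm (\<integral>x. 2 * pi * w x * \<theta> x \<partial>lborel) \<le> (\<integral>x. norm (\<theta> x) * Kf x \<partial>lborel) + e"
      by (rule LIMSEQ_le_const2) (use Ja in blast)
  qed
  have "AE x in lebesgue. x \<in> ?B \<longrightarrow> norm (2 * pi * w x) \<le> Kf x"
  proof (rule pointwise_bound_from_duality[OF Kf0])
    have "integrable lborel (\<lambda>x. indicator (cball 0 \<rho>) x *\<^sub>R w x)" by (rule w_loc)
    then have "integrable lborel (\<lambda>x. indicator ?B x *\<^sub>R (indicator (cball 0 \<rho>) x *\<^sub>R w x))"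
      by (rule integrable_mult_indicator[rotated]) simp
    moreover have "indicator ?B x *\<^sub>R (indicator (cball 0 \<rho>) x *\<^sub>R w x) = indicator ?B x *\<^sub>R w x" for x
      by (auto simp: indicator_def)
    ultimately have "integrable lborel (\<lambda>x. indicator ?B x *\<^sub>R w x)" by (simp only:)
    then have "integrable lborel (\<lambda>x. (2 * pi) * (indicator ?B x *\<^sub>R w x))" by (rule integrable_mult_right)
    moreover have "(2 * pi) * (indicator ?B x *\<^sub>R w x) = indicator ?B x *\<^sub>R (2 * pi * w x)" for x by simp
    ultimately have "integrable lborel (\<lambda>x. indicator ?B x *\<^sub>R (2 * pi * w x))" by (simp only:)
    then show "integrable lebesgue (\<lambda>x. indicator ?B x *\<^sub>R (2 * pi * w x))"
      by (subst integrable_completion) measurable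
    show "integrable lebesgue (\<lambda>x. indicator ?B x *\<^sub>R Kf x)"
      using Kf_int by (subst integrable_completion) auto
  next
    fix \<theta> :: "real^2 \<Rightarrow> complex"
    assume \<theta>: "continuous_on UNIV \<theta>" "\<And>x. norm (\<theta> x) \<le> 1" "\<And>x. x \<notin> ?B \<Longrightarrow> \<theta> x = 0"
    have [measurable]: "\<theta> \<in> borel_measurable borel" by (rule borel_measurable_continuous_onI[OF \<theta>(1)])
    have "(\<integral>x. 2 * pi * w x * \<theta> x \<partial>lebesgue) = (\<integral>x. 2 * pi * w x * \<theta> x \<partial>lborel)"
      by (rule integral_completion) measurable
    moreover have "(\<integral>x. norm (\<theta> x) * Kf x \<partial>lebesgue) = (\<integral>x. norm (\<theta> x) * Kf x \<partial>lborel)"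
      by (rule integral_completion) measurable
    ultimately show "norm (\<integral>x. 2 * pi * w x * \<theta> x \<partial>lebesgue) \<le> (\<integral>x. norm (\<theta> x) * Kf x \<partial>lebesgue)"
      using dual[OF \<theta>] by simp
  qed
  then show ?thesis by eventually_elim (simp add: Kf_def norm_mult)
qed

end

section \<open>Decay of the annulus terms at infinity\<close>

lemma integrable_indicator_cball:
  "integrable lborel (indicator (cball (x::'a::euclidean_space) r) :: 'a \<Rightarrow> real)"
  using emeasure_bounded_finite[OF bounded_cball, of x r] by simp

lemma measure_cball_2: "r \<ge> 0 \<Longrightarrow> measure lborel (cball (x::real^2) r) = pi * r\<^sup>2"
  by (simp add: measure_def emeasure_cball_2)

context weak_helmholtz
begin

text \<open>Young's inequality is used with the weight \<open>t\<close>, which is fixed before \<open>R\<close>.\<close>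

lemma bd_square_integrable:
  assumes w2: "integrable lborel (\<lambda>y. (norm (w y))\<^sup>2)"
    and W2: "\<And>b. b \<in> Basis \<Longrightarrow> integrable lborel (\<lambda>y. (norm (W b y))\<^sup>2)"
    and e: "e > 0" and B: "B > 0"
  obtains R0 where "R0 > 0" "\<And>R g0 g1. R \<ge> R0 \<Longrightarrow>
      (\<And>y. R \<le> norm y \<Longrightarrow> norm y \<le> 2 * R \<Longrightarrow> norm (g0 y) \<le> B \<and> norm (g1 y) \<le> B * norm y) \<Longrightarrow> norm (bd R g0 g1) \<le> e"
proof -
  obtain L where L: "L > 0" "\<And>t. \<bar>deriv step t\<bar> \<le> L" using deriv_step_bound by blast
  define P where "P y = (norm (w y))\<^sup>2 + (\<Sum>b\<in>Basis. (norm (W b y))\<^sup>2)" for y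
  have P_int: "integrable lborel P" unfolding P_def
    using w2 W2 by (intro Bochner_Integration.integrable_add Bochner_Integration.integrable_sum) auto
  have P0: "P y \<ge> 0" for y unfolding P_def by (intro add_nonneg_nonneg sum_nonneg) auto
  \<comment> \<open>Chosen so that the part of the estimate that does not decay,
    \<open>48 * pi * L * B * t\<close>, equals \<open>e / 2\<close>.\<close>
  define t where "t = e / (96 * pi * L * B)"
  have t: "t > 0" using e L B by (simp add: t_def)
  \<comment> \<open>The energy outside radius \<open>R\<close>. It tends to 0 and is divided by the
    fixed \<open>t\<close>, so a large \<open>R\<close> makes the other half small.\<close>
  define T where "T R = (\<integral>y. indicator (- ball 0 R) y * P y \<partial>lborel)" for R
  have T_int: "integrable lborel (\<lambda>y. indicator (- ball 0 R) y * P y)" for R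
    using integrable_mult_indicator[OF _ P_int, of "- ball 0 R"] by simp
  have "(\<lambda>n. T (real n)) \<longlonglongrightarrow> (\<integral>y. 0 \<partial>(lborel::(real^2) measure))"
    unfolding T_def
  proof (rule integral_dominated_convergence[OF _ _ P_int])
    show "AE y in lborel. (\<lambda>n. indicator (- ball 0 (real n)) y * P y) \<longlonglongrightarrow> 0"
    proof (rule AE_I2)
      fix y :: "real^2"
      have "\<forall>\<^sub>F n in sequentially. norm y + 1 \<le> real n"
        using filterlim_at_top[THEN iffD1, OF filterlim_real_sequentially] by blast
      then have "\<forall>\<^sub>F n in sequentially. 0 = indicator (- ball 0 (real n)) y * P y"
        by eventually_elim auto
      then show "(\<lambda>n. indicator (- ball 0 (real n)) y * P y) \<longlonglongrightarrow> 0"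
        by (rule Lim_transform_eventually[OF tendsto_const])
    qed
    show "AE y in lborel. norm (indicator (- ball 0 (real n)) y * P y) \<le> P y" for n
      by (intro AE_I2) (auto simp: indicator_def P0)
  qed (use T_int P_int in \<open>auto dest: borel_measurable_integrable\<close>)
  moreover have "e * t / (2 * L * B) > 0" using e t L B by simp
  ultimately have "\<forall>\<^sub>F n in sequentially. T (real n) < e * t / (2 * L * B)"
    by (intro order_tendstoD(2)) auto
  then obtain n where n: "n \<ge> 1" "T (real n) < e * t / (2 * L * B)"
    unfolding eventually_sequentially by (metis le_add1 le_add2 nat_le_linear)
  have T_mono: "T R \<le> T (real n)" if "R \<ge> real n" for R
    unfolding T_def
    by (rule integral_mono[OF T_int T_int]) (use that P0 in \<open>auto simp: indicator_def\<close>)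
  \<comment> \<open>The area of the annulus is of order \<open>R^2\<close>, so
    \<open>t / R^2\<close> integrates to a multiple of \<open>t\<close> whatever \<open>R\<close>
    is; the smallness of this part must come from \<open>t\<close>.\<close>
  have young: "a / R \<le> t / R\<^sup>2 + a\<^sup>2 / (4 * t)" if "R > 0" for a R :: real
  proof -
    have "0 \<le> (2 * t / R - a)\<^sup>2 / (4 * t)" using t by simp
    also have "\<dots> = t / R\<^sup>2 - a / R + a\<^sup>2 / (4 * t)"
      using t that by (simp add: power2_diff power_divide field_simps) (simp add: eval_nat_numeral algebra_simps)
    finally show ?thesis by simp
  qed
  show ?thesis
  proof (rule that[of "real n"])
    show "real n > 0" using n by simp
    fix R and g0 g1 :: "real^2 \<Rightarrow> complex"
    assume R: "R \<ge> real n" and g: "\<And>y. R \<le> norm y \<Longrightarrow> norm y \<le> 2 * R \<Longrightarrow> norm (g0 y) \<le> B \<and> norm (g1 y) \<le> B * norm y"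
    have R0: "R > 0" using R n by simp
    \<comment> \<open>The coefficient 3 counts \<open>w\<close> and its two derivatives, each
      contributing \<open>t / R^2\<close>.\<close>
    define hb where "hb y = 4 * L * B * (3 * t / R\<^sup>2 * indicator (cball 0 (2 * R)) y + indicator (- ball 0 R) y * P y / (4 * t))" for y :: "real^2"
    have hb_int: "integrable lborel hb" unfolding hb_def
      by (intro integrable_mult_right Bochner_Integration.integrable_add integrable_divide_zero T_int integrable_indicator_cball)
    have "norm (bd R g0 g1) \<le> integral\<^sup>L lborel hb"
      unfolding bd_def
    proof (rule norm_integral_le[OF hb_int], rule AE_I2)
      fix y :: "real^2"
      define d where "d = deriv step ((norm y)\<^sup>2 / R\<^sup>2)"
      show "norm (- complex_of_real (d * (2 / R\<^sup>2)) * (w y * g1 y - g0 y * (\<Sum>b\<in>Basis. W b y * of_real (y \<bullet> b)))) \<le> hb y"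
      proof (cases "1 \<le> (norm y)\<^sup>2 / R\<^sup>2 \<and> (norm y)\<^sup>2 / R\<^sup>2 \<le> 2")
        case False
        then have "d = 0" unfolding d_def by (rule deriv_step_eq_0)
        moreover have "hb y \<ge> 0" unfolding hb_def using L B t P0 by (intro mult_nonneg_nonneg add_nonneg_nonneg) auto
        ultimately show ?thesis by simp
      next
        case True
        have "R\<^sup>2 \<le> (norm y)\<^sup>2" using True R0 by (simp add: le_divide_eq)
          then have y1: "R \<le> norm y" by (rule power2_le_imp_le) simp
        have "(norm y)\<^sup>2 \<le> 2 * R\<^sup>2" using True R0 by (simp add: divide_le_eq)
        also have "\<dots> \<le> (2 * R)\<^sup>2" by (simp add: power_mult_distrib)
        finally have "(norm y)\<^sup>2 \<le> (2 * R)\<^sup>2" .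
          then have y2: "norm y \<le> 2 * R" by (rule power2_le_imp_le) (use R0 in simp)
        have "norm (w y * g1 y - g0 y * (\<Sum>b\<in>Basis. W b y * of_real (y \<bullet> b))) \<le>
          norm (w y) * norm (g1 y) + norm (g0 y) * norm (\<Sum>b\<in>Basis. W b y * of_real (y \<bullet> b))"
          by (rule order_trans[OF norm_triangle_ineq4]) (simp add: norm_mult)
        also have "\<dots> \<le> norm (w y) * (B * norm y) + B * (\<Sum>b\<in>Basis. norm (W b y) * norm y)"
        proof (intro add_mono mult_mono)
          show "norm (\<Sum>b\<in>Basis. W b y * of_real (y \<bullet> b)) \<le> (\<Sum>b\<in>Basis. norm (W b y) * norm y)"
            by (intro sum_norm_le) (auto simp: norm_mult Basis_le_norm intro!: mult_left_mono)
        qed (use g[OF y1 y2] B in auto)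
        also have "\<dots> = B * norm y * (norm (w y) + (\<Sum>b\<in>Basis. norm (W b y)))"
          by (simp only: sum_distrib_right[symmetric]) (simp add: algebra_simps)
        also have "\<dots> \<le> B * (2 * R) * (norm (w y) + (\<Sum>b\<in>Basis. norm (W b y)))"
          using B y2 by (intro mult_right_mono mult_left_mono add_nonneg_nonneg sum_nonneg) auto
        finally have 1: "norm (w y * g1 y - g0 y * (\<Sum>b\<in>Basis. W b y * of_real (y \<bullet> b))) \<le> B * (2 * R) * (norm (w y) + (\<Sum>b\<in>Basis. norm (W b y)))" .
        have "norm (- complex_of_real (d * (2 / R\<^sup>2)) * (w y * g1 y - g0 y * (\<Sum>b\<in>Basis. W b y * of_real (y \<bullet> b)))) =
           \<bar>d\<bar> * (2 / R\<^sup>2) * norm (w y * g1 y - g0 y * (\<Sum>b\<in>Basis. W b y * of_real (y \<bullet> b)))"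
          unfolding norm_mult norm_minus_cancel norm_of_real abs_mult by simp
        also have "\<dots> \<le> L * (2 / R\<^sup>2) * (B * (2 * R) * (norm (w y) + (\<Sum>b\<in>Basis. norm (W b y))))"
          unfolding d_def by (intro mult_mono 1 L(2)) (use L in auto)
        also have "\<dots> = 4 * L * B * (norm (w y) / R + (\<Sum>b\<in>Basis. norm (W b y) / R))"
          using R0 by (simp add: power2_eq_square sum_divide_distrib[symmetric] field_simps)
        also have "\<dots> \<le> 4 * L * B * ((t / R\<^sup>2 + (norm (w y))\<^sup>2 / (4 * t)) + (\<Sum>b\<in>(Basis::(real^2) set). t / R\<^sup>2 + (norm (W b y))\<^sup>2 / (4 * t)))"
          using L B by (intro mult_left_mono add_mono sum_mono young R0) auto
        also have "\<dots> = 4 * L * B * (3 * t / R\<^sup>2 + P y / (4 * t))"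
          by (simp add: P_def sum.distrib sum_divide_distrib[symmetric] add_divide_distrib)
        also have "\<dots> = hb y" using y1 y2 by (simp add: hb_def)
        finally show ?thesis .
      qed
    qed
    also have "integral\<^sup>L lborel hb = 4 * L * B * (3 * t / R\<^sup>2 * (pi * (2 * R)\<^sup>2) + T R / (4 * t))"
      unfolding hb_def T_def using R0 T_int[of R] integrable_indicator_cball[of "0::real^2" "2 * R"] measure_cball_2[of "2 * R" 0]
      by (subst integral_mult_right_zero, subst Bochner_Integration.integral_add) (auto simp del: mult_eq_0_iff)
    also have "\<dots> = 48 * pi * L * B * t + L * B * T R / t"
      using R0 t by (simp add: field_simps power2_eq_square)
    also have "48 * pi * L * B * t = e / 2" using L B by (simp add: t_def)
    also have "L * B * T R / t \<le> e / 2"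
    proof -
      have "T R \<le> e * t / (2 * L * B)" using T_mono[OF R] n by simp
      then have "L * B * T R \<le> L * B * (e * t / (2 * L * B))" using L B by (intro mult_left_mono) auto
      then show ?thesis using L B t by (simp add: divide_le_eq)
    qed
    finally show "norm (bd R g0 g1) \<le> e" by simp
  qed
qed

end

context helmholtz_kernel
begin

text \<open>Size alone does not suffice: the decay rates only bound the two products in
  \<open>bd\<close> by a quantity of order 1 as \<open>R\<close> grows. But \<open>G0\<close> and
  \<open>w\<close> satisfy the outgoing condition with the same \<open>c\<close>, so in the
  difference, a kind of Wronskian, the leading orders cancel.\<close>

lemma bd_radiating:
  assumes w_decay: "AE y in lborel. norm y \<ge> R1 \<longrightarrow> norm (w y) \<le> C / sqrt (norm y)"
    and rad: "\<And>d. d > 0 \<Longrightarrow> \<exists>R2. AE y in lborel. norm y \<ge> R2 \<longrightarrow>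
      norm ((\<Sum>b\<in>Basis. W b y * of_real (y \<bullet> b)) / of_real (norm y) + c * w y) \<le> d / sqrt (norm y)"
    and G0_bound: "\<And>r. r > 0 \<Longrightarrow> norm (G0 r) \<le> B / sqrt r"
    and G1_bound: "\<And>r. r > 0 \<Longrightarrow> norm (G1 r + c * G0 r) \<le> B / (r * sqrt r)"
    and B: "B > 0" and C: "C > 0" and \<rho>: "\<rho> > 0" and e: "e > 0"
  shows "\<exists>R\<ge>\<rho>. \<forall>x\<in>ball 0 \<rho>. \<forall>\<epsilon>\<in>{0<..1}.
      norm (bd R (\<lambda>y. G0 (rg \<epsilon> (y - x))) (\<lambda>y. of_real (y \<bullet> (y - x)) * (G1 (rg \<epsilon> (y - x)) / of_real (rg \<epsilon> (y - x))))) \<le> e"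
proof -
  obtain L where L: "L > 0" "\<And>t. \<bar>deriv step t\<bar> \<le> L" using deriv_step_bound by blast
  \<comment> \<open>Makes the contribution \<open>32 * pi * L * B * d\<close> of the radiation
    condition of \<open>w\<close> equal to \<open>e / 2\<close>.\<close>
  define d where "d = e / (64 * pi * L * B)"
  have d: "d > 0" using e L B by (simp add: d_def)
  obtain R2 where R2: "AE y in lborel. norm y \<ge> R2 \<longrightarrow>
      norm ((\<Sum>b\<in>Basis. W b y * of_real (y \<bullet> b)) / of_real (norm y) + c * w y) \<le> d / sqrt (norm y)"
    using rad[OF d] by blast
  \<comment> \<open>Coefficients of the errors of relative size \<open>1 / R\<close>: the first
    summand comes from the radiation condition of the kernel, the second from its centre being
    \<open>x\<close> instead of 0 and from the regularised radius.\<close>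
  define Q where "Q = 4 * C * B + 4 * C * B * (norm c + 1) * (2 * \<rho> + 1)"
  have Q: "Q \<ge> 0" using B C \<rho> by (simp add: Q_def)
  \<comment> \<open>The summand with \<open>Q\<close> makes the remaining part of the error at most
    \<open>e / 2\<close>; the others put the annulus far beyond \<open>x\<close> and into the range
    of the two decay hypotheses.\<close>
  define R where "R = 2 * \<rho> + 2 + \<bar>R1\<bar> + \<bar>R2\<bar> + 32 * pi * L * Q / e"
  have "32 * pi * L * Q / e \<ge> 0" using L Q e by simp
  then have R: "R \<ge> 2 * \<rho>" "R \<ge> 2" "R \<ge> R1" "R \<ge> R2" "R \<ge> 32 * pi * L * Q / e"
    using \<rho> unfolding R_def by linarith+
  have R0: "R > 0" using R by simp
  show ?thesis
  proof (intro exI[of _ R] conjI ballI)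
    show "R \<ge> \<rho>" using R \<rho> by simp
    fix x :: "real^2" and \<epsilon> assume x: "x \<in> ball 0 \<rho>" and \<epsilon>: "\<epsilon> \<in> {0<..1::real}"
    define hb where "hb y = 4 * L / R\<^sup>2 * (Q / R + 2 * B * d) * indicator (cball 0 (2 * R)) y" for y :: "real^2"
    have hb_int: "integrable lborel hb" unfolding hb_def
      by (intro integrable_mult_right integrable_indicator_cball)
    have "norm (bd R (\<lambda>y. G0 (rg \<epsilon> (y - x))) (\<lambda>y. of_real (y \<bullet> (y - x)) * (G1 (rg \<epsilon> (y - x)) / of_real (rg \<epsilon> (y - x))))) \<le> integral\<^sup>L lborel hb"
      unfolding bd_def
    proof (rule norm_integral_le[OF hb_int])
      show "AE y in lborel. norm (- complex_of_real (deriv step ((norm y)\<^sup>2 / R\<^sup>2) * (2 / R\<^sup>2)) * (w y * (of_real (y \<bullet> (y - x)) * (G1 (rg \<epsilon> (y - x)) / of_real (rg \<epsilon> (y - x)))) - G0 (rg \<epsilon> (y - x)) * (\<Sum>b\<in>Basis. W b y * of_real (y \<bullet> b)))) \<le> hb y"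
        using w_decay R2
      proof eventually_elim
        case (elim y)
        define dd where "dd = deriv step ((norm y)\<^sup>2 / R\<^sup>2)"
        define s where "s = rg \<epsilon> (y - x)"
        define Wy where "Wy = (\<Sum>b\<in>Basis. W b y * of_real (y \<bullet> b))"
        have s0: "s > 0" using rg_pos \<epsilon> by (simp add: s_def)
        have "norm (- complex_of_real (dd * (2 / R\<^sup>2)) * (w y * (of_real (y \<bullet> (y - x)) * (G1 s / of_real s)) - G0 s * Wy)) \<le> hb y"
        proof (cases "1 \<le> (norm y)\<^sup>2 / R\<^sup>2 \<and> (norm y)\<^sup>2 / R\<^sup>2 \<le> 2")
          case False
          then have "dd = 0" unfolding dd_def by (rule deriv_step_eq_0)
          moreover have "hb y \<ge> 0" unfolding hb_def using L B d Q R0 by (intro mult_nonneg_nonneg add_nonneg_nonneg) auto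
          ultimately show ?thesis by simp
        next
          case True
          have "R\<^sup>2 \<le> (norm y)\<^sup>2" using True R0 by (simp add: le_divide_eq)
          then have y1: "R \<le> norm y" by (rule power2_le_imp_le) simp
          have "(norm y)\<^sup>2 \<le> 2 * R\<^sup>2" using True R0 by (simp add: divide_le_eq)
          also have "\<dots> \<le> (2 * R)\<^sup>2" by (simp add: power_mult_distrib)
          finally have "(norm y)\<^sup>2 \<le> (2 * R)\<^sup>2" .
          then have y2: "norm y \<le> 2 * R" by (rule power2_le_imp_le) (use R0 in simp)
          define n where "n = norm y"
          have n: "n \<ge> R" "n > 0" "n \<le> 2 * R" using y1 y2 R0 by (auto simp: n_def)
          define q where "q = sqrt R"
          have q: "q > 0" "q * q = R" using R0 by (auto simp: q_def)
          have s_ge: "norm (y - x) \<le> s" unfolding s_def rg_def by (rule real_le_rsqrt) simp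
          have "s \<le> norm (y - x) + \<bar>\<epsilon>\<bar>" unfolding s_def rg_def
            using sqrt_add_le_add_sqrt[of "(norm (y - x))\<^sup>2" "\<epsilon>\<^sup>2"] by simp
          then have s_le: "s \<le> n + \<rho> + 1" using norm_triangle_ineq4[of y x] x \<epsilon> by (simp add: n_def)
          have s_ge': "s \<ge> n - \<rho>" using s_ge norm_triangle_ineq2[of y x] x by (simp add: n_def)
          have sR: "s \<ge> R / 2" using s_ge' n R by simp
          have s1: "s \<ge> 1" using sR R by simp
          have ss: "1 / sqrt s \<le> 2 / q"
          proof -
            have "(q / 2)\<^sup>2 \<le> s" using sR q s0 by (simp add: power_divide power2_eq_square)
            then have "q / 2 \<le> sqrt s" by (rule real_le_rsqrt)
            then show ?thesis using q s0 by (simp add: field_simps)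
          qed
          have ns: "1 / sqrt n \<le> 1 / q" unfolding q_def using n R0 by (intro divide_left_mono) auto
          have si: "1 / s \<le> 2 / R" using sR s0 R0 by (simp add: field_simps)
          \<comment> \<open>The derivative of the kernel along \<open>y / |y|\<close> is
            \<open>\<mu> * G1 s\<close>; the deviation of \<open>\<mu>\<close> from 1 is of order
            \<open>1 / s\<close>.\<close>
          define \<mu> where "\<mu> = (y \<bullet> (y - x)) / (s * n)"
          have \<mu>: "\<bar>\<mu> - 1\<bar> \<le> (2 * \<rho> + 1) / s"
          proof -
            have "y \<bullet> (y - x) = n * n - y \<bullet> x" by (simp add: inner_diff_right n_def power2_norm_eq_inner[symmetric] power2_eq_square)
            then have "\<mu> - 1 = ((n - s) * n - y \<bullet> x) / (s * n)" using s0 n by (simp add: \<mu>_def field_simps)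
            moreover have "\<bar>(n - s) * n - y \<bullet> x\<bar> \<le> (\<rho> + 1) * n + n * \<rho>"
            proof -
              have "\<bar>y \<bullet> x\<bar> \<le> n * norm x" unfolding n_def by (rule Cauchy_Schwarz_ineq2)
              also have "\<dots> \<le> n * \<rho>" using x n by (intro mult_left_mono) auto
              finally have "\<bar>y \<bullet> x\<bar> \<le> n * \<rho>" .
              moreover have "\<bar>n - s\<bar> \<le> \<rho> + 1" using s_le s_ge' by linarith
              then have "\<bar>(n - s) * n\<bar> \<le> (\<rho> + 1) * n" using n by (simp add: abs_mult mult_right_mono)
              ultimately show ?thesis by linarith
            qed
            ultimately have "\<bar>\<mu> - 1\<bar> \<le> ((\<rho> + 1) * n + n * \<rho>) / (s * n)"
              using s0 n by (simp add: abs_divide abs_mult divide_right_mono)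
            also have "\<dots> = (2 * \<rho> + 1) / s" using n s0 by (simp add: field_simps)
            finally show ?thesis .
          qed
          define E where "E = Wy / of_real n + c * w y"
          have E: "norm E \<le> d / sqrt n" using elim(2) y1 R by (simp add: E_def Wy_def n_def)
          have wn: "norm (w y) \<le> C / sqrt n" using elim(1) y1 R by (simp add: n_def)
          have wq: "norm (w y) \<le> C / q" using wn mult_left_mono[OF ns, of C] C by simp
          have Eq: "norm E \<le> d / q" using E mult_left_mono[OF ns, of d] d by simp
          have G0q: "norm (G0 s) \<le> 2 * B / q" using G0_bound[OF s0] mult_left_mono[OF ss, of B] B by (simp add: mult.commute)
          have GG: "norm (G1 s + c * G0 s) \<le> (2 * B / q) * (2 / R)"
          proof -
            have "B / (s * sqrt s) = (B * (1 / sqrt s)) * (1 / s)" by simp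
            also have "\<dots> \<le> (B * (2 / q)) * (2 / R)" using B q s0 by (intro mult_mono ss si) auto
            finally show ?thesis using G1_bound[OF s0] by (simp add: mult.commute)
          qed
          have G1q: "norm (G1 s) \<le> (norm c + 1) * (2 * B / q)"
          proof -
            have "norm (G1 s) \<le> norm (G1 s + c * G0 s) + norm (c * G0 s)" using norm_triangle_ineq4[of "G1 s + c * G0 s" "c * G0 s"] by simp
            also have "\<dots> \<le> (2 * B / q) * (2 / R) + norm c * (2 * B / q)"
              unfolding norm_mult by (intro add_mono GG mult_left_mono G0q) auto
            also have "(2 * B / q) * (2 / R) \<le> (2 * B / q) * 1" using R B q by (intro mult_left_mono) auto
            finally show ?thesis by (simp add: algebra_simps add_divide_distrib)
          qed
          \<comment> \<open>Adding and subtracting \<open>c * w y * G0 s\<close> writes the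
            difference through three small quantities: the radiation errors of kernel and solution,
            and \<open>\<mu> - 1\<close>.\<close>
          have "w y * (of_real (y \<bullet> (y - x)) * (G1 s / of_real s)) - G0 s * Wy =
             of_real n * (w y * (G1 s + c * G0 s) + w y * G1 s * of_real (\<mu> - 1) - G0 s * E)"
            using n s0 by (simp add: E_def \<mu>_def field_simps)
          then have "norm (w y * (of_real (y \<bullet> (y - x)) * (G1 s / of_real s)) - G0 s * Wy) =
             n * norm (w y * (G1 s + c * G0 s) + w y * G1 s * of_real (\<mu> - 1) - G0 s * E)"
            using n by (simp only: norm_mult norm_of_real abs_of_pos)
          moreover have "norm (w y * (G1 s + c * G0 s) + w y * G1 s * of_real (\<mu> - 1) - G0 s * E) \<le> (Q / R + 2 * B * d) / R"
          proof -
          have "norm (w y * (G1 s + c * G0 s) + w y * G1 s * of_real (\<mu> - 1) - G0 s * E) \<le>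
             norm (w y) * norm (G1 s + c * G0 s) + norm (w y) * norm (G1 s) * \<bar>\<mu> - 1\<bar> + norm (G0 s) * norm E"
            by (intro order_trans[OF norm_triangle_ineq4] order_trans[OF add_right_mono[OF norm_triangle_ineq]]) (simp only: norm_mult norm_of_real order_refl)
          also have "\<dots> \<le> (C / q) * ((2 * B / q) * (2 / R)) + (C / q) * ((norm c + 1) * (2 * B / q)) * ((2 * \<rho> + 1) * (2 / R)) + (2 * B / q) * (d / q)"
          proof (intro add_mono mult_mono wq GG G1q G0q Eq)
            show "\<bar>\<mu> - 1\<bar> \<le> (2 * \<rho> + 1) * (2 / R)"
              using \<mu> mult_left_mono[OF si, of "2 * \<rho> + 1"] \<rho> by simp
          qed (use B C q d R0 in auto)
          also have "\<dots> = (Q / R + 2 * B * d) / R"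
            unfolding Q_def q(2)[symmetric] using q(1) by (simp add: field_simps)
          finally show ?thesis .
          qed
          ultimately have 1: "norm (w y * (of_real (y \<bullet> (y - x)) * (G1 s / of_real s)) - G0 s * Wy) \<le> 2 * R * ((Q / R + 2 * B * d) / R)"
            using n(2,3) R0 by (simp only:) (intro mult_mono, auto)
          have "norm (- complex_of_real (dd * (2 / R\<^sup>2)) * (w y * (of_real (y \<bullet> (y - x)) * (G1 s / of_real s)) - G0 s * Wy)) =
             \<bar>dd\<bar> * (2 / R\<^sup>2) * norm (w y * (of_real (y \<bullet> (y - x)) * (G1 s / of_real s)) - G0 s * Wy)"
            unfolding norm_mult[of "- complex_of_real (dd * (2 / R\<^sup>2))"] norm_minus_cancel norm_of_real abs_mult by simp
          also have "\<dots> \<le> L * (2 / R\<^sup>2) * (2 * R * ((Q / R + 2 * B * d) / R))"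
            unfolding dd_def by (intro mult_mono 1 L(2)) (use L in auto)
          also have "\<dots> = 4 * L / R\<^sup>2 * (Q / R + 2 * B * d)" using R0 by (simp add: field_simps)
          also have "\<dots> = hb y" using y2 by (simp add: hb_def)
          finally show ?thesis .
        qed
        then show ?case by (simp only: dd_def s_def Wy_def)
      qed
    qed
    also have "integral\<^sup>L lborel hb = 4 * L / R\<^sup>2 * (Q / R + 2 * B * d) * (pi * (2 * R)\<^sup>2)"
      unfolding hb_def using R0 measure_cball_2[of "2 * R" 0] by simp
    also have "\<dots> = 16 * pi * L * Q / R + 32 * pi * L * B * d"
      using R0 by (simp add: field_simps power2_eq_square)
    also have "32 * pi * L * B * d = e / 2" using L B by (simp add: d_def)
    also have "16 * pi * L * Q / R \<le> e / 2"
      using R(5) R0 e by (simp add: field_simps)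
    finally show "norm (bd R (\<lambda>y. G0 (rg \<epsilon> (y - x))) (\<lambda>y. of_real (y \<bullet> (y - x)) * (G1 (rg \<epsilon> (y - x)) / of_real (rg \<epsilon> (y - x))))) \<le> e" by simp
  qed
qed

end

section \<open>Bounds by the Bessel and the logarithmic kernel\<close>

lemma (in wavenumber) radial_kernel_G:
  "radial_kernel (G 0) (G 1) (c\<^sup>2) (1 + sqrt (2 * norm c) * sqrt pi + norm (c\<^sup>2) * (sqrt pi / sqrt (2 * norm c)))"
proof
  fix r :: real assume r: "r > 0"
  show "(G 0 has_vector_derivative G 1 r) (at r)" using G_deriv[OF r, of 0] by simp
  have "c\<^sup>2 * G 0 r - G 1 r / of_real r = G 2 r" using G_ode[OF r] by (simp add: algebra_simps)
  then show "(G 1 has_vector_derivative c\<^sup>2 * G 0 r - G 1 r / of_real r) (at r)"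
    using G_deriv[OF r, of 1] by (simp add: numeral_2_eq_2)
  define a where "a = sqrt (2 * norm c) * sqrt pi"
  define b where "b = norm (c\<^sup>2) * (sqrt pi / sqrt (2 * norm c))"
  have ab: "a \<ge> 0" "b \<ge> 0" by (simp_all add: a_def b_def)
  have "norm (of_real r * G 1 r) \<le> a * sqrt r + 1"
    using norm_G1[OF r] by (simp add: a_def real_sqrt_mult mult_ac)
  also have "\<dots> \<le> (1 + a + b) * (1 + sqrt r)" using ab r by (simp add: algebra_simps)
  finally show "norm (of_real r * G 1 r) \<le> (1 + sqrt (2 * norm c) * sqrt pi + norm (c\<^sup>2) * (sqrt pi / sqrt (2 * norm c))) * (1 + sqrt r)"
    by (simp only: a_def b_def)
  have "norm (c\<^sup>2 * G 0 r) \<le> b * r powr (-1/2)"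
    using mult_left_mono[OF norm_G0[OF r], of "norm (c\<^sup>2)"] by (simp add: b_def norm_mult)
  also have "\<dots> \<le> (1 + a + b) * r powr (-1/2)" using ab by (intro mult_right_mono) auto
  finally show "norm (c\<^sup>2 * G 0 r) \<le> (1 + sqrt (2 * norm c) * sqrt pi + norm (c\<^sup>2) * (sqrt pi / sqrt (2 * norm c))) * r powr (-1/2)"
    by (simp only: a_def b_def)
next
  fix \<epsilon> :: real and x :: "real^2" assume \<epsilon>: "\<epsilon> > 0"
  have pos: "(norm (y - x))\<^sup>2 + \<epsilon>\<^sup>2 > 0" for y using \<epsilon> by (simp add: add_nonneg_pos)
  have "smooth (\<lambda>y. complex_of_real ((norm (y - x))\<^sup>2) + complex_of_real (\<epsilon>\<^sup>2))"
    by (intro smooth_add smooth_norm2 smooth_const)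
  then have "smooth (\<lambda>y. complex_of_real ((norm (y - x))\<^sup>2 + \<epsilon>\<^sup>2))" by simp
  from smooth_sqrt[OF this pos]
  show "smooth (\<lambda>y. G 0 (sqrt ((norm (y - x))\<^sup>2 + \<epsilon>\<^sup>2)))"
    by (intro smooth_compose_tower[where S="{0<..}" and F=G]) (use G_deriv pos in auto)
qed (rule G1_limit)

text \<open>Constants are harmonic, so for \<open>c2 = 0\<close> the scale \<open>L\<close> stays a
  parameter and can be adapted to the place where the kernel is evaluated.\<close>

lemma radial_kernel_ln: "radial_kernel (\<lambda>r. of_real (ln L - ln r)) (\<lambda>r. - 1 / of_real r) 0 1"
proof
  fix r :: real assume r: "r > 0"
  have "((\<lambda>r. ln L - ln r) has_real_derivative - 1 / r) (at r)"
    using r by (auto intro!: derivative_eq_intros)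
  then have "((\<lambda>r. complex_of_real (ln L - ln r)) has_vector_derivative of_real (- 1 / r)) (at r)"
    by (intro has_vector_derivative_of_real) (simp only: has_real_derivative_iff_has_vector_derivative)
  then show "((\<lambda>r. complex_of_real (ln L - ln r)) has_vector_derivative - 1 / of_real r) (at r)" by simp
  have "((\<lambda>r. - 1 / r) has_real_derivative 1 / (r * r)) (at r)"
    using r by (auto intro!: derivative_eq_intros)
  then have "((\<lambda>r. complex_of_real (- 1 / r)) has_vector_derivative of_real (1 / (r * r))) (at r)"
    by (intro has_vector_derivative_of_real) (simp only: has_real_derivative_iff_has_vector_derivative)
  then show "((\<lambda>r. - 1 / complex_of_real r) has_vector_derivative 0 * complex_of_real (ln L - ln r) - - 1 / of_real r / of_real r) (at r)"
    by simp
  show "norm (of_real r * (- 1 / complex_of_real r)) \<le> 1 * (1 + sqrt r)" using r by (simp add: norm_divide)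
next
  fix \<epsilon> :: real and x :: "real^2" assume \<epsilon>: "\<epsilon> > 0"
  have pos: "(norm (y - x))\<^sup>2 + \<epsilon>\<^sup>2 > 0" for y using \<epsilon> by (simp add: add_nonneg_pos)
  have "smooth (\<lambda>y. complex_of_real ((norm (y - x))\<^sup>2) + complex_of_real (\<epsilon>\<^sup>2))"
    by (intro smooth_add smooth_norm2 smooth_const)
  then have "smooth (\<lambda>y. complex_of_real ((norm (y - x))\<^sup>2 + \<epsilon>\<^sup>2))" by simp
  then have "smooth (\<lambda>y. complex_of_real (ln (sqrt ((norm (y - x))\<^sup>2 + \<epsilon>\<^sup>2))))"
    using pos by (intro smooth_ln smooth_sqrt) auto
  then have "smooth (\<lambda>y. complex_of_real (ln L) - complex_of_real (ln (sqrt ((norm (y - x))\<^sup>2 + \<epsilon>\<^sup>2))))"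
    by (intro smooth_diff smooth_const)
  then show "smooth (\<lambda>y. complex_of_real (ln L - ln (sqrt ((norm (y - x))\<^sup>2 + \<epsilon>\<^sup>2))))" by simp
next
  show "((\<lambda>r. complex_of_real r * (- 1 / complex_of_real r)) \<longlongrightarrow> - 1) (at_right 0)"
    by (rule Lim_transform_eventually[OF tendsto_const])
       (auto intro!: eventually_mono[OF eventually_at_right_less[of 0]])
qed auto

lemma emeasure_ball_2: "r > 0 \<Longrightarrow> emeasure lborel (ball (x::real^2) r) = ennreal (pi * r\<^sup>2)"
  by (simp add: emeasure_ball unit_ball_vol_2)

text \<open>For \<open>R\<close> large compared with \<open>\<rho>\<close> the centre
  \<open>x\<close> hardly matters: regularised distances to the annulus are comparable to
  \<open>R\<close>. The annulus estimates for square integrable modes rest on this.\<close>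

lemma (in helmholtz_kernel) rg_annulus:
  assumes "norm y \<ge> R" "norm y \<le> 2 * R" "R \<ge> 2 * \<rho> + 2" "x \<in> ball 0 \<rho>" "0 < \<epsilon>" "\<epsilon> \<le> 1"
  shows "R / 2 \<le> rg \<epsilon> (y - x)" "rg \<epsilon> (y - x) \<le> 3 * R" "1 \<le> rg \<epsilon> (y - x)" "\<bar>y \<bullet> (y - x)\<bar> \<le> norm y * rg \<epsilon> (y - x)"
proof -
  have x: "norm x < \<rho>" using assms by simp
  have 1: "norm (y - x) \<le> rg \<epsilon> (y - x)" unfolding rg_def by (rule real_le_rsqrt) simp
  have 2: "rg \<epsilon> (y - x) \<le> norm (y - x) + \<bar>\<epsilon>\<bar>" unfolding rg_def
    using sqrt_add_le_add_sqrt[of "(norm (y - x))\<^sup>2" "\<epsilon>\<^sup>2"] by simp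
  have \<rho>: "\<rho> > 0" using x norm_ge_zero[of x] by linarith
  show "R / 2 \<le> rg \<epsilon> (y - x)" "rg \<epsilon> (y - x) \<le> 3 * R" "1 \<le> rg \<epsilon> (y - x)"
    using 1 2 norm_triangle_ineq2[of y x] norm_triangle_ineq4[of y x] x assms \<rho> by linarith+
  have "\<bar>y \<bullet> (y - x)\<bar> \<le> norm y * norm (y - x)" by (rule Cauchy_Schwarz_ineq2)
  also have "\<dots> \<le> norm y * rg \<epsilon> (y - x)" using 1 by (intro mult_left_mono) auto
  finally show "\<bar>y \<bullet> (y - x)\<bar> \<le> norm y * rg \<epsilon> (y - x)" .
qed

context weak_helmholtz
begin

text \<open>For \<open>norm c \<ge> 1/2\<close> the kernel is at most
  \<open>sqrt pi * r powr (- 1/2)\<close>, with no trace of \<open>c\<close>; the kind of decay,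
  square integrability or radiation, only decides how the annulus term is removed.\<close>

lemma representation_wavenumber:
  assumes c: "Re c \<ge> 0" "norm c \<ge> 1/2" and c2: "c2 = c\<^sup>2"
    and decay: "((integrable lborel (\<lambda>y. (norm (w y))\<^sup>2) \<and> (\<forall>b\<in>Basis. integrable lborel (\<lambda>y. (norm (W b y))\<^sup>2))) \<or>
      (\<exists>R1 C. AE y in lborel. norm y \<ge> R1 \<longrightarrow> norm (w y) \<le> C / sqrt (norm y)) \<and>
      (\<forall>d>0. \<exists>R2. AE y in lborel. norm y \<ge> R2 \<longrightarrow>
        norm ((\<Sum>b\<in>Basis. W b y * of_real (y \<bullet> b)) / of_real (norm y) + c * w y) \<le> d / sqrt (norm y)))"
    and \<rho>: "\<rho> > 0" and supp: "\<And>x. x \<notin> ball 0 \<rho> \<Longrightarrow> f x = 0"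
  shows "AE x in lebesgue. x \<in> ball 0 \<rho> \<longrightarrow> 2 * pi * norm (w x) \<le> (\<integral>y. norm (f y) * (sqrt pi * norm (y - x) powr (-1/2)) \<partial>lborel)"
proof -
  have cnz: "c \<noteq> 0" using c by auto
  interpret N: wavenumber c by unfold_locales (use c cnz in auto)
  define A where "A = 1 + sqrt (2 * norm c) * sqrt pi + norm (c\<^sup>2) * (sqrt pi / sqrt (2 * norm c))"
  interpret radial_kernel "N.G 0" "N.G 1" c2 A using N.radial_kernel_G by (simp add: c2 A_def)
  interpret K: helmholtz_kernel w W f c2 "N.G 0" "N.G 1" A by unfold_locales
  \<comment> \<open>One positive constant for the kernel and for its radiation error; it may depend
    on \<open>c\<close>, since it is used only in the annulus term.\<close>
  define B where "B = max (sqrt pi / sqrt (2 * norm c)) (sqrt (2 * pi) / sqrt (2 * norm c)) + 1"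
  have B: "B > 0" "sqrt pi / sqrt (2 * norm c) \<le> B" "sqrt (2 * pi) / sqrt (2 * norm c) \<le> B"
    by (auto simp: B_def add_nonneg_pos max_def)
  have G0B: "norm (N.G 0 r) \<le> B / sqrt r" if "r > 0" for r
  proof -
    have "norm (N.G 0 r) \<le> sqrt pi / sqrt (2 * norm c) * (1 / sqrt r)" using N.norm_G0[OF that] unfolding powr_m_half[OF that] .
    also have "\<dots> \<le> B * (1 / sqrt r)" using B that by (intro mult_right_mono) auto
    finally show ?thesis by simp
  qed
  have G1B: "norm (N.G 1 r + c * N.G 0 r) \<le> B / (r * sqrt r)" if "r > 0" for r
  proof -
    have "r powr (-3/2) = r powr (- 1) * r powr (-1/2)" by (subst powr_add[symmetric]) simp
    also have "\<dots> = 1 / (r * sqrt r)" using powr_m_half[OF that] that by (simp add: powr_minus_divide)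
    finally have p: "r powr (-3/2) = 1 / (r * sqrt r)" .
    have "norm (N.G 1 r + c * N.G 0 r) \<le> sqrt (2 * pi) / sqrt (2 * norm c) * (1 / (r * sqrt r))"
      using N.norm_G1_plus[OF that] unfolding p .
    also have "\<dots> \<le> B * (1 / (r * sqrt r))" using B that by (intro mult_right_mono) auto
    finally show ?thesis by simp
  qed
  have bd: "\<exists>R\<ge>\<rho>. \<forall>x\<in>ball 0 \<rho>. \<forall>\<epsilon>\<in>{0<..1}.
      norm (bd R (\<lambda>y. N.G 0 (rg \<epsilon> (y - x))) (\<lambda>y. of_real (y \<bullet> (y - x)) * (N.G 1 (rg \<epsilon> (y - x)) / of_real (rg \<epsilon> (y - x))))) \<le> e"
    if e: "e > 0" for e
    using decay
  proof (elim disjE conjE exE)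
    fix R1 C assume w: "AE y in lborel. norm y \<ge> R1 \<longrightarrow> norm (w y) \<le> C / sqrt (norm y)"
      and rad: "\<forall>d>0. \<exists>R2. AE y in lborel. norm y \<ge> R2 \<longrightarrow>
        norm ((\<Sum>b\<in>Basis. W b y * of_real (y \<bullet> b)) / of_real (norm y) + c * w y) \<le> d / sqrt (norm y)"
    have w': "AE y in lborel. norm y \<ge> R1 \<longrightarrow> norm (w y) \<le> (\<bar>C\<bar> + 1) / sqrt (norm y)"
      using w
    proof eventually_elim
      case (elim y)
      have "C / sqrt (norm y) \<le> (\<bar>C\<bar> + 1) / sqrt (norm y)" by (intro divide_right_mono) auto
      then show ?case using elim by linarith
    qed
    show ?thesis by (rule K.bd_radiating[OF w' _ G0B G1B B(1) _ \<rho> e]) (use rad in auto)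
  next
    assume w2: "integrable lborel (\<lambda>y. (norm (w y))\<^sup>2)" and W2: "\<forall>b\<in>Basis. integrable lborel (\<lambda>y. (norm (W b y))\<^sup>2)"
    \<comment> \<open>For a square integrable mode it is enough that the kernel and its derivative
      are bounded on the annulus.\<close>
    have Bc: "B * (norm c + 1) > 0" using B by (simp add: add_nonneg_pos)
    obtain R0 where R0: "R0 > 0" "\<And>R g0 g1. R \<ge> R0 \<Longrightarrow>
      (\<And>y. R \<le> norm y \<Longrightarrow> norm y \<le> 2 * R \<Longrightarrow> norm (g0 y) \<le> B * (norm c + 1) \<and> norm (g1 y) \<le> B * (norm c + 1) * norm y) \<Longrightarrow> norm (bd R g0 g1) \<le> e"
      using bd_square_integrable[OF w2 _ e Bc] W2 by blast
    define R where "R = R0 + 2 * \<rho> + 2"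
    show ?thesis
    proof (intro exI[of _ R] conjI ballI)
      show "\<rho> \<le> R" using R0 \<rho> by (simp add: R_def)
      fix x :: "real^2" and \<epsilon> assume x: "x \<in> ball 0 \<rho>" and \<epsilon>: "\<epsilon> \<in> {0<..1::real}"
      show "norm (bd R (\<lambda>y. N.G 0 (rg \<epsilon> (y - x))) (\<lambda>y. of_real (y \<bullet> (y - x)) * (N.G 1 (rg \<epsilon> (y - x)) / of_real (rg \<epsilon> (y - x))))) \<le> e"
      proof (rule R0(2))
        show "R \<ge> R0" using \<rho> by (simp add: R_def)
        fix y :: "real^2" assume y: "R \<le> norm y" "norm y \<le> 2 * R"
        have R: "R \<ge> 2 * \<rho> + 2" using R0 by (simp add: R_def)
        define s where "s = rg \<epsilon> (y - x)"
        have s: "1 \<le> s" "\<bar>y \<bullet> (y - x)\<bar> \<le> norm y * s"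
          using K.rg_annulus(3,4)[OF y R x] \<epsilon> by (auto simp: s_def)
        have s0: "s > 0" "sqrt s \<ge> 1" using s by auto
        have "norm (N.G 0 s) \<le> B / sqrt s" by (rule G0B[OF s0(1)])
        also have "\<dots> \<le> B / 1" using B s0 by (intro divide_left_mono) auto
        finally have g0: "norm (N.G 0 s) \<le> B" by simp
        have "norm (N.G 1 s + c * N.G 0 s) \<le> B / (s * sqrt s)" by (rule G1B[OF s0(1)])
        also have "\<dots> \<le> B / 1" using B s s0 mult_mono[OF s(1) s0(2)] by (intro divide_left_mono) auto
        finally have g1: "norm (N.G 1 s + c * N.G 0 s) \<le> B" by simp
        have "norm (N.G 1 s) \<le> norm (N.G 1 s + c * N.G 0 s) + norm (c * N.G 0 s)" using norm_triangle_ineq4[of "N.G 1 s + c * N.G 0 s" "c * N.G 0 s"] by simp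
        also have "\<dots> \<le> B + norm c * B" unfolding norm_mult by (intro add_mono g1 mult_left_mono g0) auto
        finally have g1': "norm (N.G 1 s) \<le> B * (norm c + 1)" by (simp add: algebra_simps)
        have "norm (of_real (y \<bullet> (y - x)) * (N.G 1 s / of_real s)) = \<bar>y \<bullet> (y - x)\<bar> / s * norm (N.G 1 s)"
          using s0 by (simp add: norm_mult norm_divide)
        also have "\<dots> \<le> norm y * (B * (norm c + 1))"
          using s(2) s0 g1' by (intro mult_mono) (auto simp: divide_le_eq)
        finally have "norm (of_real (y \<bullet> (y - x)) * (N.G 1 s / of_real s)) \<le> B * (norm c + 1) * norm y" by (simp add: mult.commute)
        moreover have "B * 1 \<le> B * (norm c + 1)" using B by (intro mult_left_mono) auto
        with g0 have "norm (N.G 0 s) \<le> B * (norm c + 1)" by linarith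
        ultimately show "norm (N.G 0 (rg \<epsilon> (y - x))) \<le> B * (norm c + 1) \<and>
           norm (of_real (y \<bullet> (y - x)) * (N.G 1 (rg \<epsilon> (y - x)) / of_real (rg \<epsilon> (y - x)))) \<le> B * (norm c + 1) * norm y"
          by (simp add: s_def)
      qed
    qed
  qed
  show ?thesis
  \<comment> \<open>\<open>S\<close> only has to be finite here; the bound that enters the theorem
    is taken later over \<open>I\<close> instead of over the ball.\<close>
  proof (rule K.pointwise_representation[OF \<rho> supp zero_less_one order_refl, where k="\<lambda>r. sqrt pi * r powr (-1/2)" and S="sqrt pi * ((1 + pi) * (pi * \<rho>\<^sup>2) powr (3/4))"])
    fix x :: "real^2"
    have [measurable]: "ball (0::real^2) \<rho> \<in> sets borel" by simp
    have "(\<integral>\<^sup>+y. indicator (ball 0 \<rho>) y * ennreal (sqrt pi * norm (y - x) powr (-1/2)) \<partial>lborel) =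
      (\<integral>\<^sup>+y. ennreal (sqrt pi) * (indicator (ball 0 \<rho>) y * ennreal (norm (y - x) powr (-1/2))) \<partial>lborel)"
      by (intro nn_integral_cong) (simp add: ennreal_mult mult.left_commute)
    also have "\<dots> = ennreal (sqrt pi) * (\<integral>\<^sup>+y. indicator (ball 0 \<rho>) y * ennreal (norm (y - x) powr (-1/2)) \<partial>lborel)"
      by (rule nn_integral_cmult) measurable
    also have "\<dots> \<le> ennreal (sqrt pi) * ennreal ((1 + pi) * (pi * \<rho>\<^sup>2) powr (3/4))"
      using \<rho> by (intro mult_left_mono nn_integral_powr_kernel emeasure_ball_2) auto
    also have "\<dots> = ennreal (sqrt pi * ((1 + pi) * (pi * \<rho>\<^sup>2) powr (3/4)))" by (simp add: ennreal_mult')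
    finally show "(\<integral>\<^sup>+y. indicator (ball 0 \<rho>) y * ennreal (sqrt pi * norm (y - x) powr (-1/2)) \<partial>lborel) \<le> \<dots>" .
  next
    fix r \<epsilon> :: real assume r: "0 < r" and \<epsilon>: "0 < \<epsilon>"
    define s where "s = sqrt (r\<^sup>2 + \<epsilon>\<^sup>2)"
    \<comment> \<open>The regularised radius is the larger one and the majorant is decreasing, so
      the bound survives regularisation.\<close>
    have s: "s \<ge> r" "s > 0" using r by (auto simp: s_def real_le_rsqrt add_pos_nonneg)
    have "norm (N.G 0 s) \<le> sqrt pi / sqrt (2 * norm c) * s powr (-1/2)" by (rule N.norm_G0[OF s(2)])
    also have "\<dots> \<le> sqrt pi / 1 * r powr (-1/2)"
      using s r c by (intro mult_mono divide_left_mono powr_mono2') auto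
    finally show "norm (N.G 0 (sqrt (r\<^sup>2 + \<epsilon>\<^sup>2))) \<le> sqrt pi * r powr (-1/2)" by (simp add: s_def)
  qed (use bd in auto)
qed

text \<open>The logarithm is unbounded at infinity, so with a fixed scale it does not meet the bound
  required on the annulus. Mean zero of \<open>f\<close> makes the annulus term independent of the
  scale, and the scale \<open>R\<close> keeps the logarithm bounded on the annulus of radius
  \<open>R\<close>.\<close>

lemma representation_threshold:
  assumes c2: "c2 = 0"
    and w2: "integrable lborel (\<lambda>y. (norm (w y))\<^sup>2)" and W2: "\<And>b. b \<in> Basis \<Longrightarrow> integrable lborel (\<lambda>y. (norm (W b y))\<^sup>2)"
    and \<rho>: "\<rho> > 0" and supp: "\<And>x. x \<notin> ball 0 \<rho> \<Longrightarrow> f x = 0"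
  shows "AE x in lebesgue. x \<in> ball 0 \<rho> \<longrightarrow> 2 * pi * norm (w x) \<le> (\<integral>y. norm (f y) * max 0 (ln (5/2 * \<rho> / norm (y - x))) \<partial>lborel)"
proof -
  \<comment> \<open>Distances within the ball are below \<open>2 * \<rho>\<close>, so the
    regularised radius is at most \<open>sqrt 5 * \<rho>\<close>, below \<open>L\<close>, and the
    kernel is nonnegative there; \<open>5/2 \<le> exp 1\<close> limits the cost of this scale
    later.\<close>
  define L where "L = 5/2 * \<rho>"
  have L: "L > 0" using \<rho> by (simp add: L_def)
  have f_cut: "(\<integral>y. f y * cutoff R y * z \<partial>lborel) = z * (\<integral>y. f y \<partial>lborel)" if "R \<ge> \<rho>" for R z
  proof -
    have "f y * cutoff R y * z = z * f y" for y
      using supp[of y] cutoff_eq_1[of R y] \<rho> that by (cases "y \<in> ball 0 \<rho>") auto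
    then show ?thesis by (simp only: integral_mult_right_zero)
  qed
  \<comment> \<open>Testing with the cut-off alone, \<open>g = 1\<close>: the equation has no term
    of order zero, and the annulus term becomes arbitrarily small by square integrability.\<close>
  have f0: "(\<integral>y. f y \<partial>lborel) = 0"
  proof -
    have "norm (\<integral>y. f y \<partial>lborel) \<le> 0 + e" if e: "e > 0" for e
    proof -
      obtain R0 where R0: "R0 > 0" "\<And>R g0 g1. R \<ge> R0 \<Longrightarrow>
        (\<And>y. R \<le> norm y \<Longrightarrow> norm y \<le> 2 * R \<Longrightarrow> norm (g0 y) \<le> 1 \<and> norm (g1 y) \<le> 1 * norm y) \<Longrightarrow> norm (bd R g0 g1) \<le> e"
        using bd_square_integrable[OF w2 W2 e, of 1] by auto
      define R where "R = R0 + \<rho>"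
      have R: "R > 0" "R \<ge> \<rho>" "R \<ge> R0" using R0 \<rho> by (auto simp: R_def)
      have p: "partial b (\<lambda>y::real^2. 1) = (\<lambda>y. 0)" "partial b (\<lambda>y::real^2. 0) = (\<lambda>y. 0)" for b
        by (auto intro!: partial_eq)
      have "0 = (\<integral>y. f y \<partial>lborel) + bd R (\<lambda>y. 1) (\<lambda>y. 0)"
        using cutoff_identity[OF R(1) smooth_const[of 1]] f_cut[OF R(2), of 1] by (simp add: c2 p)
      then have "norm (\<integral>y. f y \<partial>lborel) = norm (bd R (\<lambda>y. 1) (\<lambda>y. 0))"
        by (metis add_eq_0_iff norm_minus_cancel)
      also have "\<dots> \<le> e" by (rule R0(2)[OF R(3)]) auto
      finally show ?thesis by simp
    qed
    then have "norm (\<integral>y. f y \<partial>lborel) \<le> 0" by (rule field_le_epsilon)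
    then show ?thesis by simp
  qed
  interpret radial_kernel "\<lambda>r. of_real (ln L - ln r)" "\<lambda>r. - 1 / of_real r" c2 1
    using radial_kernel_ln by (simp add: c2)
  interpret K: helmholtz_kernel w W f c2 "\<lambda>r. of_real (ln L - ln r)" "\<lambda>r. - 1 / of_real r" 1 by unfold_locales
  have bd: "\<exists>R\<ge>\<rho>. \<forall>x\<in>ball 0 \<rho>. \<forall>\<epsilon>\<in>{0<..\<epsilon>0}.
      norm (bd R (\<lambda>y. of_real (ln L - ln (rg \<epsilon> (y - x)))) (\<lambda>y. of_real (y \<bullet> (y - x)) * (- 1 / of_real (rg \<epsilon> (y - x)) / of_real (rg \<epsilon> (y - x))))) \<le> e"
    if e: "e > 0" and \<epsilon>0: "\<epsilon>0 \<le> 1" for e \<epsilon>0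
  proof -
    obtain R0 where R0: "R0 > 0" "\<And>R g0 g1. R \<ge> R0 \<Longrightarrow>
      (\<And>y. R \<le> norm y \<Longrightarrow> norm y \<le> 2 * R \<Longrightarrow> norm (g0 y) \<le> 2 \<and> norm (g1 y) \<le> 2 * norm y) \<Longrightarrow> norm (bd R g0 g1) \<le> e"
      using bd_square_integrable[OF w2 W2 e, of 2] by auto
    define R where "R = R0 + 2 * \<rho> + 2"
    have R: "R > 0" "R \<ge> \<rho>" "R \<ge> R0" "R \<ge> 2 * \<rho> + 2" using R0 \<rho> by (auto simp: R_def)
    show ?thesis
    proof (intro exI[of _ R] conjI ballI)
      show "\<rho> \<le> R" by fact
      fix x :: "real^2" and \<epsilon> assume x: "x \<in> ball 0 \<rho>" and "\<epsilon> \<in> {0<..\<epsilon>0::real}"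
      then have \<epsilon>: "0 < \<epsilon>" "\<epsilon> \<le> 1" using \<epsilon>0 by auto
      let ?g1 = "\<lambda>y. of_real (y \<bullet> (y - x)) * (- 1 / of_real (rg \<epsilon> (y - x)) / of_real (rg \<epsilon> (y - x))) :: complex"
      \<comment> \<open>The same kernel at scale \<open>R\<close>. \<open>\<psi>\<close> does not
        depend on the scale since \<open>c2 = 0\<close>, and the terms with \<open>f\<close> agree
        by \<open>f0\<close>; hence so do the annulus terms.\<close>
      interpret R: helmholtz_kernel w W f c2 "\<lambda>r. of_real (ln R - ln r)" "\<lambda>r. - 1 / of_real r" 1
        using radial_kernel_ln[of R] weak_helmholtz_axioms by (simp add: helmholtz_kernel_def c2)
      have \<psi>_eq: "R.\<psi> = \<psi>" 
        by (intro ext) (unfold R.\<psi>_def \<psi>_def, simp add: c2)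
      have f_int: "integrable lborel (\<lambda>y. f y * (cutoff R y * of_real (ln L - ln (rg \<epsilon> (y - x)))))"
      proof (rule loc_integrable_mult[OF _ f_m])
        show "integrable lborel (\<lambda>x. indicator (cball 0 R') x *\<^sub>R f x)" for R'
          using f_int by (intro integrable_mult_indicator) auto
        show "(\<lambda>y. cutoff R y * of_real (ln L - ln (rg \<epsilon> (y - x)))) \<in> test_functions UNIV"
          by (rule test_functions_mult[OF cutoff_test[OF R(1)] smooth_G_rg[OF \<epsilon>(1)]])
      qed
      have f_int1: "integrable lborel (\<lambda>y. f y * cutoff R y * of_real (ln R - ln L))"
      proof (rule integrable_mult_left, rule loc_integrable_mult[OF _ f_m cutoff_test[OF R(1)]])
        show "integrable lborel (\<lambda>x. indicator (cball 0 R') x *\<^sub>R f x)" for R'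
          using weak_helmholtz.f_int[OF weak_helmholtz_axioms] by (intro integrable_mult_indicator) auto
      qed
      have "f y * cutoff R y * complex_of_real (ln R - ln (rg \<epsilon> (y - x))) =
        f y * (cutoff R y * of_real (ln L - ln (rg \<epsilon> (y - x)))) + f y * cutoff R y * of_real (ln R - ln L)" for y
        by (simp add: algebra_simps)
      then have "(\<integral>y. f y * cutoff R y * complex_of_real (ln R - ln (rg \<epsilon> (y - x))) \<partial>lborel) =
        (\<integral>y. f y * (cutoff R y * of_real (ln L - ln (rg \<epsilon> (y - x)))) \<partial>lborel) + (\<integral>y. f y * cutoff R y * of_real (ln R - ln L) \<partial>lborel)"
        using f_int f_int1 by (simp only: Bochner_Integration.integral_add)
      then have "(\<integral>y. f y * cutoff R y * complex_of_real (ln R - ln (rg \<epsilon> (y - x))) \<partial>lborel) =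
        (\<integral>y. f y * cutoff R y * of_real (ln L - ln (rg \<epsilon> (y - x))) \<partial>lborel)"
        unfolding f_cut[OF R(2)] f0 by (simp add: mult.assoc)
      then have "bd R (\<lambda>y. of_real (ln L - ln (rg \<epsilon> (y - x)))) ?g1 = bd R (\<lambda>y. of_real (ln R - ln (rg \<epsilon> (y - x)))) ?g1"
        using K.kernel_identity[OF R(1) \<epsilon>(1), of x] R.kernel_identity[OF R(1) \<epsilon>(1), of x]
        unfolding \<psi>_eq by simp
      also have "norm \<dots> \<le> e"
      proof (rule R0(2)[OF R(3)])
        fix y :: "real^2" assume y: "R \<le> norm y" "norm y \<le> 2 * R"
        define s where "s = rg \<epsilon> (y - x)"
        have s: "R / 2 \<le> s" "s \<le> 3 * R" "1 \<le> s" "\<bar>y \<bullet> (y - x)\<bar> \<le> norm y * s"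
          using K.rg_annulus[OF y R(4) x \<epsilon>] by (auto simp: s_def)
        \<comment> \<open>With \<open>s\<close> between \<open>R / 2\<close> and
          \<open>3 * R\<close>, the inequality \<open>ln x \<le> x - 1\<close> bounds both signs of
          the logarithm.\<close>
        have "ln R - ln s = ln (R / s)" using R s by (simp add: ln_div)
        moreover have "ln (R / s) \<le> R / s - 1" using R s by (intro ln_le_minus_one) auto
        moreover have "R / s \<le> 2" using s by (simp add: divide_le_eq)
        moreover have "ln s - ln R = ln (s / R)" using R s by (simp add: ln_div)
        moreover have "ln (s / R) \<le> s / R - 1" using R s by (intro ln_le_minus_one) auto
        moreover have "s / R \<le> 3" using s R by (simp add: divide_le_eq)
        ultimately have 1: "\<bar>ln R - ln s\<bar> \<le> 2" by linarith
        have "\<bar>y \<bullet> (y - x)\<bar> / s \<le> norm y" using s by (simp add: divide_le_eq)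
        then have "\<bar>y \<bullet> (y - x)\<bar> / s / s \<le> norm y / s" using s by (intro divide_right_mono) auto
        also have "\<dots> \<le> norm y / 1" using s by (intro divide_left_mono) auto
        also have "\<dots> \<le> 2 * norm y" by simp
        finally have "\<bar>y \<bullet> (y - x)\<bar> / s / s \<le> 2 * norm y" .
        moreover have "norm (of_real (y \<bullet> (y - x)) * (- 1 / complex_of_real s / of_real s)) = \<bar>y \<bullet> (y - x)\<bar> / s / s"
          using s by (simp add: norm_mult norm_divide)
        ultimately show "norm (complex_of_real (ln R - ln (rg \<epsilon> (y - x)))) \<le> 2 \<and> norm (?g1 y) \<le> 2 * norm y"
          using 1 unfolding s_def[symmetric] norm_of_real by simp
      qed
      finally show "norm (bd R (\<lambda>y. of_real (ln L - ln (rg \<epsilon> (y - x)))) ?g1) \<le> e" .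
    qed
  qed
  \<comment> \<open>\<open>\<epsilon> \<le> \<rho>\<close> keeps the regularised radius below
    \<open>L\<close>, and \<open>\<epsilon> \<le> 1\<close> is what the approximate identity
    requires.\<close>
  define \<epsilon>0 where "\<epsilon>0 = min 1 \<rho>"
  have \<epsilon>0: "0 < \<epsilon>0" "\<epsilon>0 \<le> 1" "\<epsilon>0 \<le> \<rho>" using \<rho> by (auto simp: \<epsilon>0_def)
  have "AE x in lebesgue. x \<in> ball 0 \<rho> \<longrightarrow> 2 * pi * norm (w x) \<le> (\<integral>y. norm (f y) * max 0 (ln (L / norm (y - x))) \<partial>lborel)"
  proof (rule K.pointwise_representation[OF \<rho> supp \<epsilon>0(1,2), where k="\<lambda>r. max 0 (ln (L / r))" and S="(pi * \<rho>\<^sup>2) * (1 + ln (pi * L\<^sup>2 / (pi * \<rho>\<^sup>2)) / 2)"])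
    fix x :: "real^2"
    have e: "ennreal (max 0 z) = ennreal z" for z by (simp add: max_def ennreal_neg)
    show "(\<integral>\<^sup>+y. indicator (ball 0 \<rho>) y * ennreal (max 0 (ln (L / norm (y - x)))) \<partial>lborel) \<le> ennreal ((pi * \<rho>\<^sup>2) * (1 + ln (pi * L\<^sup>2 / (pi * \<rho>\<^sup>2)) / 2))"
      unfolding e using \<rho> L by (intro nn_integral_ln_kernel emeasure_ball_2) (auto simp: L_def power_mult_distrib)
  next
    fix r \<epsilon> :: real assume r: "0 < r" "r < 2 * \<rho>" and \<epsilon>: "0 < \<epsilon>" "\<epsilon> \<le> \<epsilon>0"
    define s where "s = sqrt (r\<^sup>2 + \<epsilon>\<^sup>2)"
    have s: "s \<ge> r" "s > 0" using r by (auto simp: s_def real_le_rsqrt add_pos_nonneg)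
    have "r\<^sup>2 \<le> (2 * \<rho>)\<^sup>2" "\<epsilon>\<^sup>2 \<le> \<rho>\<^sup>2" using r \<epsilon> \<epsilon>0 by (intro power_mono; simp)+
    moreover have "(2 * \<rho>)\<^sup>2 = 4 * \<rho>\<^sup>2" "L\<^sup>2 = 25/4 * \<rho>\<^sup>2" by (simp_all add: L_def power_mult_distrib power_divide)
    ultimately have "r\<^sup>2 + \<epsilon>\<^sup>2 \<le> L\<^sup>2" using zero_le_power2[of \<rho>] by linarith
    then have "s \<le> sqrt (L\<^sup>2)" unfolding s_def by (rule real_sqrt_le_mono)
    then have sL: "s \<le> L" using L by simp
    have "norm (complex_of_real (ln L - ln s)) = ln L - ln s" using sL s L by (simp only: norm_of_real) simp
    also have "\<dots> \<le> ln L - ln r" using s r by simp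
    also have "\<dots> = ln (L / r)" using L r by (simp add: ln_div)
    finally show "norm (complex_of_real (ln L - ln (sqrt (r\<^sup>2 + \<epsilon>\<^sup>2)))) \<le> max 0 (ln (L / r))" by (simp add: s_def)
  qed (use bd \<epsilon>0 in auto)
  then show ?thesis by (simp add: L_def)
qed

end

text \<open>Cauchy-Schwarz with the kernel split into two square roots: the first factor is at most
  \<open>S\<close>, and after Tonelli the symmetric kernel contributes \<open>S\<close> once
  more.\<close>

lemma Schur_bound:
  fixes w f :: "real^2 \<Rightarrow> complex" and k :: "real \<Rightarrow> real"
  assumes [measurable]: "I \<in> sets borel" "f \<in> borel_measurable borel" "w \<in> borel_measurable borel" "k \<in> borel_measurable borel"
    and k0: "\<And>r. k r \<ge> 0" and S: "S \<ge> 0" and c: "c > 0"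
    and kS: "\<And>x::real^2. (\<integral>\<^sup>+y. indicator I y * ennreal (k (norm (y - x))) \<partial>lborel) \<le> ennreal S"
    and supp: "\<And>x. x \<notin> I \<Longrightarrow> f x = 0"
    and wf: "AE x in lborel. x \<in> I \<longrightarrow> c * norm (w x) \<le> (\<integral>y. norm (f y) * k (norm (y - x)) \<partial>lborel)"
  shows "(\<integral>\<^sup>+x. indicator I x * ennreal ((norm (w x))\<^sup>2) \<partial>lborel) \<le> ennreal ((S / c)\<^sup>2) * (\<integral>\<^sup>+x. ennreal ((norm (f x))\<^sup>2) \<partial>lborel)"
proof -
  have pt: "AE x in lborel. indicator I x * ennreal ((c * norm (w x))\<^sup>2) \<le>
     ennreal S * (\<integral>\<^sup>+y. ennreal ((norm (f y))\<^sup>2) * (indicator I x * ennreal (k (norm (x - y)))) \<partial>lborel)"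
    using wf
  proof eventually_elim
    case (elim x)
    show ?case
    proof (cases "x \<in> I")
      case True
      have "ennreal (c * norm (w x)) \<le> ennreal (\<integral>y. norm (f y) * k (norm (y - x)) \<partial>lborel)"
        using elim True by (intro ennreal_leI) auto
      \<comment> \<open>A non-integrable product has Bochner integral 0, so the inequality holds in
        either case.\<close>
      also have "\<dots> \<le> (\<integral>\<^sup>+y. ennreal (norm (f y) * k (norm (y - x))) \<partial>lborel)"
      proof (cases "integrable lborel (\<lambda>y. norm (f y) * k (norm (y - x)))")
        case True
        then show ?thesis by (subst nn_integral_eq_integral) (auto simp: k0)
      qed (simp add: not_integrable_integral_eq)
      also have "\<dots> = (\<integral>\<^sup>+y. ennreal (indicator I y * sqrt (k (norm (y - x)))) * ennreal (norm (f y) * sqrt (k (norm (y - x)))) \<partial>lborel)"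
        using k0 supp by (intro nn_integral_cong) (auto simp: indicator_def ennreal_mult'[symmetric] mult.left_commute)
      finally have "(ennreal (c * norm (w x)))\<^sup>2 \<le> (\<integral>\<^sup>+y. ennreal (indicator I y * sqrt (k (norm (y - x)))) * ennreal (norm (f y) * sqrt (k (norm (y - x)))) \<partial>lborel)\<^sup>2"
        by (intro power_mono) auto
      also have "\<dots> \<le> (\<integral>\<^sup>+y. (ennreal (indicator I y * sqrt (k (norm (y - x)))))\<^sup>2 \<partial>lborel) * (\<integral>\<^sup>+y. (ennreal (norm (f y) * sqrt (k (norm (y - x)))))\<^sup>2 \<partial>lborel)"
        by (rule Cauchy_Schwarz_nn_integral) measurable
      also have "(\<integral>\<^sup>+y. (ennreal (indicator I y * sqrt (k (norm (y - x)))))\<^sup>2 \<partial>lborel) = (\<integral>\<^sup>+y. indicator I y * ennreal (k (norm (y - x))) \<partial>lborel)"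
        using k0 by (intro nn_integral_cong) (auto simp: indicator_def ennreal_power)
      also have "(\<integral>\<^sup>+y. (ennreal (norm (f y) * sqrt (k (norm (y - x)))))\<^sup>2 \<partial>lborel) = (\<integral>\<^sup>+y. ennreal ((norm (f y))\<^sup>2) * (indicator I x * ennreal (k (norm (x - y)))) \<partial>lborel)"
        using k0 True by (intro nn_integral_cong) (auto simp: ennreal_power power_mult_distrib ennreal_mult norm_minus_commute)
      finally have "(ennreal (c * norm (w x)))\<^sup>2 \<le> (\<integral>\<^sup>+y. indicator I y * ennreal (k (norm (y - x))) \<partial>lborel) * (\<integral>\<^sup>+y. ennreal ((norm (f y))\<^sup>2) * (indicator I x * ennreal (k (norm (x - y)))) \<partial>lborel)" .
      also have "\<dots> \<le> ennreal S * (\<integral>\<^sup>+y. ennreal ((norm (f y))\<^sup>2) * (indicator I x * ennreal (k (norm (x - y)))) \<partial>lborel)"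
        by (intro mult_right_mono kS) auto
      finally show ?thesis using True c by (simp add: ennreal_power)
    qed simp
  qed
  have "(\<integral>\<^sup>+x. indicator I x * ennreal ((c * norm (w x))\<^sup>2) \<partial>lborel) \<le>
    (\<integral>\<^sup>+x. ennreal S * (\<integral>\<^sup>+y. ennreal ((norm (f y))\<^sup>2) * (indicator I x * ennreal (k (norm (x - y)))) \<partial>lborel) \<partial>lborel)"
    by (rule nn_integral_mono_AE[OF pt])
  also have "\<dots> = ennreal S * (\<integral>\<^sup>+x. \<integral>\<^sup>+y. ennreal ((norm (f y))\<^sup>2) * (indicator I x * ennreal (k (norm (x - y)))) \<partial>lborel \<partial>lborel)"
    by (rule nn_integral_cmult) measurable
  also have "(\<integral>\<^sup>+x. \<integral>\<^sup>+y. ennreal ((norm (f y))\<^sup>2) * (indicator I x * ennreal (k (norm (x - y)))) \<partial>lborel \<partial>lborel) =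
    (\<integral>\<^sup>+y. \<integral>\<^sup>+x. ennreal ((norm (f y))\<^sup>2) * (indicator I x * ennreal (k (norm (x - y)))) \<partial>lborel \<partial>lborel)"
    by (rule lborel_pair.Fubini') measurable
  also have "\<dots> = (\<integral>\<^sup>+y. ennreal ((norm (f y))\<^sup>2) * (\<integral>\<^sup>+x. indicator I x * ennreal (k (norm (x - y))) \<partial>lborel) \<partial>lborel)"
    by (intro nn_integral_cong nn_integral_cmult) measurable
  also have "\<dots> \<le> (\<integral>\<^sup>+y. ennreal ((norm (f y))\<^sup>2) * ennreal S \<partial>lborel)"
    by (intro nn_integral_mono mult_left_mono kS) auto
  also have "\<dots> = (\<integral>\<^sup>+y. ennreal ((norm (f y))\<^sup>2) \<partial>lborel) * ennreal S"
    by (rule nn_integral_multc) measurable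
  finally have main: "(\<integral>\<^sup>+x. indicator I x * ennreal ((c * norm (w x))\<^sup>2) \<partial>lborel) \<le> ennreal S * ((\<integral>\<^sup>+y. ennreal ((norm (f y))\<^sup>2) \<partial>lborel) * ennreal S)"
    by (simp add: mult_left_mono)
  have "(\<integral>\<^sup>+x. indicator I x * ennreal ((norm (w x))\<^sup>2) \<partial>lborel) =
     (\<integral>\<^sup>+x. ennreal (1 / c\<^sup>2) * (indicator I x * ennreal ((c * norm (w x))\<^sup>2)) \<partial>lborel)"
    using c by (intro nn_integral_cong) (auto simp: indicator_def ennreal_mult'[symmetric] power_mult_distrib)
  also have "\<dots> = ennreal (1 / c\<^sup>2) * (\<integral>\<^sup>+x. indicator I x * ennreal ((c * norm (w x))\<^sup>2) \<partial>lborel)"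
    by (rule nn_integral_cmult) measurable
  also have "\<dots> \<le> ennreal (1 / c\<^sup>2) * (ennreal S * ((\<integral>\<^sup>+y. ennreal ((norm (f y))\<^sup>2) \<partial>lborel) * ennreal S))"
    by (intro mult_left_mono main) auto
  also have "\<dots> = (ennreal (1 / c\<^sup>2) * ennreal S * ennreal S) * (\<integral>\<^sup>+y. ennreal ((norm (f y))\<^sup>2) \<partial>lborel)"
    by (simp only: ac_simps)
  also have "ennreal (1 / c\<^sup>2) * ennreal S * ennreal S = ennreal ((S / c)\<^sup>2)"
    using S c by (simp add: ennreal_mult[symmetric] power_divide power2_eq_square)
  finally show ?thesis .
qed

section \<open>Separation of variables in the layer\<close>

text \<open>Tonelli and slicing are carried out for Borel functions, whereas the spaces of the
  problem consist of Lebesgue measurable ones; each of these is replaced by a Borel function equal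
  to it almost everywhere.\<close>

lemma lebesgue_borel_rep:
  fixes h :: "'a::euclidean_space \<Rightarrow> complex"
  assumes "h \<in> borel_measurable lebesgue"
  obtains h' where "h' \<in> borel_measurable borel" "AE x in lborel. h x = h' x"
proof -
  have "(\<lambda>x. Re (h x)) \<in> borel_measurable lebesgue" "(\<lambda>x. Im (h x)) \<in> borel_measurable lebesgue"
    using assms by measurable
  then obtain a b where ab: "a \<in> borel_measurable lborel" "AE x in lborel. Re (h x) = a x"
     "b \<in> borel_measurable lborel" "AE x in lborel. Im (h x) = b x"
    using completion_ex_borel_measurable_real by metis
  show ?thesis
  proof (rule that[of "\<lambda>x. Complex (a x) (b x)"])
    have "(\<lambda>x. complex_of_real (a x) + \<i> * complex_of_real (b x)) \<in> borel_measurable borel"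
      using ab by measurable
    then show "(\<lambda>x. Complex (a x) (b x)) \<in> borel_measurable borel" by (simp add: Complex_eq)
    show "AE x in lborel. h x = Complex (a x) (b x)" using ab(2,4) by eventually_elim (simp add: complex_eq_iff)
  qed
qed

text \<open>With a representative that vanishes off \<open>S\<close>, integrals over
  \<open>S\<close> become integrals over the whole space, where the product structure of
  \<open>lborel\<close> is available.\<close>

lemma integral_lebesgue_rep:
  fixes h h' :: "'a::euclidean_space \<Rightarrow> 'b::euclidean_space"
  assumes S: "S \<in> sets borel" and h': "h' \<in> borel_measurable borel" "\<And>x. x \<notin> S \<Longrightarrow> h' x = 0"
    and ae: "AE x in lborel. x \<in> S \<longrightarrow> h x = h' x"
  shows "(LINT x|lebesgue_on S. h x) = (\<integral>x. h' x \<partial>lborel)" "integrable (lebesgue_on S) h \<longleftrightarrow> integrable lborel h'"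
proof -
  have ae': "AE x in lebesgue. indicator S x *\<^sub>R h x = h' x"
    using AE_completion[OF ae] by eventually_elim (auto simp: indicator_def h'(2))
  have m': "h' \<in> borel_measurable lebesgue" using h'(1) by (intro measurable_completion) simp
  have ae'': "AE x in lebesgue. h' x = indicator S x *\<^sub>R h x" using ae' by eventually_elim simp
  have m: "(\<lambda>x. indicator S x *\<^sub>R h x) \<in> borel_measurable lebesgue"
    by (rule borel_measurable_AE[OF m' ae''])
  have S': "S \<inter> space lebesgue \<in> sets lebesgue" using S by simp
  show "(LINT x|lebesgue_on S. h x) = (\<integral>x. h' x \<partial>lborel)"
    unfolding integral_restrict_space[OF S'] integral_cong_AE[OF m m' ae'] using h'(1) by (simp add: integral_completion)
  show "integrable (lebesgue_on S) h \<longleftrightarrow> integrable lborel h'"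
    unfolding integrable_restrict_space[OF S'] integrable_cong_AE[OF m m' ae'] using h'(1) by (simp add: integrable_completion)
qed

lemma layer_borel [measurable]: "layer \<in> sets borel"
proof -
  have "open layer" unfolding layer_def by (intro open_Times) auto
  then show ?thesis by simp
qed

lemma borel_rep_on:
  fixes h :: "'a::euclidean_space \<Rightarrow> complex"
  assumes S: "S \<in> sets borel" and "h \<in> borel_measurable (lebesgue_on S)"
  obtains h' where "h' \<in> borel_measurable borel" "\<And>x. x \<notin> S \<Longrightarrow> h' x = 0" "AE x in lborel. x \<in> S \<longrightarrow> h x = h' x"
proof -
  have "(\<lambda>x. if x \<in> S then h x else 0) \<in> borel_measurable lebesgue"
    using assms by (subst borel_measurable_if) auto
  then obtain h' where h': "h' \<in> borel_measurable borel" "AE x in lborel. (if x \<in> S then h x else 0) = h' x"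
    by (rule lebesgue_borel_rep)
  show ?thesis
  proof (rule that[of "\<lambda>x. indicator S x * h' x"])
    show "(\<lambda>x. indicator S x * h' x) \<in> borel_measurable borel" using h'(1) S by measurable
    show "AE x in lborel. x \<in> S \<longrightarrow> h x = indicator S x * h' x"
      using h'(2) by eventually_elim auto
  qed auto
qed

lemma measurable_on_exhaustion:
  fixes h :: "'a::euclidean_space \<Rightarrow> complex"
  assumes S: "S \<in> sets borel" and h: "\<And>R. h \<in> borel_measurable (lebesgue_on (S \<inter> ball 0 R))"
  shows "h \<in> borel_measurable (lebesgue_on S)"
proof -
  have 1: "(\<lambda>x. if x \<in> S \<inter> ball 0 (real n) then h x else 0) \<in> borel_measurable lebesgue" for n
    using h[of "real n"] S by (subst borel_measurable_if) auto
  have "(\<lambda>x. if x \<in> S then h x else 0) \<in> borel_measurable lebesgue"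
  proof (rule borel_measurable_LIMSEQ_metric[OF 1])
    fix x :: 'a
    have "\<forall>\<^sub>F n in sequentially. norm x + 1 \<le> real n"
      using filterlim_at_top[THEN iffD1, OF filterlim_real_sequentially] by blast
    then have "\<forall>\<^sub>F n in sequentially. (if x \<in> S then h x else 0) = (if x \<in> S \<inter> ball 0 (real n) then h x else 0)"
      by eventually_elim auto
    then show "(\<lambda>n. if x \<in> S \<inter> ball 0 (real n) then h x else 0) \<longlonglongrightarrow> (if x \<in> S then h x else 0)"
      by (rule Lim_transform_eventually[OF tendsto_const])
  qed
  then show ?thesis using S by (subst (asm) borel_measurable_if) auto
qed

lemma sum_Basis_prod:
  fixes F :: "'a::euclidean_space \<times> real \<Rightarrow> complex"
  shows "(\<Sum>b\<in>Basis. F b) = (\<Sum>b\<in>Basis. F (b, 0)) + F (0, 1)"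
proof -
  have "(\<Sum>b\<in>Basis. F b) = (\<Sum>b\<in>(\<lambda>b. (b, 0)) ` Basis. F b) + (\<Sum>b\<in>(\<lambda>b. (0, b)) ` Basis. F b)"
    unfolding Basis_prod_def by (intro sum.union_disjoint) auto
  also have "(\<Sum>b\<in>(\<lambda>b. (b, 0)) ` Basis. F b) = (\<Sum>b\<in>Basis. F (b, 0))"
    by (subst sum.reindex) (auto simp: inj_on_def)
  also have "(\<Sum>b\<in>(\<lambda>b. (0, b)) ` Basis. F b) = F (0, 1)" by simp
  finally show ?thesis .
qed

text \<open>The profiles \<open>bump j\<close> exhaust the interval; the derivative of their product with a sine stays bounded
  because the sine vanishes at the end points.\<close>

definition bump :: "nat \<Rightarrow> real \<Rightarrow> real" where
  "bump j y = step (real j * (y * (1 - y)))"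

lemma smooth_bump: "smooth (\<lambda>y. complex_of_real (bump j y))"
proof -
  have y: "smooth (\<lambda>y::real. complex_of_real y)" by (rule smooth_of_real_linear[OF bounded_linear_ident])
  have "smooth (\<lambda>y. of_real (real j) * (complex_of_real y * (1 - complex_of_real y)))"
    by (intro smooth_mult smooth_diff smooth_const y)
  then have "smooth (\<lambda>y. complex_of_real (real j * (y * (1 - y))))" by simp
  then show ?thesis unfolding bump_def by (rule smooth_step)
qed

text \<open>Within distance \<open>1 / (j + 2)\<close> of an end point the argument of the step is
  at most 1. The summand 2 keeps this distance at most \<open>1/2\<close>, also for
  \<open>j = 0\<close>.\<close>

lemma bump_eq_0: 
  assumes "y \<le> 1 / (real j + 2) \<or> y \<ge> 1 - 1 / (real j + 2)" shows "bump j y = 0"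
proof -
  define a where "a = 1 / (real j + 2)"
  have a: "a > 0" "real j * a \<le> 1" by (auto simp: a_def)
  have "real j * (y * (1 - y)) \<le> 1"
  proof (cases "0 \<le> y \<and> y \<le> 1")
    case True
    then have "y * (1 - y) \<le> min y (1 - y)" by (auto simp: min_def mult_left_le mult_left_le_one_le)
    also have "\<dots> \<le> a" using assms by (auto simp: a_def)
    finally have "real j * (y * (1 - y)) \<le> real j * a" by (intro mult_left_mono) auto
    then show ?thesis using a by linarith
  next
    case False
    then have "y * (1 - y) \<le> 0" by (auto simp: mult_le_0_iff)
    then have "real j * (y * (1 - y)) \<le> 0" by (simp add: mult_nonneg_nonpos)
    then show ?thesis by simp
  qed
  then show ?thesis by (simp add: bump_def step_eq_0)
qed

lemma bump_bounds: "0 \<le> bump j y" "bump j y \<le> 1"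
  by (simp_all add: bump_def step_nonneg step_le_1)

lemma bump_eventually: 
  assumes "0 < y" "y < 1" shows "\<forall>\<^sub>F j in sequentially. 2 < real j * (y * (1 - y))"
proof -
  have "\<forall>\<^sub>F j in sequentially. 2 / (y * (1 - y)) < real j"
    using filterlim_at_top_dense[THEN iffD1, OF filterlim_real_sequentially] by blast
  then show ?thesis by eventually_elim (use assms in \<open>simp add: divide_less_eq\<close>)
qed

lemma bump_test: 
  assumes "smooth \<zeta>" shows "(\<lambda>y. complex_of_real (bump j y) * \<zeta> y) \<in> test_functions {0<..<1}"
proof (rule test_functionsI[of _ "{1 / (real j + 2)..1 - 1 / (real j + 2)}"])
  show "smooth (\<lambda>y. complex_of_real (bump j y) * \<zeta> y)" by (intro smooth_mult smooth_bump assms)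
  have a: "1 / (real j + 2) > 0" by simp
  show "{1 / (real j + 2)..1 - 1 / (real j + 2)} \<subseteq> {0<..<1}"
  proof
    fix y assume "y \<in> {1 / (real j + 2)..1 - 1 / (real j + 2)}"
    then have "1 / (real j + 2) \<le> y" "y \<le> 1 - 1 / (real j + 2)" by auto
    with a have "0 < y" "y < 1" by linarith+
    then show "y \<in> {0<..<1}" by simp
  qed
  show "y \<in> {1 / (real j + 2)..1 - 1 / (real j + 2)}" if "complex_of_real (bump j y) * \<zeta> y \<noteq> 0" for y
    using that bump_eq_0[of y j] by fastforce
qed auto

lemma partial_bump:
  "partial 1 (\<lambda>y. complex_of_real (bump j y)) y = of_real (deriv step (real j * (y * (1 - y))) * (real j * (1 - 2 * y)))"
proof -
  have 1: "((\<lambda>y. real j * (y * (1 - y))) has_real_derivative real j * (1 - 2 * y)) (at y)"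
    by (auto intro!: derivative_eq_intros simp: algebra_simps)
  have "(bump j has_real_derivative deriv step (real j * (y * (1 - y))) * (real j * (1 - 2 * y))) (at y)"
    unfolding bump_def by (rule DERIV_chain2[OF deriv_step 1])
  then have "((\<lambda>y. complex_of_real (bump j y)) has_derivative (\<lambda>h. of_real (deriv step (real j * (y * (1 - y))) * (real j * (1 - 2 * y)) * h))) (at y)"
    unfolding has_field_derivative_def by (rule has_derivative_of_real)
  from partial_eq[OF this, of 1] show ?thesis by simp
qed

lemma partial_sin: "partial 1 (\<lambda>y. complex_of_real (sin (a * y))) y = of_real (a * cos (a * y))"
proof -
  have "((\<lambda>y. sin (a * y)) has_real_derivative a * cos (a * y)) (at y)" by (auto intro!: derivative_eq_intros)
  then have "((\<lambda>y. complex_of_real (sin (a * y))) has_derivative (\<lambda>h. of_real (a * cos (a * y) * h))) (at y)"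
    unfolding has_field_derivative_def by (rule has_derivative_of_real)
  from partial_eq[OF this, of 1] show ?thesis by simp
qed

lemma partial_cos: "partial 1 (\<lambda>y. complex_of_real (cos (a * y))) y = - of_real (a * sin (a * y))"
proof -
  have "((\<lambda>y. cos (a * y)) has_real_derivative - (a * sin (a * y))) (at y)" by (auto intro!: derivative_eq_intros)
  then have "((\<lambda>y. complex_of_real (cos (a * y))) has_derivative (\<lambda>h. of_real (- (a * sin (a * y)) * h))) (at y)"
    unfolding has_field_derivative_def by (rule has_derivative_of_real)
  from partial_eq[OF this, of 1] show ?thesis by simp
qed

text \<open>The sine vanishes to first order at both end points, like \<open>y * (1 - y)\<close>.
  The derivative of \<open>bump j\<close> has size \<open>j\<close> where \<open>y * (1 - y)\<close>
  is of order \<open>1 / j\<close>, so the product stays bounded.\<close>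

lemma sin_le_parabola:
  assumes "0 \<le> y" "y \<le> 1" shows "\<bar>sin (real m * pi * y)\<bar> \<le> 2 * (real m * pi) * (y * (1 - y))"
proof -
  have b: "\<bar>sin x\<bar> \<le> \<bar>x\<bar>" for x :: real by (rule abs_sin_x_le_abs_x)
  have "\<bar>sin (real m * pi * y)\<bar> = \<bar>sin (real m * pi * (1 - y))\<bar>"
  proof -
    have "real m * pi * (1 - y) = real m * pi - real m * pi * y" by (simp add: algebra_simps)
    then have "sin (real m * pi * (1 - y)) = - (cos (real m * pi) * sin (real m * pi * y))"
      by (simp only: sin_diff) simp
    moreover have "\<bar>cos (real m * pi)\<bar> = 1" by simp
    ultimately show ?thesis by (simp add: abs_mult)
  qed
  then have 1: "\<bar>sin (real m * pi * y)\<bar> \<le> real m * pi * (1 - y)" using b[of "real m * pi * (1 - y)"] assms by (simp add: abs_mult)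
  have 2: "\<bar>sin (real m * pi * y)\<bar> \<le> real m * pi * y" using b[of "real m * pi * y"] assms by (simp add: abs_mult)
  show ?thesis
  proof (cases "y \<le> 1/2")
    case True
    note 2
    also have "real m * pi * y \<le> real m * pi * (y * (2 * (1 - y)))"
      using True assms mult_left_mono[of 1 "2 * (1 - y)" y] by (intro mult_left_mono) auto
    also have "\<dots> = 2 * (real m * pi) * (y * (1 - y))" by (simp only: ac_simps)
    finally show ?thesis .
  next
    case False
    note 1
    also have "real m * pi * (1 - y) \<le> real m * pi * ((2 * y) * (1 - y))"
      using False assms mult_right_mono[of 1 "2 * y" "1 - y"] by (intro mult_left_mono) auto
    also have "\<dots> = 2 * (real m * pi) * (y * (1 - y))" by (simp only: ac_simps)
    finally show ?thesis .
  qed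
qed

lemma bump_sin_derivative:
  obtains C where "C \<ge> 0" "\<And>j y. 0 < y \<Longrightarrow> y < 1 \<Longrightarrow> norm (partial 1 (\<lambda>y. complex_of_real (bump j y) * complex_of_real (sin (real m * pi * y))) y) \<le> C"
    "\<And>y. 0 < y \<Longrightarrow> y < 1 \<Longrightarrow> (\<lambda>j. partial 1 (\<lambda>y. complex_of_real (bump j y) * complex_of_real (sin (real m * pi * y))) y) \<longlonglongrightarrow> of_real (real m * pi * cos (real m * pi * y))"
proof -
  obtain L where L: "L > 0" "\<And>t. \<bar>deriv step t\<bar> \<le> L" using deriv_step_bound by blast
  define M where "M = real m * pi"
  have M: "M \<ge> 0" by (simp add: M_def)
  have eq: "partial 1 (\<lambda>y. complex_of_real (bump j y) * complex_of_real (sin (real m * pi * y))) y =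
     of_real (deriv step (real j * (y * (1 - y))) * (real j * (1 - 2 * y)) * sin (M * y) + bump j y * (M * cos (M * y)))" for j y
    unfolding partial_mult[OF smooth_bump smooth_sin] partial_bump partial_sin M_def by simp
  show ?thesis
  proof (rule that[of "L * (4 * M) + M"])
    show "0 \<le> L * (4 * M) + M" using L M by simp
    fix y :: real assume y: "0 < y" "y < 1"
    show "norm (partial 1 (\<lambda>y. complex_of_real (bump j y) * complex_of_real (sin (real m * pi * y))) y) \<le> L * (4 * M) + M" for j
    proof -
      define t where "t = real j * (y * (1 - y))"
      have t0: "t \<ge> 0" using y by (simp add: t_def)
      have "\<bar>deriv step t * (real j * (1 - 2 * y)) * sin (M * y)\<bar> \<le> L * (4 * M)"
      proof (cases "1 \<le> t \<and> t \<le> 2")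
        case True
        have "\<bar>real j * (1 - 2 * y)\<bar> * \<bar>sin (M * y)\<bar> \<le> real j * (2 * M * (y * (1 - y)))"
        proof (intro mult_mono)
          show "\<bar>real j * (1 - 2 * y)\<bar> \<le> real j" using y by (simp add: abs_mult mult_left_le)
          show "\<bar>sin (M * y)\<bar> \<le> 2 * M * (y * (1 - y))" using sin_le_parabola[of y m] y by (simp add: M_def)
        qed auto
        also have "\<dots> = 2 * M * t" by (simp add: t_def)
        also have "\<dots> \<le> 2 * M * 2" using True M by (intro mult_left_mono) auto
        finally have "\<bar>real j * (1 - 2 * y)\<bar> * \<bar>sin (M * y)\<bar> \<le> 4 * M" by simp
        then have "\<bar>deriv step t\<bar> * (\<bar>real j * (1 - 2 * y)\<bar> * \<bar>sin (M * y)\<bar>) \<le> L * (4 * M)"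
          by (rule mult_mono[OF L(2)]) (use L in auto)
        then show ?thesis by (simp only: abs_mult mult.assoc)
      next
        case False
        then show ?thesis using deriv_step_eq_0 L M by simp
      qed
      moreover have "\<bar>bump j y * (M * cos (M * y))\<bar> \<le> 1 * (M * 1)"
        unfolding abs_mult using bump_bounds[of j y] M by (intro mult_mono) auto
      ultimately show ?thesis unfolding eq norm_of_real t_def[symmetric] by linarith
    qed
    have "\<forall>\<^sub>F j in sequentially. complex_of_real (M * cos (M * y)) = of_real (deriv step (real j * (y * (1 - y))) * (real j * (1 - 2 * y)) * sin (M * y) + bump j y * (M * cos (M * y)))"
      using bump_eventually[OF y]
    proof eventually_elim
      case (elim j)
      then have "deriv step (real j * (y * (1 - y))) = 0" "bump j y = 1" by (auto intro: deriv_step_eq_0 simp: bump_def step_eq_1)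
      then show ?case by simp
    qed
    then have "(\<lambda>j. complex_of_real (deriv step (real j * (y * (1 - y))) * (real j * (1 - 2 * y)) * sin (M * y) + bump j y * (M * cos (M * y)))) \<longlonglongrightarrow> of_real (M * cos (M * y))"
      by (rule Lim_transform_eventually[OF tendsto_const])
    then show "(\<lambda>j. partial 1 (\<lambda>y. complex_of_real (bump j y) * complex_of_real (sin (real m * pi * y))) y) \<longlonglongrightarrow> of_real (real m * pi * cos (real m * pi * y))"
      unfolding eq unfolding M_def .
  qed
qed

lemma bump_tendsto: "0 < y \<Longrightarrow> y < 1 \<Longrightarrow> (\<lambda>j. complex_of_real (bump j y) * z) \<longlonglongrightarrow> z"
proof -
  assume y: "0 < y" "y < 1"
  have "\<forall>\<^sub>F j in sequentially. z = complex_of_real (bump j y) * z"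
    using bump_eventually[OF y] by eventually_elim (simp add: bump_def step_eq_1)
  then show ?thesis by (rule Lim_transform_eventually[OF tendsto_const])
qed

text \<open>\<open>H\<close> vanishes off the layer, so the functions of the height have to be
  bounded and convergent only between 0 and 1, where the bumps behave well.\<close>

lemma layer_dominated_limit:
  fixes H :: "(real^2) \<times> real \<Rightarrow> complex"
  assumes H: "integrable lborel H" "\<And>z. z \<notin> layer \<Longrightarrow> H z = 0"
    and m: "\<And>j::nat. \<zeta> j \<in> borel_measurable borel" "\<zeta>' \<in> borel_measurable borel"
    and b: "\<And>j y. 0 < y \<Longrightarrow> y < 1 \<Longrightarrow> norm (\<zeta> j y) \<le> C"
    and lim: "\<And>y. 0 < y \<Longrightarrow> y < 1 \<Longrightarrow> (\<lambda>j. \<zeta> j y) \<longlonglongrightarrow> \<zeta>' y"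
  shows "(\<lambda>j. \<integral>z. H z * \<zeta> j (snd z) \<partial>lborel) \<longlonglongrightarrow> (\<integral>z. H z * \<zeta>' (snd z) \<partial>lborel)"
proof (rule integral_dominated_convergence)
  have Hm: "H \<in> borel_measurable borel" using H(1) by (auto dest: borel_measurable_integrable)
  have sm: "(\<lambda>z::(real^2) \<times> real. g (snd z)) \<in> borel_measurable borel" if "g \<in> borel_measurable borel" for g :: "real \<Rightarrow> complex"
    by (rule measurable_compose[OF borel_measurable_continuous_onI that]) (intro continuous_intros)
  show "(\<lambda>z. H z * \<zeta>' (snd z)) \<in> borel_measurable lborel" "(\<lambda>z. H z * \<zeta> j (snd z)) \<in> borel_measurable lborel" for j
    using Hm sm m by (auto intro!: borel_measurable_times)
  show "integrable lborel (\<lambda>z. norm (H z) * C)" using H(1) by (intro integrable_mult_left integrable_norm)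
  have cases: "H z = 0 \<or> 0 < snd z \<and> snd z < 1" for z using H(2)[of z] by (cases z) (auto simp: layer_def)
  show "AE z in lborel. (\<lambda>j. H z * \<zeta> j (snd z)) \<longlonglongrightarrow> H z * \<zeta>' (snd z)"
  proof (rule AE_I2)
    fix z
    show "(\<lambda>j. H z * \<zeta> j (snd z)) \<longlonglongrightarrow> H z * \<zeta>' (snd z)"
      using cases[of z]
    proof
      assume "0 < snd z \<and> snd z < 1"
      then show ?thesis by (intro tendsto_mult_left lim) auto
    qed simp
  qed
  show "AE z in lborel. norm (H z * \<zeta> j (snd z)) \<le> norm (H z) * C" for j
  proof (rule AE_I2)
    fix z
    show "norm (H z * \<zeta> j (snd z)) \<le> norm (H z) * C"
      using cases[of z]
    proof
      assume "0 < snd z \<and> snd z < 1"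
      then show ?thesis by (simp add: norm_mult mult_left_mono b)
    qed simp
  qed
qed

section \<open>Sine modes of functions on the layer\<close>

lemma norm_pair_layer: "z \<in> layer \<Longrightarrow> norm z \<le> norm (fst z) + 1"
  using norm_Pair_le[of "fst z" "snd z"] by (auto simp: layer_def)

lemma fst_measurable_borel [measurable]: "(fst :: (real^2) \<times> real \<Rightarrow> _) \<in> borel_measurable borel"
  and snd_measurable_borel [measurable]: "(snd :: (real^2) \<times> real \<Rightarrow> _) \<in> borel_measurable borel"
  by (auto intro!: borel_measurable_continuous_onI continuous_intros)

lemma test_function_measurable: "\<phi> \<in> test_functions S \<Longrightarrow> \<phi> \<in> borel_measurable borel"
  by (rule borel_measurable_continuous_onI[OF smooth_continuous[OF test_functions_smooth]])

lemma layer_integrable: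
  fixes g :: "(real^2) \<times> real \<Rightarrow> complex"
  assumes g: "g \<in> borel_measurable borel" "\<And>z. z \<notin> layer \<Longrightarrow> g z = 0"
    "\<And>R. integrable lborel (\<lambda>z. indicator (ball 0 R) z *\<^sub>R g z)"
    and \<phi>: "\<phi> \<in> test_functions UNIV" and c: "c \<in> borel_measurable borel" "\<And>y. 0 < y \<Longrightarrow> y < 1 \<Longrightarrow> norm (c y) \<le> C"
  shows "integrable lborel (\<lambda>z. g z * (\<phi> (fst z) * c (snd z)))"
proof -
  obtain K where K: "smooth \<phi>" "compact K" "\<And>x. x \<notin> K \<Longrightarrow> \<phi> x = 0" using \<phi> by (rule test_functionsE) blast
  obtain B where B: "B > 0" "\<And>x. norm (\<phi> x) \<le> B" using test_function_bounded[OF \<phi>] by blast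
  obtain R where R: "\<And>x. x \<in> K \<Longrightarrow> norm x \<le> R" using compact_imp_bounded[OF K(2)] bounded_iff by metis
  have [measurable]: "\<phi> \<in> borel_measurable borel" by (rule test_function_measurable[OF \<phi>])
  note [measurable] = g(1) c(1)
  have C: "C \<ge> 0" using c(2)[of "1/2"] norm_ge_zero[of "c (1/2)"] by (simp del: norm_ge_zero)
  show ?thesis
  \<comment> \<open>A point of the layer over \<open>K\<close> has norm at most
    \<open>R + 1\<close>; radius \<open>R + 2\<close> puts it inside the open ball.\<close>
  proof (rule Bochner_Integration.integrable_bound[OF integrable_mult_left[OF integrable_norm[OF g(3)[of "R + 2"]], of "B * C"]])
    show "(\<lambda>z. g z * (\<phi> (fst z) * c (snd z))) \<in> borel_measurable lborel" by measurable
    show "AE z in lborel. norm (g z * (\<phi> (fst z) * c (snd z))) \<le> norm (norm (indicator (ball 0 (R + 2)) z *\<^sub>R g z) * (B * C))"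
    proof (rule AE_I2)
      fix z :: "(real^2) \<times> real"
      show "norm (g z * (\<phi> (fst z) * c (snd z))) \<le> norm (norm (indicator (ball 0 (R + 2)) z *\<^sub>R g z) * (B * C))"
      proof (cases "z \<in> layer \<and> fst z \<in> K")
        case True
        then have "z \<in> ball 0 (R + 2)" using norm_pair_layer[of z] R[of "fst z"] by simp
        moreover have "norm (\<phi> (fst z)) * norm (c (snd z)) \<le> B * C"
          using True B C by (intro mult_mono c(2)) (auto simp: layer_def)
        ultimately show ?thesis using B C by (simp add: norm_mult abs_mult mult_left_mono)
      next
        case False
        then show ?thesis using g(2)[of z] K(3)[of "fst z"] by auto
      qed
    qed
  qed
qed

text \<open>Borel counterpart of \<open>mode\<close>: for functions that vanish off the layer the
  integral may run over the whole line, and it is measurable in \<open>x\<close> at every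
  point.\<close>

definition sine_mode :: "((real^2) \<times> real \<Rightarrow> complex) \<Rightarrow> nat \<Rightarrow> real^2 \<Rightarrow> complex" where
  "sine_mode g m x = 2 * (\<integral>y. g (x, y) * of_real (sin (real m * pi * y)) \<partial>lborel)"

lemma sine_mode_measurable:
  assumes [measurable]: "g \<in> borel_measurable borel"
  shows "sine_mode g m \<in> borel_measurable borel"
proof -
  have "(\<lambda>z. g z) \<in> borel_measurable (borel \<Otimes>\<^sub>M borel)" unfolding borel_prod by measurable
  then have [measurable]: "(\<lambda>(x, y). g (x, y)) \<in> borel_measurable (borel \<Otimes>\<^sub>M borel)" by simp
  show ?thesis unfolding sine_mode_def by measurable
qed

lemma sine_mode_integral:
  fixes g :: "(real^2) \<times> real \<Rightarrow> complex"
  assumes "integrable lborel (\<lambda>z. g z * (\<phi> (fst z) * of_real (sin (real m * pi * snd z))))"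
  shows "(\<integral>z. g z * (\<phi> (fst z) * of_real (sin (real m * pi * snd z))) \<partial>lborel) = (\<integral>x. sine_mode g m x * \<phi> x \<partial>lborel) / 2"
    "integrable lborel (\<lambda>x. sine_mode g m x * \<phi> x)"
proof -
  have i: "integrable (lborel \<Otimes>\<^sub>M lborel) (\<lambda>z. g z * (\<phi> (fst z) * of_real (sin (real m * pi * snd z))))"
    using assms by (simp add: lborel_prod)
  have e: "(\<integral>y. g (x, y) * (\<phi> x * of_real (sin (real m * pi * y))) \<partial>lborel) = sine_mode g m x * \<phi> x / 2" for x
  proof -
    have "(\<lambda>y. g (x, y) * (\<phi> x * of_real (sin (real m * pi * y)))) = (\<lambda>y. g (x, y) * of_real (sin (real m * pi * y)) * \<phi> x)"
      by (simp add: fun_eq_iff ac_simps)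
    then show ?thesis by (simp add: sine_mode_def integral_mult_left_zero)
  qed
  show "(\<integral>z. g z * (\<phi> (fst z) * of_real (sin (real m * pi * snd z))) \<partial>lborel) = (\<integral>x. sine_mode g m x * \<phi> x \<partial>lborel) / 2"
    using lborel_pair.integral_fst'[OF i] by (simp add: e lborel_prod)
  have "integrable lborel (\<lambda>x. sine_mode g m x * \<phi> x / 2)"
    using lborel_pair.integrable_fst'[OF i] by (simp add: e)
  then have "integrable lborel (\<lambda>x. 2 * (sine_mode g m x * \<phi> x / 2))" by (rule integrable_mult_right)
  then show "integrable lborel (\<lambda>x. sine_mode g m x * \<phi> x)" by simp
qed

lemma L2_limit_integral:
  fixes d :: "nat \<Rightarrow> 'a \<Rightarrow> complex" and \<psi> :: "'a \<Rightarrow> complex"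
  assumes d: "\<And>n. integrable M (\<lambda>z. (norm (d n z))\<^sup>2)" "(\<lambda>n. \<integral>z. (norm (d n z))\<^sup>2 \<partial>M) \<longlonglongrightarrow> 0"
    and \<psi>: "integrable M (\<lambda>z. (norm (\<psi> z))\<^sup>2)"
  shows "(\<lambda>n. \<integral>z. d n z * \<psi> z \<partial>M) \<longlonglongrightarrow> 0"
proof (rule LIMSEQ_I)
  fix e :: real assume e: "e > 0"
  define P where "P = (\<integral>z. (norm (\<psi> z))\<^sup>2 \<partial>M)"
  have P: "P \<ge> 0" by (simp add: P_def)
  \<comment> \<open>Young's inequality with weight \<open>t\<close>: the fixed function contributes
    less than \<open>e / 2\<close>, the vanishing sequence the rest.\<close>
  define t where "t = e / (2 * (P + 1))"
  have t: "t > 0" "t * P < e / 2 + 0 * P" using e P by (auto simp: t_def field_simps)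
  have bound: "norm (\<integral>z. d n z * \<psi> z \<partial>M) \<le> t * P + (\<integral>z. (norm (d n z))\<^sup>2 \<partial>M) / (4 * t)" for n
  proof -
    have i: "integrable M (\<lambda>z. t * (norm (\<psi> z))\<^sup>2)" "integrable M (\<lambda>z. (norm (d n z))\<^sup>2 / (4 * t))" using d \<psi> by auto
    have "norm (\<integral>z. d n z * \<psi> z \<partial>M) \<le> (\<integral>z. t * (norm (\<psi> z))\<^sup>2 + (norm (d n z))\<^sup>2 / (4 * t) \<partial>M)"
    proof (rule norm_integral_le[OF Bochner_Integration.integrable_add[OF i]], rule AE_I2)
      fix z
      have "0 \<le> (2 * t * norm (\<psi> z) - norm (d n z))\<^sup>2 / (4 * t)" using t by simp
      also have "\<dots> = t * (norm (\<psi> z))\<^sup>2 + (norm (d n z))\<^sup>2 / (4 * t) - norm (d n z) * norm (\<psi> z)"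
        using t by (simp add: power2_diff field_simps power2_eq_square)
      finally show "norm (d n z * \<psi> z) \<le> t * (norm (\<psi> z))\<^sup>2 + (norm (d n z))\<^sup>2 / (4 * t)" by (simp add: norm_mult)
    qed
    then show ?thesis using i by (simp add: P_def)
  qed
  have "2 * e * t > 0" using e t by simp
  then obtain N where N: "\<And>n. n \<ge> N \<Longrightarrow> (\<integral>z. (norm (d n z))\<^sup>2 \<partial>M) < 2 * e * t"
    using order_tendstoD(2)[OF d(2)] unfolding eventually_sequentially by blast
  show "\<exists>no. \<forall>n\<ge>no. norm ((\<integral>z. d n z * \<psi> z \<partial>M) - 0) < e"
  proof (intro exI[of _ N] allI impI)
    fix n assume "N \<le> n"
    then have "(\<integral>z. (norm (d n z))\<^sup>2 \<partial>M) / (4 * t) < e / 2" using N[of n] t by (simp add: divide_less_eq)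
    then show "norm ((\<integral>z. d n z * \<psi> z \<partial>M) - 0) < e" using bound[of n] t by simp
  qed
qed

text \<open>\<open>F\<close> stands for \<open>V * u\<close>. The identity \<open>boundary\<close>
  is the form in which the Dirichlet condition enters the separation: partial integration in
  \<open>y\<close> against a cosine produces no boundary term.\<close>

locale layer_solution =
  fixes k :: real and U F :: "(real^2) \<times> real \<Rightarrow> complex" and D :: "(real^2) \<times> real \<Rightarrow> (real^2) \<times> real \<Rightarrow> complex"
  assumes U_m: "U \<in> borel_measurable borel" and U_0: "\<And>z. z \<notin> layer \<Longrightarrow> U z = 0"
    and U_loc: "\<And>R. integrable lborel (\<lambda>z. indicator (ball 0 R) z *\<^sub>R U z)"
    and D_m: "\<And>b. b \<in> Basis \<Longrightarrow> D b \<in> borel_measurable borel" and D_0: "\<And>b z. b \<in> Basis \<Longrightarrow> z \<notin> layer \<Longrightarrow> D b z = 0"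
    and D_loc: "\<And>b R. b \<in> Basis \<Longrightarrow> integrable lborel (\<lambda>z. indicator (ball 0 R) z *\<^sub>R D b z)"
    and F_m: "F \<in> borel_measurable borel" and F_0: "\<And>z. z \<notin> layer \<Longrightarrow> F z = 0" and F_int: "integrable lborel F"
    and weak_D: "\<And>b \<phi>. b \<in> Basis \<Longrightarrow> \<phi> \<in> test_functions layer \<Longrightarrow> (\<integral>z. U z * partial b \<phi> z \<partial>lborel) = - (\<integral>z. D b z * \<phi> z \<partial>lborel)"
    and weak_eq: "\<And>\<phi>. \<phi> \<in> test_functions layer \<Longrightarrow>
      (\<Sum>b\<in>Basis. \<integral>z. D b z * partial b \<phi> z \<partial>lborel) = of_real k * (\<integral>z. U z * \<phi> z \<partial>lborel) + (\<integral>z. F z * \<phi> z \<partial>lborel)"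
    and boundary: "\<And>m \<phi>. \<phi> \<in> test_functions UNIV \<Longrightarrow>
      (\<integral>z. D (0, 1) z * (\<phi> (fst z) * of_real (cos (real m * pi * snd z))) \<partial>lborel) =
      of_real (real m * pi) * (\<integral>z. U z * (\<phi> (fst z) * of_real (sin (real m * pi * snd z))) \<partial>lborel)"
begin

lemma F_loc: "integrable lborel (\<lambda>z. indicator (ball 0 R) z *\<^sub>R F z)"
  using F_int by (intro integrable_mult_indicator) auto

lemma Basis_pair [simp]: "b \<in> Basis \<Longrightarrow> (b, 0::real) \<in> Basis" "(0::real^2, 1::real) \<in> Basis"
  by (auto simp: Basis_prod_def)

lemma bump_limit:
  assumes "g \<in> borel_measurable borel" "\<And>z. z \<notin> layer \<Longrightarrow> g z = 0"
    "\<And>R. integrable lborel (\<lambda>z. indicator (ball 0 R) z *\<^sub>R g z)" "\<phi> \<in> test_functions UNIV"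
  shows "(\<lambda>j. \<integral>z. g z * (\<phi> (fst z) * (of_real (bump j (snd z)) * of_real (sin (real m * pi * snd z)))) \<partial>lborel)
    \<longlonglongrightarrow> (\<integral>z. g z * (\<phi> (fst z) * of_real (sin (real m * pi * snd z))) \<partial>lborel)"
proof -
  have H: "integrable lborel (\<lambda>z. g z * (\<phi> (fst z) * 1))"
    by (rule layer_integrable[OF assms, of "\<lambda>_. 1" 1]) auto
  have "(\<lambda>j. \<integral>z. g z * (\<phi> (fst z) * 1) * (of_real (bump j (snd z)) * of_real (sin (real m * pi * snd z))) \<partial>lborel)
    \<longlonglongrightarrow> (\<integral>z. g z * (\<phi> (fst z) * 1) * of_real (sin (real m * pi * snd z)) \<partial>lborel)"
  proof (rule layer_dominated_limit[OF H, where C=1])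
    have bm: "(\<lambda>y. complex_of_real (bump j y)) \<in> borel_measurable borel" for j
      by (rule borel_measurable_continuous_onI[OF smooth_continuous[OF smooth_bump]])
    then show "(\<lambda>y. complex_of_real (bump j y) * of_real (sin (real m * pi * y))) \<in> borel_measurable borel" for j by measurable
    show "norm (complex_of_real (bump j y) * of_real (sin (real m * pi * y))) \<le> 1" for j y
      using mult_mono[of "\<bar>bump j y\<bar>" 1 "\<bar>sin (real m * pi * y)\<bar>" 1] bump_bounds[of j y] by (simp add: norm_mult)
  qed (use assms(2) bump_tendsto in auto)
  then show ?thesis by (simp add: mult.assoc)
qed

text \<open>The product of \<open>\<phi>\<close> and the sine need not have compact support in the
  open layer, so the sine is first damped by \<open>bump j\<close>. The derivative is horizontal and
  does not fall on the bump.\<close>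

lemma separated_derivative:
  assumes b: "b \<in> Basis" and \<phi>: "\<phi> \<in> test_functions UNIV"
  shows "(\<integral>z. U z * (partial b \<phi> (fst z) * of_real (sin (real m * pi * snd z))) \<partial>lborel) =
    - (\<integral>z. D (b, 0) z * (\<phi> (fst z) * of_real (sin (real m * pi * snd z))) \<partial>lborel)"
proof -
  let ?\<zeta> = "\<lambda>j y. complex_of_real (bump j y) * complex_of_real (sin (real m * pi * y))"
  have \<zeta>: "?\<zeta> j \<in> test_functions {0<..<1}" for j by (rule bump_test[OF smooth_sin])
  have "(\<lambda>z. \<phi> (fst z) * ?\<zeta> j (snd z)) \<in> test_functions layer" for j
    unfolding layer_def by (rule test_functions_Times[OF \<phi> \<zeta>])
  from weak_D[OF _ this, of "(b, 0)"]
  have "(\<integral>z. U z * (partial b \<phi> (fst z) * ?\<zeta> j (snd z)) \<partial>lborel) = - (\<integral>z. D (b, 0) z * (\<phi> (fst z) * ?\<zeta> j (snd z)) \<partial>lborel)" for j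
    unfolding partial_Times[OF test_functions_smooth[OF \<phi>] test_functions_smooth[OF \<zeta>]] partial_0[OF test_functions_smooth[OF \<zeta>]]
    using b by simp
  moreover have "(\<lambda>j. \<integral>z. U z * (partial b \<phi> (fst z) * ?\<zeta> j (snd z)) \<partial>lborel) \<longlonglongrightarrow> (\<integral>z. U z * (partial b \<phi> (fst z) * of_real (sin (real m * pi * snd z))) \<partial>lborel)"
    by (rule bump_limit[OF U_m U_0 U_loc test_functions_partial[OF \<phi> b]])
  moreover have "(\<lambda>j. - (\<integral>z. D (b, 0) z * (\<phi> (fst z) * ?\<zeta> j (snd z)) \<partial>lborel)) \<longlonglongrightarrow> - (\<integral>z. D (b, 0) z * (\<phi> (fst z) * of_real (sin (real m * pi * snd z))) \<partial>lborel)"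
    using b by (intro tendsto_minus bump_limit D_m D_0 D_loc \<phi>) auto
  ultimately show ?thesis by (simp only:) (rule LIMSEQ_unique)
qed

text \<open>Here the vertical derivative does fall on the bump, but the damped sines have bounded
  derivatives that converge to that of the sine. The cosine so obtained is turned back into a sine
  by \<open>boundary\<close>, which produces the eigenvalue \<open>(m * pi)^2\<close>.\<close>

lemma separated_equation:
  assumes \<phi>: "\<phi> \<in> test_functions UNIV"
  shows "(\<Sum>b\<in>Basis. \<integral>z. D (b, 0) z * (partial b \<phi> (fst z) * of_real (sin (real m * pi * snd z))) \<partial>lborel)
      + of_real ((real m * pi)\<^sup>2) * (\<integral>z. U z * (\<phi> (fst z) * of_real (sin (real m * pi * snd z))) \<partial>lborel) =
     of_real k * (\<integral>z. U z * (\<phi> (fst z) * of_real (sin (real m * pi * snd z))) \<partial>lborel)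
      + (\<integral>z. F z * (\<phi> (fst z) * of_real (sin (real m * pi * snd z))) \<partial>lborel)"
proof -
  let ?\<zeta> = "\<lambda>j y. complex_of_real (bump j y) * complex_of_real (sin (real m * pi * y))"
  let ?s = "\<lambda>y. complex_of_real (sin (real m * pi * y))"
  have \<zeta>: "?\<zeta> j \<in> test_functions {0<..<1}" for j by (rule bump_test[OF smooth_sin])
  have t: "(\<lambda>z. \<phi> (fst z) * ?\<zeta> j (snd z)) \<in> test_functions layer" for j
    unfolding layer_def by (rule test_functions_Times[OF \<phi> \<zeta>])
  have p: "partial (b, y) (\<lambda>z. \<phi> (fst z) * ?\<zeta> j (snd z)) z = partial b \<phi> (fst z) * ?\<zeta> j (snd z) + \<phi> (fst z) * partial y (?\<zeta> j) (snd z)" for b y j z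
    by (rule partial_Times[OF test_functions_smooth[OF \<phi>] test_functions_smooth[OF \<zeta>]])
  have eq: "(\<Sum>b\<in>Basis. \<integral>z. D (b, 0) z * (partial b \<phi> (fst z) * ?\<zeta> j (snd z)) \<partial>lborel) + (\<integral>z. D (0, 1) z * (\<phi> (fst z) * 1) * partial 1 (?\<zeta> j) (snd z) \<partial>lborel) =
     of_real k * (\<integral>z. U z * (\<phi> (fst z) * ?\<zeta> j (snd z)) \<partial>lborel) + (\<integral>z. F z * (\<phi> (fst z) * ?\<zeta> j (snd z)) \<partial>lborel)" for j
    using weak_eq[OF t[of j]] unfolding sum_Basis_prod p partial_0[OF test_functions_smooth[OF \<zeta>]] partial_0[OF test_functions_smooth[OF \<phi>]]
    by (simp add: mult.assoc)
  obtain C where C: "C \<ge> 0" "\<And>j y. 0 < y \<Longrightarrow> y < 1 \<Longrightarrow> norm (partial 1 (?\<zeta> j) y) \<le> C"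
    "\<And>y. 0 < y \<Longrightarrow> y < 1 \<Longrightarrow> (\<lambda>j. partial 1 (?\<zeta> j) y) \<longlonglongrightarrow> of_real (real m * pi * cos (real m * pi * y))"
    using bump_sin_derivative[of m] by blast
  have H: "integrable lborel (\<lambda>z. D (0, 1) z * (\<phi> (fst z) * 1))"
    by (rule layer_integrable[OF _ _ _ \<phi>, of _ "\<lambda>_. 1" 1]) (auto intro: D_m D_0 D_loc)
  have "(\<lambda>j. \<integral>z. D (0, 1) z * (\<phi> (fst z) * 1) * partial 1 (?\<zeta> j) (snd z) \<partial>lborel) \<longlonglongrightarrow>
     (\<integral>z. D (0, 1) z * (\<phi> (fst z) * 1) * of_real (real m * pi * cos (real m * pi * snd z)) \<partial>lborel)"
  proof (rule layer_dominated_limit[OF H, where C=C])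
    show "partial 1 (?\<zeta> j) \<in> borel_measurable borel" for j
      by (rule borel_measurable_continuous_onI[OF smooth_continuous[OF smooth_partial[OF test_functions_smooth[OF \<zeta>]]]]) simp
  qed (use C D_0 in auto)
  also have "(\<integral>z. D (0, 1) z * (\<phi> (fst z) * 1) * of_real (real m * pi * cos (real m * pi * snd z)) \<partial>lborel) =
     of_real (real m * pi) * (\<integral>z. D (0, 1) z * (\<phi> (fst z) * of_real (cos (real m * pi * snd z))) \<partial>lborel)"
    by (subst integral_mult_right_zero[symmetric]) (simp add: ac_simps)
  also have "\<dots> = of_real ((real m * pi)\<^sup>2) * (\<integral>z. U z * (\<phi> (fst z) * ?s (snd z)) \<partial>lborel)"
    unfolding boundary[OF \<phi>] by (simp add: power2_eq_square)
  finally have l2: "(\<lambda>j. \<integral>z. D (0, 1) z * (\<phi> (fst z) * 1) * partial 1 (?\<zeta> j) (snd z) \<partial>lborel) \<longlonglongrightarrow> \<dots>" .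
  have l1: "(\<lambda>j. \<Sum>b\<in>Basis. \<integral>z. D (b, 0) z * (partial b \<phi> (fst z) * ?\<zeta> j (snd z)) \<partial>lborel) \<longlonglongrightarrow>
     (\<Sum>b\<in>Basis. \<integral>z. D (b, 0) z * (partial b \<phi> (fst z) * ?s (snd z)) \<partial>lborel)"
    by (intro tendsto_sum bump_limit D_m D_0 D_loc test_functions_partial \<phi>) auto
  have l3: "(\<lambda>j. of_real k * (\<integral>z. U z * (\<phi> (fst z) * ?\<zeta> j (snd z)) \<partial>lborel) + (\<integral>z. F z * (\<phi> (fst z) * ?\<zeta> j (snd z)) \<partial>lborel)) \<longlonglongrightarrow>
     of_real k * (\<integral>z. U z * (\<phi> (fst z) * ?s (snd z)) \<partial>lborel) + (\<integral>z. F z * (\<phi> (fst z) * ?s (snd z)) \<partial>lborel)"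
    by (intro tendsto_intros bump_limit U_m U_0 U_loc F_m F_0 F_loc \<phi>)
  show ?thesis using LIMSEQ_unique[OF tendsto_add[OF l1 l2]] l3 unfolding eq by blast
qed

lemma sin_integrable:
  assumes "g \<in> borel_measurable borel" "\<And>z. z \<notin> layer \<Longrightarrow> g z = 0"
    "\<And>R. integrable lborel (\<lambda>z. indicator (ball 0 R) z *\<^sub>R g z)" "\<phi> \<in> test_functions UNIV"
  shows "integrable lborel (\<lambda>z. g z * (\<phi> (fst z) * of_real (sin (real m * pi * snd z))))"
  by (rule layer_integrable[OF assms, of "\<lambda>y. of_real (sin (real m * pi * y))" 1]) auto

lemma mode_derivative:
  assumes b: "b \<in> Basis" and \<phi>: "\<phi> \<in> test_functions UNIV"
  shows "(\<integral>x. sine_mode U m x * partial b \<phi> x \<partial>lborel) = - (\<integral>x. sine_mode (D (b, 0)) m x * \<phi> x \<partial>lborel)"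
  using separated_derivative[OF b \<phi>, of m]
    sine_mode_integral(1)[OF sin_integrable[OF U_m U_0 U_loc test_functions_partial[OF \<phi> b]], of m]
    sine_mode_integral(1)[OF sin_integrable[OF D_m D_0 D_loc \<phi>], of "(b, 0)" m] b by simp

lemma mode_equation:
  assumes \<phi>: "\<phi> \<in> test_functions UNIV"
  shows "(\<Sum>b\<in>Basis. \<integral>x. sine_mode (D (b, 0)) m x * partial b \<phi> x \<partial>lborel) + of_real ((real m)\<^sup>2 * pi\<^sup>2 - k) * (\<integral>x. sine_mode U m x * \<phi> x \<partial>lborel) =
     (\<integral>x. sine_mode F m x * \<phi> x \<partial>lborel)"
proof -
  have 1: "(\<integral>z. D (b, 0) z * (partial b \<phi> (fst z) * of_real (sin (real m * pi * snd z))) \<partial>lborel) = (\<integral>x. sine_mode (D (b, 0)) m x * partial b \<phi> x \<partial>lborel) / 2" if "b \<in> Basis" for b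
    by (rule sine_mode_integral(1)[OF sin_integrable]) (use that in \<open>auto intro: D_m D_0 D_loc test_functions_partial \<phi>\<close>)
  have 2: "(\<Sum>b\<in>Basis. \<integral>z. D (b, 0) z * (partial b \<phi> (fst z) * of_real (sin (real m * pi * snd z))) \<partial>lborel) = (\<Sum>b\<in>Basis. \<integral>x. sine_mode (D (b, 0)) m x * partial b \<phi> x \<partial>lborel) / 2"
    unfolding sum_divide_distrib by (intro sum.cong refl 1)
  have 3: "(\<integral>z. U z * (\<phi> (fst z) * of_real (sin (real m * pi * snd z))) \<partial>lborel) = (\<integral>x. sine_mode U m x * \<phi> x \<partial>lborel) / 2"
    by (rule sine_mode_integral(1)[OF sin_integrable[OF U_m U_0 U_loc \<phi>]])
  have 4: "(\<integral>z. F z * (\<phi> (fst z) * of_real (sin (real m * pi * snd z))) \<partial>lborel) = (\<integral>x. sine_mode F m x * \<phi> x \<partial>lborel) / 2"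
    by (rule sine_mode_integral(1)[OF sin_integrable[OF F_m F_0 F_loc \<phi>]])
  \<comment> \<open>Clears the factors \<open>1/2\<close> left by the normalisation of the
    modes.\<close>
  have "s + (M - k') * x = y" if "s / 2 + M * (x / 2) = k' * (x / 2) + y / 2" for s M k' x y :: complex
  proof -
    have "(s + (M - k') * x - y) / 2 = (s / 2 + M * (x / 2)) - (k' * (x / 2) + y / 2)" by (simp add: field_simps)
    then show ?thesis unfolding that by simp
  qed
  from this[OF separated_equation[OF \<phi>, of m, unfolded 2 3 4]]
  show ?thesis by (simp add: power_mult_distrib)
qed

end

section \<open>Local square integrability and the Dirichlet condition\<close>

lemma local_integrable_mult:
  fixes g \<phi> :: "'a::euclidean_space \<Rightarrow> complex"
  assumes g: "\<And>R. integrable lborel (\<lambda>x. indicator (ball 0 R) x *\<^sub>R g x)" "g \<in> borel_measurable borel"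
    and \<phi>: "\<phi> \<in> test_functions U"
  shows "integrable lborel (\<lambda>x. g x * \<phi> x)"
proof -
  obtain B where B: "B > 0" "\<And>x. norm (\<phi> x) \<le> B" using test_function_bounded[OF \<phi>] by metis
  obtain K where K: "compact K" "\<And>x. x \<notin> K \<Longrightarrow> \<phi> x = 0" using \<phi> by (rule test_functionsE) blast
  obtain R where R: "\<And>x. x \<in> K \<Longrightarrow> norm x \<le> R" using compact_imp_bounded[OF K(1)] bounded_iff by metis
  have m: "\<phi> \<in> borel_measurable borel" by (rule test_function_measurable[OF \<phi>])
  show ?thesis
  proof (rule Bochner_Integration.integrable_bound[OF integrable_mult_left[OF integrable_norm[OF g(1)[of "R + 1"]], of B]])
    show "AE x in lborel. norm (g x * \<phi> x) \<le> norm (norm (indicator (ball 0 (R + 1)) x *\<^sub>R g x) * B)"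
    proof (rule AE_I2)
      fix x
      show "norm (g x * \<phi> x) \<le> norm (norm (indicator (ball 0 (R + 1)) x *\<^sub>R g x) * B)"
      proof (cases "x \<in> K")
        case True
        then have "x \<in> ball 0 (R + 1)" using R[of x] by simp
        then show ?thesis using B by (simp add: norm_mult abs_mult mult_left_mono)
      qed (simp add: K)
    qed
  qed (use g m in auto)
qed

lemma AE_lebesgue_on_borel:
  fixes S :: "'a::euclidean_space set"
  assumes "S \<in> sets borel"
  shows "(AE x in lebesgue_on S. P x) \<longleftrightarrow> (AE x in lborel. x \<in> S \<longrightarrow> P x)"
  using assms by (simp add: AE_restrict_space_iff AE_completion_iff)

lemma rep_square_integrable:
  fixes g g' :: "'a::euclidean_space \<Rightarrow> complex"
  assumes S: "S \<in> sets borel" and g': "g' \<in> borel_measurable borel" "\<And>x. x \<notin> S \<Longrightarrow> g' x = 0"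
    and ae: "AE x in lborel. x \<in> S \<longrightarrow> g x = g' x" and B: "B \<in> sets borel" and L2: "g \<in> L2 (S \<inter> B)"
  shows "integrable lborel (\<lambda>x. indicator B x *\<^sub>R (norm (g' x))\<^sup>2)"
proof -
  have "integrable (lebesgue_on (S \<inter> B)) (\<lambda>x. (norm (g x))\<^sup>2)" using L2 by (simp add: L2_def)
  moreover have "integrable (lebesgue_on (S \<inter> B)) (\<lambda>x. (norm (g x))\<^sup>2) \<longleftrightarrow> integrable lborel (\<lambda>x. indicator B x *\<^sub>R (norm (g' x))\<^sup>2)"
  proof (rule integral_lebesgue_rep(2))
    show "(\<lambda>x. indicator B x *\<^sub>R (norm (g' x))\<^sup>2) \<in> borel_measurable borel" using g'(1) B by measurable
    show "AE x in lborel. x \<in> S \<inter> B \<longrightarrow> (norm (g x))\<^sup>2 = indicator B x *\<^sub>R (norm (g' x))\<^sup>2"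
      using ae by eventually_elim auto
  qed (use S B g'(2) in \<open>auto simp: indicator_def\<close>)
  ultimately show ?thesis by simp
qed

lemma local_square_integrable_imp:
  fixes g :: "'a::euclidean_space \<Rightarrow> complex"
  assumes "integrable lborel (\<lambda>x. indicator (ball 0 R) x *\<^sub>R (norm (g x))\<^sup>2)" "g \<in> borel_measurable borel"
  shows "integrable lborel (\<lambda>x. indicator (ball 0 R) x *\<^sub>R g x)"
proof (rule Bochner_Integration.integrable_bound)
  have "integrable lborel (indicator (ball (0::'a) R) :: 'a \<Rightarrow> real)"
    using emeasure_bounded_finite[OF bounded_ball, of "0::'a" R] by simp
  then show "integrable lborel (\<lambda>x. indicator (ball 0 R) x + indicator (ball 0 R) x *\<^sub>R (norm (g x))\<^sup>2)"
    using assms(1) by (rule Bochner_Integration.integrable_add)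
  have n: "norm z \<le> 1 + (norm z)\<^sup>2" for z :: complex
  proof -
    have "0 \<le> (norm z - 1)\<^sup>2" by simp
    then have "2 * norm z \<le> 1 + (norm z)\<^sup>2" by (simp add: power2_diff)
    then show ?thesis using norm_ge_zero[of z] by linarith
  qed
  show "AE x in lborel. norm (indicator (ball 0 R) x *\<^sub>R g x) \<le> norm (indicator (ball 0 R) x + indicator (ball 0 R) x *\<^sub>R (norm (g x))\<^sup>2)"
    using n by (intro AE_I2) (auto simp: indicator_def abs_of_nonneg add_nonneg_nonneg)
  have [measurable]: "ball (0::'a) R \<in> sets borel" by simp
  note [measurable] = assms(2)
  show "(\<lambda>x. indicator (ball 0 R) x *\<^sub>R g x) \<in> borel_measurable lborel" by measurable
qed

lemma test_functions_layer_0: "\<phi> \<in> test_functions U \<Longrightarrow> z \<notin> U \<Longrightarrow> \<phi> z = 0" "\<phi> \<in> test_functions U \<Longrightarrow> z \<notin> U \<Longrightarrow> partial b \<phi> z = 0"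
  by (erule test_functionsE, blast)+

lemma test_function_integrable:
  assumes "\<phi> \<in> test_functions U" shows "integrable lborel \<phi>"
proof -
  obtain K where K: "smooth \<phi>" "compact K" "\<And>x. x \<notin> K \<Longrightarrow> \<phi> x = 0" using assms by (rule test_functionsE) blast
  show ?thesis by (rule compact_support_integrable[OF smooth_continuous[OF K(1)] K(2,3)])
qed

text \<open>Only here the boundary condition enters.  The weak derivative of the truncation is compared with that of the
  solution by testing with functions supported in the layer, so its uniqueness is not needed.\<close>

lemma boundary_identity:
  assumes zb: "zero_on_boundary layer u"
    and U: "U \<in> borel_measurable borel" "\<And>z. z \<notin> layer \<Longrightarrow> U z = 0" "AE z in lborel. z \<in> layer \<longrightarrow> u z = U z"
      "\<And>R. integrable lborel (\<lambda>z. indicator (ball 0 R) z *\<^sub>R U z)"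
    and Y: "Y \<in> borel_measurable borel" "\<And>z. z \<notin> layer \<Longrightarrow> Y z = 0" "\<And>R. integrable lborel (\<lambda>z. indicator (ball 0 R) z *\<^sub>R Y z)"
    and weak: "\<And>\<phi>. \<phi> \<in> test_functions layer \<Longrightarrow> (\<integral>z. U z * partial (0, 1) \<phi> z \<partial>lborel) = - (\<integral>z. Y z * \<phi> z \<partial>lborel)"
    and \<phi>: "\<phi> \<in> test_functions UNIV"
  shows "(\<integral>z. Y z * (\<phi> (fst z) * of_real (cos (a * snd z))) \<partial>lborel) = of_real a * (\<integral>z. U z * (\<phi> (fst z) * of_real (sin (a * snd z))) \<partial>lborel)"
proof -
  let ?e = "(0, 1) :: (real^2) \<times> real"
  have eB: "?e \<in> Basis" by (auto simp: Basis_prod_def)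
  obtain K where K: "compact K" "\<And>x. x \<notin> K \<Longrightarrow> \<phi> x = 0" using \<phi> by (rule test_functionsE) blast
  obtain R0 where R0: "\<And>x. x \<in> K \<Longrightarrow> norm x \<le> R0" using compact_imp_bounded[OF K(1)] bounded_iff by metis
  define R where "R = \<bar>R0\<bar> + 1"
  have R: "R > 0" by (simp add: R_def)
  \<comment> \<open>\<open>R\<close> is large enough for the cut-off to be 1 on the part of the
    layer over the support of \<open>\<phi>\<close>, where truncation therefore changes
    nothing.\<close>
  let ?\<eta> = "cutoff R :: (real^2) \<times> real \<Rightarrow> complex"
  have \<eta>: "?\<eta> \<in> test_functions UNIV" by (rule cutoff_test[OF R])
  have \<eta>1: "?\<eta> z = 1" if "z \<in> layer" "\<phi> (fst z) \<noteq> 0" for z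
  proof (rule cutoff_eq_1[OF R])
    have "norm z \<le> norm (fst z) + 1" by (rule norm_pair_layer[OF that(1)])
    also have "norm (fst z) \<le> R0" using that(2) K(2) R0 by blast
    finally show "norm z \<le> R" by (simp add: R_def)
  qed
  define v where "v z = ?\<eta> z * u z" for z
  define Vy where "Vy = weak_partial layer ?e v"
  have "v \<in> H1_0 layer" using zb \<eta> unfolding zero_on_boundary_def v_def by blast
  then obtain \<Phi> :: "nat \<Rightarrow> (real^2) \<times> real \<Rightarrow> complex" where v: "v \<in> H1 layer" and \<Phi>: "\<And>n. \<Phi> n \<in> test_functions layer"
    and l0: "(\<lambda>n. LINT z|lebesgue_on layer. (norm (\<Phi> n z - v z))\<^sup>2) \<longlonglongrightarrow> 0"
    and l1: "(\<lambda>n. LINT z|lebesgue_on layer. (norm (partial ?e (\<Phi> n) z - Vy z))\<^sup>2) \<longlonglongrightarrow> 0"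
    using eB unfolding H1_0_def Vy_def by blast
  have vL2: "v \<in> L2 layer" and VyL2: "Vy \<in> L2 layer" and "\<exists>g. has_weak_partial layer ?e v g"
    using v eB unfolding H1_def weakly_differentiable_def Vy_def by auto
  then have hw: "has_weak_partial layer ?e v Vy" unfolding Vy_def weak_partial_def using someI_ex by metis
  define v' where "v' z = ?\<eta> z * U z" for z
  have \<eta>m [measurable]: "?\<eta> \<in> borel_measurable borel" by (rule test_function_measurable[OF \<eta>])
  note [measurable] = U(1) Y(1)
  have v'm [measurable]: "v' \<in> borel_measurable borel" unfolding v'_def by measurable
  have v'0: "v' z = 0" if "z \<notin> layer" for z using U(2)[OF that] by (simp add: v'_def)
  have v'ae: "AE z in lborel. z \<in> layer \<longrightarrow> v z = v' z" using U(3) by eventually_elim (simp add: v_def v'_def)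
  have Vym: "Vy \<in> borel_measurable (lebesgue_on layer)" using VyL2 by (simp add: L2_def)
  obtain y' where y'm [measurable]: "y' \<in> borel_measurable borel" and y'0: "\<And>z. z \<notin> layer \<Longrightarrow> y' z = 0" and y'ae: "AE z in lborel. z \<in> layer \<longrightarrow> Vy z = y' z"
    by (rule borel_rep_on[OF layer_borel Vym]) blast
  have v'2: "integrable lborel (\<lambda>z. (norm (v' z))\<^sup>2)"
    using rep_square_integrable[OF layer_borel v'm v'0 v'ae, of UNIV] vL2 by simp
  have y'2: "integrable lborel (\<lambda>z. (norm (y' z))\<^sup>2)"
    using rep_square_integrable[OF layer_borel y'm y'0 y'ae, of UNIV] VyL2 by simp
  have \<phi>m [measurable]: "\<phi> \<in> borel_measurable borel" by (rule test_function_measurable[OF \<phi>])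
  have sm: "smooth (\<lambda>z. \<phi> (fst z) * of_real (cos (a * snd z)))" for a
    by (intro smooth_mult smooth_compose_linear[OF test_functions_smooth[OF \<phi>] bounded_linear_fst] smooth_compose_linear[OF smooth_cos bounded_linear_snd])
  \<comment> \<open>Boundedness and bounded support make this square integrable, so it can be paired
    with the limits in square mean of the approximants.\<close>
  define \<psi> where "\<psi> h z = (if z \<in> layer then \<phi> (fst z) * of_real (h (a * snd z)) else 0)" for h :: "real \<Rightarrow> real" and z
  have \<psi>2: "integrable lborel (\<lambda>z. (norm (\<psi> h z))\<^sup>2)" "\<psi> h \<in> borel_measurable borel" if h: "h \<in> borel_measurable borel" "\<And>t. \<bar>h t\<bar> \<le> 1" for h
  proof -
    note [measurable] = h(1)
    show m: "\<psi> h \<in> borel_measurable borel" unfolding \<psi>_def by measurable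
    obtain B where B: "B > 0" "\<And>x. norm (\<phi> x) \<le> B" using test_function_bounded[OF \<phi>] by blast
    show "integrable lborel (\<lambda>z. (norm (\<psi> h z))\<^sup>2)"
    proof (rule Bochner_Integration.integrable_bound)
      show "integrable lborel (\<lambda>z::(real^2) \<times> real. B\<^sup>2 * indicator (cball 0 R) z)"
        by (intro integrable_mult_right integrable_indicator_cball)
      show "AE z in lborel. norm ((norm (\<psi> h z))\<^sup>2) \<le> norm (B\<^sup>2 * indicator (cball 0 R) z)"
      proof (rule AE_I2)
        fix z
        show "norm ((norm (\<psi> h z))\<^sup>2) \<le> norm (B\<^sup>2 * indicator (cball 0 R) z)"
        proof (cases "\<psi> h z = 0")
          case False
          then have z: "z \<in> layer" "\<phi> (fst z) \<noteq> 0" by (auto simp: \<psi>_def split: if_splits)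
          then have zR: "norm z \<le> R" using norm_pair_layer[of z] K(2)[of "fst z"] R0[of "fst z"] by (force simp: R_def)
          have "norm (\<phi> (fst z)) * \<bar>h (a * snd z)\<bar> \<le> B * 1" by (intro mult_mono B(2) h(2)) (use B(1) in auto)
          then have "norm (\<psi> h z) \<le> B * 1" using z by (simp add: \<psi>_def norm_mult)
          then show ?thesis using zR by (simp add: power_mono)
        qed simp
      qed
    qed (use m in measurable)
  qed
  have rep_lim: "(\<lambda>n. \<integral>z. d n z * \<psi> h z \<partial>lborel) \<longlonglongrightarrow> (\<integral>z. g' z * \<psi> h z \<partial>lborel)"
    if d: "\<And>n. d n \<in> test_functions layer" and g': "g' \<in> borel_measurable borel" "\<And>z. z \<notin> layer \<Longrightarrow> g' z = 0"
      and ae: "AE z in lborel. z \<in> layer \<longrightarrow> g z = g' z" and g2: "integrable lborel (\<lambda>z. (norm (g' z))\<^sup>2)"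
      and l: "(\<lambda>n. LINT z|lebesgue_on layer. (norm (d n z - g z))\<^sup>2) \<longlonglongrightarrow> 0"
      and h: "h \<in> borel_measurable borel" "\<And>t. \<bar>h t\<bar> \<le> 1" for d g g' h
  proof -
    have dm: "d n \<in> borel_measurable borel" for n by (rule test_function_measurable[OF d])
    note [measurable] = dm g'(1) \<psi>2(2)[OF h]
    have "(LINT z|lebesgue_on layer. (norm (d n z - g z))\<^sup>2) = (\<integral>z. (norm (d n z - g' z))\<^sup>2 \<partial>lborel)" for n
    proof (rule integral_lebesgue_rep(1)[OF layer_borel])
      show "AE z in lborel. z \<in> layer \<longrightarrow> (norm (d n z - g z))\<^sup>2 = (norm (d n z - g' z))\<^sup>2" using ae by eventually_elim simp
    qed (use g'(2) test_functions_layer_0(1)[OF d] in auto)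
    then have l': "(\<lambda>n. \<integral>z. (norm (d n z - g' z))\<^sup>2 \<partial>lborel) \<longlonglongrightarrow> 0" using l by simp
    have d2: "integrable lborel (\<lambda>z. (norm (d n z))\<^sup>2)" for n
    proof -
      have "integrable lborel (\<lambda>z. d n z * cnj (d n z))"
      proof -
        obtain K where K: "compact K" "\<And>x. x \<notin> K \<Longrightarrow> d n x = 0" using d[of n] by (rule test_functionsE) blast
        have c: "continuous_on UNIV (d n)" by (rule smooth_continuous[OF test_functions_smooth[OF d]])
        show ?thesis
          by (rule compact_support_integrable[OF continuous_on_mult[OF c continuous_on_cnj[OF c]] K(1)]) (simp add: K(2))
      qed
      then have "integrable lborel (\<lambda>z. Re (d n z * cnj (d n z)))" by (rule integrable_Re)
      then show ?thesis by (simp only: complex_norm_square[symmetric] Re_complex_of_real)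
    qed
    have i2: "integrable lborel (\<lambda>z. (norm (d n z - g' z))\<^sup>2)" for n
    proof (rule Bochner_Integration.integrable_bound)
      show "integrable lborel (\<lambda>z. 3 * ((norm (d n z))\<^sup>2 + (norm (g' z))\<^sup>2))" using d2 g2 by simp
      show "AE z in lborel. norm ((norm (d n z - g' z))\<^sup>2) \<le> norm (3 * ((norm (d n z))\<^sup>2 + (norm (g' z))\<^sup>2))"
        using norm_add3_sq[of "d n z" "- g' z" 0 for z] by (intro AE_I2) auto
    qed measurable
    have prod: "integrable lborel (\<lambda>z. p z * \<psi> h z)" if p: "p \<in> borel_measurable borel" "integrable lborel (\<lambda>z. (norm (p z))\<^sup>2)" for p
    proof (rule Bochner_Integration.integrable_bound)
      show "integrable lborel (\<lambda>z. (norm (p z))\<^sup>2 + (norm (\<psi> h z))\<^sup>2)" using p \<psi>2(1)[OF h] by simp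
      show "AE z in lborel. norm (p z * \<psi> h z) \<le> norm ((norm (p z))\<^sup>2 + (norm (\<psi> h z))\<^sup>2)"
      proof (rule AE_I2)
        fix z
        have "0 \<le> (norm (p z) - norm (\<psi> h z))\<^sup>2" by simp
        then have "2 * (norm (p z) * norm (\<psi> h z)) \<le> (norm (p z))\<^sup>2 + (norm (\<psi> h z))\<^sup>2" by (simp add: power2_diff)
        moreover have "0 \<le> norm (p z) * norm (\<psi> h z)" by simp
        ultimately show "norm (p z * \<psi> h z) \<le> norm ((norm (p z))\<^sup>2 + (norm (\<psi> h z))\<^sup>2)" unfolding norm_mult real_norm_def by linarith
      qed
    qed (use p in measurable)
    have "(\<lambda>n. \<integral>z. (d n z - g' z) * \<psi> h z \<partial>lborel) \<longlonglongrightarrow> 0"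
      by (rule L2_limit_integral[OF i2 l' \<psi>2(1)[OF h]])
    moreover have "(\<integral>z. (d n z - g' z) * \<psi> h z \<partial>lborel) = (\<integral>z. d n z * \<psi> h z \<partial>lborel) - (\<integral>z. g' z * \<psi> h z \<partial>lborel)" for n
      unfolding left_diff_distrib by (intro Bochner_Integration.integral_diff prod dm d2 g' g2)
    ultimately show ?thesis using LIM_zero_cancel by fastforce
  qed
  have hc: "cos \<in> borel_measurable (borel :: real measure)" "sin \<in> borel_measurable (borel :: real measure)" by auto
  have L1: "(\<lambda>n. \<integral>z. partial ?e (\<Phi> n) z * \<psi> cos z \<partial>lborel) \<longlonglongrightarrow> (\<integral>z. y' z * \<psi> cos z \<partial>lborel)"
    by (rule rep_lim[OF test_functions_partial[OF \<Phi> eB] y'm y'0 y'ae y'2 l1 hc(1)]) auto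
  have L2: "(\<lambda>n. \<integral>z. \<Phi> n z * \<psi> sin z \<partial>lborel) \<longlonglongrightarrow> (\<integral>z. v' z * \<psi> sin z \<partial>lborel)"
    by (rule rep_lim[OF \<Phi> v'm v'0 v'ae v'2 l0 hc(2)]) auto
  \<comment> \<open>The approximants have compact support in the open layer, so partial integration
    in \<open>y\<close> leaves no boundary term; the resulting identity survives the limit.\<close>
  have parts: "(\<integral>z. partial ?e (\<Phi> n) z * \<psi> cos z \<partial>lborel) = of_real a * (\<integral>z. \<Phi> n z * \<psi> sin z \<partial>lborel)" for n
  proof -
    let ?c = "\<lambda>z. \<phi> (fst z) * complex_of_real (cos (a * snd z))"
    have t: "(\<lambda>z. \<Phi> n z * ?c z) \<in> test_functions UNIV"
      by (rule test_functions_mono[OF test_functions_mult[OF \<Phi> sm]]) simp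
    have pc: "partial ?e ?c z = - of_real a * (\<phi> (fst z) * of_real (sin (a * snd z)))" for z
      using partial_Times[OF test_functions_smooth[OF \<phi>] smooth_cos, of 0 1 a z]
      by (simp add: partial_cos partial_0[OF test_functions_smooth[OF \<phi>]])
    have e: "partial ?e (\<lambda>z. \<Phi> n z * ?c z) z = partial ?e (\<Phi> n) z * \<psi> cos z - of_real a * (\<Phi> n z * \<psi> sin z)" for z
      unfolding partial_mult[OF test_functions_smooth[OF \<Phi>] sm] pc
      using test_functions_layer_0[OF \<Phi>[of n]] by (cases "z \<in> layer") (auto simp: \<psi>_def algebra_simps)
    have i1: "integrable lborel (\<lambda>z. partial ?e (\<Phi> n) z * \<psi> cos z)"
    proof -
      have "(\<lambda>z. partial ?e (\<Phi> n) z * \<psi> cos z) = (\<lambda>z. partial ?e (\<Phi> n) z * ?c z)"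
        using test_functions_layer_0(2)[OF \<Phi>[of n]] by (auto simp: \<psi>_def fun_eq_iff)
      moreover have "integrable lborel (\<lambda>z. partial ?e (\<Phi> n) z * ?c z)"
        by (rule test_function_integrable[OF test_functions_mult[OF test_functions_partial[OF \<Phi> eB] sm]])
      ultimately show ?thesis by simp
    qed
    have "integrable lborel (partial ?e (\<lambda>z. \<Phi> n z * ?c z))"
      by (rule test_function_integrable[OF test_functions_partial[OF t eB]])
    then have "integrable lborel (\<lambda>z. partial ?e (\<Phi> n) z * \<psi> cos z - of_real a * (\<Phi> n z * \<psi> sin z))"
      by (simp only: e[abs_def])
    from Bochner_Integration.integrable_diff[OF i1 this]
    have i2: "integrable lborel (\<lambda>z. of_real a * (\<Phi> n z * \<psi> sin z))" by simp
    have "0 = (\<integral>z. partial ?e (\<Phi> n) z * \<psi> cos z - of_real a * (\<Phi> n z * \<psi> sin z) \<partial>lborel)"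
      using integral_partial_eq_0[OF t eB] unfolding e by simp
    also have "\<dots> = (\<integral>z. partial ?e (\<Phi> n) z * \<psi> cos z \<partial>lborel) - of_real a * (\<integral>z. \<Phi> n z * \<psi> sin z \<partial>lborel)"
      by (simp only: Bochner_Integration.integral_diff[OF i1 i2] integral_mult_right_zero)
    finally show ?thesis by simp
  qed
  have main: "(\<integral>z. y' z * \<psi> cos z \<partial>lborel) = of_real a * (\<integral>z. v' z * \<psi> sin z \<partial>lborel)"
    using LIMSEQ_unique[OF L1[unfolded parts] tendsto_mult_left[OF L2, of "of_real a"]] .
  have S: "(\<integral>z. v' z * \<psi> sin z \<partial>lborel) = (\<integral>z. U z * (\<phi> (fst z) * of_real (sin (a * snd z))) \<partial>lborel)"
  proof (rule Bochner_Integration.integral_cong[OF refl])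
    fix z
    show "v' z * \<psi> sin z = U z * (\<phi> (fst z) * of_real (sin (a * snd z)))"
      using \<eta>1[of z] U(2)[of z] by (cases "z \<in> layer"; cases "\<phi> (fst z) = 0") (auto simp: \<psi>_def v'_def)
  qed
  let ?\<zeta> = "\<lambda>j y. complex_of_real (bump j y) * complex_of_real (cos (a * y))"
  have \<zeta>: "?\<zeta> j \<in> test_functions {0<..<1}" for j by (rule bump_test[OF smooth_cos])
  have t: "(\<lambda>z. \<phi> (fst z) * ?\<zeta> j (snd z)) \<in> test_functions layer" for j
    unfolding layer_def by (rule test_functions_Times[OF \<phi> \<zeta>])
  have tm: "(\<lambda>z. \<phi> (fst z) * ?\<zeta> j (snd z)) \<in> borel_measurable borel" "partial ?e (\<lambda>z. \<phi> (fst z) * ?\<zeta> j (snd z)) \<in> borel_measurable borel" for j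
    by (rule test_function_measurable[OF t]) (rule test_function_measurable[OF test_functions_partial[OF t eB]])
  \<comment> \<open>Where \<open>\<phi>\<close> does not vanish, truncated and original solution
    coincide, so \<open>y'\<close> and \<open>Y\<close> act alike on these test functions supported
    in the layer; the bump is removed afterwards.\<close>
  have same: "(\<integral>z. y' z * (\<phi> (fst z) * ?\<zeta> j (snd z)) \<partial>lborel) = (\<integral>z. Y z * (\<phi> (fst z) * ?\<zeta> j (snd z)) \<partial>lborel)" for j
  proof -
    let ?\<phi> = "\<lambda>z. \<phi> (fst z) * ?\<zeta> j (snd z)"
    note [measurable] = tm
    have "(LINT z|lebesgue_on layer. v z * partial ?e ?\<phi> z) = - (LINT z|lebesgue_on layer. Vy z * ?\<phi> z)"
      using hw t unfolding has_weak_partial_def by blast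
    moreover have "(LINT z|lebesgue_on layer. v z * partial ?e ?\<phi> z) = (\<integral>z. v' z * partial ?e ?\<phi> z \<partial>lborel)"
    proof (rule integral_lebesgue_rep(1)[OF layer_borel])
      show "AE z in lborel. z \<in> layer \<longrightarrow> v z * partial ?e ?\<phi> z = v' z * partial ?e ?\<phi> z" using v'ae by eventually_elim simp
    qed (use v'0 in auto)
    moreover have "(LINT z|lebesgue_on layer. Vy z * ?\<phi> z) = (\<integral>z. y' z * ?\<phi> z \<partial>lborel)"
    proof (rule integral_lebesgue_rep(1)[OF layer_borel])
      show "AE z in lborel. z \<in> layer \<longrightarrow> Vy z * ?\<phi> z = y' z * ?\<phi> z" using y'ae by eventually_elim simp
    qed (use y'0 in auto)
    moreover have "(\<integral>z. v' z * partial ?e ?\<phi> z \<partial>lborel) = (\<integral>z. U z * partial ?e ?\<phi> z \<partial>lborel)"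
    proof (rule Bochner_Integration.integral_cong[OF refl])
      fix z
      have "partial ?e ?\<phi> z = \<phi> (fst z) * partial 1 (?\<zeta> j) (snd z)"
        using partial_Times[OF test_functions_smooth[OF \<phi>] test_functions_smooth[OF \<zeta>], of 0 1 j z]
        by (simp add: partial_0[OF test_functions_smooth[OF \<phi>]])
      then show "v' z * partial ?e ?\<phi> z = U z * partial ?e ?\<phi> z"
        using \<eta>1[of z] U(2)[of z] by (cases "z \<in> layer"; cases "\<phi> (fst z) = 0") (auto simp: v'_def)
    qed
    ultimately show ?thesis using weak[OF t[of j]] by simp
  qed
  have lim: "(\<lambda>j. \<integral>z. G z * (\<phi> (fst z) * ?\<zeta> j (snd z)) \<partial>lborel) \<longlonglongrightarrow> (\<integral>z. G z * (\<phi> (fst z) * of_real (cos (a * snd z))) \<partial>lborel)"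
    if G: "G \<in> borel_measurable borel" "\<And>z. z \<notin> layer \<Longrightarrow> G z = 0" "\<And>R. integrable lborel (\<lambda>z. indicator (ball 0 R) z *\<^sub>R G z)" for G
  proof -
    have H: "integrable lborel (\<lambda>z. G z * (\<phi> (fst z) * 1))" by (rule layer_integrable[OF G \<phi>, of "\<lambda>_. 1" 1]) auto
    have "(\<lambda>j. \<integral>z. G z * (\<phi> (fst z) * 1) * ?\<zeta> j (snd z) \<partial>lborel) \<longlonglongrightarrow> (\<integral>z. G z * (\<phi> (fst z) * 1) * of_real (cos (a * snd z)) \<partial>lborel)"
    proof (rule layer_dominated_limit[OF H, where C=1])
      show "?\<zeta> j \<in> borel_measurable borel" for j by (rule test_function_measurable[OF \<zeta>])
      show "norm (?\<zeta> j y) \<le> 1" for j y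
        using mult_mono[of "\<bar>bump j y\<bar>" 1 "\<bar>cos (a * y)\<bar>" 1] bump_bounds[of j y] by (simp add: norm_mult)
    qed (use G(2) bump_tendsto in auto)
    then show ?thesis by (simp add: mult.assoc)
  qed
  have y'loc: "integrable lborel (\<lambda>z. indicator (ball 0 r) z *\<^sub>R y' z)" for r
    using integrable_mult_indicator[OF _ y'2, of "ball 0 r"] by (intro local_square_integrable_imp y'm) auto
  have "(\<integral>z. y' z * (\<phi> (fst z) * of_real (cos (a * snd z))) \<partial>lborel) = (\<integral>z. Y z * (\<phi> (fst z) * of_real (cos (a * snd z))) \<partial>lborel)"
    using LIMSEQ_unique[OF lim[OF y'm y'0 y'loc, unfolded same] lim[OF Y]] .
  moreover have "(\<integral>z. y' z * \<psi> cos z \<partial>lborel) = (\<integral>z. y' z * (\<phi> (fst z) * of_real (cos (a * snd z))) \<partial>lborel)"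
    by (rule Bochner_Integration.integral_cong[OF refl]) (auto simp: \<psi>_def y'0)
  ultimately show ?thesis using main unfolding S by simp
qed

text \<open>Parseval on the vertical line over almost every \<open>x\<close>, then summation under
  the integral of nonnegative terms. \<open>I\<close> is arbitrary because the identity is used both
  on the support and on the whole plane.\<close>

lemma layer_Parseval:
  assumes g: "g \<in> borel_measurable borel" "\<And>z. z \<notin> layer \<Longrightarrow> g z = 0"
    "\<And>R. integrable lborel (\<lambda>z. indicator (ball 0 R) z *\<^sub>R (norm (g z))\<^sup>2)" and I: "I \<in> sets borel"
  shows "(\<integral>\<^sup>+z. indicator I (fst z) * ennreal ((norm (g z))\<^sup>2) \<partial>lborel) =
    (\<Sum>m. \<integral>\<^sup>+x. indicator I x * ennreal ((norm (sine_mode g (Suc m) x))\<^sup>2 / 2) \<partial>lborel)"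
proof -
  note [measurable] = g(1) I sine_mode_measurable[OF g(1)]
  have P: "lborel \<Otimes>\<^sub>M lborel = (lborel :: ((real^2) \<times> real) measure)" by (rule lborel_prod)
  \<comment> \<open>Square integrability is only local. Balls of integer radius are countably many,
    so one null set of base points serves all of them, and the part of a vertical line inside the
    layer lies in such a ball.\<close>
  have "AE x in lborel. integrable lborel (\<lambda>y. indicator (ball 0 (real n)) (x, y) *\<^sub>R (norm (g (x, y)))\<^sup>2)" for n
    using lborel_pair.AE_integrable_fst'[of "\<lambda>z. indicator (ball 0 (real n)) z *\<^sub>R (norm (g z))\<^sup>2"] g(3)[of "real n"] unfolding P by blast
  then have ae: "AE x in lborel. \<forall>n. integrable lborel (\<lambda>y. indicator (ball 0 (real n)) (x, y) *\<^sub>R (norm (g (x, y)))\<^sup>2)"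
    unfolding AE_all_countable by blast
  have slice: "(\<integral>\<^sup>+y. ennreal ((norm (g (x, y)))\<^sup>2) \<partial>lborel) = (\<Sum>m. ennreal ((norm (sine_mode g (Suc m) x))\<^sup>2 / 2))"
    if x: "\<And>n. integrable lborel (\<lambda>y. indicator (ball 0 (real n)) (x, y) *\<^sub>R (norm (g (x, y)))\<^sup>2)" for x
  proof -
    obtain n where n: "norm x + 1 < real n" using reals_Archimedean2 by blast
    have e: "indicator (ball 0 (real n)) (x, y) *\<^sub>R (norm (g (x, y)))\<^sup>2 = (norm (g (x, y)))\<^sup>2" for y
      using norm_pair_layer[of "(x, y)"] g(2)[of "(x, y)"] n by (cases "(x, y) \<in> layer") auto
    have i: "integrable lborel (\<lambda>y. (norm (g (x, y)))\<^sup>2)" using x[of n] by (simp only: e)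
    have "(\<lambda>y::real. (x, y)) \<in> borel_measurable borel" by (intro borel_measurable_continuous_onI continuous_intros)
    then have [measurable]: "(\<lambda>y. g (x, y)) \<in> borel_measurable borel" by (rule measurable_compose) (rule g(1))
    have g0: "g (x, y) = 0" if "y \<notin> {0<..<1}" for y using g(2)[of "(x, y)"] that by (auto simp: layer_def)
    have m: "(\<lambda>y. g (x, y)) \<in> borel_measurable I01" by (intro measurable_restrict_space1 measurable_completion) simp
    have "sin_coeff (\<lambda>y. g (x, y)) m = sine_mode g m x" for m
    proof -
      have "(\<integral>y. g (x, y) * of_real (sin (real m * pi * y)) \<partial>I01) = (\<integral>y. g (x, y) * of_real (sin (real m * pi * y)) \<partial>lborel)"
        by (rule integral_lebesgue_rep(1)) (use g0 in auto)
      then show ?thesis by (simp add: sin_coeff_def sine_mode_def)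
    qed
    moreover have "integrable I01 (\<lambda>y. (norm (g (x, y)))\<^sup>2) \<longleftrightarrow> integrable lborel (\<lambda>y. (norm (g (x, y)))\<^sup>2)"
      "(\<integral>y. (norm (g (x, y)))\<^sup>2 \<partial>I01) = (\<integral>y. (norm (g (x, y)))\<^sup>2 \<partial>lborel)"
      by (rule integral_lebesgue_rep; use g0 in auto)+
    ultimately have "(\<lambda>m. (norm (sine_mode g (Suc m) x))\<^sup>2 / 2) sums (\<integral>y. (norm (g (x, y)))\<^sup>2 \<partial>lborel)"
      using sin_Parseval[OF m] i by simp
    then have "(\<Sum>m. ennreal ((norm (sine_mode g (Suc m) x))\<^sup>2 / 2)) = ennreal (\<integral>y. (norm (g (x, y)))\<^sup>2 \<partial>lborel)"
      by (intro suminf_ennreal_eq) auto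
    then show ?thesis using nn_integral_eq_integral[OF i] by simp
  qed
  have "(\<integral>\<^sup>+z. indicator I (fst z) * ennreal ((norm (g z))\<^sup>2) \<partial>lborel) =
    (\<integral>\<^sup>+x. \<integral>\<^sup>+y. indicator I x * ennreal ((norm (g (x, y)))\<^sup>2) \<partial>lborel \<partial>lborel)"
    using lborel.nn_integral_fst[of "\<lambda>z. indicator I (fst z) * ennreal ((norm (g z))\<^sup>2)" "lborel :: (real^2) measure"] unfolding P by simp
  also have "\<dots> = (\<integral>\<^sup>+x. (\<Sum>m. indicator I x * ennreal ((norm (sine_mode g (Suc m) x))\<^sup>2 / 2)) \<partial>lborel)"
  proof (rule nn_integral_cong_AE, use ae in eventually_elim)
    case (elim x)
    have "(\<lambda>y::real. (x, y)) \<in> borel_measurable borel" by (intro borel_measurable_continuous_onI continuous_intros)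
    then have [measurable]: "(\<lambda>y. g (x, y)) \<in> borel_measurable borel" by (rule measurable_compose) (rule g(1))
    have "(\<integral>\<^sup>+y. indicator I x * ennreal ((norm (g (x, y)))\<^sup>2) \<partial>lborel) = indicator I x * (\<integral>\<^sup>+y. ennreal ((norm (g (x, y)))\<^sup>2) \<partial>lborel)"
      by (rule nn_integral_cmult) measurable
    also have "\<dots> = indicator I x * (\<Sum>m. ennreal ((norm (sine_mode g (Suc m) x))\<^sup>2 / 2))" using slice elim by simp
    finally show ?case by (simp only: ennreal_suminf_cmult)
  qed
  also have "\<dots> = (\<Sum>m. \<integral>\<^sup>+x. indicator I x * ennreal ((norm (sine_mode g (Suc m) x))\<^sup>2 / 2) \<partial>lborel)"
    by (rule nn_integral_suminf) measurable
  finally show ?thesis .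
qed

text \<open>The factor \<open>sqrt pi\<close> is the bound of the Bessel kernels,
  \<open>1 + pi\<close> comes from integrating \<open>r powr (- 1/2)\<close> over a set of area
  \<open>A\<close>, and \<open>2 * pi\<close> is the mass of the approximate identity.\<close>

definition mode_constant :: "real \<Rightarrow> real \<Rightarrow> real" where
  "mode_constant \<rho> A = max (sqrt pi * (1 + pi) / (2 * pi) * A powr (3/4)) (A / pi * (1 + ln (pi * \<rho>\<^sup>2 / A)))"

text \<open>A disjunction is enough since both alternatives lead to the same energy bound. The
  radius is a parameter because the estimate is used near \<open>I\<close> and again on arbitrarily
  large balls.\<close>

definition mode_estimate :: "(real^2 \<Rightarrow> complex) \<Rightarrow> (real^2 \<Rightarrow> complex) \<Rightarrow> real \<Rightarrow> bool" where
  "mode_estimate w f \<rho> \<longleftrightarrow>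
    (AE x in lebesgue. x \<in> ball 0 \<rho> \<longrightarrow> 2 * pi * norm (w x) \<le> (\<integral>y. norm (f y) * (sqrt pi * norm (y - x) powr (-1/2)) \<partial>lborel)) \<or>
    (AE x in lebesgue. x \<in> ball 0 \<rho> \<longrightarrow> 2 * pi * norm (w x) \<le> (\<integral>y. norm (f y) * max 0 (ln (5/2 * \<rho> / norm (y - x))) \<partial>lborel))"

text \<open>The pointwise bounds hold on the whole ball, but restricting them to \<open>I\<close>,
  which carries \<open>f\<close>, brings the area of \<open>I\<close> instead of that of the ball
  into the Schur constant.\<close>

lemma mode_energy_estimate:
  assumes est: "mode_estimate w f \<rho>" and I: "I \<in> sets borel" "I \<subseteq> ball 0 \<rho>" "emeasure lborel I = ennreal A"
    and A: "A > 0" "A \<le> pi * \<rho>\<^sup>2" and \<rho>: "\<rho> > 0" and f: "f \<in> borel_measurable borel" "\<And>x. x \<notin> I \<Longrightarrow> f x = 0"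
    and w: "w \<in> borel_measurable borel"
  shows "(\<integral>\<^sup>+x. indicator I x * ennreal ((norm (w x))\<^sup>2) \<partial>lborel) \<le> ennreal ((mode_constant \<rho> A)\<^sup>2) * (\<integral>\<^sup>+x. ennreal ((norm (f x))\<^sup>2) \<partial>lborel)"
proof -
  note [measurable] = I(1)
  have concl: ?thesis
    if k: "k \<in> borel_measurable borel" "\<And>r. k r \<ge> 0" and S: "S \<ge> 0" "S / (2 * pi) \<le> mode_constant \<rho> A"
      and kS: "\<And>x::real^2. (\<integral>\<^sup>+y. indicator I y * ennreal (k (norm (y - x))) \<partial>lborel) \<le> ennreal S"
      and e: "AE x in lebesgue. x \<in> ball 0 \<rho> \<longrightarrow> 2 * pi * norm (w x) \<le> (\<integral>y. norm (f y) * k (norm (y - x)) \<partial>lborel)" for k S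
  proof -
    have "AE x in lborel. x \<in> I \<longrightarrow> 2 * pi * norm (w x) \<le> (\<integral>y. norm (f y) * k (norm (y - x)) \<partial>lborel)"
      using e[unfolded AE_completion_iff] by eventually_elim (use I(2) in auto)
    from Schur_bound[OF I(1) f(1) w k S(1) _ kS f(2) this]
    have "(\<integral>\<^sup>+x. indicator I x * ennreal ((norm (w x))\<^sup>2) \<partial>lborel) \<le> ennreal ((S / (2 * pi))\<^sup>2) * (\<integral>\<^sup>+x. ennreal ((norm (f x))\<^sup>2) \<partial>lborel)"
      by simp
    also have "\<dots> \<le> ennreal ((mode_constant \<rho> A)\<^sup>2) * (\<integral>\<^sup>+x. ennreal ((norm (f x))\<^sup>2) \<partial>lborel)"
      by (intro mult_right_mono ennreal_leI power_mono S(2)) (use S(1) in auto)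
    finally show ?thesis .
  qed
  show ?thesis using est unfolding mode_estimate_def
  proof
    assume e: "AE x in lebesgue. x \<in> ball 0 \<rho> \<longrightarrow> 2 * pi * norm (w x) \<le> (\<integral>y. norm (f y) * (sqrt pi * norm (y - x) powr (-1/2)) \<partial>lborel)"
    show ?thesis
    proof (rule concl[OF _ _ _ _ _ e])
      show "(\<lambda>r. sqrt pi * r powr (-1/2)) \<in> borel_measurable borel" by measurable
      show "0 \<le> sqrt pi * ((1 + pi) * A powr (3/4))" by simp
      show "sqrt pi * ((1 + pi) * A powr (3/4)) / (2 * pi) \<le> mode_constant \<rho> A" by (simp add: mode_constant_def)
      fix x :: "real^2"
      have "(\<integral>\<^sup>+y. indicator I y * ennreal (sqrt pi * norm (y - x) powr (-1/2)) \<partial>lborel) =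
        (\<integral>\<^sup>+y. ennreal (sqrt pi) * (indicator I y * ennreal (norm (y - x) powr (-1/2))) \<partial>lborel)"
        by (intro nn_integral_cong) (simp add: ennreal_mult ac_simps)
      also have "\<dots> = ennreal (sqrt pi) * (\<integral>\<^sup>+y. indicator I y * ennreal (norm (y - x) powr (-1/2)) \<partial>lborel)"
        by (rule nn_integral_cmult) measurable
      also have "\<dots> \<le> ennreal (sqrt pi) * ennreal ((1 + pi) * A powr (3/4))"
        by (intro mult_left_mono nn_integral_powr_kernel[OF I(1,3) A(1)]) simp
      finally show "(\<integral>\<^sup>+y. indicator I y * ennreal (sqrt pi * norm (y - x) powr (-1/2)) \<partial>lborel) \<le> ennreal (sqrt pi * ((1 + pi) * A powr (3/4)))"
        by (simp add: ennreal_mult)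
    qed simp
  next
    assume e: "AE x in lebesgue. x \<in> ball 0 \<rho> \<longrightarrow> 2 * pi * norm (w x) \<le> (\<integral>y. norm (f y) * max 0 (ln (5/2 * \<rho> / norm (y - x))) \<partial>lborel)"
    define L where "L = ln (pi * \<rho>\<^sup>2 / A)"
    have L0: "L \<ge> 0" unfolding L_def using A by simp
    \<comment> \<open>Hence \<open>ln (25/4) \<le> 2\<close> and
      \<open>1 + (ln (25/4) + L) / 2 \<le> 2 * (1 + L)\<close>; multiplied by \<open>A\<close> and
      divided by \<open>2 * pi\<close> this is the second term of \<open>mode_constant\<close>, with
      the factor \<open>A / pi\<close>.\<close>
    have "5/2 \<le> exp (1::real)" using exp_lower_Taylor_quadratic[of "1::real"] by simp
    then have "(5/2)\<^sup>2 \<le> (exp (1::real))\<^sup>2" by (intro power_mono) auto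
    then have "25/4 \<le> exp (2::real)" by (simp add: power2_eq_square exp_add[symmetric])
    then have "ln (25/4) \<le> ln (exp (2::real))" by (subst ln_le_cancel_iff) auto
    then have "ln (25/4) \<le> (2::real)" by simp
    moreover have "ln (pi * (5/2 * \<rho>)\<^sup>2 / A) = ln (25/4) + L"
    proof -
      have "pi * (5/2 * \<rho>)\<^sup>2 / A = 25/4 * (pi * \<rho>\<^sup>2 / A)" by (simp add: power_mult_distrib power_divide)
      moreover have "ln (25/4 * (pi * \<rho>\<^sup>2 / A)) = ln (25/4) + ln (pi * \<rho>\<^sup>2 / A)" by (rule ln_mult_pos) (use A(1) \<rho> in auto)
      ultimately show ?thesis by (simp only: L_def)
    qed
    ultimately have S: "A * (1 + ln (pi * (5/2 * \<rho>)\<^sup>2 / A) / 2) \<le> A * (2 * (1 + L))" "0 \<le> 1 + ln (pi * (5/2 * \<rho>)\<^sup>2 / A) / 2"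
      using L0 A(1) ln_ge_zero[of "25/4::real"] by (auto intro!: mult_left_mono)
    show ?thesis
    proof (rule concl[OF _ _ _ _ _ e])
      show "(\<lambda>r. max 0 (ln (5/2 * \<rho> / r))) \<in> borel_measurable borel" by measurable
      show "0 \<le> A * (1 + ln (pi * (5/2 * \<rho>)\<^sup>2 / A) / 2)" using S(2) A(1) by simp
      have "A * (1 + ln (pi * (5/2 * \<rho>)\<^sup>2 / A) / 2) / (2 * pi) \<le> A * (2 * (1 + L)) / (2 * pi)" by (intro divide_right_mono S(1)) simp
      also have "\<dots> = A / pi * (1 + L)" by (simp add: field_simps)
      also have "\<dots> \<le> mode_constant \<rho> A" by (simp add: mode_constant_def L_def)
      finally show "A * (1 + ln (pi * (5/2 * \<rho>)\<^sup>2 / A) / 2) / (2 * pi) \<le> mode_constant \<rho> A" .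
      fix x :: "real^2"
      have "\<rho>\<^sup>2 \<le> (5/2 * \<rho>)\<^sup>2" using \<rho> by (intro power_mono) auto
      then have "pi * \<rho>\<^sup>2 \<le> pi * (5/2 * \<rho>)\<^sup>2" by (intro mult_left_mono) auto
      then have "A \<le> pi * (5/2 * \<rho>)\<^sup>2" using A(2) by linarith
      moreover have "ennreal (max 0 z) = ennreal z" for z by (cases "z \<ge> 0") (auto simp: max_def ennreal_neg)
      ultimately show "(\<integral>\<^sup>+y. indicator I y * ennreal (max 0 (ln (5/2 * \<rho> / norm (y - x)))) \<partial>lborel) \<le> ennreal (A * (1 + ln (pi * (5/2 * \<rho>)\<^sup>2 / A) / 2))"
        using nn_integral_ln_kernel[OF I(1,3) A(1), of "5/2 * \<rho>" x] \<rho> by simp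
    qed simp
  qed
qed

section \<open>Vanishing of solutions for small potentials\<close>

context layer_solution
begin

text \<open>Summing the mode estimates gives \<open>EU \<le> M^2 * EF\<close>, and
  \<open>EF \<le> N^2 * EU\<close>; as \<open>M * N < 1\<close> and both energies are finite,
  \<open>EF = 0\<close>. Then every mode of \<open>F\<close> vanishes, and the same estimates on
  growing balls remove every mode of \<open>U\<close>, also away from \<open>I\<close>.\<close>

lemma energy_vanishes:
  assumes I: "I \<in> sets borel" "I \<subseteq> ball 0 \<rho>" "emeasure lborel I = ennreal A" and A: "A \<ge> 0" "A \<le> pi * \<rho>\<^sup>2" and \<rho>: "\<rho> > 0"
    and supp: "\<And>z. fst z \<notin> I \<Longrightarrow> F z = 0" and FU: "AE z in lborel. norm (F z) \<le> N * norm (U z)" and N: "N \<ge> 0"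
    and U2: "\<And>R. integrable lborel (\<lambda>z. indicator (ball 0 R) z *\<^sub>R (norm (U z))\<^sup>2)"
    and est: "\<And>m R. m \<ge> 1 \<Longrightarrow> R > 0 \<Longrightarrow> I \<subseteq> ball 0 R \<Longrightarrow> mode_estimate (sine_mode U m) (sine_mode F m) R"
    and small: "mode_constant \<rho> A * N < 1"
  shows "AE z in lborel. U z = 0"
proof -
  note [measurable] = U_m F_m I(1) sine_mode_measurable[OF U_m] sine_mode_measurable[OF F_m]
  define M where "M = mode_constant \<rho> A"
  have M0: "M \<ge> 0" unfolding M_def mode_constant_def by (rule max.coboundedI1) (simp add: A)
  have FU2: "AE z in lborel. (norm (F z))\<^sup>2 \<le> N\<^sup>2 * (norm (U z))\<^sup>2"
    using FU by eventually_elim (metis norm_ge_zero power_mono power_mult_distrib)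
  have F2: "integrable lborel (\<lambda>z. indicator (ball 0 R) z *\<^sub>R (norm (F z))\<^sup>2)" for R
  proof (rule Bochner_Integration.integrable_bound[OF integrable_mult_right[OF U2[of R], of "N\<^sup>2"]])
    show "AE z in lborel. norm (indicator (ball 0 R) z *\<^sub>R (norm (F z))\<^sup>2) \<le> norm (N\<^sup>2 * (indicator (ball 0 R) z *\<^sub>R (norm (U z))\<^sup>2))"
      using FU2 by eventually_elim (auto simp: indicator_def)
    show "(\<lambda>z. indicator (ball 0 R) z *\<^sub>R (norm (F z))\<^sup>2) \<in> borel_measurable lborel"
      by (intro borel_measurable_scaleR borel_measurable_indicator borel_measurable_power borel_measurable_norm) (use F_m in auto)
  qed
  have F0x: "sine_mode F m x = 0" if "x \<notin> I" for m x using supp that by (simp add: sine_mode_def)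
  define EU where "EU = (\<integral>\<^sup>+z. indicator I (fst z) * ennreal ((norm (U z))\<^sup>2) \<partial>lborel)"
  define EF where "EF = (\<integral>\<^sup>+z. indicator I (fst z) * ennreal ((norm (F z))\<^sup>2) \<partial>lborel)"
  have EF1: "EF \<le> ennreal (N\<^sup>2) * EU"
  proof -
    have "EF \<le> (\<integral>\<^sup>+z. ennreal (N\<^sup>2) * (indicator I (fst z) * ennreal ((norm (U z))\<^sup>2)) \<partial>lborel)"
      unfolding EF_def
    proof (rule nn_integral_mono_AE, use FU2 in eventually_elim)
      case (elim z)
      then have "ennreal ((norm (F z))\<^sup>2) \<le> ennreal (N\<^sup>2) * ennreal ((norm (U z))\<^sup>2)" by (simp add: ennreal_mult[symmetric] ennreal_leI)
      then show ?case by (auto simp: indicator_def)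
    qed
    also have "\<dots> = ennreal (N\<^sup>2) * EU" unfolding EU_def by (rule nn_integral_cmult) measurable
    finally show ?thesis .
  qed
  have EUfin: "EU < \<infinity>"
  proof -
    have "EU \<le> (\<integral>\<^sup>+z. ennreal (indicator (ball 0 (\<rho> + 1)) z *\<^sub>R (norm (U z))\<^sup>2) \<partial>lborel)"
      unfolding EU_def
    proof (rule nn_integral_mono)
      fix z
      show "indicator I (fst z) * ennreal ((norm (U z))\<^sup>2) \<le> ennreal (indicator (ball 0 (\<rho> + 1)) z *\<^sub>R (norm (U z))\<^sup>2)"
      proof (cases "z \<in> layer \<and> fst z \<in> I")
        case True
        then have "z \<in> ball 0 (\<rho> + 1)" using norm_pair_layer[of z] I(2) by force
        then show ?thesis using True by simp
      next
        case False
        then show ?thesis using U_0[of z] by auto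
      qed
    qed
    also have "\<dots> < \<infinity>" using nn_integral_eq_integral[OF U2[of "\<rho> + 1"]] by simp
    finally show ?thesis .
  qed
  have EFsum: "EF = (\<Sum>m. \<integral>\<^sup>+x. indicator I x * ennreal ((norm (sine_mode F (Suc m) x))\<^sup>2 / 2) \<partial>lborel)"
    unfolding EF_def by (rule layer_Parseval[OF F_m F_0 F2 I(1)])
  have EUsum: "EU = (\<Sum>m. \<integral>\<^sup>+x. indicator I x * ennreal ((norm (sine_mode U (Suc m) x))\<^sup>2 / 2) \<partial>lborel)"
    unfolding EU_def by (rule layer_Parseval[OF U_m U_0 U2 I(1)])
  have half: "(\<integral>\<^sup>+x. indicator I x * ennreal ((norm (w x))\<^sup>2 / 2) \<partial>lborel) = ennreal (1/2) * (\<integral>\<^sup>+x. indicator I x * ennreal ((norm (w x))\<^sup>2) \<partial>lborel)"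
    if [measurable]: "w \<in> borel_measurable borel" for w :: "real^2 \<Rightarrow> complex"
  proof -
    have "indicator I x * ennreal ((norm (w x))\<^sup>2 / 2) = ennreal (1/2) * (indicator I x * ennreal ((norm (w x))\<^sup>2))" for x
    proof -
      have "ennreal ((norm (w x))\<^sup>2 / 2) = ennreal (1/2) * ennreal ((norm (w x))\<^sup>2)" using ennreal_mult[of "1/2" "(norm (w x))\<^sup>2"] by simp
      then show ?thesis by (simp only: mult.left_commute)
    qed
    then show ?thesis by (simp only:) (rule nn_integral_cmult, measurable)
  qed
  have EF0: "EF = 0"
  \<comment> \<open>Area 0 is separate because \<open>mode_energy_estimate\<close> divides by
    \<open>A\<close>; in that case the integrals over \<open>I\<close> are 0 anyway.\<close>
  proof (cases "A = 0")
    case True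
    then have "AE x in lborel. x \<notin> I" using I by (intro AE_not_in) (auto simp: null_sets_def)
    then have "(\<integral>\<^sup>+x. indicator I x * ennreal ((norm (sine_mode F (Suc m) x))\<^sup>2 / 2) \<partial>lborel) = 0" for m
      by (subst nn_integral_0_iff_AE) (measurable, auto elim!: eventually_mono)
    then show ?thesis unfolding EFsum by simp
  next
    case False
    have "EU \<le> (\<Sum>m. ennreal (M\<^sup>2) * (\<integral>\<^sup>+x. indicator I x * ennreal ((norm (sine_mode F (Suc m) x))\<^sup>2 / 2) \<partial>lborel))"
      unfolding EUsum
    proof (rule suminf_le)
      fix m
      have ind: "indicator I x * ennreal ((norm (sine_mode F (Suc m) x))\<^sup>2) = ennreal ((norm (sine_mode F (Suc m) x))\<^sup>2)" for x
        using F0x[of x "Suc m"] by (auto simp: indicator_def)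
      have "(\<integral>\<^sup>+x. indicator I x * ennreal ((norm (sine_mode U (Suc m) x))\<^sup>2) \<partial>lborel) \<le>
        ennreal (M\<^sup>2) * (\<integral>\<^sup>+x. indicator I x * ennreal ((norm (sine_mode F (Suc m) x))\<^sup>2) \<partial>lborel)"
        unfolding ind M_def
        by (rule mode_energy_estimate[OF est[OF _ \<rho> I(2)] I _ A(2) \<rho> sine_mode_measurable[OF F_m] F0x sine_mode_measurable[OF U_m]]) (use False A(1) in auto)
      from mult_left_mono[OF this, of "ennreal (1/2)"]
      show "(\<integral>\<^sup>+x. indicator I x * ennreal ((norm (sine_mode U (Suc m) x))\<^sup>2 / 2) \<partial>lborel) \<le>
        ennreal (M\<^sup>2) * (\<integral>\<^sup>+x. indicator I x * ennreal ((norm (sine_mode F (Suc m) x))\<^sup>2 / 2) \<partial>lborel)"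
        unfolding half[OF sine_mode_measurable[OF U_m]] half[OF sine_mode_measurable[OF F_m]] by (simp add: ac_simps)
    qed auto
    also have "\<dots> = ennreal (M\<^sup>2) * EF" unfolding EFsum by (rule ennreal_suminf_cmult)
    finally have 1: "EU \<le> ennreal (M\<^sup>2) * EF" .
    \<comment> \<open>Finiteness is essential: for an infinite energy the inequality below would say
      nothing.\<close>
    obtain e where e: "EF = ennreal e" "e \<ge> 0" "EU < \<infinity>"
    proof -
      have "ennreal (N\<^sup>2) * EU < \<infinity>" using EUfin by (simp add: ennreal_mult_less_top)
      with EF1 have "EF < \<infinity>" by (rule le_less_trans)
      then show ?thesis using EUfin by (intro that[of "enn2real EF"]) auto
    qed
    have "EF \<le> ennreal (N\<^sup>2) * (ennreal (M\<^sup>2) * EF)"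
      by (rule order_trans[OF EF1 mult_left_mono[OF 1]]) simp
    also have "\<dots> = ennreal (N\<^sup>2 * (M\<^sup>2 * e))"
      unfolding e(1) using e(2) by (simp only: ennreal_mult zero_le_power2 mult_nonneg_nonneg)
    finally have "e \<le> N\<^sup>2 * (M\<^sup>2 * e)"
      unfolding e(1) using e(2) by (subst (asm) ennreal_le_iff) auto
    then have le: "e \<le> (M * N)\<^sup>2 * e" by (simp add: power_mult_distrib mult.assoc mult.left_commute)
    have "(M * N)\<^sup>2 < 1\<^sup>2" by (rule power_strict_mono) (use small M0 N in \<open>auto simp: M_def\<close>)
    then have lt: "(M * N)\<^sup>2 < 1" by simp
    have "e = 0"
    proof (rule ccontr)
      assume "e \<noteq> 0"
      with e(2) have "e > 0" by simp
      then show False using mult_strict_right_mono[OF lt] le by fastforce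
    qed
    then show ?thesis using e(1) by simp
  qed
  \<comment> \<open>\<open>F\<close> vanishes over the complement of \<open>I\<close>, so its energy
    on \<open>I\<close> is its total energy, and Parseval over the whole plane shows that all its
    modes are zero.\<close>
  have IF: "indicator I (fst z) * ennreal ((norm (F z))\<^sup>2) = indicator UNIV (fst z) * ennreal ((norm (F z))\<^sup>2)" for z
    using supp[of z] by (auto simp: indicator_def)
  have "EF = (\<integral>\<^sup>+z. indicator UNIV (fst z) * ennreal ((norm (F z))\<^sup>2) \<partial>lborel)"
    unfolding EF_def by (rule nn_integral_cong) (rule IF)
  also have "\<dots> = (\<Sum>m. \<integral>\<^sup>+x. indicator UNIV x * ennreal ((norm (sine_mode F (Suc m) x))\<^sup>2 / 2) \<partial>lborel)"
    by (rule layer_Parseval[OF F_m F_0 F2 borel_open[OF open_UNIV]])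
  finally have s0: "(\<Sum>m. \<integral>\<^sup>+x. indicator UNIV x * ennreal ((norm (sine_mode F (Suc m) x))\<^sup>2 / 2) \<partial>lborel) = 0"
    using EF0 by (simp only:)
  have zm: "(\<integral>\<^sup>+x. indicator UNIV x * ennreal ((norm (sine_mode F (Suc m) x))\<^sup>2 / 2) \<partial>lborel) = 0" for m
  proof -
    define \<phi> where "\<phi> m = (\<integral>\<^sup>+x. indicator UNIV x * ennreal ((norm (sine_mode F (Suc m) x))\<^sup>2 / 2) \<partial>lborel)" for m
    have "suminf \<phi> = 0" using s0 by (simp only: \<phi>_def[abs_def])
    then have "\<phi> m = 0" using suminf_eq_zero_iff[of \<phi>] by (simp add: summableI)
    then show ?thesis by (simp only: \<phi>_def)
  qed
  have f0: "AE x in lborel. sine_mode F (Suc m) x = 0" for m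
  proof -
    have "AE x in lborel. indicator UNIV x * ennreal ((norm (sine_mode F (Suc m) x))\<^sup>2 / 2) = 0"
      by (rule iffD1[OF nn_integral_0_iff_AE zm]) measurable
    then show ?thesis by eventually_elim simp
  qed
  have w0: "AE x in lborel. sine_mode U (Suc m) x = 0" for m
  proof -
    \<comment> \<open>With zero right-hand side the bound holds on the ball of radius
      \<open>\<rho> + n\<close> for every \<open>n\<close>; the countably many exceptional null sets
      are collected afterwards.\<close>
    have *: "AE x in lborel. x \<in> ball 0 (\<rho> + real n) \<longrightarrow> sine_mode U (Suc m) x = 0" for n
    proof -
      have z: "(\<integral>y. norm (sine_mode F (Suc m) y) * k y \<partial>lborel) = 0" for k :: "real^2 \<Rightarrow> real"
        by (rule integral_eq_zero_AE) (use f0[of m] in eventually_elim, simp)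
      have "mode_estimate (sine_mode U (Suc m)) (sine_mode F (Suc m)) (\<rho> + real n)" by (rule est) (use I(2) \<rho> in auto)
      then have "AE x in lborel. x \<in> ball 0 (\<rho> + real n) \<longrightarrow> 2 * pi * norm (sine_mode U (Suc m) x) \<le> 0"
        unfolding mode_estimate_def z AE_completion_iff by simp
      moreover have "\<not> pi \<le> 0" using pi_gt_zero by linarith
      ultimately show ?thesis by (auto elim!: eventually_mono simp: mult_le_0_iff)
    qed
    then have "AE x in lborel. \<forall>n. x \<in> ball 0 (\<rho> + real n) \<longrightarrow> sine_mode U (Suc m) x = 0" unfolding AE_all_countable by blast
    then show ?thesis
    proof eventually_elim
      case (elim x)
      obtain n where "norm x < real n" using reals_Archimedean2 by blast
      then have "x \<in> ball 0 (\<rho> + real n)" using \<rho> by simp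
      then show ?case using elim by blast
    qed
  qed
  have um: "(\<integral>\<^sup>+x. indicator UNIV x * ennreal ((norm (sine_mode U (Suc m) x))\<^sup>2 / 2) \<partial>lborel) = 0" for m
  proof (rule iffD2[OF nn_integral_0_iff_AE])
    show "AE x in lborel. indicator UNIV x * ennreal ((norm (sine_mode U (Suc m) x))\<^sup>2 / 2) = 0"
      using w0[of m] by eventually_elim simp
  qed measurable
  have "(\<integral>\<^sup>+z. indicator UNIV (fst z) * ennreal ((norm (U z))\<^sup>2) \<partial>lborel) =
    (\<Sum>m. \<integral>\<^sup>+x. indicator UNIV x * ennreal ((norm (sine_mode U (Suc m) x))\<^sup>2 / 2) \<partial>lborel)"
    by (rule layer_Parseval[OF U_m U_0 U2 borel_open[OF open_UNIV]])
  then have u0: "(\<integral>\<^sup>+z. indicator UNIV (fst z) * ennreal ((norm (U z))\<^sup>2) \<partial>lborel) = 0"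
    by (simp only: um suminf_zero)
  have "AE z in lborel. indicator UNIV (fst z) * ennreal ((norm (U z))\<^sup>2) = 0"
    by (rule iffD1[OF nn_integral_0_iff_AE u0]) measurable
  then show ?thesis by eventually_elim simp
qed

end

lemma layer_solution_representatives:
  assumes sol: "weak_Dirichlet_solution k V u" and V: "V \<in> Linf layer"
    and I: "I \<in> sets borel" "I \<subseteq> ball 0 \<rho>"
    and supp: "AE z in lborel. z \<in> layer \<longrightarrow> z \<notin> I \<times> {0<..<1} \<longrightarrow> V z = 0"
  obtains U F D where "layer_solution k U F D" "AE z in lborel. z \<in> layer \<longrightarrow> u z = U z"
    "\<And>R. integrable lborel (\<lambda>z. indicator (ball 0 R) z *\<^sub>R (norm (U z))\<^sup>2)"
    "\<And>z. fst z \<notin> I \<Longrightarrow> F z = 0"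
    "AE z in lborel. norm (F z) \<le> real_of_ereal (Linf_norm layer V) * norm (U z)"
proof -
  have H1: "u \<in> H1_loc layer" and zb: "zero_on_boundary layer u" and
    weq: "\<And>\<phi>. \<phi> \<in> test_functions layer \<Longrightarrow> (LINT z|lebesgue_on layer. (\<Sum>b\<in>Basis. weak_partial layer b u z * partial b \<phi> z)) =
        (LINT z|lebesgue_on layer. (of_real k + V z) * u z * \<phi> z)"
    using sol unfolding weak_Dirichlet_solution_def by blast+
  have uL2: "u \<in> L2 (layer \<inter> ball 0 R)" for R using H1 unfolding H1_loc_def by blast
  have dL2: "weak_partial layer b u \<in> L2 (layer \<inter> ball 0 R)" if "b \<in> Basis" for b R using H1 that unfolding H1_loc_def by blast
  have um: "u \<in> borel_measurable (lebesgue_on layer)"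
    by (rule measurable_on_exhaustion[OF layer_borel]) (use uL2 in \<open>simp add: L2_def\<close>)
  have dm: "weak_partial layer b u \<in> borel_measurable (lebesgue_on layer)" if "b \<in> Basis" for b
    by (rule measurable_on_exhaustion[OF layer_borel]) (use dL2[OF that] in \<open>simp add: L2_def\<close>)
  obtain U where Um: "U \<in> borel_measurable borel" and U0: "\<And>z. z \<notin> layer \<Longrightarrow> U z = 0" and Uae: "AE z in lborel. z \<in> layer \<longrightarrow> u z = U z"
    by (rule borel_rep_on[OF layer_borel um]) blast
  have "\<forall>b\<in>Basis. \<exists>d. d \<in> borel_measurable borel \<and> (\<forall>z. z \<notin> layer \<longrightarrow> d z = 0) \<and> (AE z in lborel. z \<in> layer \<longrightarrow> weak_partial layer b u z = d z)"
  proof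
    fix b :: "(real^2) \<times> real" assume b: "b \<in> Basis"
    show "\<exists>d. d \<in> borel_measurable borel \<and> (\<forall>z. z \<notin> layer \<longrightarrow> d z = 0) \<and> (AE z in lborel. z \<in> layer \<longrightarrow> weak_partial layer b u z = d z)"
      by (rule borel_rep_on[OF layer_borel dm[OF b]]) blast
  qed
  then obtain D where D: "\<And>b. b \<in> Basis \<Longrightarrow> D b \<in> borel_measurable borel" "\<And>b z. b \<in> Basis \<Longrightarrow> z \<notin> layer \<Longrightarrow> D b z = 0"
     "\<And>b. b \<in> Basis \<Longrightarrow> AE z in lborel. z \<in> layer \<longrightarrow> weak_partial layer b u z = D b z"
    using bchoice[of Basis "\<lambda>b d. d \<in> borel_measurable borel \<and> (\<forall>z. z \<notin> layer \<longrightarrow> d z = 0) \<and> (AE z in lborel. z \<in> layer \<longrightarrow> weak_partial layer b u z = d z)"] by blast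
  have Vm: "V \<in> borel_measurable (lebesgue_on layer)" and Vfin: "Linf_norm layer V < \<infinity>" using V by (auto simp: Linf_def)
  have Vum: "(\<lambda>z. V z * u z) \<in> borel_measurable (lebesgue_on layer)" using Vm um by measurable
  obtain F0 where F0m: "F0 \<in> borel_measurable borel" and F00: "\<And>z. z \<notin> layer \<Longrightarrow> F0 z = 0" and F0ae: "AE z in lborel. z \<in> layer \<longrightarrow> V z * u z = F0 z"
    by (rule borel_rep_on[OF layer_borel Vum]) blast
  \<comment> \<open>\<open>F0\<close> equals \<open>V * u\<close> only almost everywhere; setting it
    to 0 over the complement of \<open>I\<close> at every point makes the modes of \<open>F\<close>
    vanish at every \<open>x\<close> outside \<open>I\<close>.\<close>
  define F where "F z = (if fst z \<in> I then F0 z else 0)" for z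
  note [measurable] = Um F0m I(1)
  have Fm [measurable]: "F \<in> borel_measurable borel" unfolding F_def by measurable
  have F0': "F z = 0" if "z \<notin> layer" for z using F00[OF that] by (simp add: F_def)
  have Fae: "AE z in lborel. z \<in> layer \<longrightarrow> V z * u z = F z"
    using F0ae supp
  proof eventually_elim
    case (elim z)
    then show ?case by (cases z) (auto simp: F_def layer_def)
  qed
  define N where "N = real_of_ereal (Linf_norm layer V)"
  have "AE z in lebesgue_on layer. ereal (norm (V z)) \<le> Linf_norm layer V" unfolding Linf_norm_def by (rule esssup_AE)
  then have "AE z in lborel. z \<in> layer \<longrightarrow> ereal (norm (V z)) \<le> Linf_norm layer V" by (simp add: AE_lebesgue_on_borel)
  then have Fbound: "AE z in lborel. norm (F z) \<le> N * norm (U z)"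
    using Fae Uae
  proof eventually_elim
    case (elim z)
    show ?case
    proof (cases "z \<in> layer")
      case True
      have "norm (V z) \<le> N" using elim(1) True Vfin unfolding N_def by (cases "Linf_norm layer V") auto
      then have "norm (V z) * norm (u z) \<le> N * norm (u z)" by (intro mult_right_mono) auto
      then show ?thesis using elim True by (metis norm_mult)
    next
      case False
      then show ?thesis by (simp add: F0' U0)
    qed
  qed
  have U2: "integrable lborel (\<lambda>z. indicator (ball 0 R) z *\<^sub>R (norm (U z))\<^sup>2)" for R
    by (rule rep_square_integrable[OF layer_borel Um U0 Uae _ uL2]) auto
  have Uloc: "integrable lborel (\<lambda>z. indicator (ball 0 R) z *\<^sub>R U z)" for R by (rule local_square_integrable_imp[OF U2 Um])
  have Dloc: "integrable lborel (\<lambda>z. indicator (ball 0 R) z *\<^sub>R D b z)" if "b \<in> Basis" for b R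
    by (rule local_square_integrable_imp[OF rep_square_integrable[OF layer_borel D(1,2,3) _ dL2]]) (use that D(1) in auto)
  have Fint: "integrable lborel F"
  proof (rule Bochner_Integration.integrable_bound[OF integrable_mult_right[OF integrable_norm[OF Uloc[of "\<rho> + 1"]], of "N"]])
    show "AE z in lborel. norm (F z) \<le> norm (N * norm (indicator (ball 0 (\<rho> + 1)) z *\<^sub>R U z))"
      using Fbound
    proof eventually_elim
      case (elim z)
      show ?case
      proof (cases "z \<in> layer \<and> fst z \<in> I")
        case True
        then have "z \<in> ball 0 (\<rho> + 1)" using norm_pair_layer[of z] I(2) by force
        then show ?thesis using elim by (simp add: abs_mult) (metis abs_ge_self abs_mult abs_norm_cancel order_trans)
      next
        case False
        then show ?thesis using F0'[of z] by (auto simp: F_def)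
      qed
    qed
  qed measurable
  have rep: "(LINT z|lebesgue_on layer. g z * \<phi> z) = (\<integral>z. g' z * \<phi> z \<partial>lborel)"
    if "AE z in lborel. z \<in> layer \<longrightarrow> g z = g' z" "g' \<in> borel_measurable borel" "\<And>z. z \<notin> layer \<Longrightarrow> g' z = 0" "\<phi> \<in> borel_measurable borel" for g g' \<phi> :: "(real^2) \<times> real \<Rightarrow> complex"
  proof (rule integral_lebesgue_rep(1)[OF layer_borel])
    show "AE z in lborel. z \<in> layer \<longrightarrow> g z * \<phi> z = g' z * \<phi> z" using that(1) by eventually_elim simp
  qed (use that in auto)
  have pm: "partial b \<phi> \<in> borel_measurable borel" if "\<phi> \<in> test_functions layer" "b \<in> Basis" for b \<phi>
    by (rule test_function_measurable[OF test_functions_partial[OF that]])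
  have weakD: "(\<integral>z. U z * partial b \<phi> z \<partial>lborel) = - (\<integral>z. D b z * \<phi> z \<partial>lborel)" if b: "b \<in> Basis" and \<phi>: "\<phi> \<in> test_functions layer" for b \<phi>
  proof -
    have "\<exists>g. has_weak_partial layer b u g" using H1 b unfolding H1_loc_def weakly_differentiable_def by blast
    then have "has_weak_partial layer b u (weak_partial layer b u)" unfolding weak_partial_def by (rule someI_ex)
    then have "(LINT z|lebesgue_on layer. u z * partial b \<phi> z) = - (LINT z|lebesgue_on layer. weak_partial layer b u z * \<phi> z)"
      using \<phi> unfolding has_weak_partial_def by blast
    then show ?thesis
      using rep[OF Uae Um U0 pm[OF \<phi> b]] rep[OF D(3)[OF b] D(1)[OF b] D(2)[OF b] test_function_measurable[OF \<phi>]] by simp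
  qed
  have weakE: "(\<Sum>b\<in>Basis. \<integral>z. D b z * partial b \<phi> z \<partial>lborel) = of_real k * (\<integral>z. U z * \<phi> z \<partial>lborel) + (\<integral>z. F z * \<phi> z \<partial>lborel)"
    if \<phi>: "\<phi> \<in> test_functions layer" for \<phi>
  proof -
    note [measurable] = test_function_measurable[OF \<phi>]
    have "(LINT z|lebesgue_on layer. (\<Sum>b\<in>Basis. weak_partial layer b u z * partial b \<phi> z)) = (\<integral>z. (\<Sum>b\<in>Basis. D b z * partial b \<phi> z) \<partial>lborel)"
    proof (rule integral_lebesgue_rep(1)[OF layer_borel])
      show "(\<lambda>z. \<Sum>b\<in>Basis. D b z * partial b \<phi> z) \<in> borel_measurable borel"
        using D(1) pm[OF \<phi>] by (intro borel_measurable_sum borel_measurable_times) auto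
      have "AE z in lborel. \<forall>b\<in>Basis. z \<in> layer \<longrightarrow> weak_partial layer b u z = D b z"
        by (intro AE_finite_allI finite_Basis D(3))
      then show "AE z in lborel. z \<in> layer \<longrightarrow> (\<Sum>b\<in>Basis. weak_partial layer b u z * partial b \<phi> z) = (\<Sum>b\<in>Basis. D b z * partial b \<phi> z)"
        by eventually_elim (auto intro!: sum.cong)
    qed (use D(2) in \<open>auto intro!: sum.neutral\<close>)
    also have "\<dots> = (\<Sum>b\<in>Basis. \<integral>z. D b z * partial b \<phi> z \<partial>lborel)"
      by (intro Bochner_Integration.integral_sum local_integrable_mult[OF Dloc D(1) test_functions_partial[OF \<phi>]])
    finally have 1: "(LINT z|lebesgue_on layer. (\<Sum>b\<in>Basis. weak_partial layer b u z * partial b \<phi> z)) = (\<Sum>b\<in>Basis. \<integral>z. D b z * partial b \<phi> z \<partial>lborel)" .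
    have "(LINT z|lebesgue_on layer. (of_real k + V z) * u z * \<phi> z) = (\<integral>z. (of_real k * U z + F z) * \<phi> z \<partial>lborel)"
    proof (rule rep)
      show "AE z in lborel. z \<in> layer \<longrightarrow> (of_real k + V z) * u z = of_real k * U z + F z"
        using Uae Fae by eventually_elim (auto simp: distrib_right)
      show "of_real k * U z + F z = 0" if "z \<notin> layer" for z using that by (simp add: U0 F0')
    qed measurable
    also have "\<dots> = of_real k * (\<integral>z. U z * \<phi> z \<partial>lborel) + (\<integral>z. F z * \<phi> z \<partial>lborel)"
    proof -
      have "integrable lborel (\<lambda>z. indicator (ball 0 R) z *\<^sub>R F z)" for R using Fint by (intro integrable_mult_indicator) auto
      then have i: "integrable lborel (\<lambda>z. of_real k * (U z * \<phi> z))" "integrable lborel (\<lambda>z. F z * \<phi> z)"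
        by (auto intro!: integrable_mult_right local_integrable_mult[OF _ _ \<phi>] Uloc)
      have "(\<lambda>z. (of_real k * U z + F z) * \<phi> z) = (\<lambda>z. of_real k * (U z * \<phi> z) + F z * \<phi> z)" by (simp add: fun_eq_iff algebra_simps)
      then show ?thesis by (simp only: Bochner_Integration.integral_add[OF i] integral_mult_right_zero)
    qed
    finally show ?thesis using weq[OF \<phi>] 1 by simp
  qed
  have e: "(0, 1) \<in> (Basis :: ((real^2) \<times> real) set)" by (auto simp: Basis_prod_def)
  have "layer_solution k U F D"
  proof
    show "(\<integral>z. D (0, 1) z * (\<phi> (fst z) * of_real (cos (real m * pi * snd z))) \<partial>lborel) =
      of_real (real m * pi) * (\<integral>z. U z * (\<phi> (fst z) * of_real (sin (real m * pi * snd z))) \<partial>lborel)" if "\<phi> \<in> test_functions UNIV" for m \<phi>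
      by (rule boundary_identity[OF zb Um U0 Uae Uloc D(1)[OF e] D(2)[OF e] Dloc[OF e] weakD[OF e] that])
  qed (use Um U0 Uloc D Dloc Fm F0' Fint weakD weakE in auto)
  then show ?thesis by (rule that[OF _ Uae U2 _ Fbound[unfolded N_def]]) (simp add: F_def)
qed

section \<open>Modes as weak solutions in the plane\<close>

lemma mode_eq_sine_mode:
  assumes U: "U \<in> borel_measurable borel" "\<And>z. z \<notin> layer \<Longrightarrow> U z = 0" "AE z in lborel. z \<in> layer \<longrightarrow> u z = U z"
  shows "AE x in lborel. mode u m x = sine_mode U m x"
proof -
  have P: "lborel \<Otimes>\<^sub>M lborel = (lborel :: ((real^2) \<times> real) measure)" by (rule lborel_prod)
  have "AE z in lborel \<Otimes>\<^sub>M lborel. z \<in> layer \<longrightarrow> u z = U z" unfolding P by (rule U(3))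
  from lborel_pair.AE_pair[OF this]
  show ?thesis
  proof eventually_elim
    case (elim x)
    note [measurable] = U(1)
    have "(\<lambda>y::real. (x, y)) \<in> borel_measurable borel" by (intro borel_measurable_continuous_onI continuous_intros)
    then have [measurable]: "(\<lambda>y. U (x, y)) \<in> borel_measurable borel" by (rule measurable_compose) (rule U(1))
    have "(LINT y|lebesgue_on {0<..<1}. u (x, y) * complex_of_real (sin (real m * pi * y))) = (\<integral>y. U (x, y) * complex_of_real (sin (real m * pi * y)) \<partial>lborel)"
    proof (rule integral_lebesgue_rep(1))
      show "AE y in lborel. y \<in> {0<..<1} \<longrightarrow> u (x, y) * complex_of_real (sin (real m * pi * y)) = U (x, y) * complex_of_real (sin (real m * pi * y))"
        using elim by eventually_elim (auto simp: layer_def)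
    qed (use U(2) in \<open>auto simp: layer_def\<close>)
    then show ?case by (simp add: mode_def sine_mode_def)
  qed
qed

lemma sine_mode_local_integrable:
  assumes g: "g \<in> borel_measurable borel" "\<And>z. z \<notin> layer \<Longrightarrow> g z = 0"
    "\<And>R. integrable lborel (\<lambda>z. indicator (ball 0 R) z *\<^sub>R g z)" and K: "K \<in> sets borel" "K \<subseteq> cball 0 R"
  shows "integrable lborel (\<lambda>x. indicator K x *\<^sub>R sine_mode g m x)"
proof -
  note [measurable] = g(1) K(1)
  have "integrable lborel (\<lambda>z. g z * (indicator K (fst z) * complex_of_real (sin (real m * pi * snd z))))"
  proof (rule Bochner_Integration.integrable_bound[OF integrable_norm[OF g(3)[of "R + 2"]]])
    show "AE z in lborel. norm (g z * (indicator K (fst z) * complex_of_real (sin (real m * pi * snd z)))) \<le> norm (norm (indicator (ball 0 (R + 2)) z *\<^sub>R g z))"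
    proof (rule AE_I2)
      fix z :: "(real^2) \<times> real"
      show "norm (g z * (indicator K (fst z) * complex_of_real (sin (real m * pi * snd z)))) \<le> norm (norm (indicator (ball 0 (R + 2)) z *\<^sub>R g z))"
      proof (cases "z \<in> layer \<and> fst z \<in> K")
        case True
        then have "z \<in> ball 0 (R + 2)" using norm_pair_layer[of z] K(2) by force
        then show ?thesis using True by (simp add: norm_mult mult_left_le)
      next
        case False
        then show ?thesis using g(2)[of z] by auto
      qed
    qed
  qed measurable
  from sine_mode_integral(2)[OF this]
  have "integrable lborel (\<lambda>x. sine_mode g m x * indicator K x)" .
  moreover have "sine_mode g m x * indicator K x = indicator K x *\<^sub>R sine_mode g m x" for x by (simp add: indicator_def)
  ultimately show ?thesis by simp
qed

lemma L1_loc_rep: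
  fixes h h' :: "'a::euclidean_space \<Rightarrow> complex"
  assumes h': "h' \<in> borel_measurable borel" and ae: "AE x in lborel. h x = h' x"
  shows "h \<in> L1_loc UNIV \<longleftrightarrow> (\<forall>K. compact K \<longrightarrow> integrable lborel (\<lambda>x. indicator K x *\<^sub>R h' x))"
proof -
  have "integrable (lebesgue_on K) h \<longleftrightarrow> integrable lborel (\<lambda>x. indicator K x *\<^sub>R h' x)" if K: "compact K" for K
  proof (rule integral_lebesgue_rep(2))
    show [measurable]: "K \<in> sets borel" using K by (simp add: compact_imp_closed borel_closed)
    note [measurable] = h'
    show "(\<lambda>x. indicator K x *\<^sub>R h' x) \<in> borel_measurable borel" by measurable
    show "AE x in lborel. x \<in> K \<longrightarrow> h x = indicator K x *\<^sub>R h' x" using ae by eventually_elim auto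
  qed (auto simp: indicator_def)
  then show ?thesis by (auto simp: L1_loc_def)
qed

context layer_solution
begin

text \<open>Admissibility refers to the chosen representative \<open>weak_partial\<close> of the
  derivative, separation yields the sine mode of \<open>D (b, 0)\<close>. Both are weak derivatives
  of the mode: the first supplies \<open>W\<close>, the second shows that a weak derivative exists
  and carries the equation.\<close>

lemma mode_helmholtz:
  assumes u: "AE z in lborel. z \<in> layer \<longrightarrow> u z = U z"
  obtains W where "weak_helmholtz (sine_mode U m) W (sine_mode F m) (of_real ((real m)\<^sup>2 * pi\<^sup>2 - k))"
    "\<And>b. b \<in> Basis \<Longrightarrow> AE x in lborel. weak_partial UNIV b (mode u m) x = W b x"
proof -
  let ?w = "sine_mode U m"
  have wm: "?w \<in> borel_measurable borel" by (rule sine_mode_measurable[OF U_m])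
  have wae: "AE x in lborel. mode u m x = ?w x" by (rule mode_eq_sine_mode[OF U_m U_0 u])
  have w_int: "integrable lborel (\<lambda>x. indicator K x *\<^sub>R ?w x)" if Kc: "compact K" for K
  proof -
    obtain R where "\<And>x. x \<in> K \<Longrightarrow> norm x \<le> R" using compact_imp_bounded[OF Kc] bounded_iff by metis
    then show ?thesis using Kc by (intro sine_mode_local_integrable[OF U_m U_0 U_loc, of K R]) (auto simp: compact_imp_closed borel_closed)
  qed
  have lint: "(LINT x|lebesgue_on UNIV. g x * \<phi> x) = (\<integral>x. g' x * \<phi> x \<partial>lborel)"
    if "AE x in lborel. g x = g' x" "g' \<in> borel_measurable borel" "\<phi> \<in> borel_measurable borel" for g g' \<phi> :: "real^2 \<Rightarrow> complex"
  proof (rule integral_lebesgue_rep(1))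
    show "AE x in lborel. x \<in> UNIV \<longrightarrow> g x * \<phi> x = g' x * \<phi> x" using that(1) by eventually_elim simp
  qed (use that in auto)
  have hw: "has_weak_partial UNIV b (mode u m) (sine_mode (D (b, 0)) m)" if b: "b \<in> Basis" for b
    unfolding has_weak_partial_def
  proof (intro conjI ballI)
    have dm: "sine_mode (D (b, 0)) m \<in> borel_measurable borel" using b by (intro sine_mode_measurable D_m) auto
    show "mode u m \<in> L1_loc UNIV" unfolding L1_loc_rep[OF wm wae] using w_int by blast
    show "sine_mode (D (b, 0)) m \<in> L1_loc UNIV"
    proof -
      have "integrable lborel (\<lambda>x. indicator K x *\<^sub>R sine_mode (D (b, 0)) m x)" if Kc: "compact K" for K
      proof -
        obtain R where "\<And>x. x \<in> K \<Longrightarrow> norm x \<le> R" using compact_imp_bounded[OF Kc] bounded_iff by metis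
        then show ?thesis using Kc b by (intro sine_mode_local_integrable[OF D_m D_0 D_loc, of _ K R]) (auto simp: compact_imp_closed borel_closed)
      qed
      then show ?thesis by (subst L1_loc_rep[OF dm]) auto
    qed
    fix \<phi> :: "real^2 \<Rightarrow> complex" assume \<phi>: "\<phi> \<in> test_functions UNIV"
    show "(LINT x|lebesgue_on UNIV. mode u m x * partial b \<phi> x) = - (LINT x|lebesgue_on UNIV. sine_mode (D (b, 0)) m x * \<phi> x)"
      using mode_derivative[OF b \<phi>, of m] lint[OF wae wm test_function_measurable[OF test_functions_partial[OF \<phi> b]]]
        lint[OF _ dm test_function_measurable[OF \<phi>], of "sine_mode (D (b, 0)) m"] by simp
  qed
  have hw': "has_weak_partial UNIV b (mode u m) (weak_partial UNIV b (mode u m))" if "b \<in> Basis" for b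
  proof -
    have ex: "\<exists>g. has_weak_partial UNIV b (mode u m) g" using hw[OF that] by blast
    show ?thesis unfolding weak_partial_def by (rule someI_ex[OF ex])
  qed
  have "\<exists>g. g \<in> borel_measurable borel \<and> (AE x in lborel. weak_partial UNIV b (mode u m) x = g x)" if b: "b \<in> Basis" for b
  proof -
    have L: "weak_partial UNIV b (mode u m) \<in> L1_loc UNIV" using hw'[OF b] by (simp add: has_weak_partial_def)
    have pm: "weak_partial UNIV b (mode u m) \<in> borel_measurable (lebesgue_on UNIV)"
    proof (rule measurable_on_exhaustion)
      fix R :: real
      have "weak_partial UNIV b (mode u m) \<in> borel_measurable (lebesgue_on (cball 0 R))"
        using L by (auto simp: L1_loc_def intro!: borel_measurable_integrable)
      then show "weak_partial UNIV b (mode u m) \<in> borel_measurable (lebesgue_on (UNIV \<inter> ball 0 R))"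
        by (rule measurable_restrict_mono) auto
    qed simp
    show ?thesis by (rule borel_rep_on[OF _ pm]) (simp, auto)
  qed
  then obtain W where W: "\<And>b. b \<in> Basis \<Longrightarrow> W b \<in> borel_measurable borel" "\<And>b. b \<in> Basis \<Longrightarrow> AE x in lborel. weak_partial UNIV b (mode u m) x = W b x"
    using bchoice[of Basis "\<lambda>b g. g \<in> borel_measurable borel \<and> (AE x in lborel. weak_partial UNIV b (mode u m) x = g x)"] by blast
  have weakW: "(\<integral>x. ?w x * partial b \<phi> x \<partial>lborel) = - (\<integral>x. W b x * \<phi> x \<partial>lborel)" if b: "b \<in> Basis" and \<phi>: "\<phi> \<in> test_functions UNIV" for b \<phi>
  proof -
    have "(LINT x|lebesgue_on UNIV. mode u m x * partial b \<phi> x) = - (LINT x|lebesgue_on UNIV. weak_partial UNIV b (mode u m) x * \<phi> x)"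
      using hw'[OF b] \<phi> unfolding has_weak_partial_def by blast
    then show ?thesis
      using lint[OF wae wm test_function_measurable[OF test_functions_partial[OF \<phi> b]]] lint[OF W(2)[OF b] W(1)[OF b] test_function_measurable[OF \<phi>]] by simp
  qed
  have "weak_helmholtz ?w W (sine_mode F m) (of_real ((real m)\<^sup>2 * pi\<^sup>2 - k))"
  proof
    show "?w \<in> borel_measurable borel" by fact
    show "W b \<in> borel_measurable borel" if "b \<in> Basis" for b using W(1)[OF that] .
    show "sine_mode F m \<in> borel_measurable borel" by (rule sine_mode_measurable[OF F_m])
    show "integrable lborel (\<lambda>x. indicator (cball 0 R) x *\<^sub>R ?w x)" for R by (rule w_int) simp
    show "integrable lborel (\<lambda>x. indicator (cball 0 R) x *\<^sub>R W b x)" if b: "b \<in> Basis" for b R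
      using hw'[OF b] unfolding has_weak_partial_def L1_loc_rep[OF W(1)[OF b] W(2)[OF b]] by auto
    show "integrable lborel (sine_mode F m)"
    proof -
      note [measurable] = F_m
      have "integrable lborel (\<lambda>z. F z * (1 * complex_of_real (sin (real m * pi * snd z))))"
        by (rule Bochner_Integration.integrable_bound[OF F_int]) (measurable, auto simp: norm_mult mult_left_le)
      from sine_mode_integral(2)[OF this] show ?thesis by simp
    qed
    show "(\<integral>x. ?w x * partial b \<phi> x \<partial>lborel) = - (\<integral>x. W b x * \<phi> x \<partial>lborel)" if "b \<in> Basis" "\<phi> \<in> test_functions UNIV" for b \<phi>
      by (rule weakW[OF that])
    fix \<phi> :: "real^2 \<Rightarrow> complex" assume \<phi>: "\<phi> \<in> test_functions UNIV"
    \<comment> \<open>Both integrals are minus the integral of the mode against the second partial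
      of \<open>\<phi>\<close>.\<close>
    have "(\<integral>x. W b x * partial b \<phi> x \<partial>lborel) = (\<integral>x. sine_mode (D (b, 0)) m x * partial b \<phi> x \<partial>lborel)" if b: "b \<in> Basis" for b
      using weakW[OF b test_functions_partial[OF \<phi> b]] mode_derivative[OF b test_functions_partial[OF \<phi> b], of m] by simp
    then show "(\<Sum>b\<in>Basis. \<integral>x. W b x * partial b \<phi> x \<partial>lborel) + of_real ((real m)\<^sup>2 * pi\<^sup>2 - k) * (\<integral>x. ?w x * \<phi> x \<partial>lborel) = (\<integral>x. sine_mode F m x * \<phi> x \<partial>lborel)"
      using mode_equation[OF \<phi>, of m] by simp
  qed
  then show ?thesis using that W(2) by blast
qed

end

context layer_solution
begin

lemma admissible_mode_estimate:
  assumes adm: "admissible k u" and u: "AE z in lborel. z \<in> layer \<longrightarrow> u z = U z"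
    and k: "k = (real m0)\<^sup>2 * pi\<^sup>2" and m: "m \<ge> 1" and R: "R > 0" "I \<subseteq> ball 0 R" and supp: "\<And>z. fst z \<notin> I \<Longrightarrow> F z = 0"
  shows "mode_estimate (sine_mode U m) (sine_mode F m) R"
proof -
  obtain W where W: "weak_helmholtz (sine_mode U m) W (sine_mode F m) (of_real ((real m)\<^sup>2 * pi\<^sup>2 - k))"
    and Wae: "\<And>b. b \<in> Basis \<Longrightarrow> AE x in lborel. weak_partial UNIV b (mode u m) x = W b x"
    by (rule mode_helmholtz[OF u, where m=m]) blast
  interpret H: weak_helmholtz "sine_mode U m" W "sine_mode F m" "of_real ((real m)\<^sup>2 * pi\<^sup>2 - k)" by (rule W)
  have wae: "AE x in lborel. mode u m x = sine_mode U m x" by (rule mode_eq_sine_mode[OF U_m U_0 u])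
  have F0x: "sine_mode F m x = 0" if "x \<notin> ball 0 R" for x
  proof -
    have "x \<notin> I" using R(2) that by blast
    then have "F (x, y) = 0" for y using supp by simp
    then show ?thesis by (simp add: sine_mode_def)
  qed
  have wm: "sine_mode U m \<in> borel_measurable borel" by (rule sine_mode_measurable[OF U_m])
  have Wm: "W b \<in> borel_measurable borel" if "b \<in> Basis" for b using W that unfolding weak_helmholtz_def by blast
  have L2w: "integrable lborel (\<lambda>y. (norm (sine_mode U m y))\<^sup>2)" if "k \<le> (real m)\<^sup>2 * pi\<^sup>2"
  proof -
    have L: "mode u m \<in> L2 (UNIV \<inter> UNIV)" using adm m that by (auto simp: admissible_def H1_def)
    have "integrable lborel (\<lambda>x. indicator UNIV x *\<^sub>R (norm (sine_mode U m x))\<^sup>2)"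
      by (rule rep_square_integrable[OF borel_open[OF open_UNIV] wm _ _ borel_open[OF open_UNIV] L]) (use wae in auto)
    then show ?thesis by simp
  qed
  have L2W: "integrable lborel (\<lambda>y. (norm (W b y))\<^sup>2)" if "k \<le> (real m)\<^sup>2 * pi\<^sup>2" and b: "b \<in> Basis" for b
  proof -
    have L: "weak_partial UNIV b (mode u m) \<in> L2 (UNIV \<inter> UNIV)" using adm m that by (auto simp: admissible_def H1_def)
    have "integrable lborel (\<lambda>x. indicator UNIV x *\<^sub>R (norm (W b x))\<^sup>2)"
      by (rule rep_square_integrable[OF borel_open[OF open_UNIV] Wm[OF b] _ _ borel_open[OF open_UNIV] L]) (use Wae[OF b] in auto)
    then show ?thesis by simp
  qed
  \<comment> \<open>As \<open>k\<close> is one of the numbers \<open>m0^2 * pi^2\<close>, the other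
    eigenvalues are at least \<open>pi^2\<close> away from it. So the wavenumbers of all other modes
    have modulus at least \<open>1/2\<close>, whatever \<open>m\<close> and
    \<open>k\<close>.\<close>
  have gap: "sqrt (((real a)\<^sup>2 - (real b)\<^sup>2) * pi\<^sup>2) \<ge> 1/2" if "b < a" for a b :: nat
  proof (rule real_le_rsqrt)
    have le: "b\<^sup>2 + 1 \<le> a\<^sup>2" using that power_strict_mono[OF that, of 2] by auto
    have "real (b\<^sup>2 + 1) \<le> real (a\<^sup>2)" using le by (rule of_nat_mono)
    then have "1 \<le> (real a)\<^sup>2 - (real b)\<^sup>2" by simp
    moreover have "1 \<le> pi\<^sup>2" using pi_gt3 by (intro one_le_power) linarith
    ultimately have "1 * 1 \<le> ((real a)\<^sup>2 - (real b)\<^sup>2) * pi\<^sup>2" by (intro mult_mono) (use that in auto)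
    then show "(1/2)\<^sup>2 \<le> ((real a)\<^sup>2 - (real b)\<^sup>2) * pi\<^sup>2" by (simp add: power2_eq_square)
  qed
  consider "m < m0" | "m = m0" | "m0 < m" by linarith
  then show ?thesis
  proof cases
    case 1
    define s where "s = sqrt (k - (real m)\<^sup>2 * pi\<^sup>2)"
    have s: "s \<ge> 1/2" using gap[OF 1] by (simp add: s_def k left_diff_distrib)
    have mk: "(real m)\<^sup>2 * pi\<^sup>2 < k" using 1 by (simp add: k power_strict_mono)
    then have s2: "s\<^sup>2 = k - (real m)\<^sup>2 * pi\<^sup>2" by (simp add: s_def)
    have wn: "mode_wavenumber k m = of_real s" using mk by (simp add: mode_wavenumber_def s_def)
    \<comment> \<open>With this sign \<open>exp (- c * r)\<close> is the outgoing wave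
      \<open>exp (\<i> * s * r)\<close>, and the term \<open>c * w\<close> in the kernel estimates
      is the \<open>- \<i> * s * w\<close> of the radiation condition.\<close>
    define c where "c = - \<i> * complex_of_real s"
    have norm_powr: "norm (complex_of_real (norm y powr (-1/2))) = 1 / sqrt (norm y)" for y :: "real^2"
    proof (cases "y = 0")
      case False
      then have n: "norm y > 0" by simp
      show ?thesis unfolding norm_of_real powr_m_half[OF n] by simp
    qed simp
    have bigO: "mode u m \<in> O[ae_at_infinity](\<lambda>x. of_real (norm x powr (-1/2)))" using adm m mk by (simp add: admissible_def)
    have smallo: "(\<lambda>x. radial_derivative (mode u m) x - \<i> * mode_wavenumber k m * mode u m x) \<in> o[ae_at_infinity](\<lambda>x. of_real (norm x powr (-1/2)))"
      using adm m mk by (simp add: admissible_def)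
    obtain C where "eventually (\<lambda>x. norm (mode u m x) \<le> C * norm (complex_of_real (norm x powr (-1/2)))) ae_at_infinity"
      using bigO by (rule landau_o.bigE)
    then obtain R1 where R1: "AE x in lborel. norm x \<ge> R1 \<longrightarrow> norm (mode u m x) \<le> C * norm (complex_of_real (norm x powr (-1/2)))"
      unfolding eventually_ae_at_infinity AE_completion_iff by blast
    have d1: "AE y in lborel. norm y \<ge> R1 \<longrightarrow> norm (sine_mode U m y) \<le> C / sqrt (norm y)"
      using R1 wae
    proof eventually_elim
      case (elim y)
      then show ?case unfolding norm_powr by simp
    qed
    have d2: "\<exists>R2. AE y in lborel. norm y \<ge> R2 \<longrightarrow>
        norm ((\<Sum>b\<in>Basis. W b y * of_real (y \<bullet> b)) / of_real (norm y) + c * sine_mode U m y) \<le> d / sqrt (norm y)" if d: "d > 0" for d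
    proof -
      have "eventually (\<lambda>x. norm (radial_derivative (mode u m) x - \<i> * mode_wavenumber k m * mode u m x) \<le> d * norm (complex_of_real (norm x powr (-1/2)))) ae_at_infinity"
        by (rule landau_o.smallD[OF smallo d])
      then obtain R2 where R2: "AE x in lborel. norm x \<ge> R2 \<longrightarrow>
          norm (radial_derivative (mode u m) x - \<i> * mode_wavenumber k m * mode u m x) \<le> d * norm (complex_of_real (norm x powr (-1/2)))"
        unfolding eventually_ae_at_infinity AE_completion_iff by blast
      have "AE x in lborel. \<forall>b\<in>Basis. weak_partial UNIV b (mode u m) x = W b x" by (intro AE_finite_allI finite_Basis Wae)
      then have "AE y in lborel. norm y \<ge> R2 \<longrightarrow>
        norm ((\<Sum>b\<in>Basis. W b y * of_real (y \<bullet> b)) / of_real (norm y) + c * sine_mode U m y) \<le> d / sqrt (norm y)"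
        using R2 wae
      proof eventually_elim
        case (elim y)
        have "radial_derivative (mode u m) y = (\<Sum>b\<in>Basis. W b y * of_real (y \<bullet> b)) / of_real (norm y)"
          unfolding radial_derivative_def sum_divide_distrib
          by (rule sum.cong[OF refl]) (use elim(1) in \<open>simp add: divide_inverse ac_simps\<close>)
        then show ?case using elim(2,3) unfolding norm_powr wn by (simp add: c_def)
      qed
      then show ?thesis by blast
    qed
    show ?thesis unfolding mode_estimate_def
    proof (rule disjI1, rule H.representation_wavenumber[where c=c, OF _ _ _ disjI2[OF conjI] R(1) F0x])
      show "0 \<le> Re c" "1/2 \<le> norm c" using s by (auto simp: c_def norm_mult)
      show "of_real ((real m)\<^sup>2 * pi\<^sup>2 - k) = c\<^sup>2" unfolding c_def power_mult_distrib of_real_power[symmetric] s2 by simp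
    qed (use d1 d2 in \<open>blast+\<close>)
  next
    case 2
    show ?thesis unfolding mode_estimate_def
      by (rule disjI2, rule H.representation_threshold[OF _ _ _ R(1) F0x]) (use 2 k L2w L2W in auto)
  next
    case 3
    define s where "s = sqrt ((real m)\<^sup>2 * pi\<^sup>2 - k)"
    have s: "s \<ge> 1/2" using gap[OF 3] by (simp add: s_def k left_diff_distrib)
    have mk: "k \<le> (real m)\<^sup>2 * pi\<^sup>2" using 3 by (simp add: k power_mono)
    then have s2: "s\<^sup>2 = (real m)\<^sup>2 * pi\<^sup>2 - k" by (simp add: s_def)
    show ?thesis unfolding mode_estimate_def
    proof (rule disjI1, rule H.representation_wavenumber[where c="complex_of_real s", OF _ _ _ disjI1[OF conjI[OF L2w[OF mk]]] R(1) F0x])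
      show "0 \<le> Re (complex_of_real s)" "1/2 \<le> norm (complex_of_real s)" using s by auto
      show "of_real ((real m)\<^sup>2 * pi\<^sup>2 - k) = (complex_of_real s)\<^sup>2" unfolding of_real_power[symmetric] s2 ..
    qed (use L2W[OF mk] in blast)
  qed
qed

end

theorem theorem4p5:
  shows "\<exists>C::real. C > 0 \<and>
    (\<forall>(k::real) (I::(real^2) set) (D::((real^2) \<times> real) set) (\<rho>::real)
       (V::(real^2) \<times> real \<Rightarrow> complex).
       k \<in> thresholds \<longrightarrow>
       I \<in> sets lebesgue \<longrightarrow>
       D = I \<times> {0<..<1} \<longrightarrow>
       \<rho> > 0 \<longrightarrow>
       D \<subseteq> ball 0 \<rho> \<times> {0<..<1} \<longrightarrow>
       V \<in> Linf layer \<longrightarrow>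
       (AE z in lebesgue_on layer. z \<notin> D \<longrightarrow> V z = 0) \<longrightarrow>
       (\<exists>u. admissible_solution k V u \<and> \<not> (AE z in lebesgue_on layer. u z = 0)) \<longrightarrow>
       max (C * measure lebesgue D powr (3/4))
           (measure lebesgue D / pi * (1 + ln (pi * \<rho>\<^sup>2 / measure lebesgue D)))
         * real_of_ereal (Linf_norm layer V) \<ge> 1)"
proof (intro exI[of _ "sqrt pi * (1 + pi) / (2 * pi)"] conjI allI impI)
  show "sqrt pi * (1 + pi) / (2 * pi) > 0" by (simp add: add_pos_pos)
  fix k :: real and I :: "(real^2) set" and D :: "((real^2) \<times> real) set" and \<rho> :: real and V :: "(real^2) \<times> real \<Rightarrow> complex"
  assume k: "k \<in> thresholds" and I: "I \<in> sets lebesgue" and D: "D = I \<times> {0<..<1}" and \<rho>: "\<rho> > 0"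
    and sub: "D \<subseteq> ball 0 \<rho> \<times> {0<..<1}" and V: "V \<in> Linf layer"
    and supp: "AE z in lebesgue_on layer. z \<notin> D \<longrightarrow> V z = 0"
    and "\<exists>u. admissible_solution k V u \<and> \<not> (AE z in lebesgue_on layer. u z = 0)"
  then obtain u where sol: "weak_Dirichlet_solution k V u" and adm: "admissible k u"
    and nontrivial: "\<not> (AE z in lebesgue_on layer. u z = 0)" unfolding admissible_solution_def by blast
  obtain m0 where m0: "k = (real m0)\<^sup>2 * pi\<^sup>2" using k by (auto simp: thresholds_def)
  \<comment> \<open>\<open>I\<close> is Lebesgue measurable; it differs from the Borel set
    \<open>S\<close> by a null set, so the cylinder over \<open>S\<close> has the measure of
    \<open>D\<close> and carries \<open>V\<close> up to a null set.\<close>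
  obtain S Z Z' where SZ: "I = S \<union> Z" "Z \<subseteq> Z'" "Z' \<in> null_sets lborel" "S \<in> sets lborel" using I by (rule sets_completionE)
  have Sb: "S \<in> sets borel" using SZ(4) by simp
  have P: "lborel \<Otimes>\<^sub>M lborel = (lborel :: ((real^2) \<times> real) measure)" by (rule lborel_prod)
  have I\<rho>: "I \<subseteq> ball 0 \<rho>"
  proof
    fix x assume "x \<in> I"
    then have "(x, 1/2) \<in> D" by (simp add: D)
    then show "x \<in> ball 0 \<rho>" using sub by blast
  qed
  then have S\<rho>: "S \<subseteq> ball 0 \<rho>" using SZ(1) by blast
  have Z0: "Z' \<times> (UNIV :: real set) \<in> null_sets lborel"
  proof -
    have "Z' \<times> (UNIV :: real set) \<in> null_sets (lborel \<Otimes>\<^sub>M lborel)"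
      by (rule lborel.times_in_null_sets1[OF SZ(3)]) (simp only: sets_lborel borel_open[OF open_UNIV])
    then show ?thesis by (simp only: P)
  qed
  have SI: "AE z :: (real^2) \<times> real in lborel. fst z \<in> I \<longleftrightarrow> fst z \<in> S"
    using AE_not_in[OF Z0]
  proof eventually_elim
    case (elim z)
    then show ?case using SZ(1,2) by (cases z) auto
  qed
  have ball: "emeasure lborel (ball (0::real^2) \<rho>) = ennreal (pi * \<rho>\<^sup>2)"
    using emeasure_ball[of \<rho> "0::real^2"] \<rho> by (simp add: unit_ball_vol_2)
  define A where "A = measure lborel S"
  have le: "emeasure lborel S \<le> ennreal (pi * \<rho>\<^sup>2)" using emeasure_mono[OF S\<rho>, of lborel] ball by simp
  then have "emeasure lborel S \<noteq> top" using ennreal_less_top[of "pi * \<rho>\<^sup>2"] by (metis leD)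
  then have eS: "emeasure lborel S = ennreal A" unfolding A_def by (rule emeasure_eq_ennreal_measure)
  have A0: "A \<ge> 0" by (simp add: A_def)
  have A1: "A \<le> pi * \<rho>\<^sup>2" using le unfolding eS by (simp add: ennreal_le_iff)
  have mD: "measure lebesgue D = A"
  proof -
    have S1: "S \<times> {0<..<1::real} \<in> sets borel" using Sb by (intro borel_Times) auto
    have DL: "D \<in> sets lebesgue"
      by (rule sets_completionI[of _ "S \<times> {0<..<1}" "Z \<times> {0<..<1}", OF _ _ Z0]) (use SZ(1,2) S1 in \<open>auto simp: D\<close>)
    have ae: "AE z in lebesgue. z \<in> D \<longleftrightarrow> z \<in> S \<times> {0<..<1}"
      unfolding AE_completion_iff using SI by eventually_elim (auto simp: D)
    have "S \<times> {0<..<1::real} \<in> sets lebesgue" by (rule sets_completionI_sets) (use S1 in simp)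
    with ae DL have "emeasure lebesgue D = emeasure lebesgue (S \<times> {0<..<1::real})" by (rule emeasure_eq_AE)
    also have "\<dots> = emeasure lborel (S \<times> {0<..<1::real})" using S1 by simp
    \<comment> \<open>The layer has height 1, so volume and base area agree.\<close>
    also have "\<dots> = emeasure lborel S * emeasure lborel {0<..<1::real}"
      using lborel.emeasure_pair_measure_Times[of S "lborel :: (real^2) measure" "{0<..<1::real}"] Sb unfolding P by simp
    finally show ?thesis using eS A0 by (simp add: measure_def)
  qed
  have suppV: "AE z in lborel. z \<in> layer \<longrightarrow> z \<notin> S \<times> {0<..<1} \<longrightarrow> V z = 0"
    using supp[unfolded AE_lebesgue_on_borel[OF layer_borel]] SI
    by eventually_elim (auto simp: D)
  define N where "N = real_of_ereal (Linf_norm layer V)"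
  obtain U F D' where LS: "layer_solution k U F D'" and uU: "AE z in lborel. z \<in> layer \<longrightarrow> u z = U z"
    and U2: "\<And>R. integrable lborel (\<lambda>z. indicator (ball 0 R) z *\<^sub>R (norm (U z))\<^sup>2)"
    and F0: "\<And>z. fst z \<notin> S \<Longrightarrow> F z = 0" and FU: "AE z in lborel. norm (F z) \<le> N * norm (U z)"
    unfolding N_def by (rule layer_solution_representatives[OF sol V Sb S\<rho> suppV]) blast
  interpret layer_solution k U F D' by (rule LS)
  have "mode_constant \<rho> A * N \<ge> 1"
  proof (rule ccontr)
    assume "\<not> mode_constant \<rho> A * N \<ge> 1"
    \<comment> \<open>Passing to the nonnegative part secures the sign that
      \<open>energy_vanishes\<close> asks for; the strict inequality holds for either sign of
      \<open>N\<close>.\<close>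
    then have small: "mode_constant \<rho> A * max N 0 < 1" by (simp add: max_def)
    have FU': "AE z in lborel. norm (F z) \<le> max N 0 * norm (U z)"
      using FU
    proof eventually_elim
      case (elim z)
      also have "N * norm (U z) \<le> max N 0 * norm (U z)" by (intro mult_right_mono) auto
      finally show ?case .
    qed
    have "AE z in lborel. U z = 0"
      by (rule energy_vanishes[OF Sb S\<rho> eS A0 A1 \<rho> F0 FU' _ U2 admissible_mode_estimate[OF adm uU m0 _ _ _ F0] small]) auto
    then have "AE z in lborel. z \<in> layer \<longrightarrow> u z = 0" using uU by eventually_elim auto
    then show False using nontrivial by (simp add: AE_lebesgue_on_borel[OF layer_borel])
  qed
  then show "1 \<le> max (sqrt pi * (1 + pi) / (2 * pi) * measure lebesgue D powr (3/4))
      (measure lebesgue D / pi * (1 + ln (pi * \<rho>\<^sup>2 / measure lebesgue D))) * real_of_ereal (Linf_norm layer V)"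
    unfolding mD N_def mode_constant_def .
qed

end
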